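(* Let $d,n\ge1$, let $\mathbf{Q}=(Q_1,\dots,Q_n)$ be real quadratic forms in $d$ variables and $\mathcal{M}=\{(\xi,\mathbf{Q}(\xi)):\xi\in[0,1]^d\}$. Let $2\le k\le d+1$, $\theta>0$, $K\in 2^{\mathbb{N}}$, and let $\{\tau_j\}_{j=1}^M\subset\mathcal{P}(\frac1K)$ be $\theta$-uniform with the controlling sequence $\{X(\mathcal{M},k,m)\}_{m=1}^{d+n}$. Then for every $2\le p\le 2M$ and every $\epsilon>0$ there is a constant $C_{\epsilon,p,K,\theta}$ (which may also depend on $d,n,\mathbf{Q}$) such that for every $0<\delta<1$, every ball $B_{\delta^{-1}}\subset\mathbb{R}^{d+n}$ of radius $\delta^{-1}$ and every $f$, $$\Big\|\prod_{j=1}^M|E^{\mathcal{M}}_{\tau_j}f|^{\frac1M}\Big\|_{L^p(B_{\delta^{-1}})}\le C_{\epsilon,p,K,\theta}\,\delta^{-\epsilon-(d+n)\theta/2}\max_{0\le m\le d+n}\delta^{-\frac mp+\frac12X(\mathcal{M},k,m)}\prod_{j=1}^M\|f\|_{L^2(\tau_j)}^{\frac1M}.$$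
   Context: Extension operator: for $\square\subset[0,1]^d$, $E^{\mathcal{M}}_{\square}f(x)=\int_{\square}f(\xi)e^{2\pi i x\cdot(\xi,\mathbf{Q}(\xi))}\,d\xi$, $x\in\mathbb{R}^{d+n}$. $\mathcal{P}(\frac1K)$ is the partition of $[0,1]^d$ into dyadic cubes of side length $\frac1K$. For $\xi\in\mathbb{R}^d$, $V_\xi\subset\mathbb{R}^{d+n}$ is the $d$-dimensional linear tangent space of the graph of $\mathbf{Q}$ at $(\xi,\mathbf{Q}(\xi))$, i.e. the span of $(e_j,\partial_j\mathbf{Q}(\xi))$, $1\le j\le d$; $\pi_{V_\xi}$ is the orthogonal projection onto $V_\xi$. $\theta$-uniform: given nonnegative integers $\{X_m\}_{m=1}^{d+n}$, a subset $\{\tau_j\}_{j=1}^M$ of $\mathcal{P}(\frac1K)$ is $\theta$-uniform with the controlling sequence $\{X_m\}$ if for each $1\le m\le d+n$ and each linear subspace $V\subset\mathbb{R}^{d+n}$ of dimension $m$, at most $\theta M$ of the $\tau_j$ intersect $\{\xi\in\mathbb{R}^d:\dim(\pi_{V_\xi}(V))<X_m\}$. $X(\mathcal{M},k,m)$: for $2\le k\le d+1$ and $0\le m\le d+n$, it is the largest integer $X\le d+1$ such that $\sup_{\dim V=m}\dim\{\xi\in\mathbb{R}^d:\dim(\pi_{V_\xi}(V))<X\}\le k-2$, where the supremum is over linear subspaces $V\subset\mathbb{R}^{d+n}$ of dimension $m$ and the outer $\dim$ is Hausdorff dimension. *)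

theory Defs
  imports "HOL-Analysis.Analysis"
begin

text \<open>The ambient space \<open>\<real>\<^bsup>d+n\<^esup>\<close> is the product \<open>(real^'d) \<times> (real^'n)\<close> with its Euclidean
  structure, where \<open>d = CARD('d)\<close> and \<open>n = CARD('n)\<close>.\<close>

definition quadratic_form :: "(real^'d \<Rightarrow> real) \<Rightarrow> bool" where
  "quadratic_form q \<longleftrightarrow> (\<exists>A :: real^'d^'d. \<forall>\<xi>. q \<xi> = \<xi> \<bullet> (A *v \<xi>))"

subsection \<open>Tangent spaces and projections\<close>

definition tangent_space :: "(real^'d \<Rightarrow> real^'n) \<Rightarrow> real^'d \<Rightarrow> ((real^'d) \<times> (real^'n)) set" where
  "tangent_space Q \<xi> = span (range (\<lambda>j. (axis j 1, frechet_derivative Q (at \<xi>) (axis j 1))))"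

definition orth_proj :: "'a::euclidean_space set \<Rightarrow> 'a \<Rightarrow> 'a" where
  "orth_proj V x = (THE y. y \<in> V \<and> (\<forall>v\<in>V. (x - y) \<bullet> v = 0))"

lemma orth_proj_works:
  assumes "subspace V"
  shows "orth_proj V x \<in> V \<and> (\<forall>v\<in>V. (x - orth_proj V x) \<bullet> v = 0)"
proof -
  obtain y z where yz: "y \<in> span V" "\<And>w. w \<in> span V \<Longrightarrow> orthogonal z w" "x = y + z"
    using orthogonal_subspace_decomp_exists[of V x] by metis
  have V: "span V = V" using assms by simp
  show ?thesis unfolding orth_proj_def
  proof (rule theI)
    show "y \<in> V \<and> (\<forall>v\<in>V. (x - y) \<bullet> v = 0)"
      using yz V by (auto simp: orthogonal_def)
    fix u assume u: "u \<in> V \<and> (\<forall>v\<in>V. (x - u) \<bullet> v = 0)"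
    have "y - u \<in> V" using yz(1) V u assms by (auto intro: subspace_diff)
    then have "(x - u) \<bullet> (y - u) = 0" "z \<bullet> (y - u) = 0"
      using u yz(2) V by (auto simp: orthogonal_def)
    then have "(y - u) \<bullet> (y - u) = 0" using yz(3) by (simp add: inner_diff_left inner_add_left)
    then show "u = y" by simp
  qed
qed

definition bad_set ::
  "(real^'d \<Rightarrow> real^'n) \<Rightarrow> ((real^'d) \<times> (real^'n)) set \<Rightarrow> nat \<Rightarrow> (real^'d) set" where
  "bad_set Q V X = {\<xi>. dim (orth_proj (tangent_space Q \<xi>) ` V) < X}"

subsection \<open>Hausdorff dimension\<close>

text \<open>Only used for exponents \<open>s > 0\<close>, since \<open>0 powr 0 = 0\<close>.  Boundedness of the covering sets is
  required because \<^const>\<open>diameter\<close> is unspecified on unbounded sets.\<close>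

definition hausdorff_content :: "real \<Rightarrow> real \<Rightarrow> 'a::metric_space set \<Rightarrow> ennreal" where
  "hausdorff_content s \<delta> A =
     Inf {(\<Sum>i. ennreal (diameter (U i) powr s)) | U :: nat \<Rightarrow> 'a set.
            A \<subseteq> (\<Union>i. U i) \<and> (\<forall>i. bounded (U i) \<and> diameter (U i) \<le> \<delta>)}"

definition hausdorff_measure :: "real \<Rightarrow> 'a::metric_space set \<Rightarrow> ennreal" where
  "hausdorff_measure s A = (SUP \<delta>\<in>{0<..}. hausdorff_content s \<delta> A)"

text \<open>With this definition the empty set has dimension 0.\<close>

definition hausdorff_dim :: "'a::metric_space set \<Rightarrow> ereal" where
  "hausdorff_dim A = Inf (ereal ` {s. 0 < s \<and> hausdorff_measure s A = 0})"

subsection \<open>The exponents and uniformity\<close>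

text \<open>The number \<open>X(\<M>, k, m)\<close>.  The value \<open>X = 0\<close> is always admissible (for \<open>k \<ge> 2\<close>), because
  \<open>bad_set Q V 0\<close> is empty; so the largest integer is the largest natural number.\<close>

definition X_exponent :: "(real^'d \<Rightarrow> real^'n) \<Rightarrow> nat \<Rightarrow> nat \<Rightarrow> nat" where
  "X_exponent Q k m =
     Max {X. X \<le> CARD('d) + 1 \<and>
             (SUP V\<in>{V. subspace V \<and> dim V = m}. hausdorff_dim (bad_set Q V X))
               \<le> ereal (real k - 2)}"

text \<open>Closed cubes, hence overlapping in their boundaries.\<close>

definition dyadic_cubes :: "nat \<Rightarrow> (real^'d) set set" where
  "dyadic_cubes K =
     {cbox (\<chi> i. real (a i) / real K) (\<chi> i. (real (a i) + 1) / real K) | a. \<forall>i. a i < K}"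

definition uniform_family ::
  "(real^'d \<Rightarrow> real^'n) \<Rightarrow> real \<Rightarrow> (nat \<Rightarrow> nat) \<Rightarrow> (real^'d) set set \<Rightarrow> bool" where
  "uniform_family Q \<theta> X T \<longleftrightarrow>
     (\<forall>m\<in>{1..CARD('d) + CARD('n)}. \<forall>V. subspace V \<and> dim V = m \<longrightarrow>
        real (card {\<tau>\<in>T. \<tau> \<inter> bad_set Q V (X m) \<noteq> {}}) \<le> \<theta> * real (card T))"

subsection \<open>Extension operator and Lebesgue norms\<close>

definition extension_op ::
  "(real^'d \<Rightarrow> real^'n) \<Rightarrow> (real^'d) set \<Rightarrow> (real^'d \<Rightarrow> complex) \<Rightarrow> (real^'d) \<times> (real^'n) \<Rightarrow> complex" where
  "extension_op Q S f x = (LINT \<xi>:S|lebesgue. f \<xi> * exp (2 * of_real pi * \<i> * of_real (x \<bullet> (\<xi>, Q \<xi>))))"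

definition in_Lp ::
  "real \<Rightarrow> 'a::euclidean_space set \<Rightarrow> ('a \<Rightarrow> 'b::{banach, second_countable_topology}) \<Rightarrow> bool" where
  "in_Lp p S g \<longleftrightarrow> set_borel_measurable lebesgue S g \<and>
     set_integrable lebesgue S (\<lambda>x. norm (g x) powr p)"

definition Lp_norm ::
  "real \<Rightarrow> 'a::euclidean_space set \<Rightarrow> ('a \<Rightarrow> 'b::{banach, second_countable_topology}) \<Rightarrow> real" where
  "Lp_norm p S g = (LINT x:S|lebesgue. norm (g x) powr p) powr (1 / p)"

end

theory Submission
  imports Defs
begin

text \<open>The exponential sums with frequencies in the \<open>1/R\<close>-grid over small cubes around fixed points \<open>\<xi>0 j\<close>
  are estimated by induction on \<open>R\<close>, multiplying \<open>R\<close> by a fixed factor \<open>s\<close> in each step.  On a ball of radius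
  \<open>s R\<close> the local \<open>L\<^sup>2\<close> mass of the \<open>j\<close>-th sum at scale \<open>R\<close> is essentially a function of the projection to the
  tangent space at \<open>\<xi>0 j\<close>, and Bessel's inequality on a finite group bounds its sum over that projection.  A
  Brascamp-Lieb inequality at the finite scale \<open>s\<close>, for the one datum given by the points \<open>\<xi>0 j\<close>, then gains
  \<open>s\<^bsup>B\<^esup>\<close> with a constant independent of \<open>s\<close>; choosing \<open>s\<close> large turns this constant into an \<open>\<epsilon>\<close>-loss.  The cubes
  shrink with \<open>s\<close>, but finitely many data suffice by compactness, so that no uniformity of the Brascamp-Lieb
  constant is needed.

  The Brascamp-Lieb inequality is proved in its dual form, as an inequality between the entropies of a random point
  modulo subspaces, which only uses submodularity.

  The uniformity assumption bounds the Brascamp-Lieb exponent \<open>B\<close>, because \<open>X(\<M>, k, m) \<le> d + 1 \<le> d + n\<close>, and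
  \<open>B \<ge> 0\<close> because \<open>X(\<M>, k, 0) = 0\<close>.\<close>

section \<open>Submodular functions on the lattice of subspaces\<close>


text \<open>The hypothesis p \<le> 2M enters through q = p/(2M) \<le> 1. The p-th power of the
  product has the exponent 2q on each factor, and since t powr q is subadditive for q \<le> 1, the
  pieces of a sum can be separated inside that exponent. The same q is the exponent of the
  Brascamp-Lieb inequality, whose condition is dim V - q (sum over j of dim L_j V) \<le> B. It has
  to hold for every choice of one point in each cube, which is what \<theta>-uniformity provides.
  Freezing the points \<xi>0 j works because of a balance: frequencies within O(1/s) of \<xi>0 j
  have tangent spaces that deviate by O(1/s). After rescaling by R the ball has radius s, and this
  deviation displaces its projections by O(1) only. Besides the Brascamp-Lieb gain, each step costs
  s to the power q d M, the normalisation in Bessel's inequality. It is no loss: when a function is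
  replaced by coefficients on cells of side 1/R, Cauchy-Schwarz on the cells gives R to the power -
  q d M, which cancels the product of these costs.\<close>

lemma dim_span_Un_Int:
  fixes K L :: "'a::euclidean_space set"
  assumes "subspace K" "subspace L"
  shows "dim (span (K \<union> L)) + dim (K \<inter> L) = dim K + dim L"
proof -
  have "span (K \<union> L) = {x + y |x y. x \<in> K \<and> y \<in> L}"
    unfolding span_Un using assms by (simp add: span_eq_iff[THEN iffD2])
  then show ?thesis using dim_sums_Int[OF assms] by simp
qed

text \<open>The modular law: subtracting the V-part of an element of W stays in W. It makes the
  dimension of \<open>V' \<inter> span (K j \<union> V)\<close> computable when the problem is
  divided at V.\<close>

lemma span_Un_Int_modular:
  fixes K V W :: "'a::euclidean_space set"
  assumes K: "subspace K" and V: "subspace V" and W: "subspace W" and "V \<subseteq> W"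
  shows "W \<inter> span (K \<union> V) = span ((W \<inter> K) \<union> V)"
proof
  have sK: "span K = K" and sV: "span V = V" and sI: "span (W \<inter> K) = W \<inter> K"
    using assms by (simp_all add: subspace_inter)
  show "W \<inter> span (K \<union> V) \<subseteq> span ((W \<inter> K) \<union> V)"
  proof
    fix x assume x: "x \<in> W \<inter> span (K \<union> V)"
    then obtain k v where kv: "k \<in> K" "v \<in> V" "x = k + v" unfolding span_Un sK sV by auto
    have "k = x - v" using kv by simp
    then have "k \<in> W" using x kv \<open>V \<subseteq> W\<close> W by (metis IntD1 subsetD subspace_diff)
    then show "x \<in> span ((W \<inter> K) \<union> V)" unfolding span_Un sI sV using kv by blast
  qed
  show "span ((W \<inter> K) \<union> V) \<subseteq> W \<inter> span (K \<union> V)"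
  proof (intro Int_greatest)
    show "span ((W \<inter> K) \<union> V) \<subseteq> W" using \<open>V \<subseteq> W\<close> W by (intro span_minimal) auto
    show "span ((W \<inter> K) \<union> V) \<subseteq> span (K \<union> V)" by (intro span_mono) auto
  qed
qed

section \<open>Coarsely submodular functions and the rank condition\<close>

text \<open>The model is the entropy of a random point of a ball of radius \<open>exp \<Lambda>\<close>, observed at unit scale
  modulo a subspace.  The error \<open>c K L\<close> has to depend on the pair, since it blows up as the angle between
  \<open>K\<close> and \<open>L\<close> tends to 0.\<close>

definition coarse_submodular :: "('a set \<Rightarrow> 'a set \<Rightarrow> real) \<Rightarrow> real \<Rightarrow> ('a::euclidean_space set \<Rightarrow> real) \<Rightarrow> bool" where
  "coarse_submodular c \<Lambda> h \<longleftrightarrow>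
     (\<forall>K L. subspace K \<and> subspace L \<longrightarrow> h (K \<inter> L) + h (span (K \<union> L)) \<le> h K + h L + c K L) \<and>
     (\<forall>K L. subspace K \<and> subspace L \<and> K \<subseteq> L \<longrightarrow>
        h L \<le> h K + c K L \<and> h K \<le> h L + (real (dim L) - real (dim K)) * \<Lambda> + c K L)"

text \<open>If \<open>K j\<close> is the kernel of a linear map,
  \<open>dim V - dim (V \<inter> K j)\<close> is the rank of that map on V. For
  \<open>U = {0}\<close> this is the quantity bounded in the Bennett-Carbery-Christ-Tao condition; a
  general U gives its version modulo U.\<close>

definition rank_defect :: "'j set \<Rightarrow> ('j \<Rightarrow> 'a::euclidean_space set) \<Rightarrow> ('j \<Rightarrow> real) \<Rightarrow> 'a set \<Rightarrow> 'a set \<Rightarrow> real" where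
  "rank_defect J K p U V =
     real (dim V) - real (dim U) - (\<Sum>j\<in>J. p j * (real (dim V) - real (dim (V \<inter> K j))))"

text \<open>C may depend on c, on the subspaces and on p, but not on h or \<Lambda>: the scale
  enters through \<open>B * \<Lambda>\<close> alone. Since every term is measured against
  \<open>h W\<close>, inequalities over U \<subseteq> V and over V \<subseteq> W can be
  added.\<close>

definition submodular_bound ::
  "('a set \<Rightarrow> 'a set \<Rightarrow> real) \<Rightarrow> 'j set \<Rightarrow> 'a::euclidean_space set \<Rightarrow> 'a set \<Rightarrow> ('j \<Rightarrow> 'a set) \<Rightarrow> ('j \<Rightarrow> real) \<Rightarrow> real \<Rightarrow> bool" where
  "submodular_bound c J U W K p B \<longleftrightarrow>
     (\<exists>C. \<forall>h \<Lambda>. 0 \<le> \<Lambda> \<and> coarse_submodular c \<Lambda> h \<longrightarrow>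
        h U - h W \<le> B * \<Lambda> + (\<Sum>j\<in>J. p j * (h (K j) - h W)) + C)"

definition rank_condition ::
  "'j set \<Rightarrow> 'a::euclidean_space set \<Rightarrow> 'a set \<Rightarrow> ('j \<Rightarrow> 'a set) \<Rightarrow> ('j \<Rightarrow> real) \<Rightarrow> real \<Rightarrow> bool" where
  "rank_condition J U W K p B \<longleftrightarrow> finite J \<and> subspace U \<and> subspace W \<and> U \<subseteq> W \<and>
     (\<forall>j\<in>J. subspace (K j) \<and> U \<subseteq> K j \<and> K j \<subseteq> W \<and> 0 \<le> p j \<and> p j \<le> 1) \<and>
     (\<forall>V. subspace V \<and> U \<subseteq> V \<and> V \<subseteq> W \<longrightarrow> rank_defect J K p U V \<le> B)"

text \<open>The case of exponents 1. Intersecting with one more \<open>K j\<close> costs one use of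
  submodularity; the span that it produces lies in W, so its value is at least \<open>h W\<close> up
  to a constant.\<close>

lemma submodular_Inter:
  fixes K :: "'j \<Rightarrow> 'a::euclidean_space set"
  assumes "finite J" and W: "subspace W" and K: "\<And>j. j \<in> J \<Longrightarrow> subspace (K j) \<and> K j \<subseteq> W"
  shows "\<exists>C. \<forall>h \<Lambda>. coarse_submodular c \<Lambda> h \<longrightarrow>
    h (W \<inter> \<Inter> (K ` J)) - h W \<le> (\<Sum>j\<in>J. h (K j) - h W) + C"
  using \<open>finite J\<close> K
proof (induction J rule: finite_induct)
  case empty
  then show ?case by auto
next
  case (insert j J)
  define V where "V = W \<inter> \<Inter> (K ` J)"
  have V: "subspace V" unfolding V_def using insert.prems W
    by (intro subspace_inter subspace_Inter) auto
  have Kj: "subspace (K j)" "K j \<subseteq> W" using insert.prems by auto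
  have sub: "span (K j \<union> V) \<subseteq> W" using Kj W by (intro span_minimal) (auto simp: V_def)
  obtain C where C: "\<And>h \<Lambda>. coarse_submodular c \<Lambda> h \<Longrightarrow> h V - h W \<le> (\<Sum>j\<in>J. h (K j) - h W) + C"
    using insert unfolding V_def by blast
  show ?case
  proof (intro exI allI impI)
    fix h :: "'a set \<Rightarrow> real" and \<Lambda> assume h: "coarse_submodular c \<Lambda> h"
    have "h (K j \<inter> V) + h (span (K j \<union> V)) \<le> h (K j) + h V + c (K j) V"
      using h Kj V by (auto simp: coarse_submodular_def)
    moreover have "h W \<le> h (span (K j \<union> V)) + c (span (K j \<union> V)) W"
      using h sub W by (auto simp: coarse_submodular_def)
    moreover have "W \<inter> \<Inter> (K ` insert j J) = K j \<inter> V" by (auto simp: V_def)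
    ultimately show "h (W \<inter> \<Inter> (K ` insert j J)) - h W \<le> (\<Sum>j\<in>insert j J. h (K j) - h W)
        + (C + c (K j) V + c (span (K j \<union> V)) W)"
      using insert.hyps C[OF h] by (simp add: algebra_simps)
  qed
qed

text \<open>With at most one fractional exponent, the subspace to test is the intersection V of the
  other \<open>K j\<close> with exponent 1. The passage from V to \<open>V \<inter> K j0\<close> is
  estimated in two ways, by submodularity with weight \<open>p j0\<close> and by growth in dimension
  with weight \<open>1 - p j0\<close>. The multiples of \<Lambda> then add up to the rank defect of
  V.\<close>

lemma submodular_bound_base:
  fixes K :: "'j \<Rightarrow> 'a::euclidean_space set"
  assumes rc: "rank_condition J U W K p B" and j0: "j0 \<in> J"
    and p01: "\<And>j. j \<in> J \<Longrightarrow> j \<noteq> j0 \<Longrightarrow> p j = 0 \<or> p j = 1"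
  shows "submodular_bound c J U W K p B"
proof -
  define J1 where "J1 = {j\<in>J. j \<noteq> j0 \<and> p j = 1}"
  define V where "V = W \<inter> \<Inter> (K ` J1)"
  have fin: "finite J" "finite J1" and W: "subspace W" and U: "subspace U" "U \<subseteq> W"
    and K: "\<And>j. j \<in> J \<Longrightarrow> subspace (K j) \<and> U \<subseteq> K j \<and> K j \<subseteq> W \<and> 0 \<le> p j \<and> p j \<le> 1"
    using rc by (auto simp: rank_condition_def J1_def)
  have V: "subspace V" unfolding V_def using K W
    by (intro subspace_inter subspace_Inter) (auto simp: J1_def)
  have UV: "U \<subseteq> V" "V \<subseteq> W" using K U by (auto simp: V_def J1_def)
  have split: "(\<Sum>j\<in>J. p j * g j) = p j0 * g j0 + (\<Sum>j\<in>J1. g j)" for g :: "'j \<Rightarrow> real"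
  proof -
    have "(\<Sum>j\<in>J. p j * g j) = p j0 * g j0 + (\<Sum>j\<in>J-{j0}. p j * g j)"
      using fin j0 by (simp add: sum.remove)
    also have "(\<Sum>j\<in>J-{j0}. p j * g j) = (\<Sum>j\<in>J1. g j)"
      by (rule sum.mono_neutral_cong_right) (use fin p01 in \<open>auto simp: J1_def\<close>)
    finally show ?thesis .
  qed
  define V0 where "V0 = V \<inter> K j0"
  have VJ1: "V \<inter> K j = V" if "j \<in> J1" for j using that by (auto simp: V_def)
  have "rank_defect J K p U V \<le> B" using rc V UV by (auto simp: rank_condition_def)
  then have B: "real (dim V) - real (dim U) - p j0 * (real (dim V) - real (dim V0)) \<le> B"
    unfolding rank_defect_def split V0_def using VJ1 by simp
  have V0: "subspace V0" "U \<subseteq> V0" "V0 \<subseteq> V" "V0 \<subseteq> K j0"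
    using V K[OF j0] UV by (auto simp: V0_def subspace_inter)
  obtain C where C: "\<And>h \<Lambda>. coarse_submodular c \<Lambda> h \<Longrightarrow> h V - h W \<le> (\<Sum>j\<in>J1. h (K j) - h W) + C"
  proof -
    have "subspace (K j) \<and> K j \<subseteq> W" if "j \<in> J1" for j using K that by (auto simp: J1_def)
    then show ?thesis using submodular_Inter[OF fin(2) W, of K c] that unfolding V_def by meson
  qed
  let ?S = "span (V \<union> K j0)"
  show ?thesis unfolding submodular_bound_def
  proof (intro exI allI impI, elim conjE)
    fix h :: "'a set \<Rightarrow> real" and \<Lambda> assume \<Lambda>: "0 \<le> (\<Lambda>::real)" and h: "coarse_submodular c \<Lambda> h"
    have p0: "0 \<le> p j0" "p j0 \<le> 1" using K[OF j0] by auto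
    note 1 = C[OF h]
    have 2: "h U \<le> h V0 + (real (dim V0) - real (dim U)) * \<Lambda> + c U V0"
      using h U V0 by (auto simp: coarse_submodular_def)
    have 3: "h V0 \<le> h V + (real (dim V) - real (dim V0)) * \<Lambda> + c V0 V"
      using h V V0 by (auto simp: coarse_submodular_def)
    have 4: "h V0 + h (span (V \<union> K j0)) \<le> h V + h (K j0) + c V (K j0)"
      using h V K[OF j0] by (auto simp: coarse_submodular_def V0_def)
    have "span (V \<union> K j0) \<subseteq> W" using K[OF j0] UV W by (intro span_minimal) auto
    then have 5: "h W \<le> h (span (V \<union> K j0)) + c ?S W" using h W by (auto simp: coarse_submodular_def)
    have 6: "p j0 * (h V0 - h V) \<le> p j0 * (h (K j0) - h W + (c V (K j0) + c ?S W))"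
      using 4 5 p0 by (intro mult_left_mono) auto
    have 7: "(1 - p j0) * (h V0 - h V) \<le> (1 - p j0) * ((real (dim V) - real (dim V0)) * \<Lambda> + c V0 V)"
      using 3 p0 by (intro mult_left_mono) auto
    have 8: "(real (dim V) - real (dim U) - p j0 * (real (dim V) - real (dim V0))) * \<Lambda> \<le> B * \<Lambda>"
      using B \<Lambda> by (rule mult_right_mono)
    have "h U - h V \<le> (real (dim V0) - real (dim U)) * \<Lambda> + c U V0 + (h V0 - h V)" using 2 by simp
    also have "h V0 - h V = p j0 * (h V0 - h V) + (1 - p j0) * (h V0 - h V)"
      by (simp add: algebra_simps)
    also have "\<dots> \<le> p j0 * (h (K j0) - h W + (c V (K j0) + c ?S W)) + (1 - p j0) * ((real (dim V) - real (dim V0)) * \<Lambda> + c V0 V)"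
      using 6 7 by simp
    finally have "h U - h V \<le> B * \<Lambda> + p j0 * (h (K j0) - h W) + (c U V0 + p j0 * (c V (K j0) + c ?S W) + (1 - p j0) * c V0 V)"
      using 8 by (simp add: algebra_simps)
    with 1 show "h U - h W \<le> B * \<Lambda> + (\<Sum>j\<in>J. p j * (h (K j) - h W))
        + (c U V0 + p j0 * (c V (K j0) + c ?S W) + (1 - p j0) * c V0 V + C)"
      unfolding split by linarith
  qed
qed

text \<open>The submodular inequality for \<open>K j\<close> and \<open>V\<close> splits the problem over \<open>U \<subseteq> W\<close> into one over
  \<open>U \<subseteq> V\<close> and one over \<open>V \<subseteq> W\<close>; tightness of \<open>V\<close> is what makes the rank condition pass to the second
  with bound 0.\<close>

lemma submodular_bound_split:
  fixes K :: "'j \<Rightarrow> 'a::euclidean_space set"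
  assumes rc: "rank_condition J U W K p B"
    and V: "subspace V" "U \<subseteq> V" "V \<subseteq> W" and tight: "rank_defect J K p U V = B"
    and lower: "rank_condition J U V (\<lambda>j. K j \<inter> V) p B \<Longrightarrow> submodular_bound c J U V (\<lambda>j. K j \<inter> V) p B"
    and upper: "rank_condition J V W (\<lambda>j. span (K j \<union> V)) p 0 \<Longrightarrow>
      submodular_bound c J V W (\<lambda>j. span (K j \<union> V)) p 0"
  shows "submodular_bound c J U W K p B"
proof -
  have fin: "finite J" and W: "subspace W" and U: "subspace U" "U \<subseteq> W"
    and K: "\<And>j. j \<in> J \<Longrightarrow> subspace (K j) \<and> U \<subseteq> K j \<and> K j \<subseteq> W \<and> 0 \<le> p j \<and> p j \<le> 1"
    and B: "\<And>V. subspace V \<Longrightarrow> U \<subseteq> V \<Longrightarrow> V \<subseteq> W \<Longrightarrow> rank_defect J K p U V \<le> B"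
    using rc by (auto simp: rank_condition_def)
  have "rank_condition J U V (\<lambda>j. K j \<inter> V) p B"
    unfolding rank_condition_def
  proof (intro conjI ballI allI impI)
    fix V' assume V': "subspace V' \<and> U \<subseteq> V' \<and> V' \<subseteq> V"
    have eq: "V' \<inter> (K j \<inter> V) = V' \<inter> K j" for j using V' by auto
    have "rank_defect J (\<lambda>j. K j \<inter> V) p U V' = rank_defect J K p U V'"
      by (simp add: rank_defect_def eq)
    then show "rank_defect J (\<lambda>j. K j \<inter> V) p U V' \<le> B" using B[of V'] V' V by auto
  qed (use fin U V K in \<open>auto simp: subspace_inter\<close>)
  note lo = lower[OF this]
  have "rank_condition J V W (\<lambda>j. span (K j \<union> V)) p 0"
    unfolding rank_condition_def
  proof (intro conjI ballI allI impI)
    fix V' assume V': "subspace V' \<and> V \<subseteq> V' \<and> V' \<subseteq> W"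
    \<comment> \<open>By the modular law the intersection is
      \<open>span ((V' \<inter> K j) \<union> V)\<close>. Hence rank defects relative to V are
      differences of rank defects relative to U.\<close>
    have eq: "real (dim (V' \<inter> span (K j \<union> V))) = real (dim (V' \<inter> K j)) + real (dim V) - real (dim (V \<inter> K j))"
      if "j \<in> J" for j
    proof -
      have "dim (V' \<inter> span (K j \<union> V)) + dim (V' \<inter> K j \<inter> V) = dim (V' \<inter> K j) + dim V"
        using dim_span_Un_Int[of "V' \<inter> K j" V] span_Un_Int_modular[of "K j" V V'] K[OF that] V V'
        by (simp add: subspace_inter)
      moreover have "V' \<inter> K j \<inter> V = V \<inter> K j" using V' by auto
      ultimately show ?thesis by simp
    qed
    have "rank_defect J (\<lambda>j. span (K j \<union> V)) p V V' = rank_defect J K p U V' - rank_defect J K p U V"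
      unfolding rank_defect_def by (simp add: eq algebra_simps sum.distrib sum_subtractf)
    then show "rank_defect J (\<lambda>j. span (K j \<union> V)) p V V' \<le> 0"
      using B[of V'] V' V tight by auto
  next
    fix j assume j: "j \<in> J"
    show "span (K j \<union> V) \<subseteq> W" using K[OF j] V W by (intro span_minimal) auto
    show "V \<subseteq> span (K j \<union> V)" by (meson Un_upper2 span_superset subset_trans)
  qed (use fin V W K in auto)
  note up = upper[OF this]
  from lo obtain C1 where C1: "\<And>h \<Lambda>. 0 \<le> \<Lambda> \<Longrightarrow> coarse_submodular c \<Lambda> h \<Longrightarrow>
        h U - h V \<le> B * \<Lambda> + (\<Sum>j\<in>J. p j * (h (K j \<inter> V) - h V)) + C1"
    by (auto simp: submodular_bound_def)
  from up obtain C2 where C2: "\<And>h \<Lambda>. 0 \<le> \<Lambda> \<Longrightarrow> coarse_submodular c \<Lambda> h \<Longrightarrow>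
        h V - h W \<le> (\<Sum>j\<in>J. p j * (h (span (K j \<union> V)) - h W)) + C2"
    by (auto simp: submodular_bound_def)
  show ?thesis unfolding submodular_bound_def
  proof (intro exI allI impI, elim conjE)
    fix h :: "'a set \<Rightarrow> real" and \<Lambda> assume \<Lambda>: "0 \<le> (\<Lambda>::real)" and h: "coarse_submodular c \<Lambda> h"
    have "p j * (h (K j \<inter> V) - h V) + p j * (h (span (K j \<union> V)) - h W) \<le> p j * (h (K j) - h W) + p j * c (K j) V"
      if "j \<in> J" for j
    proof -
      have "h (K j \<inter> V) + h (span (K j \<union> V)) \<le> h (K j) + h V + c (K j) V"
        using h K[OF that] V by (auto simp: coarse_submodular_def)
      then have "p j * (h (K j \<inter> V) - h V + (h (span (K j \<union> V)) - h W)) \<le> p j * (h (K j) - h W + c (K j) V)"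
        using K[OF that] by (intro mult_left_mono) auto
      then show ?thesis by (simp add: algebra_simps)
    qed
    then have "(\<Sum>j\<in>J. p j * (h (K j \<inter> V) - h V)) + (\<Sum>j\<in>J. p j * (h (span (K j \<union> V)) - h W))
       \<le> (\<Sum>j\<in>J. p j * (h (K j) - h W)) + (\<Sum>j\<in>J. p j * c (K j) V)"
      unfolding sum.distrib[symmetric] by (rule sum_mono)
    then show "h U - h W \<le> B * \<Lambda> + (\<Sum>j\<in>J. p j * (h (K j) - h W)) + (C1 + C2 + (\<Sum>j\<in>J. p j * c (K j) V))"
      using C1[OF \<Lambda> h] C2[OF \<Lambda> h] by linarith
  qed
qed

section \<open>Moving the exponents until a constraint becomes tight\<close>

lemma affine_exit:
  fixes G :: "(real \<times> real) set"
  assumes "finite G" "\<And>a b. (a, b) \<in> G \<Longrightarrow> a > 0" "\<exists>(a, b)\<in>G. b < 0"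
  shows "\<exists>t>0. (\<forall>(a, b)\<in>G. a + t * b \<ge> 0) \<and> (\<exists>(a, b)\<in>G. a + t * b = 0)"
proof -
  define S where "S = (\<lambda>(a, b). a / (- b)) ` {(a, b)\<in>G. b < 0}"
  have "finite {(a, b)\<in>G. b < 0}" by (rule finite_subset[OF _ assms(1)]) auto
  then have S: "finite S" "S \<noteq> {}" using assms(3) by (auto simp: S_def)
  have pos: "s > 0" if "s \<in> S" for s using that assms(2) by (auto simp: S_def divide_pos_neg)
  have "Min S \<in> S" using S by simp
  then obtain a b where ab: "(a, b) \<in> G" "b < 0" "Min S = a / (- b)" by (auto simp: S_def)
  show ?thesis
  proof (intro exI[of _ "Min S"] conjI ballI)
    show "Min S > 0" using pos \<open>Min S \<in> S\<close> by blast
    show "\<exists>(a, b)\<in>G. a + Min S * b = 0" using ab by (intro bexI[of _ "(a, b)"]) auto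
    fix g assume "g \<in> G"
    then obtain a b where g: "g = (a, b)" "(a, b) \<in> G" by (cases g) auto
    have "a + Min S * b \<ge> 0"
    proof (cases "b < 0")
      case True
      then have "a / (- b) \<in> S" using g(2) by (force simp: S_def)
      then have "Min S \<le> a / (- b)" using S by simp
      then show ?thesis using True by (simp add: field_simps)
    next
      case False
      then show ?thesis using assms(2)[OF g(2)] \<open>Min S > 0\<close> by (simp add: add_nonneg_nonneg)
    qed
    then show "case g of (a, b) \<Rightarrow> a + Min S * b \<ge> 0" by (simp add: g(1))
  qed
qed

definition fractional :: "'j set \<Rightarrow> ('j \<Rightarrow> real) \<Rightarrow> 'j set" where
  "fractional J p = {j\<in>J. 0 < p j \<and> p j < 1}"

text \<open>Along the direction e, the constraints \<open>0 \<le> p j\<close>,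
  \<open>p j \<le> 1\<close> and the rank condition at each V are affine in t. Those that involve a
  moving exponent or a proper subspace hold strictly at t = 0, so the first of them to become an
  equality gives the exit time. The rank defects of U and W do not move, the latter by
  \<open>eW\<close>.\<close>

lemma exponent_exit:
  fixes K :: "'j \<Rightarrow> 'a::euclidean_space set"
  assumes rc: "rank_condition J U W K p B" and UW: "U \<subset> W"
    and nt: "\<And>V. subspace V \<Longrightarrow> U \<subset> V \<Longrightarrow> V \<subset> W \<Longrightarrow> rank_defect J K p U V < B"
    and e: "\<And>j. j \<in> J \<Longrightarrow> e j \<noteq> 0 \<Longrightarrow> 0 < p j \<and> p j < 1" "i \<in> J" "e i \<noteq> 0"
    and eW: "(\<Sum>j\<in>J. e j * (real (dim W) - real (dim (K j)))) = 0"
  shows "\<exists>t>0. rank_condition J U W K (\<lambda>j. p j + t * e j) B \<and>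
     (fractional J (\<lambda>j. p j + t * e j) \<subset> fractional J p \<or>
      (\<exists>V. subspace V \<and> U \<subset> V \<and> V \<subset> W \<and> rank_defect J K (\<lambda>j. p j + t * e j) U V = B))"
proof -
  have fin: "finite J" and W: "subspace W" and U: "subspace U" "U \<subseteq> W"
    and K: "\<And>j. j \<in> J \<Longrightarrow> subspace (K j) \<and> U \<subseteq> K j \<and> K j \<subseteq> W \<and> 0 \<le> p j \<and> p j \<le> 1"
    and B: "\<And>V. subspace V \<Longrightarrow> U \<subseteq> V \<Longrightarrow> V \<subseteq> W \<Longrightarrow> rank_defect J K p U V \<le> B"
    using rc by (auto simp: rank_condition_def)
  define E where "E V = (\<Sum>j\<in>J. e j * (real (dim V) - real (dim (V \<inter> K j))))" for V
  define VV where "VV = {V. subspace V \<and> U \<subset> V \<and> V \<subset> W}"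
  define JE where "JE = {j\<in>J. e j \<noteq> 0}"
  define G where "G = (\<lambda>j. (p j, e j)) ` JE \<union> (\<lambda>j. (1 - p j, - e j)) ` JE
      \<union> (\<lambda>V. (B - rank_defect J K p U V, E V)) ` VV"
  have rd: "rank_defect J K (\<lambda>j. p j + t * e j) U V = rank_defect J K p U V - t * E V" for V t
    by (simp add: rank_defect_def E_def sum.distrib sum_distrib_left sum_subtractf algebra_simps)
  \<comment> \<open>There are infinitely many subspaces, but the affine function belonging to V
    depends only on the dimensions of V and of the \<open>V \<inter> K j\<close>, which take
    finitely many values.\<close>
  have finV: "finite ((\<lambda>V. (B - rank_defect J K p U V, E V)) ` VV)"
  proof -
    let ?f = "\<lambda>V::'a set. (dim V, \<lambda>j\<in>J. dim (V \<inter> K j))"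
    let ?F = "\<lambda>(m::nat, d). (B - (real m - real (dim U) - (\<Sum>j\<in>J. p j * (real m - real (d j)))),
        (\<Sum>j\<in>J. e j * (real m - real (d j))))"
    have "?f ` VV \<subseteq> {..DIM('a)} \<times> PiE J (\<lambda>_. {..DIM('a)})" by (auto simp: dim_subset_UNIV)
    then have "finite (?f ` VV)" by (rule finite_subset) (auto intro!: finite_PiE fin)
    then have "finite (?F ` ?f ` VV)" by (rule finite_imageI)
    then show ?thesis by (simp add: image_image rank_defect_def[abs_def] E_def[abs_def])
  qed
  have "finite G" using finV fin by (auto simp: G_def JE_def)
  moreover have "a > 0" if "(a, b) \<in> G" for a b
  proof -
    have "B - rank_defect J K p U V > 0" if "V \<in> VV" for V using nt[of V] that by (simp add: VV_def)
    then show ?thesis using that e by (auto simp: G_def JE_def)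
  qed
  moreover have "\<exists>(a, b)\<in>G. b < 0"
  proof (cases "e i < 0")
    case True
    then show ?thesis using e by (intro bexI[of _ "(p i, e i)"]) (auto simp: G_def JE_def)
  next
    case False
    then show ?thesis using e by (intro bexI[of _ "(1 - p i, - e i)"]) (auto simp: G_def JE_def)
  qed
  ultimately have "\<exists>t>0. (\<forall>(a, b)\<in>G. a + t * b \<ge> 0) \<and> (\<exists>(a, b)\<in>G. a + t * b = 0)"
    by (rule affine_exit)
  then obtain t where t: "t > 0" "\<And>a b. (a, b) \<in> G \<Longrightarrow> a + t * b \<ge> 0" "\<exists>(a, b)\<in>G. a + t * b = 0"
    by auto
  have pj: "0 \<le> p j + t * e j \<and> p j + t * e j \<le> 1" if "j \<in> J" for j
  proof (cases "e j = 0")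
    case False
    then have "j \<in> JE" using that by (auto simp: JE_def)
    then have "(p j, e j) \<in> G" "(1 - p j, - e j) \<in> G" by (auto simp: G_def)
    from this[THEN t(2)] show ?thesis by auto
  qed (use K[OF that] in auto)
  have rc': "rank_condition J U W K (\<lambda>j. p j + t * e j) B" unfolding rank_condition_def
  proof (intro conjI ballI allI impI)
    fix V assume V: "subspace V \<and> U \<subseteq> V \<and> V \<subseteq> W"
    show "rank_defect J K (\<lambda>j. p j + t * e j) U V \<le> B"
    proof (cases "V = U \<or> V = W")
      case True
      then have "E V = 0"
      proof
        assume "V = U"
        then have "V \<inter> K j = V" if "j \<in> J" for j using K[OF that] by auto
        then show ?thesis by (simp add: E_def)
      next
        assume "V = W"
        then have "V \<inter> K j = K j" if "j \<in> J" for j using K[OF that] by auto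
        then show ?thesis using eW \<open>V = W\<close> by (simp add: E_def)
      qed
      then show ?thesis using B[of V] V by (simp add: rd)
    next
      case False
      then have "(B - rank_defect J K p U V, E V) \<in> G" using V by (auto simp: G_def VV_def)
      from t(2)[OF this] show ?thesis by (simp add: rd)
    qed
  qed (use fin U W K pj in auto)
  from t(3) obtain a b where ab: "(a, b) \<in> G" "a + t * b = 0" by auto
  have "fractional J (\<lambda>j. p j + t * e j) \<subset> fractional J p \<or>
      (\<exists>V. subspace V \<and> U \<subset> V \<and> V \<subset> W \<and> rank_defect J K (\<lambda>j. p j + t * e j) U V = B)"
  proof (cases "\<exists>j\<in>JE. p j + t * e j = 0 \<or> p j + t * e j = 1")
    case True
    then obtain j where j: "j \<in> JE" "p j + t * e j = 0 \<or> p j + t * e j = 1" by auto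
    have "j \<in> fractional J p" using j e by (auto simp: fractional_def JE_def)
    moreover have "j \<notin> fractional J (\<lambda>j. p j + t * e j)" using j by (auto simp: fractional_def)
    moreover have "fractional J (\<lambda>j. p j + t * e j) \<subseteq> fractional J p"
    proof
      fix k assume "k \<in> fractional J (\<lambda>j. p j + t * e j)"
      then show "k \<in> fractional J p" using e(1)[of k] by (cases "e k = 0") (auto simp: fractional_def)
    qed
    ultimately show ?thesis by blast
  next
    case False
    then have "(a, b) \<in> (\<lambda>V. (B - rank_defect J K p U V, E V)) ` VV"
      using ab by (auto simp: G_def algebra_simps)
    then obtain V where V: "V \<in> VV" "a = B - rank_defect J K p U V" "b = E V" by blast
    then have "rank_defect J K (\<lambda>j. p j + t * e j) U V = B" using ab(2) rd[of t V] by simp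
    then show ?thesis using V(1) by (auto simp: VV_def)
  qed
  then show ?thesis using t(1) rc' by blast
qed

text \<open>The claim is affine in \<open>p\<close>.  If no proper subspace is tight, two fractional exponents are moved
  along the line on which the rank defect of \<open>W\<close> is constant, in both directions, until an exponent
  becomes 0 or 1 or some proper subspace becomes tight; \<open>p\<close> lies between the two end points.\<close>

theorem submodular_bound:
  fixes K :: "'j \<Rightarrow> 'a::euclidean_space set"
  assumes "rank_condition J U W K p B"
  shows "submodular_bound c J U W K p B"
  using assms
proof (induction "(dim W - dim U) * (card J + 1) + card (fractional J p)" arbitrary: U W K p B
    rule: less_induct)
  case less
  have fin: "finite J" and W: "subspace W" and U: "subspace U" "U \<subseteq> W"
    and K: "\<And>j. j \<in> J \<Longrightarrow> subspace (K j) \<and> U \<subseteq> K j \<and> K j \<subseteq> W \<and> 0 \<le> p j \<and> p j \<le> 1"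
    and B: "\<And>V. subspace V \<Longrightarrow> U \<subseteq> V \<Longrightarrow> V \<subseteq> W \<Longrightarrow> rank_defect J K p U V \<le> B"
    using less.prems by (auto simp: rank_condition_def)
  have dims: "dim S < dim T" if "subspace S" "subspace T" "S \<subset> T" for S T :: "'a set"
    using that by (metis dim_psubset span_eq_iff)
  have frac: "card (fractional J p') \<le> card J" for p'
    using fin by (auto simp: fractional_def intro: card_mono)
  \<comment> \<open>The induction measure is lexicographic: at most \<open>card J\<close> exponents
    are fractional, so a drop of \<open>dim W - dim U\<close> outweighs any increase in their
    number.\<close>
  have small: "(dim W' - dim U') * (card J + 1) + card (fractional J p') <
      (dim W - dim U) * (card J + 1) + card (fractional J p)"
    if "dim W' - dim U' < dim W - dim U" for U' W' :: "'a set" and p'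
  proof -
    have "(dim W' - dim U' + 1) * (card J + 1) \<le> (dim W - dim U) * (card J + 1)"
      using that by (intro mult_right_mono) auto
    then show ?thesis using frac[of p'] by (simp add: algebra_simps)
  qed
  have split: "submodular_bound c J U W K p' B"
    if rc': "rank_condition J U W K p' B"
      and V: "subspace V" "U \<subset> V" "V \<subset> W" "rank_defect J K p' U V = B" for p' V
  proof -
    have d: "dim U < dim V" "dim V < dim W" using dims V U W by auto
    show ?thesis
    proof (rule submodular_bound_split[OF rc' V(1) _ _ V(4)])
      show "submodular_bound c J U V (\<lambda>j. K j \<inter> V) p' B"
        if "rank_condition J U V (\<lambda>j. K j \<inter> V) p' B"
        using d by (intro less.hyps[OF small that]) auto
      show "submodular_bound c J V W (\<lambda>j. span (K j \<union> V)) p' 0"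
        if "rank_condition J V W (\<lambda>j. span (K j \<union> V)) p' 0"
        using d by (intro less.hyps[OF small that]) auto
    qed (use V in auto)
  qed
  consider (eq) "U = W" | (none) "J = {}" | (one) j0 where "j0 \<in> J" "fractional J p \<subseteq> {j0}"
    | (two) i j where "i \<in> fractional J p" "j \<in> fractional J p" "i \<noteq> j" "U \<noteq> W"
  proof (cases "U = W \<or> J = {} \<or> (\<exists>j0\<in>J. fractional J p \<subseteq> {j0})")
    case False
    then have F: "U \<noteq> W" "\<And>j0. j0 \<in> J \<Longrightarrow> \<not> fractional J p \<subseteq> {j0}" "J \<noteq> {}" by auto
    then obtain i where i: "i \<in> fractional J p" by blast
    then have "\<not> fractional J p \<subseteq> {i}" using F(2) by (simp add: fractional_def)
    then obtain j where j: "j \<in> fractional J p" "j \<noteq> i" by blast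
    then show ?thesis using that(4)[OF i j(1)] F(1) by simp
  next
    case True
    then show ?thesis using that(1-3) by metis
  qed
  then show ?case
  proof cases
    case eq
    have "h U - h W \<le> B * \<Lambda> + (\<Sum>j\<in>J. p j * (h (K j) - h W)) + 0" if "0 \<le> \<Lambda>" for h and \<Lambda> :: real
    proof -
      have "K j = W" if "j \<in> J" for j using K[OF that] eq by auto
      moreover have "rank_defect J K p U U = 0"
        unfolding rank_defect_def using K by (simp add: Int_absorb2)
      then have "0 \<le> B" using B[of U] U by simp
      ultimately show ?thesis using eq that by simp
    qed
    then show ?thesis unfolding submodular_bound_def by blast
  next
    case none
    have "real (dim W) - real (dim U) \<le> B" using B[of W] W U none by (simp add: rank_defect_def)
    then have "h U - h W \<le> B * \<Lambda> + c U W" if "0 \<le> \<Lambda>" "coarse_submodular c \<Lambda> h" for h \<Lambda>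
    proof -
      have "h U \<le> h W + (real (dim W) - real (dim U)) * \<Lambda> + c U W"
        using that U W by (auto simp: coarse_submodular_def)
      moreover have "(real (dim W) - real (dim U)) * \<Lambda> \<le> B * \<Lambda>"
        using \<open>real (dim W) - real (dim U) \<le> B\<close> that by (intro mult_right_mono)
      ultimately show ?thesis by simp
    qed
    then show ?thesis unfolding submodular_bound_def none by auto
  next
    case one
    have "p j = 0 \<or> p j = 1" if "j \<in> J" "j \<noteq> j0" for j
      using one K[OF that(1)] that by (auto simp: fractional_def)
    then show ?thesis using submodular_bound_base[OF less.prems one(1)] by blast
  next
    case two
    show ?thesis
    proof (cases "\<exists>V. subspace V \<and> U \<subset> V \<and> V \<subset> W \<and> rank_defect J K p U V = B")
      case True
      then show ?thesis using split[OF less.prems] by blast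
    next
      case False
      have nt: "rank_defect J K p U V < B" if "subspace V" "U \<subset> V" "V \<subset> W" for V
        using B[of V] False that by (metis order_le_less psubset_imp_subset)
      define d where "d k = real (dim W) - real (dim (K k))" for k
      \<comment> \<open>The direction must be orthogonal to d, so that the rank defect of W does not
        change: (d j, - d i) in the coordinates i and j does this, and if both entries of d vanish,
        i may move alone.\<close>
      define e where "e = (if d i = 0 \<and> d j = 0 then (\<lambda>k. if k = i then 1 else 0)
         else (\<lambda>k. if k = i then d j else if k = j then - d i else 0))"
      have ij: "i \<in> J" "j \<in> J" "0 < p i" "p i < 1" "0 < p j" "p j < 1"
        using two by (auto simp: fractional_def)
      have e1: "0 < p k \<and> p k < 1" if "k \<in> J" "e k \<noteq> 0" for k
        using that ij by (auto simp: e_def split: if_splits)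
      have "(\<Sum>k\<in>J. e k * d k) = (\<Sum>k\<in>{i,j}. e k * d k)"
        by (rule sum.mono_neutral_right) (use fin ij in \<open>auto simp: e_def\<close>)
      also have "\<dots> = 0" using two(3) by (auto simp: e_def)
      finally have e2: "(\<Sum>k\<in>J. e k * (real (dim W) - real (dim (K k)))) = 0" by (simp add: d_def)
      obtain j0 where j0: "j0 \<in> J" "e j0 \<noteq> 0"
      proof (cases "d i = 0")
        case True
        then show ?thesis using that[of i] ij by (auto simp: e_def)
      next
        case False
        then show ?thesis using that[of j] ij two(3) by (auto simp: e_def)
      qed
      have UW: "U \<subset> W" using two U by auto
      have go: "submodular_bound c J U W K p' B"
        if rc': "rank_condition J U W K p' B" and
          or: "fractional J p' \<subset> fractional J p \<or>
            (\<exists>V. subspace V \<and> U \<subset> V \<and> V \<subset> W \<and> rank_defect J K p' U V = B)" for p'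
        using or
      proof
        assume "fractional J p' \<subset> fractional J p"
        moreover have "finite (fractional J p)" using fin by (auto simp: fractional_def)
        ultimately have "card (fractional J p') < card (fractional J p)" by (rule psubset_card_mono[rotated])
        then show ?thesis using less.hyps[OF _ rc'] by simp
      qed (use split[OF rc'] in blast)
      obtain t where t: "t > 0" "submodular_bound c J U W K (\<lambda>k. p k + t * e k) B"
        using exponent_exit[OF less.prems UW nt e1 j0 e2] go by blast
      have "(\<Sum>k\<in>J. - e k * (real (dim W) - real (dim (K k)))) = 0"
        using e2 by (simp add: sum_negf)
      then have "\<exists>t>0. rank_condition J U W K (\<lambda>k. p k + t * - e k) B \<and>
          (fractional J (\<lambda>k. p k + t * - e k) \<subset> fractional J p \<or>
          (\<exists>V. subspace V \<and> U \<subset> V \<and> V \<subset> W \<and> rank_defect J K (\<lambda>k. p k + t * - e k) U V = B))"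
        using e1 j0 by (intro exponent_exit[OF less.prems UW nt, where i = j0]) auto
      then obtain u where u: "u > 0" "submodular_bound c J U W K (\<lambda>k. p k + u * - e k) B"
        using go by blast
      from t(2) obtain C1 where C1: "\<And>h \<Lambda>. 0 \<le> \<Lambda> \<Longrightarrow> coarse_submodular c \<Lambda> h \<Longrightarrow>
          h U - h W \<le> B * \<Lambda> + (\<Sum>k\<in>J. (p k + t * e k) * (h (K k) - h W)) + C1"
        by (auto simp: submodular_bound_def)
      from u(2) obtain C2 where C2: "\<And>h \<Lambda>. 0 \<le> \<Lambda> \<Longrightarrow> coarse_submodular c \<Lambda> h \<Longrightarrow>
          h U - h W \<le> B * \<Lambda> + (\<Sum>k\<in>J. (p k + u * - e k) * (h (K k) - h W)) + C2"
        by (auto simp: submodular_bound_def)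
      show ?thesis unfolding submodular_bound_def
      proof (intro exI allI impI, elim conjE)
        fix h :: "'a set \<Rightarrow> real" and \<Lambda> assume \<Lambda>: "0 \<le> (\<Lambda>::real)" and h: "coarse_submodular c \<Lambda> h"
        define S where "S = (\<Sum>k\<in>J. p k * (h (K k) - h W))"
        define S' where "S' = (\<Sum>k\<in>J. e k * (h (K k) - h W))"
        define x where "x = h U - h W - B * \<Lambda>"
        have "(\<Sum>k\<in>J. (p k + t * e k) * (h (K k) - h W)) = S + t * S'"
          by (simp add: S_def S'_def sum.distrib sum_distrib_left sum_subtractf algebra_simps)
        then have "x \<le> S + t * S' + C1" using C1[OF \<Lambda> h] by (simp add: x_def)
        then have 1: "u * x \<le> u * (S + t * S' + C1)" using u by (simp add: mult_left_mono)
        have "(\<Sum>k\<in>J. (p k + u * - e k) * (h (K k) - h W)) = S - u * S'"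
          by (simp add: S_def S'_def sum.distrib sum_distrib_left algebra_simps sum_subtractf)
        then have "x \<le> S - u * S' + C2" using C2[OF \<Lambda> h] by (simp add: x_def)
        then have 2: "t * x \<le> t * (S - u * S' + C2)" using t by (simp add: mult_left_mono)
        \<comment> \<open>p is the average of the two end points p + t e and p - u e with weights u
          and t, and in this average the terms \<open>S'\<close> cancel.\<close>
        have "(t + u) * x \<le> (t + u) * S + (u * C1 + t * C2)" using 1 2 by (simp add: algebra_simps)
        then have "x \<le> S + (u * C1 + t * C2) / (t + u)" using t u by (simp add: field_simps)
        then show "h U - h W \<le> B * \<Lambda> + (\<Sum>k\<in>J. p k * (h (K k) - h W)) + (u * C1 + t * C2) / (t + u)"
          by (simp add: x_def S_def)
      qed
    qed
  qed
qed

section \<open>Entropy of labels on a finite set\<close>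


definition fiber_weight :: "'x set \<Rightarrow> ('x \<Rightarrow> real) \<Rightarrow> ('x \<Rightarrow> 'l) \<Rightarrow> 'x \<Rightarrow> real" where
  "fiber_weight \<Omega> P \<phi> x = (\<Sum>y | y \<in> \<Omega> \<and> \<phi> y = \<phi> x. P y)"

text \<open>Shannon entropy of the label \<phi>, written as an expectation over points instead of a
  sum over labels.\<close>

definition label_entropy :: "'x set \<Rightarrow> ('x \<Rightarrow> real) \<Rightarrow> ('x \<Rightarrow> 'l) \<Rightarrow> real" where
  "label_entropy \<Omega> P \<phi> = - (\<Sum>x\<in>\<Omega>. P x * ln (fiber_weight \<Omega> P \<phi> x))"

text \<open>Points of weight 0 are excluded, so that all fibre weights are positive and every
  logarithm below is taken at a positive number.\<close>

definition positive_distribution :: "'x set \<Rightarrow> ('x \<Rightarrow> real) \<Rightarrow> bool" where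
  "positive_distribution \<Omega> P \<longleftrightarrow> finite \<Omega> \<and> (\<forall>x\<in>\<Omega>. P x > 0) \<and> (\<Sum>x\<in>\<Omega>. P x) = 1"

lemma fiber_weight_pos:
  assumes "positive_distribution \<Omega> P" "x \<in> \<Omega>"
  shows "fiber_weight \<Omega> P \<phi> x > 0"
  unfolding fiber_weight_def using assms
  by (intro sum_pos2[of _ x]) (auto simp: positive_distribution_def less_imp_le)

text \<open>Jensen's inequality for the logarithm, from ln t \<le> t - 1 at t = r x / m.\<close>

lemma expectation_ln_le:
  assumes P: "positive_distribution \<Omega> P" and r: "\<And>x. x \<in> \<Omega> \<Longrightarrow> r x > 0"
    and m: "(\<Sum>x\<in>\<Omega>. P x * r x) \<le> m" "m > 0"
  shows "(\<Sum>x\<in>\<Omega>. P x * ln (r x)) \<le> ln m"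
proof -
  have "(\<Sum>x\<in>\<Omega>. P x * ln (r x)) \<le> (\<Sum>x\<in>\<Omega>. P x * (ln m + (r x / m - 1)))"
  proof (rule sum_mono)
    fix x assume x: "x \<in> \<Omega>"
    have "ln (r x / m) \<le> r x / m - 1" using r[OF x] m by (intro ln_le_minus_one) auto
    then have "ln (r x) \<le> ln m + (r x / m - 1)" using r[OF x] m by (simp add: ln_div)
    then show "P x * ln (r x) \<le> P x * (ln m + (r x / m - 1))"
      using P x by (intro mult_left_mono) (auto simp: positive_distribution_def less_imp_le)
  qed
  also have "\<dots> = ln m * (\<Sum>x\<in>\<Omega>. P x) + (\<Sum>x\<in>\<Omega>. P x * r x) / m - (\<Sum>x\<in>\<Omega>. P x)"
    by (simp add: algebra_simps sum.distrib sum_subtractf sum_distrib_left sum_divide_distrib)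
  also have "\<dots> \<le> ln m" using P m by (simp add: positive_distribution_def field_simps)
  finally show ?thesis .
qed

lemma sum_over_fiber_pairs:
  assumes "finite \<Omega>"
  shows "(\<Sum>x\<in>\<Omega>. g x * fiber_weight \<Omega> P \<phi> x) = (\<Sum>y\<in>\<Omega>. P y * (\<Sum>x | x \<in> \<Omega> \<and> \<phi> x = \<phi> y. g x))"
proof -
  have "(\<Sum>x\<in>\<Omega>. g x * fiber_weight \<Omega> P \<phi> x) = (\<Sum>x\<in>\<Omega>. \<Sum>y | y \<in> \<Omega> \<and> \<phi> x = \<phi> y. P y * g x)"
    unfolding fiber_weight_def sum_distrib_left by (intro sum.cong) (auto simp: mult.commute)
  also have "\<dots> = (\<Sum>y\<in>\<Omega>. \<Sum>x | x \<in> \<Omega> \<and> \<phi> x = \<phi> y. P y * g x)"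
    by (rule sum.swap_restrict[OF assms assms])
  finally show ?thesis by (simp add: sum_distrib_left)
qed

text \<open>The quotient is the probability of x given its label; the points of F with one common
  label contribute at most 1 in total.\<close>

lemma sum_fiber_ratio_le_card:
  assumes P: "positive_distribution \<Omega> P" and F: "F \<subseteq> \<Omega>"
  shows "(\<Sum>x\<in>F. P x / fiber_weight \<Omega> P \<psi> x) \<le> real (card (\<psi> ` F))"
proof -
  have fin: "finite \<Omega>" "finite F" using P F by (auto simp: positive_distribution_def finite_subset)
  have "(\<Sum>x\<in>F. P x / fiber_weight \<Omega> P \<psi> x) = (\<Sum>v\<in>\<psi> ` F. \<Sum>x | x \<in> F \<and> \<psi> x = v. P x / fiber_weight \<Omega> P \<psi> x)"
    by (rule sum.image_gen[OF fin(2)])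
  also have "\<dots> \<le> (\<Sum>v\<in>\<psi> ` F. 1)"
  proof (rule sum_mono)
    fix v assume "v \<in> \<psi> ` F"
    then obtain z where z: "z \<in> F" "v = \<psi> z" by auto
    have "(\<Sum>x | x \<in> F \<and> \<psi> x = v. P x / fiber_weight \<Omega> P \<psi> x)
        = (\<Sum>x | x \<in> F \<and> \<psi> x = v. P x) / fiber_weight \<Omega> P \<psi> z"
      unfolding sum_divide_distrib by (intro sum.cong) (auto simp: fiber_weight_def z)
    also have "(\<Sum>x | x \<in> F \<and> \<psi> x = v. P x) \<le> fiber_weight \<Omega> P \<psi> z"
      unfolding fiber_weight_def using fin F P z
      by (intro sum_mono2) (auto simp: positive_distribution_def less_imp_le)
    finally show "(\<Sum>x | x \<in> F \<and> \<psi> x = v. P x / fiber_weight \<Omega> P \<psi> x) \<le> 1"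
      using fiber_weight_pos[OF P, of z \<psi>] z F by (auto simp: divide_le_eq_1_pos divide_right_mono subset_iff)
  qed
  finally show ?thesis by simp
qed

text \<open>The conditional entropy of \<psi> given \<phi> is at most the logarithm of the number of
  values of \<psi> on a \<phi>-fibre. Jensen is applied to the ratio of the fibre weights; its mean
  becomes a sum of conditional probabilities once the two points of a pair in a common \<phi>-fibre
  are exchanged.\<close>

lemma label_entropy_le_count:
  assumes P: "positive_distribution \<Omega> P" and m: "m > 0"
    and c: "\<And>x. x \<in> \<Omega> \<Longrightarrow> card (\<psi> ` {y \<in> \<Omega>. \<phi> y = \<phi> x}) \<le> m"
  shows "label_entropy \<Omega> P \<psi> \<le> label_entropy \<Omega> P \<phi> + ln (real m)"
proof -
  have fin: "finite \<Omega>" using P by (simp add: positive_distribution_def)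
  let ?r = "\<lambda>x. fiber_weight \<Omega> P \<phi> x / fiber_weight \<Omega> P \<psi> x"
  have "(\<Sum>x\<in>\<Omega>. P x * ?r x) = (\<Sum>x\<in>\<Omega>. P x / fiber_weight \<Omega> P \<psi> x * fiber_weight \<Omega> P \<phi> x)"
    by (simp add: mult.commute)
  also have "\<dots> = (\<Sum>y\<in>\<Omega>. P y * (\<Sum>x | x \<in> \<Omega> \<and> \<phi> x = \<phi> y. P x / fiber_weight \<Omega> P \<psi> x))"
    by (rule sum_over_fiber_pairs[OF fin])
  also have "\<dots> \<le> (\<Sum>y\<in>\<Omega>. P y * real m)"
  proof (intro sum_mono mult_left_mono)
    fix y assume y: "y \<in> \<Omega>"
    have "(\<Sum>x | x \<in> \<Omega> \<and> \<phi> x = \<phi> y. P x / fiber_weight \<Omega> P \<psi> x) \<le> real (card (\<psi> ` {x. x \<in> \<Omega> \<and> \<phi> x = \<phi> y}))"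
      by (intro sum_fiber_ratio_le_card[OF P]) auto
    then show "(\<Sum>x | x \<in> \<Omega> \<and> \<phi> x = \<phi> y. P x / fiber_weight \<Omega> P \<psi> x) \<le> real m"
      using c[OF y] by linarith
  qed (use P in \<open>auto simp: positive_distribution_def less_imp_le\<close>)
  also have "\<dots> = real m" using P by (simp add: positive_distribution_def flip: sum_distrib_right)
  finally have "(\<Sum>x\<in>\<Omega>. P x * ln (?r x)) \<le> ln (real m)"
    using m by (intro expectation_ln_le[OF P]) (auto simp: fiber_weight_pos[OF P])
  also have "(\<Sum>x\<in>\<Omega>. P x * ln (?r x)) = (\<Sum>x\<in>\<Omega>. P x * ln (fiber_weight \<Omega> P \<phi> x) - P x * ln (fiber_weight \<Omega> P \<psi> x))"
    using fiber_weight_pos[OF P] by (intro sum.cong) (auto simp: ln_div less_imp_neq[OF fiber_weight_pos[OF P], symmetric] right_diff_distrib)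
  finally show ?thesis by (simp add: label_entropy_def sum_subtractf)
qed

text \<open>Nonnegativity of the conditional mutual information of \<phi> and \<psi> given \<omega>,
  where \<omega> is a function of either label. Jensen is applied to the ratio \<open>?r\<close>,
  whose mean is at most 1.\<close>

lemma label_entropy_submodular:
  assumes P: "positive_distribution \<Omega> P"
    and \<omega>\<phi>: "\<And>x y. x \<in> \<Omega> \<Longrightarrow> y \<in> \<Omega> \<Longrightarrow> \<phi> x = \<phi> y \<Longrightarrow> \<omega> x = \<omega> y"
    and \<omega>\<psi>: "\<And>x y. x \<in> \<Omega> \<Longrightarrow> y \<in> \<Omega> \<Longrightarrow> \<psi> x = \<psi> y \<Longrightarrow> \<omega> x = \<omega> y"
  shows "label_entropy \<Omega> P (\<lambda>x. (\<phi> x, \<psi> x)) + label_entropy \<Omega> P \<omega> \<le> label_entropy \<Omega> P \<phi> + label_entropy \<Omega> P \<psi>"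
proof -
  have fin: "finite \<Omega>" using P by (simp add: positive_distribution_def)
  have P0: "P x \<ge> 0" if "x \<in> \<Omega>" for x using P that by (auto simp: positive_distribution_def less_imp_le)
  let ?w = "fiber_weight \<Omega> P"
  let ?\<phi>\<psi> = "\<lambda>x. (\<phi> x, \<psi> x)"
  note pos = fiber_weight_pos[OF P]
  let ?r = "\<lambda>x. ?w \<phi> x * ?w \<psi> x / (?w ?\<phi>\<psi> x * ?w \<omega> x)"
  \<comment> \<open>Once the \<psi>-weight of x is expanded as a sum over z, the points x with the
    \<phi>-label of y and the \<psi>-label of z share one joint label, so their conditional weights
    add up to at most 1. If such an x exists, y and z have the same \<omega>-label; the sum over z
    is then at most the weight of an \<omega>-fibre, which cancels the denominator.\<close>
  have inner: "(\<Sum>x | x \<in> \<Omega> \<and> \<phi> x = \<phi> y. P x * ?w \<psi> x / (?w ?\<phi>\<psi> x * ?w \<omega> x)) \<le> 1" if y: "y \<in> \<Omega>" for y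
  proof -
    let ?F = "{x. x \<in> \<Omega> \<and> \<phi> x = \<phi> y}"
    have "(\<Sum>x\<in>?F. P x * ?w \<psi> x / (?w ?\<phi>\<psi> x * ?w \<omega> x)) =
        (\<Sum>x\<in>?F. \<Sum>z | z \<in> \<Omega> \<and> \<psi> x = \<psi> z. P z / ?w \<omega> y * (P x / ?w ?\<phi>\<psi> x))"
    proof (rule sum.cong[OF refl])
      fix x assume x: "x \<in> ?F"
      then have "?w \<omega> x = ?w \<omega> y" using \<omega>\<phi>[of x y] y by (simp add: fiber_weight_def)
      moreover have "?w \<psi> x = (\<Sum>z | z \<in> \<Omega> \<and> \<psi> x = \<psi> z. P z)" unfolding fiber_weight_def
        by (rule sum.cong) auto
      ultimately show "P x * ?w \<psi> x / (?w ?\<phi>\<psi> x * ?w \<omega> x) = (\<Sum>z | z \<in> \<Omega> \<and> \<psi> x = \<psi> z. P z / ?w \<omega> y * (P x / ?w ?\<phi>\<psi> x))"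
        by (simp add: sum_distrib_left sum_distrib_right sum_divide_distrib field_simps)
    qed
    also have "\<dots> = (\<Sum>z\<in>\<Omega>. \<Sum>x | x \<in> ?F \<and> \<psi> x = \<psi> z. P z / ?w \<omega> y * (P x / ?w ?\<phi>\<psi> x))"
      by (rule sum.swap_restrict) (use fin in auto)
    also have "\<dots> \<le> (\<Sum>z\<in>\<Omega>. if \<omega> z = \<omega> y then P z / ?w \<omega> y else 0)"
    proof (rule sum_mono)
      fix z assume z: "z \<in> \<Omega>"
      let ?G = "{x. x \<in> ?F \<and> \<psi> x = \<psi> z}"
      show "(\<Sum>x\<in>?G. P z / ?w \<omega> y * (P x / ?w ?\<phi>\<psi> x)) \<le> (if \<omega> z = \<omega> y then P z / ?w \<omega> y else 0)"
      proof (cases "?G = {}")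
        case True
        then show ?thesis using P0[OF z] pos[OF y, of \<omega>] by (simp only: True sum.empty) (auto simp: divide_nonneg_pos)
      next
        case False
        then obtain x where x: "x \<in> \<Omega>" "\<phi> x = \<phi> y" "\<psi> x = \<psi> z" by auto
        then have "\<omega> z = \<omega> y" using \<omega>\<phi>[of x y] \<omega>\<psi>[of x z] y z by simp
        have "(\<Sum>x\<in>?G. P x / ?w ?\<phi>\<psi> x) \<le> real (card (?\<phi>\<psi> ` ?G))"
          by (rule sum_fiber_ratio_le_card[OF P]) auto
        also have "?\<phi>\<psi> ` ?G \<subseteq> {(\<phi> y, \<psi> z)}" by auto
        then have "card (?\<phi>\<psi> ` ?G) \<le> card {(\<phi> y, \<psi> z)}" by (intro card_mono) auto
        then have "real (card (?\<phi>\<psi> ` ?G)) \<le> 1" by simp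
        finally have "P z / ?w \<omega> y * (\<Sum>x\<in>?G. P x / ?w ?\<phi>\<psi> x) \<le> P z / ?w \<omega> y * 1"
          using P0[OF z] pos[OF y, of \<omega>] by (intro mult_left_mono) auto
        then show ?thesis using \<open>\<omega> z = \<omega> y\<close> by (simp add: sum_distrib_left)
      qed
    qed
    also have "\<dots> = (\<Sum>z | z \<in> \<Omega> \<and> \<omega> z = \<omega> y. P z) / ?w \<omega> y"
      using fin by (simp add: sum.inter_filter sum_divide_distrib if_distrib[of "\<lambda>t. t / _"] cong: if_cong)
    also have "\<dots> = 1" using pos[OF y, of \<omega>] by (simp add: fiber_weight_def)
    finally show ?thesis .
  qed
  have "(\<Sum>x\<in>\<Omega>. P x * ?r x) = (\<Sum>x\<in>\<Omega>. (P x * ?w \<psi> x / (?w ?\<phi>\<psi> x * ?w \<omega> x)) * ?w \<phi> x)"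
    by (simp add: mult_ac)
  also have "\<dots> = (\<Sum>y\<in>\<Omega>. P y * (\<Sum>x | x \<in> \<Omega> \<and> \<phi> x = \<phi> y. P x * ?w \<psi> x / (?w ?\<phi>\<psi> x * ?w \<omega> x)))"
    by (rule sum_over_fiber_pairs[OF fin])
  also have "\<dots> \<le> (\<Sum>y\<in>\<Omega>. P y * 1)" using inner P0 by (intro sum_mono mult_left_mono) auto
  finally have "(\<Sum>x\<in>\<Omega>. P x * ?r x) \<le> 1" using P by (simp add: positive_distribution_def)
  then have "(\<Sum>x\<in>\<Omega>. P x * ln (?r x)) \<le> ln 1"
    by (intro expectation_ln_le[OF P] divide_pos_pos mult_pos_pos pos) auto
  also have "(\<Sum>x\<in>\<Omega>. P x * ln (?r x)) = (\<Sum>x\<in>\<Omega>. P x * ln (?w \<phi> x) + P x * ln (?w \<psi> x)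
      - P x * ln (?w ?\<phi>\<psi> x) - P x * ln (?w \<omega> x))"
    using pos by (intro sum.cong) (auto simp: ln_div ln_mult pos less_imp_neq[OF pos, symmetric] algebra_simps)
  finally show ?thesis by (simp add: label_entropy_def sum_subtractf sum.distrib)
qed

text \<open>Gibbs' inequality against the unnormalised weights H: relative to H / S, of total mass
  at most 1, the distribution of \<phi> has nonnegative relative entropy.\<close>

lemma label_entropy_le_cross_entropy:
  assumes P: "positive_distribution \<Omega> P" and H: "\<And>x. x \<in> \<Omega> \<Longrightarrow> H (\<phi> x) > 0"
    and S: "(\<Sum>k\<in>\<phi> ` \<Omega>. H k) \<le> S"
  shows "label_entropy \<Omega> P \<phi> \<le> ln S - (\<Sum>x\<in>\<Omega>. P x * ln (H (\<phi> x)))"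
proof -
  have fin: "finite \<Omega>" using P by (simp add: positive_distribution_def)
  have ne: "\<Omega> \<noteq> {}" using P by (auto simp: positive_distribution_def)
  note pos = fiber_weight_pos[OF P]
  have "(\<Sum>k\<in>\<phi> ` \<Omega>. H k) > 0" using fin ne H by (intro sum_pos) auto
  then have S0: "S > 0" using S by simp
  have "(\<Sum>x\<in>\<Omega>. P x * (H (\<phi> x) / fiber_weight \<Omega> P \<phi> x)) = (\<Sum>k\<in>\<phi> ` \<Omega>. \<Sum>x | x \<in> \<Omega> \<and> \<phi> x = k. P x * (H (\<phi> x) / fiber_weight \<Omega> P \<phi> x))"
    by (rule sum.image_gen[OF fin])
  also have "\<dots> = (\<Sum>k\<in>\<phi> ` \<Omega>. H k)"
  proof (rule sum.cong[OF refl])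
    fix k assume "k \<in> \<phi> ` \<Omega>"
    then obtain z where z: "z \<in> \<Omega>" "k = \<phi> z" by auto
    have "(\<Sum>x | x \<in> \<Omega> \<and> \<phi> x = k. P x * (H (\<phi> x) / fiber_weight \<Omega> P \<phi> x)) = (\<Sum>x | x \<in> \<Omega> \<and> \<phi> x = \<phi> z. P x) * (H k / fiber_weight \<Omega> P \<phi> z)"
      unfolding sum_distrib_right by (intro sum.cong) (auto simp: fiber_weight_def z)
    also have "\<dots> = H k" using pos[OF z(1), of \<phi>] by (simp add: fiber_weight_def)
    finally show "(\<Sum>x | x \<in> \<Omega> \<and> \<phi> x = k. P x * (H (\<phi> x) / fiber_weight \<Omega> P \<phi> x)) = H k" .
  qed
  finally have "(\<Sum>x\<in>\<Omega>. P x * ln (H (\<phi> x) / fiber_weight \<Omega> P \<phi> x)) \<le> ln S"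
    using S S0 H pos by (intro expectation_ln_le[OF P] divide_pos_pos) auto
  also have "(\<Sum>x\<in>\<Omega>. P x * ln (H (\<phi> x) / fiber_weight \<Omega> P \<phi> x)) = (\<Sum>x\<in>\<Omega>. P x * ln (H (\<phi> x)) - P x * ln (fiber_weight \<Omega> P \<phi> x))"
    using pos H by (intro sum.cong) (auto simp: ln_div less_imp_neq[OF pos, symmetric] less_imp_neq[OF H, symmetric] right_diff_distrib)
  finally show ?thesis by (simp add: label_entropy_def sum_subtractf)
qed

section \<open>A finite-scale Brascamp-Lieb inequality\<close>


definition fl :: "'b::euclidean_space \<Rightarrow> 'b \<Rightarrow> int" where
  "fl y = (\<lambda>b\<in>Basis. \<lfloor>y \<bullet> b\<rfloor>)"

lemma norm_diff_le_of_fl_eq: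
  fixes x y :: "'b::euclidean_space"
  assumes "fl x = fl y"
  shows "norm (x - y) \<le> real DIM('b)"
proof -
  have "norm (x - y) \<le> (\<Sum>b\<in>Basis. \<bar>(x - y) \<bullet> b\<bar>)" by (rule norm_le_l1)
  also have "\<dots> \<le> (\<Sum>b\<in>(Basis::'b set). 1)"
  proof (rule sum_mono)
    fix b :: 'b assume b: "b \<in> Basis"
    have "\<lfloor>x \<bullet> b\<rfloor> = \<lfloor>y \<bullet> b\<rfloor>" using fun_cong[OF assms, of b] b by (simp add: fl_def)
    then show "\<bar>(x - y) \<bullet> b\<bar> \<le> 1" by (simp add: inner_diff_left) linarith
  qed
  finally show ?thesis by simp
qed

lemma card_fl_image_le:
  fixes S :: "'b::euclidean_space set"
  assumes S: "\<And>y. y \<in> S \<Longrightarrow> norm (y - z) \<le> C"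
  shows "finite (fl ` S) \<and> card (fl ` S) \<le> nat (2 * \<lceil>C\<rceil> + 3) ^ DIM('b)"
proof -
  let ?R = "\<lambda>b. {\<lfloor>z \<bullet> b\<rfloor> - \<lceil>C\<rceil> - 1 .. \<lfloor>z \<bullet> b\<rfloor> + \<lceil>C\<rceil> + 1}"
  have "fl ` S \<subseteq> PiE Basis ?R"
  proof (intro image_subsetI PiE_I)
    fix y b assume y: "y \<in> S" and b: "b \<in> (Basis::'b set)"
    have "\<bar>(y - z) \<bullet> b\<bar> \<le> norm (y - z)" using b by (rule Basis_le_norm)
    then have "\<bar>y \<bullet> b - z \<bullet> b\<bar> \<le> C" using S[OF y] by (simp add: inner_diff_left)
    then have "\<lfloor>z \<bullet> b\<rfloor> - \<lceil>C\<rceil> - 1 \<le> \<lfloor>y \<bullet> b\<rfloor> \<and> \<lfloor>y \<bullet> b\<rfloor> \<le> \<lfloor>z \<bullet> b\<rfloor> + \<lceil>C\<rceil> + 1" by linarith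
    then show "fl y b \<in> ?R b" using b by (simp add: fl_def)
  qed (simp add: fl_def)
  moreover have fin: "finite (PiE (Basis::'b set) ?R)" by (intro finite_PiE) auto
  moreover have "card (PiE (Basis::'b set) ?R) = nat (2 * \<lceil>C\<rceil> + 3) ^ DIM('b)"
    by (subst card_PiE) (auto simp: add.commute)
  ultimately show ?thesis using card_mono[OF fin, of "fl ` S"] finite_subset[OF _ fin, of "fl ` S"] by simp
qed

section \<open>Comparison of rounded linear images\<close>

text \<open>Nested kernels let L2 factor through L1: L1 is injective on the orthogonal complement of
  its kernel, and L2 composed with a left inverse there is linear, hence bounded.\<close>

lemma linear_kernel_factor_bound:
  fixes L1 :: "'a::euclidean_space \<Rightarrow> 'b::euclidean_space" and L2 :: "'a \<Rightarrow> 'c::euclidean_space"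
  assumes L: "linear L1" "linear L2" and ker: "\<And>x. L1 x = 0 \<Longrightarrow> L2 x = 0"
  obtains C where "C \<ge> 0" "\<And>x. norm (L2 x) \<le> C * norm (L1 x)"
proof -
  define N where "N = {x. L1 x = 0}"
  have N: "subspace N" unfolding N_def using L(1) by (rule linear_subspace_kernel)
  let ?V = "orthogonal_comp N"
  have V: "subspace ?V" by (rule subspace_orthogonal_comp)
  have "inj_on L1 ?V"
  proof (subst linear_inj_on_iff_eq_0[OF L(1) V], intro ballI impI)
    fix v assume v: "v \<in> ?V" "L1 v = 0"
    then have "v \<in> N" by (simp add: N_def)
    with v show "v = 0" by (auto simp: orthogonal_comp_def orthogonal_def)
  qed
  then obtain g where g: "linear g" "\<And>v. v \<in> ?V \<Longrightarrow> g (L1 v) = v"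
    using linear_exists_left_inverse_on[OF L(1) V] by blast
  have eq: "L2 x = (L2 \<circ> g) (L1 x)" for x
  proof -
    obtain k v where kv: "k \<in> span N" "\<And>w. w \<in> span N \<Longrightarrow> orthogonal v w" "x = k + v"
      using orthogonal_subspace_decomp_exists[of N x] by metis
    have k: "L1 k = 0" using kv(1) N by (simp add: span_eq_iff[THEN iffD2] N_def)
    have "v \<in> ?V" using kv(2) N by (auto simp: orthogonal_comp_def orthogonal_commute span_base)
    then show ?thesis using k ker[OF k] kv(3) L g by (simp add: linear_add)
  qed
  have "linear (L2 \<circ> g)" using g(1) L(2) by (rule linear_compose)
  then obtain C where C: "C > 0" "\<And>y. norm ((L2 \<circ> g) y) \<le> C * norm y"
    using linear_bounded_pos by blast
  show ?thesis using that[of C] C eq by (metis less_imp_le)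
qed

text \<open>The count m is chosen before \<Omega> and \<phi>, so it depends only on the two maps and
  on D. This uniformity makes all later entropy errors independent of the scale.\<close>

lemma card_fl_fiber_le:
  fixes L1 :: "'a::euclidean_space \<Rightarrow> 'b::euclidean_space" and L2 :: "'a \<Rightarrow> 'c::euclidean_space"
  assumes "linear L1" "linear L2" "\<And>x. L1 x = 0 \<Longrightarrow> L2 x = 0"
  shows "\<exists>m>0. \<forall>\<Omega> (\<phi>::'a \<Rightarrow> 'l). (\<forall>x\<in>\<Omega>. \<forall>y\<in>\<Omega>. \<phi> x = \<phi> y \<longrightarrow> norm (L1 x - L1 y) \<le> D) \<longrightarrow>
    (\<forall>x\<in>\<Omega>. finite ((\<lambda>x. fl (L2 x)) ` {y\<in>\<Omega>. \<phi> y = \<phi> x}) \<and> card ((\<lambda>x. fl (L2 x)) ` {y\<in>\<Omega>. \<phi> y = \<phi> x}) \<le> (m::nat))"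
proof -
  obtain C where C: "C \<ge> 0" "\<And>x. norm (L2 x) \<le> C * norm (L1 x)"
    using linear_kernel_factor_bound[OF assms] by blast
  show ?thesis
  proof (intro exI[of _ "Suc (nat (2 * \<lceil>C * D\<rceil> + 3) ^ DIM('c))"] conjI allI impI ballI)
    fix \<Omega> and \<phi> :: "'a \<Rightarrow> 'l" and x
    assume H: "\<forall>x\<in>\<Omega>. \<forall>y\<in>\<Omega>. \<phi> x = \<phi> y \<longrightarrow> norm (L1 x - L1 y) \<le> D" and x: "x \<in> \<Omega>"
    have "norm (y - L2 x) \<le> C * D" if y: "y \<in> L2 ` {y\<in>\<Omega>. \<phi> y = \<phi> x}" for y
    proof -
      obtain z where z: "z \<in> \<Omega>" "\<phi> z = \<phi> x" "y = L2 z" using y by auto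
      have "norm (y - L2 x) \<le> C * norm (L1 z - L1 x)"
        using C(2)[of "z - x"] assms by (simp add: linear_diff z)
      also have "\<dots> \<le> C * D" using H z x C by (intro mult_left_mono) auto
      finally show ?thesis .
    qed
    from card_fl_image_le[of "L2 ` {y\<in>\<Omega>. \<phi> y = \<phi> x}", OF this] show "finite ((\<lambda>x. fl (L2 x)) ` {y \<in> \<Omega>. \<phi> y = \<phi> x})"
      "card ((\<lambda>x. fl (L2 x)) ` {y \<in> \<Omega>. \<phi> y = \<phi> x}) \<le> Suc (nat (2 * \<lceil>C * D\<rceil> + 3) ^ DIM('c))"
      by (auto simp: image_image)
  qed simp
qed

lemma entropy_fl_compare:
  fixes L1 :: "'a::euclidean_space \<Rightarrow> 'b::euclidean_space" and L2 :: "'a \<Rightarrow> 'c::euclidean_space"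
  assumes "linear L1" "linear L2" "\<And>x. L1 x = 0 \<Longrightarrow> L2 x = 0"
  shows "\<exists>C. \<forall>\<Omega> P (\<phi>::'a \<Rightarrow> 'l). positive_distribution \<Omega> P \<and>
     (\<forall>x\<in>\<Omega>. \<forall>y\<in>\<Omega>. \<phi> x = \<phi> y \<longrightarrow> norm (L1 x - L1 y) \<le> D) \<longrightarrow>
     label_entropy \<Omega> P (\<lambda>x. fl (L2 x)) \<le> label_entropy \<Omega> P \<phi> + C"
proof -
  have "\<exists>m>0. \<forall>\<Omega> (\<phi>::'a \<Rightarrow> 'l). (\<forall>x\<in>\<Omega>. \<forall>y\<in>\<Omega>. \<phi> x = \<phi> y \<longrightarrow> norm (L1 x - L1 y) \<le> D) \<longrightarrow>
    (\<forall>x\<in>\<Omega>. finite ((\<lambda>x. fl (L2 x)) ` {y\<in>\<Omega>. \<phi> y = \<phi> x}) \<and> card ((\<lambda>x. fl (L2 x)) ` {y\<in>\<Omega>. \<phi> y = \<phi> x}) \<le> (m::nat))"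
    by (rule card_fl_fiber_le[OF assms])
  then obtain m where m: "m > 0" "\<forall>\<Omega> (\<phi>::'a \<Rightarrow> 'l). (\<forall>x\<in>\<Omega>. \<forall>y\<in>\<Omega>. \<phi> x = \<phi> y \<longrightarrow> norm (L1 x - L1 y) \<le> D) \<longrightarrow>
    (\<forall>x\<in>\<Omega>. finite ((\<lambda>x. fl (L2 x)) ` {y\<in>\<Omega>. \<phi> y = \<phi> x}) \<and> card ((\<lambda>x. fl (L2 x)) ` {y\<in>\<Omega>. \<phi> y = \<phi> x}) \<le> (m::nat))"
    by (elim exE conjE)
  show ?thesis
  proof (intro exI allI impI, elim conjE)
    fix \<Omega> P and \<phi> :: "'a \<Rightarrow> 'l"
    assume P: "positive_distribution \<Omega> P"
      and H: "\<forall>x\<in>\<Omega>. \<forall>y\<in>\<Omega>. \<phi> x = \<phi> y \<longrightarrow> norm (L1 x - L1 y) \<le> D"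
    show "label_entropy \<Omega> P (\<lambda>x. fl (L2 x)) \<le> label_entropy \<Omega> P \<phi> + ln (real m)"
      by (rule label_entropy_le_count[OF P m(1)]) (use m(2)[rule_format, of \<Omega> \<phi>] H in blast)
  qed
qed

lemma exists_linear_kernel:
  fixes K :: "'a::euclidean_space set"
  assumes "subspace K"
  shows "\<exists>L::'a \<Rightarrow> 'a. linear L \<and> (\<forall>x. L x = 0 \<longleftrightarrow> x \<in> K)"
proof -
  obtain B where B: "B \<subseteq> orthogonal_comp K" "pairwise orthogonal B" "\<And>x. x \<in> B \<Longrightarrow> norm x = 1"
    "independent B" "span B = orthogonal_comp K"
    using orthonormal_basis_subspace[OF subspace_orthogonal_comp[of K]] by metis
  have fin: "finite B" using B(4) by (rule finiteI_independent)
  define L where "L x = (\<Sum>b\<in>B. (x \<bullet> b) *\<^sub>R b)" for x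
  have "linear L" unfolding L_def
    by (intro linearI) (simp_all add: inner_add_left scaleR_add_left sum.distrib scaleR_sum_right)
  moreover have "L x = 0 \<longleftrightarrow> x \<in> K" for x
  proof
    assume "x \<in> K"
    then have "x \<bullet> b = 0" if "b \<in> B" for b using B(1) that by (auto simp: orthogonal_comp_def orthogonal_def)
    then show "L x = 0" by (simp add: L_def)
  next
    assume 0: "L x = 0"
    have "(\<Sum>b\<in>B. (x \<bullet> b) * c b) = 0 \<Longrightarrow> x \<bullet> b = 0" if "b \<in> B" "c = (\<lambda>b'. b' \<bullet> b)" for b c
    proof -
      assume "(\<Sum>b\<in>B. (x \<bullet> b) * c b) = 0"
      moreover have "(\<Sum>b\<in>B. (x \<bullet> b) * c b) = (\<Sum>b'\<in>B. if b' = b then x \<bullet> b else 0)"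
        using that B(2,3) by (intro sum.cong) (auto simp: pairwise_def orthogonal_def dot_square_norm)
      ultimately show ?thesis using that fin by simp
    qed
    moreover have "(\<Sum>b'\<in>B. (x \<bullet> b') * (b' \<bullet> b)) = 0" for b
      using arg_cong[OF 0, of "\<lambda>y. y \<bullet> b"] by (simp add: L_def inner_sum_left)
    ultimately have *: "x \<bullet> b = 0" if "b \<in> B" for b using that by blast
    have "x \<in> orthogonal_comp (orthogonal_comp K)"
    proof -
      have "orthogonal y x" if "y \<in> span B" for y
        using orthogonal_to_span[OF that, of x] * by (simp add: orthogonal_def inner_commute)
      then show ?thesis by (auto simp: orthogonal_comp_def[of "orthogonal_comp K"] B(5))
    qed
    then show "x \<in> K" using orthogonal_comp_self[OF assms] by simp
  qed
  ultimately show ?thesis by blast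
qed

section \<open>Entropy of a point modulo a subspace\<close>

text \<open>A substitute for the quotient map by K that stays in one type. The choice is harmless:
  by \<open>entropy_fl_compare\<close>, maps with the same kernel give rounded labels whose
  entropies differ by a bounded amount.\<close>

definition ker_map :: "'a::euclidean_space set \<Rightarrow> 'a \<Rightarrow> 'a" where
  "ker_map K = (SOME L. linear L \<and> (\<forall>x. L x = 0 \<longleftrightarrow> x \<in> K))"

lemma ker_map:
  assumes "subspace K"
  shows "linear (ker_map K)" "ker_map K x = 0 \<longleftrightarrow> x \<in> K"
  using someI_ex[OF exists_linear_kernel[OF assms]] by (auto simp: ker_map_def)

definition quotient_entropy :: "'a::euclidean_space set \<Rightarrow> ('a \<Rightarrow> real) \<Rightarrow> 'a set \<Rightarrow> real" where
  "quotient_entropy \<Omega> P K = label_entropy \<Omega> P (\<lambda>x. fl (ker_map K x))"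

lemma quotient_entropy_antimono:
  fixes K L :: "'a::euclidean_space set"
  assumes "subspace K" "subspace L" "K \<subseteq> L"
  shows "\<exists>C. \<forall>\<Omega> P. positive_distribution \<Omega> P \<longrightarrow> quotient_entropy \<Omega> P L \<le> quotient_entropy \<Omega> P K + C"
proof -
  have "\<exists>C. \<forall>\<Omega> P (\<phi>::'a \<Rightarrow> 'a \<Rightarrow> int). positive_distribution \<Omega> P \<and>
     (\<forall>x\<in>\<Omega>. \<forall>y\<in>\<Omega>. \<phi> x = \<phi> y \<longrightarrow> norm (ker_map K x - ker_map K y) \<le> real DIM('a)) \<longrightarrow>
     label_entropy \<Omega> P (\<lambda>x. fl (ker_map L x)) \<le> label_entropy \<Omega> P \<phi> + C"
    by (rule entropy_fl_compare) (use assms ker_map in auto)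
  then show ?thesis unfolding quotient_entropy_def using norm_diff_le_of_fl_eq by meson
qed

text \<open>\<open>label_entropy_submodular\<close> wants the coarse label to be an exact function
  of the two finer ones, whereas rounding modulo K determines the rounded label modulo K + L only up
  to boundedly many values. So this label is adjoined to both sides, at bounded cost. The joint
  label controls the class modulo \<open>K \<inter> L\<close>, the common kernel of the two
  maps.\<close>

lemma quotient_entropy_submodular:
  fixes K L :: "'a::euclidean_space set"
  assumes K: "subspace K" and L: "subspace L"
  shows "\<exists>C. \<forall>\<Omega> P. positive_distribution \<Omega> P \<longrightarrow>
    quotient_entropy \<Omega> P (K \<inter> L) + quotient_entropy \<Omega> P (span (K \<union> L)) \<le> quotient_entropy \<Omega> P K + quotient_entropy \<Omega> P L + C"
proof -
  let ?k = "\<lambda>x. fl (ker_map K x)" and ?l = "\<lambda>x. fl (ker_map L x)"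
  let ?S = "span (K \<union> L)"
  let ?s = "\<lambda>x. fl (ker_map ?S x)"
  let ?D = "real DIM('a)"
  have sub: "K \<subseteq> ?S" "L \<subseteq> ?S" by (meson Un_upper1 Un_upper2 order_trans span_superset)+
  have KL: "subspace (K \<inter> L)" and S: "subspace ?S" using K L by (auto simp: subspace_inter)
  note lin = ker_map(1)[OF K] ker_map(1)[OF L] ker_map(1)[OF KL] ker_map(1)[OF S]
  have "\<exists>C. \<forall>\<Omega> P (\<phi>::'a \<Rightarrow> (('a \<Rightarrow> int) \<times> ('a \<Rightarrow> int)) \<times> (('a \<Rightarrow> int) \<times> ('a \<Rightarrow> int))). positive_distribution \<Omega> P \<and>
     (\<forall>x\<in>\<Omega>. \<forall>y\<in>\<Omega>. \<phi> x = \<phi> y \<longrightarrow> norm ((ker_map K x, ker_map L x) - (ker_map K y, ker_map L y)) \<le> 2 * ?D) \<longrightarrow>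
     label_entropy \<Omega> P (\<lambda>x. fl (ker_map (K \<inter> L) x)) \<le> label_entropy \<Omega> P \<phi> + C"
    by (rule entropy_fl_compare) (use lin ker_map(2)[OF K] ker_map(2)[OF L] ker_map(2)[OF KL] in
        \<open>auto intro!: linearI simp: linear_add linear_scale zero_prod_def\<close>)
  then obtain C0 where C0: "\<And>\<Omega> P (\<phi>::'a \<Rightarrow> (('a \<Rightarrow> int) \<times> ('a \<Rightarrow> int)) \<times> (('a \<Rightarrow> int) \<times> ('a \<Rightarrow> int))). positive_distribution \<Omega> P \<Longrightarrow>
     (\<forall>x\<in>\<Omega>. \<forall>y\<in>\<Omega>. \<phi> x = \<phi> y \<longrightarrow> norm ((ker_map K x, ker_map L x) - (ker_map K y, ker_map L y)) \<le> 2 * ?D) \<Longrightarrow>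
     label_entropy \<Omega> P (\<lambda>x. fl (ker_map (K \<inter> L) x)) \<le> label_entropy \<Omega> P \<phi> + C0" by blast
  have pair: "\<exists>C. \<forall>\<Omega> P. positive_distribution \<Omega> P \<longrightarrow>
      label_entropy \<Omega> P (\<lambda>x. (fl (ker_map M x), ?s x)) \<le> label_entropy \<Omega> P (\<lambda>x. fl (ker_map M x)) + C"
    if M: "subspace M" "M \<subseteq> ?S" for M
  proof -
    have "\<exists>m>0. \<forall>\<Omega> (\<phi>::'a \<Rightarrow> 'a \<Rightarrow> int). (\<forall>x\<in>\<Omega>. \<forall>y\<in>\<Omega>. \<phi> x = \<phi> y \<longrightarrow> norm (ker_map M x - ker_map M y) \<le> ?D) \<longrightarrow>
      (\<forall>x\<in>\<Omega>. finite (?s ` {y\<in>\<Omega>. \<phi> y = \<phi> x}) \<and> card (?s ` {y\<in>\<Omega>. \<phi> y = \<phi> x}) \<le> (m::nat))"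
      by (rule card_fl_fiber_le) (use ker_map(1)[OF M(1)] lin ker_map(2)[OF M(1)] ker_map(2)[OF S] M(2) in auto)
    then obtain m where m: "m > 0" "\<forall>\<Omega> (\<phi>::'a \<Rightarrow> 'a \<Rightarrow> int). (\<forall>x\<in>\<Omega>. \<forall>y\<in>\<Omega>. \<phi> x = \<phi> y \<longrightarrow> norm (ker_map M x - ker_map M y) \<le> ?D) \<longrightarrow>
      (\<forall>x\<in>\<Omega>. finite (?s ` {y\<in>\<Omega>. \<phi> y = \<phi> x}) \<and> card (?s ` {y\<in>\<Omega>. \<phi> y = \<phi> x}) \<le> (m::nat))"
      by (elim exE conjE)
    show ?thesis
    proof (intro exI allI impI)
      fix \<Omega> P assume P: "positive_distribution \<Omega> (P::'a \<Rightarrow> real)"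
      show "label_entropy \<Omega> P (\<lambda>x. (fl (ker_map M x), ?s x)) \<le> label_entropy \<Omega> P (\<lambda>x. fl (ker_map M x)) + ln (real m)"
      proof (rule label_entropy_le_count[OF P m(1)])
        fix x assume x: "x \<in> \<Omega>"
        let ?F = "{y\<in>\<Omega>. fl (ker_map M y) = fl (ker_map M x)}"
        have *: "finite (?s ` ?F) \<and> card (?s ` ?F) \<le> m"
        proof -
          have "\<forall>x\<in>\<Omega>. \<forall>y\<in>\<Omega>. fl (ker_map M x) = fl (ker_map M y) \<longrightarrow> norm (ker_map M x - ker_map M y) \<le> ?D"
            by (simp add: norm_diff_le_of_fl_eq)
          from mp[OF spec[OF spec[OF m(2), of \<Omega>], of "\<lambda>x. fl (ker_map M x)"] this] x show ?thesis by simp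
        qed
        have "(\<lambda>x. (fl (ker_map M x), ?s x)) ` ?F = Pair (fl (ker_map M x)) ` ?s ` ?F" by (auto simp: image_iff)
        then show "card ((\<lambda>x. (fl (ker_map M x), ?s x)) ` ?F) \<le> m"
          using * card_image_le[of "?s ` ?F" "Pair (fl (ker_map M x))"] by simp
      qed
    qed
  qed
  obtain C1 where C1: "\<And>\<Omega> P. positive_distribution \<Omega> P \<Longrightarrow>
      label_entropy \<Omega> P (\<lambda>x. (?k x, ?s x)) \<le> label_entropy \<Omega> P ?k + C1" using pair[OF K sub(1)] by blast
  obtain C2 where C2: "\<And>\<Omega> P. positive_distribution \<Omega> P \<Longrightarrow>
      label_entropy \<Omega> P (\<lambda>x. (?l x, ?s x)) \<le> label_entropy \<Omega> P ?l + C2" using pair[OF L sub(2)] by blast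
  show ?thesis
  proof (intro exI allI impI)
    fix \<Omega> P assume P: "positive_distribution \<Omega> (P::'a \<Rightarrow> real)"
    have "label_entropy \<Omega> P (\<lambda>x. ((?k x, ?s x), (?l x, ?s x))) + label_entropy \<Omega> P ?s
        \<le> label_entropy \<Omega> P (\<lambda>x. (?k x, ?s x)) + label_entropy \<Omega> P (\<lambda>x. (?l x, ?s x))"
      by (rule label_entropy_submodular[OF P]) auto
    moreover have "label_entropy \<Omega> P (\<lambda>x. fl (ker_map (K \<inter> L) x)) \<le> label_entropy \<Omega> P (\<lambda>x. ((?k x, ?s x), (?l x, ?s x))) + C0"
    proof (rule C0[OF P], intro ballI impI)
      fix x y assume "((?k x, ?s x), (?l x, ?s x)) = ((?k y, ?s y), (?l y, ?s y))"
      then have "norm (ker_map K x - ker_map K y) \<le> ?D" "norm (ker_map L x - ker_map L y) \<le> ?D"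
        by (auto intro: norm_diff_le_of_fl_eq)
      then show "norm ((ker_map K x, ker_map L x) - (ker_map K y, ker_map L y)) \<le> 2 * ?D"
        using norm_Pair_le[of "ker_map K x - ker_map K y" "ker_map L x - ker_map L y"] by simp
    qed
    ultimately show "quotient_entropy \<Omega> P (K \<inter> L) + quotient_entropy \<Omega> P ?S
        \<le> quotient_entropy \<Omega> P K + quotient_entropy \<Omega> P L + (C0 + C1 + C2)"
      using C1[OF P] C2[OF P] unfolding quotient_entropy_def by linarith
  qed
qed

text \<open>An orthonormal basis B of the orthogonal complement of K in L has dim L - dim K
  elements. The label modulo L and the rounded coordinates along B determine the label modulo K up
  to boundedly many values, and on a ball of radius s each coordinate takes O(s) rounded
  values.\<close>

lemma quotient_entropy_growth:
  fixes K L :: "'a::euclidean_space set"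
  assumes K: "subspace K" and L: "subspace L" and KL: "K \<subseteq> L"
  shows "\<exists>C. \<forall>\<Omega> P s. positive_distribution \<Omega> P \<and> 1 \<le> s \<and> (\<forall>x\<in>\<Omega>. norm x \<le> s) \<longrightarrow>
    quotient_entropy \<Omega> P K \<le> quotient_entropy \<Omega> P L + (real (dim L) - real (dim K)) * ln s + C"
proof -
  define M where "M = {y\<in>L. \<forall>x\<in>K. orthogonal x y}"
  have "subspace M" unfolding M_def
    using L by (auto simp: subspace_def orthogonal_clauses)
  then obtain B where B: "B \<subseteq> M" "pairwise orthogonal B" "\<And>x. x \<in> B \<Longrightarrow> norm x = 1"
    "independent B" "card B = dim M" "span B = M"
    using orthonormal_basis_subspace by metis
  have fin: "finite B" using B(4) by (rule finiteI_independent)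
  have "dim M + dim K = dim L" unfolding M_def by (rule dim_subspace_orthogonal_to_vectors[OF K L KL])
  then have cB: "real (card B) = real (dim L) - real (dim K)" using B(5) by linarith
  let ?D = "real DIM('a)"
  define g where "g x = (\<lambda>b\<in>B. \<lfloor>x \<bullet> b\<rfloor>)" for x :: 'a
  let ?G = "\<lambda>x::'a. (\<Sum>b\<in>B. (x \<bullet> b) *\<^sub>R b)"
  let ?L1 = "\<lambda>x. (ker_map L x, ?G x)"
  have linG: "linear ?G"
    by (intro linearI) (simp_all add: inner_add_left scaleR_add_left sum.distrib scaleR_sum_right)
  have lin: "linear ?L1" using ker_map(1)[OF L] linG
    by (intro linearI) (auto simp: linear_add linear_scale inner_add_left scaleR_add_left sum.distrib scaleR_sum_right)
  have ker: "ker_map K x = 0" if "?L1 x = 0" for x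
  proof -
    have x: "x \<in> L" "?G x = 0" using that ker_map(2)[OF L] by (auto simp: zero_prod_def)
    have "x \<bullet> b = 0" if b: "b \<in> B" for b
    proof -
      have "0 = (\<Sum>b'\<in>B. (x \<bullet> b') * (b' \<bullet> b))"
        using arg_cong[OF x(2), of "\<lambda>y. y \<bullet> b"] by (simp add: inner_sum_left)
      also have "\<dots> = (\<Sum>b'\<in>B. if b' = b then x \<bullet> b else 0)"
        using b B(2,3) by (intro sum.cong) (auto simp: pairwise_def orthogonal_def dot_square_norm)
      finally show ?thesis using b fin by simp
    qed
    then have xM: "orthogonal x y" if "y \<in> M" for y
      using that B(6) by (metis orthogonal_def orthogonal_to_span)
    obtain u v where uv: "u \<in> span K" "\<And>w. w \<in> span K \<Longrightarrow> orthogonal v w" "x = u + v"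
      using orthogonal_subspace_decomp_exists[of K x] by metis
    have u: "u \<in> K" using uv K by (simp add: span_eq_iff[THEN iffD2])
    have "v = x - u" using uv by simp
    then have "v \<in> L" using x u KL L by (auto intro: subspace_diff)
    then have "v \<in> M" using uv(2) unfolding M_def by (auto simp: orthogonal_commute span_base)
    then have "x \<bullet> v = 0" using xM by (simp add: orthogonal_def)
    moreover have "v \<bullet> u = 0" using uv(1,2) by (simp add: orthogonal_def)
    ultimately have "v \<bullet> v = 0" using uv(3) by (simp add: inner_add_left inner_add_right inner_commute)
    then show ?thesis using u uv(3) ker_map(2)[OF K] by simp
  qed
  have "\<exists>C. \<forall>\<Omega> P (\<phi>::'a \<Rightarrow> ('a \<Rightarrow> int) \<times> ('a \<Rightarrow> int)). positive_distribution \<Omega> P \<and>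
     (\<forall>x\<in>\<Omega>. \<forall>y\<in>\<Omega>. \<phi> x = \<phi> y \<longrightarrow> norm (?L1 x - ?L1 y) \<le> ?D + real (card B)) \<longrightarrow>
     label_entropy \<Omega> P (\<lambda>x. fl (ker_map K x)) \<le> label_entropy \<Omega> P \<phi> + C"
    by (rule entropy_fl_compare[OF lin ker_map(1)[OF K] ker])
  then obtain C where C: "\<And>\<Omega> P (\<phi>::'a \<Rightarrow> ('a \<Rightarrow> int) \<times> ('a \<Rightarrow> int)). positive_distribution \<Omega> P \<Longrightarrow>
     (\<forall>x\<in>\<Omega>. \<forall>y\<in>\<Omega>. \<phi> x = \<phi> y \<longrightarrow> norm (?L1 x - ?L1 y) \<le> ?D + real (card B)) \<Longrightarrow>
     label_entropy \<Omega> P (\<lambda>x. fl (ker_map K x)) \<le> label_entropy \<Omega> P \<phi> + C" by blast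
  show ?thesis
  proof (intro exI allI impI, elim conjE)
    fix \<Omega> P s assume P: "positive_distribution \<Omega> (P::'a \<Rightarrow> real)" and s: "1 \<le> (s::real)"
      and bd: "\<forall>x\<in>\<Omega>. norm x \<le> s"
    let ?\<phi> = "\<lambda>x. (fl (ker_map L x), g x)"
    have "label_entropy \<Omega> P (\<lambda>x. fl (ker_map K x)) \<le> label_entropy \<Omega> P ?\<phi> + C"
    proof (rule C[OF P], intro ballI impI)
      fix x y assume "?\<phi> x = ?\<phi> y"
      then have eq: "fl (ker_map L x) = fl (ker_map L y)" "g x = g y" by auto
      have "?G x - ?G y = (\<Sum>b\<in>B. ((x - y) \<bullet> b) *\<^sub>R b)"
        by (simp add: inner_diff_left scaleR_diff_left sum_subtractf)
      also have "norm \<dots> \<le> (\<Sum>b\<in>B. 1)"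
      proof (rule sum_norm_le)
        fix b assume b: "b \<in> B"
        have "\<lfloor>x \<bullet> b\<rfloor> = \<lfloor>y \<bullet> b\<rfloor>" using fun_cong[OF eq(2), of b] b by (simp add: g_def)
        then have "\<bar>(x - y) \<bullet> b\<bar> \<le> 1" by (simp add: inner_diff_left) linarith
        then show "norm (((x - y) \<bullet> b) *\<^sub>R b) \<le> 1" using B(3)[OF b] by simp
      qed
      finally show "norm (?L1 x - ?L1 y) \<le> ?D + real (card B)"
        using norm_Pair_le[of "ker_map L x - ker_map L y" "?G x - ?G y"] norm_diff_le_of_fl_eq[OF eq(1)] by simp
    qed
    also have "label_entropy \<Omega> P ?\<phi> \<le> label_entropy \<Omega> P (\<lambda>x. fl (ker_map L x)) + ln (real (nat (2 * \<lceil>s\<rceil> + 3) ^ card B))"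
    proof (rule label_entropy_le_count[OF P])
      show "0 < nat (2 * \<lceil>s\<rceil> + 3) ^ card B" using s by simp linarith
      fix x assume x: "x \<in> \<Omega>"
      let ?F = "{y\<in>\<Omega>. fl (ker_map L y) = fl (ker_map L x)}"
      let ?R = "PiE B (\<lambda>_. {- \<lceil>s\<rceil> - 1 .. \<lceil>s\<rceil> + 1})"
      have "g y \<in> ?R" if "y \<in> \<Omega>" for y
      proof (intro PiE_I)
        fix b assume b: "b \<in> B"
        have "\<bar>y \<bullet> b\<bar> \<le> norm y * norm b" by (rule Cauchy_Schwarz_ineq2)
        then have "\<bar>y \<bullet> b\<bar> \<le> s" using bd that B(3)[OF b] by fastforce
        then have "- \<lceil>s\<rceil> - 1 \<le> \<lfloor>y \<bullet> b\<rfloor> \<and> \<lfloor>y \<bullet> b\<rfloor> \<le> \<lceil>s\<rceil> + 1" by linarith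
        then show "g y b \<in> {- \<lceil>s\<rceil> - 1 .. \<lceil>s\<rceil> + 1}" using b by (simp add: g_def)
      qed (simp add: g_def)
      then have "?\<phi> ` ?F \<subseteq> {fl (ker_map L x)} \<times> ?R" by auto
      moreover have "finite ({fl (ker_map L x)} \<times> ?R)" using fin by (intro finite_cartesian_product finite_PiE) auto
      ultimately have "card (?\<phi> ` ?F) \<le> card ({fl (ker_map L x)} \<times> ?R)" by (intro card_mono)
      also have "\<dots> = nat (2 * \<lceil>s\<rceil> + 3) ^ card B" using fin by (simp add: card_cartesian_product card_PiE add.commute)
      finally show "card (?\<phi> ` ?F) \<le> nat (2 * \<lceil>s\<rceil> + 3) ^ card B" .
    qed
    also have "ln (real (nat (2 * \<lceil>s\<rceil> + 3) ^ card B)) = real (card B) * ln (real (nat (2 * \<lceil>s\<rceil> + 3)))"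
      using s by (simp add: ln_realpow)
    \<comment> \<open>2 \<lceil>s\<rceil> + 3 is at most 2 s + 5, hence at most 7 s because s \<ge>
      1; ln 7 goes into the constant.\<close>
    also have "\<dots> \<le> real (card B) * ln (7 * s)"
    proof (intro mult_left_mono)
      have c: "real_of_int \<lceil>s\<rceil> \<le> s + 1" "s \<le> real_of_int \<lceil>s\<rceil>" by linarith+
      then have "real (nat (2 * \<lceil>s\<rceil> + 3)) = 2 * real_of_int \<lceil>s\<rceil> + 3" using s by simp
      then show "ln (real (nat (2 * \<lceil>s\<rceil> + 3))) \<le> ln (7 * s)" using s c by (intro ln_mono) linarith+
    qed simp
    also have "\<dots> = (real (dim L) - real (dim K)) * ln s + real (card B) * ln 7"
      using s by (simp add: ln_mult cB[symmetric] algebra_simps)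
    finally show "quotient_entropy \<Omega> P K \<le> quotient_entropy \<Omega> P L + (real (dim L) - real (dim K)) * ln s + (real (card B) * ln 7 + C)"
      unfolding quotient_entropy_def by linarith
  qed
qed

text \<open>The errors are chosen pair by pair, but before \<Omega>, P and s, so one c serves all
  scales with \<Lambda> = ln s.\<close>

lemma coarse_submodular_quotient_entropy:
  "\<exists>c. \<forall>\<Omega> P s. positive_distribution \<Omega> P \<and> 1 \<le> s \<and> (\<forall>x\<in>\<Omega>. norm x \<le> s) \<longrightarrow>
     coarse_submodular c (ln s) (quotient_entropy \<Omega> (P :: 'a::euclidean_space \<Rightarrow> real))"
proof -
  let ?P = "\<lambda>K L C. \<forall>\<Omega> P s. positive_distribution \<Omega> P \<and> 1 \<le> s \<and> (\<forall>x\<in>\<Omega>. norm (x::'a) \<le> s) \<longrightarrow>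
     (let h = quotient_entropy \<Omega> P in (subspace K \<and> subspace L \<longrightarrow> h (K \<inter> L) + h (span (K \<union> L)) \<le> h K + h L + C) \<and>
      (subspace K \<and> subspace L \<and> K \<subseteq> L \<longrightarrow> h L \<le> h K + C \<and> h K \<le> h L + (real (dim L) - real (dim K)) * ln s + C))"
  have "\<exists>C. ?P K L C" for K L
  proof (cases "subspace K \<and> subspace L")
    case True
    obtain C1 where C1: "\<And>\<Omega> P. positive_distribution \<Omega> P \<Longrightarrow>
      quotient_entropy \<Omega> P (K \<inter> L) + quotient_entropy \<Omega> P (span (K \<union> L)) \<le> quotient_entropy \<Omega> P K + quotient_entropy \<Omega> P L + C1"
      using quotient_entropy_submodular[of K L] True by auto
    have "\<exists>C. K \<subseteq> L \<longrightarrow> (\<forall>\<Omega> P. positive_distribution \<Omega> P \<longrightarrow> quotient_entropy \<Omega> P L \<le> quotient_entropy \<Omega> P K + C)"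
      using True quotient_entropy_antimono[of K L] by metis
    then obtain C2 where C2: "\<And>\<Omega> P. K \<subseteq> L \<Longrightarrow> positive_distribution \<Omega> P \<Longrightarrow> quotient_entropy \<Omega> P L \<le> quotient_entropy \<Omega> P K + C2"
      by metis
    have "\<exists>C. K \<subseteq> L \<longrightarrow> (\<forall>\<Omega> P s. positive_distribution \<Omega> P \<and> 1 \<le> s \<and> (\<forall>x\<in>\<Omega>. norm x \<le> s) \<longrightarrow>
      quotient_entropy \<Omega> P K \<le> quotient_entropy \<Omega> P L + (real (dim L) - real (dim K)) * ln s + C)"
      using True quotient_entropy_growth[of K L] by metis
    then obtain C3 where C3: "\<And>\<Omega> P s. K \<subseteq> L \<Longrightarrow> positive_distribution \<Omega> P \<Longrightarrow> 1 \<le> s \<Longrightarrow> (\<forall>x\<in>\<Omega>. norm x \<le> s) \<Longrightarrow>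
      quotient_entropy \<Omega> P K \<le> quotient_entropy \<Omega> P L + (real (dim L) - real (dim K)) * ln s + C3"
      by metis
    have m: "C1 \<le> max C1 (max C2 C3)" "C2 \<le> max C1 (max C2 C3)" "C3 \<le> max C1 (max C2 C3)" by auto
    have "?P K L (max C1 (max C2 C3))"
    proof (intro allI impI, unfold Let_def, elim conjE, intro conjI impI)
      fix \<Omega> P s assume a: "positive_distribution \<Omega> P" "1 \<le> s" "\<forall>x\<in>\<Omega>. norm (x::'a) \<le> s"
      show "quotient_entropy \<Omega> P (K \<inter> L) + quotient_entropy \<Omega> P (span (K \<union> L)) \<le> quotient_entropy \<Omega> P K + quotient_entropy \<Omega> P L + max C1 (max C2 C3)"
        using C1[OF a(1)] m by linarith
      assume "subspace K \<and> subspace L \<and> K \<subseteq> L"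
      then have "K \<subseteq> L" by simp
      show "quotient_entropy \<Omega> P L \<le> quotient_entropy \<Omega> P K + max C1 (max C2 C3)"
        using C2[OF \<open>K \<subseteq> L\<close> a(1)] m by linarith
      show "quotient_entropy \<Omega> P K \<le> quotient_entropy \<Omega> P L + (real (dim L) - real (dim K)) * ln s + max C1 (max C2 C3)"
        using C3[OF \<open>K \<subseteq> L\<close> a] m by linarith
    qed
    then show ?thesis by blast
  next
    case False
    then have "?P K L 0" by (auto simp: Let_def)
    then show ?thesis by blast
  qed
  then have "\<forall>K L. \<exists>C. ?P K L C" by blast
  then have "\<forall>K. \<exists>c. \<forall>L. ?P K L (c L)" by (intro allI choice) blast
  then have "\<exists>c. \<forall>K. \<forall>L. ?P K L (c K L)" by (rule choice)
  then obtain c where "\<forall>K L. ?P K L (c K L)" by (elim exE)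
  then have "coarse_submodular c (ln s) (quotient_entropy \<Omega> P)"
    if "positive_distribution \<Omega> P" "1 \<le> s" "\<forall>x\<in>\<Omega>. norm (x::'a) \<le> s" for \<Omega> P s
    using that unfolding coarse_submodular_def Let_def by blast
  then show ?thesis by blast
qed

text \<open>Rank-nullity on V: on the orthogonal complement in V of the kernel, L is injective and
  has the same image.\<close>

lemma dim_linear_image_subspace:
  fixes L :: "'a::euclidean_space \<Rightarrow> 'b::euclidean_space"
  assumes L: "linear L" and V: "subspace V"
  shows "dim (L ` V) + dim (V \<inter> {x. L x = 0}) = dim V"
proof -
  let ?N = "V \<inter> {x. L x = 0}"
  have N: "subspace ?N" using V linear_subspace_kernel[OF L] by (rule subspace_inter)
  define M where "M = {y\<in>V. \<forall>x\<in>?N. orthogonal x y}"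
  have M: "subspace M" unfolding M_def using V by (auto simp: subspace_def orthogonal_clauses)
  have d: "dim M + dim ?N = dim V" unfolding M_def by (rule dim_subspace_orthogonal_to_vectors[OF N V]) auto
  have "inj_on L M"
  proof (subst linear_inj_on_iff_eq_0[OF L M], intro ballI impI)
    fix v assume "v \<in> M" "L v = 0"
    then have "v \<in> ?N" "\<forall>x\<in>?N. orthogonal x v" by (auto simp: M_def)
    then have "orthogonal v v" by blast
    then show "v = 0" by (simp add: orthogonal_def)
  qed
  then have "dim (L ` M) = dim M" using L M by (simp add: dim_image_eq span_eq_iff[THEN iffD2])
  moreover have "L ` V = L ` M"
  proof
    show "L ` V \<subseteq> L ` M"
    proof (rule image_subsetI)
      fix x assume x: "x \<in> V"
      obtain u v where uv: "u \<in> span ?N" "\<And>w. w \<in> span ?N \<Longrightarrow> orthogonal v w" "x = u + v"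
        using orthogonal_subspace_decomp_exists[of ?N x] by metis
      have u: "u \<in> ?N" using uv N by (simp add: span_eq_iff[THEN iffD2])
      have "v = x - u" using uv by simp
      then have "v \<in> V" using x u V by (auto intro: subspace_diff)
      then have "v \<in> M" using uv(2) unfolding M_def by (auto simp: orthogonal_commute span_base)
      moreover have "L x = L v" using u uv(3) L by (simp add: linear_add)
      ultimately show "L x \<in> L ` M" by blast
    qed
  qed (auto simp: M_def)
  ultimately show ?thesis using d by simp
qed

section \<open>The inequality for finite sets of points\<close>

text \<open>Duality of Brascamp-Lieb and entropy inequalities (Carlen and Cordero-Erausquin): for
  the distribution proportional to the integrand, ln Z is its entropy plus q times the sum of the
  expectations of ln (H j). The entropy is bounded by the entropies of the images, these by Gibbs'
  inequality, and there the expectations cancel. Injectivity of the joint label admits boundedly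
  many points per unit cube, so the left side acts as an integral at unit scale. C is independent of
  s.\<close>

theorem discrete_Brascamp_Lieb:
  fixes L :: "'j \<Rightarrow> 'a::euclidean_space \<Rightarrow> 'b::euclidean_space"
  assumes J: "finite J" and lin: "\<And>j. j \<in> J \<Longrightarrow> linear (L j)" and q: "0 < q" "q \<le> 1"
    and rank: "\<And>V. subspace V \<Longrightarrow> real (dim V) - q * (\<Sum>j\<in>J. real (dim (L j ` V))) \<le> B"
  shows "\<exists>C>0. \<forall>s \<Omega> H. 1 \<le> s \<and> finite \<Omega> \<and> (\<forall>x\<in>\<Omega>. norm x \<le> s) \<and>
      inj_on (\<lambda>x. (fl x, \<lambda>j\<in>J. fl (L j x))) \<Omega> \<and> (\<forall>j\<in>J. \<forall>k. 0 \<le> H j k) \<longrightarrow>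
      (\<Sum>x\<in>\<Omega>. \<Prod>j\<in>J. H j (fl (L j x)) powr q)
        \<le> C * s powr B * (\<Prod>j\<in>J. (\<Sum>k\<in>(\<lambda>x. fl (L j x)) ` \<Omega>. H j k) powr q)"
proof -
  define K where "K j = {x. L j x = 0}" for j
  have K: "subspace (K j)" if "j \<in> J" for j
    unfolding K_def using lin[OF that] by (rule linear_subspace_kernel)
  have "rank_condition J {0} UNIV K (\<lambda>_. q) B"
    unfolding rank_condition_def
  proof (intro conjI ballI allI impI)
    fix V :: "'a set" assume V: "subspace V \<and> {0} \<subseteq> V \<and> V \<subseteq> UNIV"
    have "real (dim V) - real (dim (V \<inter> K j)) = real (dim (L j ` V))" if "j \<in> J" for j
      using dim_linear_image_subspace[OF lin[OF that], of V] V by (simp add: K_def)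
    then show "rank_defect J K (\<lambda>_. q) {0} V \<le> B"
      using rank[of V] V by (simp add: rank_defect_def sum_distrib_left)
  qed (use J K q subspace_0 in \<open>auto simp: subspace_0\<close>)
  from submodular_bound[OF this] have sb: "submodular_bound c J {0} UNIV K (\<lambda>_. q) B" for c .
  obtain c where c: "\<And>\<Omega> P s. positive_distribution \<Omega> P \<Longrightarrow> 1 \<le> s \<Longrightarrow> (\<forall>x\<in>\<Omega>. norm (x::'a) \<le> s) \<Longrightarrow>
     coarse_submodular c (ln s) (quotient_entropy \<Omega> P)"
    using coarse_submodular_quotient_entropy by blast
  obtain C0 where C0: "\<And>h \<Lambda>. 0 \<le> \<Lambda> \<Longrightarrow> coarse_submodular c \<Lambda> h \<Longrightarrow>
      h {0} - h UNIV \<le> B * \<Lambda> + (\<Sum>j\<in>J. q * (h (K j) - h UNIV)) + C0"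
    using sb[of c] unfolding submodular_bound_def by blast
  have "\<exists>C. \<forall>\<Omega> P (\<phi>::'a \<Rightarrow> 'a \<Rightarrow> int). positive_distribution \<Omega> P \<and>
     (\<forall>x\<in>\<Omega>. \<forall>y\<in>\<Omega>. \<phi> x = \<phi> y \<longrightarrow> norm (ker_map {0} x - ker_map {0} y) \<le> real DIM('a)) \<longrightarrow>
     label_entropy \<Omega> P (\<lambda>x. fl (id x)) \<le> label_entropy \<Omega> P \<phi> + C"
  proof (rule entropy_fl_compare)
    show "linear (ker_map {0::'a})" by (rule ker_map(1)[OF subspace_single_0])
    show "linear (id :: 'a \<Rightarrow> 'a)" by (rule linear_id)
    show "id x = (0::'a)" if "ker_map {0::'a} x = 0" for x
      using that ker_map(2)[OF subspace_single_0, of x] by simp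
  qed
  then obtain C1 where "\<forall>\<Omega> P (\<phi>::'a \<Rightarrow> 'a \<Rightarrow> int). positive_distribution \<Omega> P \<and>
     (\<forall>x\<in>\<Omega>. \<forall>y\<in>\<Omega>. \<phi> x = \<phi> y \<longrightarrow> norm (ker_map {0} x - ker_map {0} y) \<le> real DIM('a)) \<longrightarrow>
     label_entropy \<Omega> P (\<lambda>x. fl (id x)) \<le> label_entropy \<Omega> P \<phi> + C1" by (elim exE)
  note a = this
  have C1: "label_entropy \<Omega> P fl \<le> quotient_entropy \<Omega> P {0} + C1" if P: "positive_distribution \<Omega> P" for \<Omega> :: "'a set" and P
    using mp[OF spec[OF spec[OF spec[OF a, of \<Omega>], of P], of "\<lambda>x. fl (ker_map {0} x)"]] P
      by (simp add: norm_diff_le_of_fl_eq quotient_entropy_def)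

  have "\<exists>C. \<forall>\<Omega> P. positive_distribution \<Omega> P \<longrightarrow> quotient_entropy \<Omega> P (K j) \<le> label_entropy \<Omega> P (\<lambda>x. fl (L j x)) + C"
    if j: "j \<in> J" for j
  proof -
    have "\<exists>C. \<forall>\<Omega> P (\<phi>::'a \<Rightarrow> 'b \<Rightarrow> int). positive_distribution \<Omega> P \<and>
       (\<forall>x\<in>\<Omega>. \<forall>y\<in>\<Omega>. \<phi> x = \<phi> y \<longrightarrow> norm (L j x - L j y) \<le> real DIM('b)) \<longrightarrow>
       label_entropy \<Omega> P (\<lambda>x. fl (ker_map (K j) x)) \<le> label_entropy \<Omega> P \<phi> + C"
      by (rule entropy_fl_compare) (use ker_map[OF K[OF j]] lin[OF j] in \<open>auto simp: K_def\<close>)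
    then obtain C where "\<forall>\<Omega> P (\<phi>::'a \<Rightarrow> 'b \<Rightarrow> int). positive_distribution \<Omega> P \<and>
       (\<forall>x\<in>\<Omega>. \<forall>y\<in>\<Omega>. \<phi> x = \<phi> y \<longrightarrow> norm (L j x - L j y) \<le> real DIM('b)) \<longrightarrow>
       label_entropy \<Omega> P (\<lambda>x. fl (ker_map (K j) x)) \<le> label_entropy \<Omega> P \<phi> + C" by (elim exE)
    note a = this
    have "quotient_entropy \<Omega> P (K j) \<le> label_entropy \<Omega> P (\<lambda>x. fl (L j x)) + C" if P: "positive_distribution \<Omega> P" for \<Omega> :: "'a set" and P
      using mp[OF spec[OF spec[OF spec[OF a, of \<Omega>], of P], of "\<lambda>x. fl (L j x)"]] P
      by (simp add: norm_diff_le_of_fl_eq quotient_entropy_def)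
    then show ?thesis by blast
  qed
  then have "\<forall>j\<in>J. \<exists>C. \<forall>\<Omega> P. positive_distribution \<Omega> P \<longrightarrow> quotient_entropy \<Omega> P (K j) \<le> label_entropy \<Omega> P (\<lambda>x. fl (L j x)) + C"
    by blast
  then have "\<exists>C2. \<forall>j\<in>J. \<forall>\<Omega> P. positive_distribution \<Omega> P \<longrightarrow> quotient_entropy \<Omega> P (K j) \<le> label_entropy \<Omega> P (\<lambda>x. fl (L j x)) + C2 j"
    by (rule bchoice)
  then obtain C2 where C2: "\<And>j \<Omega> P. j \<in> J \<Longrightarrow> positive_distribution \<Omega> P \<Longrightarrow> quotient_entropy \<Omega> P (K j) \<le> label_entropy \<Omega> P (\<lambda>x. fl (L j x)) + C2 j"
    by blast
  have "\<forall>j\<in>J. \<exists>m>0. \<forall>\<Omega> (\<phi>::'a \<Rightarrow> 'a \<Rightarrow> int). (\<forall>x\<in>\<Omega>. \<forall>y\<in>\<Omega>. \<phi> x = \<phi> y \<longrightarrow> norm (id x - id y) \<le> real DIM('a)) \<longrightarrow>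
    (\<forall>x\<in>\<Omega>. finite ((\<lambda>x. fl (L j x)) ` {y\<in>\<Omega>. \<phi> y = \<phi> x}) \<and> card ((\<lambda>x. fl (L j x)) ` {y\<in>\<Omega>. \<phi> y = \<phi> x}) \<le> (m::nat))"
    by (intro ballI card_fl_fiber_le) (use lin in \<open>auto simp: linear_0 id_def linear_iff[of "\<lambda>x::'a. x"]\<close>)
  from bchoice[OF this] obtain m where m: "\<And>j. j \<in> J \<Longrightarrow> m j > 0 \<and> (\<forall>\<Omega> (\<phi>::'a \<Rightarrow> 'a \<Rightarrow> int). (\<forall>x\<in>\<Omega>. \<forall>y\<in>\<Omega>. \<phi> x = \<phi> y \<longrightarrow> norm (id x - id y) \<le> real DIM('a)) \<longrightarrow>
    (\<forall>x\<in>\<Omega>. finite ((\<lambda>x. fl (L j x)) ` {y\<in>\<Omega>. \<phi> y = \<phi> x}) \<and> card ((\<lambda>x. fl (L j x)) ` {y\<in>\<Omega>. \<phi> y = \<phi> x}) \<le> (m j::nat)))"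
    by (elim exE) (rule that, erule (1) bspec)
  \<comment> \<open>On one unit cube, \<open>fl (L j x)\<close> takes at most \<open>m j\<close>
    values; the product bounds the number of joint labels there.\<close>
  define m0 where "m0 = (\<Prod>j\<in>J. m j)"
  have m0: "m0 > 0" unfolding m0_def using m by (simp add: prod_pos)
  let ?lab = "\<lambda>x. (fl x, \<lambda>j\<in>J. fl (L j x))"
  have full: "label_entropy \<Omega> P ?lab \<le> label_entropy \<Omega> P fl + ln (real m0)"
    if P: "positive_distribution \<Omega> P" for \<Omega> P
  proof (rule label_entropy_le_count[OF P m0])
    fix x assume x: "x \<in> \<Omega>"
    let ?F = "{y\<in>\<Omega>. fl y = fl x}"
    have *: "finite ((\<lambda>x. fl (L j x)) ` ?F) \<and> card ((\<lambda>x. fl (L j x)) ` ?F) \<le> m j" if j: "j \<in> J" for j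
    proof -
      have "\<forall>x\<in>\<Omega>. \<forall>y\<in>\<Omega>. fl x = fl y \<longrightarrow> norm (id x - id y) \<le> real DIM('a)"
        by (simp add: norm_diff_le_of_fl_eq)
      from mp[OF spec[OF spec[OF conjunct2[OF m[OF j]], of \<Omega>], of fl] this] x show ?thesis by simp
    qed
    let ?R = "{fl x} \<times> PiE J (\<lambda>j. (\<lambda>x. fl (L j x)) ` ?F)"
    have "?lab ` ?F \<subseteq> ?R" by auto
    moreover have "finite ?R" using * J by (intro finite_cartesian_product finite_PiE) auto
    ultimately have "card (?lab ` ?F) \<le> card ?R" by (simp add: card_mono)
    also have "\<dots> = (\<Prod>j\<in>J. card ((\<lambda>x. fl (L j x)) ` ?F))" using J by (simp add: card_cartesian_product card_PiE)
    also have "\<dots> \<le> m0" unfolding m0_def using * by (intro prod_mono) auto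
    finally show "card (?lab ` ?F) \<le> m0" .
  qed
  let ?D = "ln (real m0) + C1 + C0 + (\<Sum>j\<in>J. q * C2 j)"
  show ?thesis
  proof (intro exI[of _ "exp ?D"] conjI allI impI, simp, elim conjE)
    fix s :: real and \<Omega> :: "'a set" and H :: "'j \<Rightarrow> ('b \<Rightarrow> int) \<Rightarrow> real"
    assume s: "1 \<le> s" and fin: "finite \<Omega>" and bd: "\<forall>x\<in>\<Omega>. norm x \<le> s" and inj: "inj_on ?lab \<Omega>"
      and H0: "\<forall>j\<in>J. \<forall>k. 0 \<le> H j k"
    define w where "w x = (\<Prod>j\<in>J. H j (fl (L j x)) powr q)" for x
    \<comment> \<open>Where some \<open>H j\<close> vanishes, so does the integrand; these points
      are dropped to keep the distribution positive.\<close>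
    define \<Omega>' where "\<Omega>' = {x\<in>\<Omega>. \<forall>j\<in>J. H j (fl (L j x)) > 0}"
    define S where "S j = (\<Sum>k\<in>(\<lambda>x. fl (L j x)) ` \<Omega>. H j k)" for j
    define Z where "Z = (\<Sum>x\<in>\<Omega>'. w x)"
    have fin': "finite \<Omega>'" "\<Omega>' \<subseteq> \<Omega>" using fin by (auto simp: \<Omega>'_def)
    have w0: "w x > 0" if "x \<in> \<Omega>'" for x unfolding w_def using that by (intro prod_pos) (auto simp: \<Omega>'_def)
    have "(\<Sum>x\<in>\<Omega>. w x) = Z" unfolding Z_def
    proof (rule sum.mono_neutral_right[OF fin fin'(2)], intro ballI)
      fix x assume "x \<in> \<Omega> - \<Omega>'"
      then obtain j where j: "j \<in> J" "H j (fl (L j x)) \<le> 0" by (auto simp: \<Omega>'_def not_less)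
      then have "H j (fl (L j x)) = 0" using H0 by (simp add: antisym)
      then show "w x = 0" unfolding w_def using J j(1) by (intro prod_zero) auto
    qed
    moreover have "Z \<le> exp ?D * s powr B * (\<Prod>j\<in>J. S j powr q)"
    proof (cases "\<Omega>' = {}")
      case True
      then show ?thesis by (simp add: Z_def prod_nonneg)
    next
      case False
      have Z: "Z > 0" unfolding Z_def using fin' False w0 by (intro sum_pos) auto
      define P where "P x = w x / Z" for x
      have P: "positive_distribution \<Omega>' P"
        using fin' w0 Z by (auto simp: positive_distribution_def P_def Z_def simp flip: sum_divide_distrib)
      have S0: "S j > 0" if "j \<in> J" for j
      proof -
        obtain x where x: "x \<in> \<Omega>'" using False by auto
        then show ?thesis unfolding S_def
          using fin fin' H0 that by (intro sum_pos2[of _ "fl (L j x)"]) (auto simp: \<Omega>'_def)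
      qed
      let ?E = "\<lambda>j. \<Sum>x\<in>\<Omega>'. P x * ln (H j (fl (L j x)))"
      have "fiber_weight \<Omega>' P ?lab x = P x" if x: "x \<in> \<Omega>'" for x
      proof -
        have "{y. y \<in> \<Omega>' \<and> ?lab y = ?lab x} = {x}" using inj_onD[OF inj, of _ x] x fin'(2) by blast
        then show ?thesis by (simp add: fiber_weight_def)
      qed
      then have "label_entropy \<Omega>' P ?lab = - (\<Sum>x\<in>\<Omega>'. P x * ln (P x))"
        by (simp add: label_entropy_def)
      also have "(\<Sum>x\<in>\<Omega>'. P x * ln (P x)) = (\<Sum>x\<in>\<Omega>'. (\<Sum>j\<in>J. q * (P x * ln (H j (fl (L j x))))) - P x * ln Z)"
      proof (rule sum.cong[OF refl])
        fix x assume x: "x \<in> \<Omega>'"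
        have "ln (w x) = (\<Sum>j\<in>J. ln (H j (fl (L j x)) powr q))"
          unfolding w_def using x J by (subst ln_prod) (auto simp: \<Omega>'_def)
        also have "\<dots> = (\<Sum>j\<in>J. q * ln (H j (fl (L j x))))"
          using x by (intro sum.cong) (auto simp: \<Omega>'_def ln_powr)
        finally have "ln (P x) = (\<Sum>j\<in>J. q * ln (H j (fl (L j x)))) - ln Z"
          using w0[OF x] Z by (simp add: P_def ln_div)
        then show "P x * ln (P x) = (\<Sum>j\<in>J. q * (P x * ln (H j (fl (L j x))))) - P x * ln Z"
          by (simp add: right_diff_distrib sum_distrib_left mult_ac)
      qed
      also have "\<dots> = (\<Sum>x\<in>\<Omega>'. \<Sum>j\<in>J. q * (P x * ln (H j (fl (L j x))))) - ln Z"
        using P by (simp add: sum_subtractf positive_distribution_def flip: sum_distrib_right)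
      also have "(\<Sum>x\<in>\<Omega>'. \<Sum>j\<in>J. q * (P x * ln (H j (fl (L j x))))) = (\<Sum>j\<in>J. q * ?E j)"
        by (subst sum.swap) (simp add: sum_distrib_left)
      finally have e1: "label_entropy \<Omega>' P ?lab = ln Z - (\<Sum>j\<in>J. q * ?E j)" by (simp only: minus_diff_eq)
      \<comment> \<open>Modulo the whole space there is a single label, so the terms
        \<open>h UNIV\<close> of the submodular bound vanish.\<close>
      have "quotient_entropy \<Omega>' P UNIV = 0"
      proof -
        have "ker_map UNIV x = (0::'a)" for x by (simp add: ker_map(2))
        then have "fiber_weight \<Omega>' P (\<lambda>x. fl (ker_map UNIV x)) x = 1" for x
          using P by (simp add: fiber_weight_def positive_distribution_def)
        then show ?thesis by (simp add: quotient_entropy_def label_entropy_def)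
      qed
      then have e2: "quotient_entropy \<Omega>' P {0} \<le> B * ln s + (\<Sum>j\<in>J. q * quotient_entropy \<Omega>' P (K j)) + C0"
        using C0[OF _ c[OF P s]] bd fin'(2) s by auto
      have "(\<Sum>j\<in>J. q * quotient_entropy \<Omega>' P (K j)) \<le> (\<Sum>j\<in>J. q * (ln (S j) - ?E j + C2 j))"
      proof (intro sum_mono mult_left_mono)
        fix j assume j: "j \<in> J"
        have "label_entropy \<Omega>' P (\<lambda>x. fl (L j x)) \<le> ln (S j) - ?E j"
        proof (rule label_entropy_le_cross_entropy[OF P])
          show "(\<Sum>k\<in>(\<lambda>x. fl (L j x)) ` \<Omega>'. H j k) \<le> S j" unfolding S_def
            using fin fin' H0 j by (intro sum_mono2) auto
        qed (use j in \<open>auto simp: \<Omega>'_def\<close>)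
        then show "quotient_entropy \<Omega>' P (K j) \<le> ln (S j) - ?E j + C2 j" using C2[OF j P] by linarith
      qed (use q in auto)
      also have "\<dots> = (\<Sum>j\<in>J. q * ln (S j)) - (\<Sum>j\<in>J. q * ?E j) + (\<Sum>j\<in>J. q * C2 j)"
        by (simp add: algebra_simps sum.distrib sum_subtractf)
      finally have e3: "ln Z \<le> ?D + B * ln s + (\<Sum>j\<in>J. q * ln (S j))"
        using e1 e2 C1[OF P] full[OF P] by linarith
      have "Z = exp (ln Z)" using Z by simp
      also have "\<dots> \<le> exp (?D + B * ln s + (\<Sum>j\<in>J. q * ln (S j)))" using e3 by simp
      also have "\<dots> = exp ?D * s powr B * (\<Prod>j\<in>J. S j powr q)"
      proof -
        have "exp (\<Sum>j\<in>J. q * ln (S j)) = (\<Prod>j\<in>J. S j powr q)"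
          unfolding exp_sum[OF J] using S0 by (intro prod.cong) (simp_all add: powr_def less_imp_neq[OF S0, symmetric])
        moreover have "exp (B * ln s) = s powr B" using s by (simp add: powr_def)
        ultimately show ?thesis by (simp add: exp_add)
      qed
      finally show ?thesis .
    qed
    ultimately show "(\<Sum>x\<in>\<Omega>. \<Prod>j\<in>J. H j (fl (L j x)) powr q)
        \<le> exp ?D * s powr B * (\<Prod>j\<in>J. (\<Sum>k\<in>(\<lambda>x. fl (L j x)) ` \<Omega>. H j k) powr q)"
      by (simp add: w_def S_def)
  qed
qed

section \<open>Multilinear bounds for exponential sums\<close>


text \<open>After normalising a + b to 1 this is t \<le> t powr q on [0, 1].\<close>

lemma powr_add_le_add_powr:
  fixes a b q :: real
  assumes "0 \<le> a" "0 \<le> b" "0 < q" "q \<le> 1"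
  shows "(a + b) powr q \<le> a powr q + b powr q"
proof (cases "a + b = 0")
  case False
  then have s: "a + b > 0" using assms by simp
  have le: "t \<le> t powr q" if "0 \<le> t" "t \<le> 1" for t :: real
    using powr_mono'[of q 1 t] that assms by (cases "t = 0") auto
  have "a / (a + b) + b / (a + b) = 1" using s by (simp flip: add_divide_distrib)
  then have "1 \<le> (a / (a + b)) powr q + (b / (a + b)) powr q"
    using le[of "a / (a + b)"] le[of "b / (a + b)"] assms s
    by (smt (verit, best) divide_nonneg_nonneg divide_le_eq_1_pos)
  also have "\<dots> = (a powr q + b powr q) / (a + b) powr q"
    using assms s by (simp add: powr_divide add_divide_distrib)
  finally show ?thesis using s by (simp add: field_simps)
qed (use assms in auto)

lemma powr_sum_le_sum_powr:
  fixes f :: "'i \<Rightarrow> real"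
  assumes "finite S" "\<And>i. i \<in> S \<Longrightarrow> 0 \<le> f i" "0 < q" "q \<le> 1"
  shows "(\<Sum>i\<in>S. f i) powr q \<le> (\<Sum>i\<in>S. f i powr q)"
  using assms(1,2)
proof (induction S rule: finite_induct)
  case (insert x S)
  have "(f x + (\<Sum>i\<in>S. f i)) powr q \<le> f x powr q + (\<Sum>i\<in>S. f i) powr q"
    using insert assms by (intro powr_add_le_add_powr sum_nonneg) auto
  then show ?case using insert by simp
qed simp

text \<open>Cauchy-Schwarz with the weights w, then subadditivity of the q-th power. It separates
  the pieces even when 2 q < 1, where the triangle inequality in the corresponding Lebesgue space
  fails.\<close>

lemma weighted_sum_powr_le:
  fixes w y :: "'l \<Rightarrow> real"
  assumes "finite \<Lambda>" "\<And>l. l \<in> \<Lambda> \<Longrightarrow> 0 \<le> w l" "\<And>l. l \<in> \<Lambda> \<Longrightarrow> 0 \<le> y l" "0 < q" "q \<le> 1"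
    and W: "(\<Sum>l\<in>\<Lambda>. w l) \<le> W"
  shows "(\<Sum>l\<in>\<Lambda>. w l * y l) powr (2 * q) \<le> W powr q * (\<Sum>l\<in>\<Lambda>. w l powr q * y l powr (2 * q))"
proof -
  have sw: "0 \<le> (\<Sum>l\<in>\<Lambda>. w l)" using assms by (intro sum_nonneg)
  have "(\<Sum>l\<in>\<Lambda>. w l * y l)\<^sup>2 = (\<Sum>l\<in>\<Lambda>. sqrt (w l) * (sqrt (w l) * y l))\<^sup>2"
    using assms(2) by (intro arg_cong[where f = "\<lambda>t. t\<^sup>2"] sum.cong) (auto simp flip: mult.assoc)
  also have "\<dots> \<le> (\<Sum>l\<in>\<Lambda>. (sqrt (w l))\<^sup>2) * (\<Sum>l\<in>\<Lambda>. (sqrt (w l) * y l)\<^sup>2)"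
    by (rule Cauchy_Schwarz_ineq_sum)
  also have "\<dots> = (\<Sum>l\<in>\<Lambda>. w l) * (\<Sum>l\<in>\<Lambda>. w l * (y l)\<^sup>2)"
    using assms(2) by (intro arg_cong2[where f = "(*)"] sum.cong) (auto simp: power_mult_distrib)
  also have "\<dots> \<le> W * (\<Sum>l\<in>\<Lambda>. w l * (y l)\<^sup>2)"
    using assms by (intro mult_right_mono sum_nonneg) auto
  finally have le: "(\<Sum>l\<in>\<Lambda>. w l * y l)\<^sup>2 \<le> W * (\<Sum>l\<in>\<Lambda>. w l * (y l)\<^sup>2)" .
  have s0: "0 \<le> (\<Sum>l\<in>\<Lambda>. w l * y l)" using assms by (intro sum_nonneg) auto
  have sq: "t powr (2 * q) = (t\<^sup>2) powr q" if "0 \<le> t" for t :: real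
    using that by (cases "t = 0") (simp_all add: powr_powr flip: powr_numeral)
  have "(\<Sum>l\<in>\<Lambda>. w l * y l) powr (2 * q) = ((\<Sum>l\<in>\<Lambda>. w l * y l)\<^sup>2) powr q" by (rule sq[OF s0])
  also have "\<dots> \<le> (W * (\<Sum>l\<in>\<Lambda>. w l * (y l)\<^sup>2)) powr q" using le assms by (intro powr_mono2) auto
  also have "\<dots> = W powr q * (\<Sum>l\<in>\<Lambda>. w l * (y l)\<^sup>2) powr q"
    by (rule powr_mult)
  also have "\<dots> \<le> W powr q * (\<Sum>l\<in>\<Lambda>. (w l * (y l)\<^sup>2) powr q)"
    using assms by (intro mult_left_mono powr_sum_le_sum_powr) auto
  also have "(\<Sum>l\<in>\<Lambda>. (w l * (y l)\<^sup>2) powr q) = (\<Sum>l\<in>\<Lambda>. w l powr q * y l powr (2 * q))"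
    using assms by (intro sum.cong) (auto simp: powr_mult sq)
  finally show ?thesis .
qed

section \<open>Multilinear estimates with fixed frequencies\<close>

definition exp_sum :: "('i \<Rightarrow> 'e::euclidean_space) \<Rightarrow> 'i set \<Rightarrow> ('i \<Rightarrow> complex) \<Rightarrow> 'e \<Rightarrow> complex" where
  "exp_sum \<omega> \<Theta> a x = (\<Sum>\<kappa>\<in>\<Theta>. a \<kappa> * cis (2 * pi * (x \<bullet> \<omega> \<kappa>)))"

lemma continuous_exp_sum: "continuous_on S (exp_sum \<omega> \<Theta> a)"
  unfolding exp_sum_def[abs_def] cis_conv_exp by (intro continuous_intros)

lemma borel_measurable_exp_sum [measurable]: "exp_sum \<omega> \<Theta> a \<in> borel_measurable borel"
  by (rule borel_measurable_continuous_onI[OF continuous_exp_sum])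

text \<open>A is uniform in the coefficients; only the frequencies and the region Z are fixed. The
  extended nonnegative integral makes finiteness part of the claim.\<close>

definition multilinear_bound ::
  "'j set \<Rightarrow> real \<Rightarrow> ('i \<Rightarrow> 'e::euclidean_space) \<Rightarrow> ('j \<Rightarrow> 'i set) \<Rightarrow> 'e set \<Rightarrow> real \<Rightarrow> bool" where
  "multilinear_bound J q \<omega> \<Theta> Z A \<longleftrightarrow> (\<forall>a.
     (\<integral>\<^sup>+x. ennreal (\<Prod>j\<in>J. cmod (exp_sum \<omega> (\<Theta> j) (a j) x) powr (2 * q)) * indicator Z x \<partial>lborel)
       \<le> ennreal (A * (\<Prod>j\<in>J. (\<Sum>\<kappa>\<in>\<Theta> j. (cmod (a j \<kappa>))\<^sup>2) powr q)))"

text \<open>The product over J of sums over \<Lambda> expands into one product for each choice g of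
  a term per j, and each of these is an instance of \<open>mb\<close> with its own coefficients.
  Thus A is preserved up to the sums of powers of weights, and the number of terms does not
  enter.\<close>

lemma multilinear_bound_superposition:
  fixes F :: "'j \<Rightarrow> 'e::euclidean_space \<Rightarrow> complex"
  assumes mb: "multilinear_bound J q \<omega> \<Theta> Z A" and A: "0 \<le> A" and J: "finite J" and q: "0 < q" "q \<le> 1"
    and Z: "Z \<in> sets borel" and \<Lambda>: "finite \<Lambda>" and w: "\<And>l. l \<in> \<Lambda> \<Longrightarrow> 0 \<le> w l"
    and W: "(\<Sum>l\<in>\<Lambda>. w l) \<le> W" and W': "(\<Sum>l\<in>\<Lambda>. w l powr (q / 2)) \<le> W'"
    and F: "\<And>j x. j \<in> J \<Longrightarrow> x \<in> Z \<Longrightarrow> cmod (F j x) \<le> (\<Sum>l\<in>\<Lambda>. w l * cmod (exp_sum \<omega> (\<Theta> j) (b j l) x))"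
    and h: "\<And>j. j \<in> J \<Longrightarrow> (\<Sum>l\<in>\<Lambda>. sqrt (w l) * (\<Sum>\<kappa>\<in>\<Theta> j. (cmod (b j l \<kappa>))\<^sup>2)) \<le> h j"
  shows "(\<integral>\<^sup>+x. ennreal (\<Prod>j\<in>J. cmod (F j x) powr (2 * q)) * indicator Z x \<partial>lborel)
       \<le> ennreal (A * (W powr q * W') ^ card J * (\<Prod>j\<in>J. h j powr q))"
proof -
  define N where "N j l = (\<Sum>\<kappa>\<in>\<Theta> j. (cmod (b j l \<kappa>))\<^sup>2)" for j l
  let ?D = "\<lambda>j l x. cmod (exp_sum \<omega> (\<Theta> j) (b j l) x) powr (2 * q)"
  let ?E = "PiE J (\<lambda>_. \<Lambda>)"
  have N0: "0 \<le> N j l" for j l by (simp add: N_def sum_nonneg)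
  have finE: "finite ?E" using J \<Lambda> by (intro finite_PiE) auto
  have pw: "(\<Prod>j\<in>J. cmod (F j x) powr (2 * q)) \<le>
      (W powr q) ^ card J * (\<Sum>g\<in>?E. (\<Prod>j\<in>J. w (g j) powr q) * (\<Prod>j\<in>J. ?D j (g j) x))" if x: "x \<in> Z" for x
  proof -
    have "(\<Prod>j\<in>J. cmod (F j x) powr (2 * q)) \<le> (\<Prod>j\<in>J. W powr q * (\<Sum>l\<in>\<Lambda>. w l powr q * ?D j l x))"
    proof (intro prod_mono conjI)
      fix j assume j: "j \<in> J"
      have "cmod (F j x) powr (2 * q) \<le> (\<Sum>l\<in>\<Lambda>. w l * cmod (exp_sum \<omega> (\<Theta> j) (b j l) x)) powr (2 * q)"
        using F[OF j x] q by (intro powr_mono2) auto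
      also have "\<dots> \<le> W powr q * (\<Sum>l\<in>\<Lambda>. w l powr q * ?D j l x)"
        using \<Lambda> w q W by (intro weighted_sum_powr_le) auto
      finally show "cmod (F j x) powr (2 * q) \<le> W powr q * (\<Sum>l\<in>\<Lambda>. w l powr q * ?D j l x)" .
    qed simp
    also have "\<dots> = (W powr q) ^ card J * (\<Prod>j\<in>J. \<Sum>l\<in>\<Lambda>. w l powr q * ?D j l x)"
      by (simp add: prod.distrib)
    also have "(\<Prod>j\<in>J. \<Sum>l\<in>\<Lambda>. w l powr q * ?D j l x) = (\<Sum>g\<in>?E. \<Prod>j\<in>J. w (g j) powr q * ?D j (g j) x)"
      by (rule prod_sum_PiE[OF J \<Lambda>])
    finally show ?thesis by (simp add: prod.distrib)
  qed
  have "(\<integral>\<^sup>+x. ennreal (\<Prod>j\<in>J. cmod (F j x) powr (2 * q)) * indicator Z x \<partial>lborel) \<le>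
     (\<integral>\<^sup>+x. (\<Sum>g\<in>?E. ennreal ((W powr q) ^ card J * (\<Prod>j\<in>J. w (g j) powr q)) *
        (ennreal (\<Prod>j\<in>J. ?D j (g j) x) * indicator Z x)) \<partial>lborel)"
  proof (rule nn_integral_mono)
    fix x
    show "ennreal (\<Prod>j\<in>J. cmod (F j x) powr (2 * q)) * indicator Z x \<le>
      (\<Sum>g\<in>?E. ennreal ((W powr q) ^ card J * (\<Prod>j\<in>J. w (g j) powr q)) * (ennreal (\<Prod>j\<in>J. ?D j (g j) x) * indicator Z x))"
    proof (cases "x \<in> Z")
      case True
      have "ennreal (\<Prod>j\<in>J. cmod (F j x) powr (2 * q)) \<le>
        ennreal (\<Sum>g\<in>?E. (W powr q) ^ card J * (\<Prod>j\<in>J. w (g j) powr q) * (\<Prod>j\<in>J. ?D j (g j) x))"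
        using pw[OF True] by (intro ennreal_leI) (simp add: sum_distrib_left mult.assoc)
      also have "\<dots> = (\<Sum>g\<in>?E. ennreal ((W powr q) ^ card J * (\<Prod>j\<in>J. w (g j) powr q) * (\<Prod>j\<in>J. ?D j (g j) x)))"
        by (subst sum_ennreal) (auto intro!: mult_nonneg_nonneg prod_nonneg)
      also have "\<dots> = (\<Sum>g\<in>?E. ennreal ((W powr q) ^ card J * (\<Prod>j\<in>J. w (g j) powr q)) * ennreal (\<Prod>j\<in>J. ?D j (g j) x))"
        by (intro sum.cong refl ennreal_mult mult_nonneg_nonneg prod_nonneg) auto
      finally show ?thesis using True by simp
    qed simp
  qed
  also have "\<dots> = (\<Sum>g\<in>?E. ennreal ((W powr q) ^ card J * (\<Prod>j\<in>J. w (g j) powr q)) *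
        (\<integral>\<^sup>+x. ennreal (\<Prod>j\<in>J. ?D j (g j) x) * indicator Z x \<partial>lborel))"
    using Z by (subst nn_integral_sum) (auto simp: nn_integral_cmult)
  also have "\<dots> \<le> (\<Sum>g\<in>?E. ennreal ((W powr q) ^ card J * (\<Prod>j\<in>J. w (g j) powr q)) *
        ennreal (A * (\<Prod>j\<in>J. N j (g j) powr q)))"
    unfolding N_def
    using mb[unfolded multilinear_bound_def, rule_format, of "\<lambda>j. b j (g j)" for g]
    by (intro sum_mono mult_left_mono) auto
  also have "\<dots> = (\<Sum>g\<in>?E. ennreal ((W powr q) ^ card J * (\<Prod>j\<in>J. w (g j) powr q) * (A * (\<Prod>j\<in>J. N j (g j) powr q))))"
    using A by (intro sum.cong refl ennreal_mult[symmetric] mult_nonneg_nonneg prod_nonneg) auto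
  also have "\<dots> = ennreal (\<Sum>g\<in>?E. (W powr q) ^ card J * (\<Prod>j\<in>J. w (g j) powr q) * (A * (\<Prod>j\<in>J. N j (g j) powr q)))"
    using A by (subst sum_ennreal) (auto intro!: mult_nonneg_nonneg prod_nonneg)
  also have "(\<Sum>g\<in>?E. (W powr q) ^ card J * (\<Prod>j\<in>J. w (g j) powr q) * (A * (\<Prod>j\<in>J. N j (g j) powr q)))
     = A * (W powr q) ^ card J * (\<Sum>g\<in>?E. \<Prod>j\<in>J. w (g j) powr q * N j (g j) powr q)"
    by (simp add: sum_distrib_left prod.distrib mult_ac)
  also have "(\<Sum>g\<in>?E. \<Prod>j\<in>J. w (g j) powr q * N j (g j) powr q) = (\<Prod>j\<in>J. \<Sum>l\<in>\<Lambda>. w l powr q * N j l powr q)"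
    by (rule prod_sum_PiE[OF J \<Lambda>, symmetric])
  also have "ennreal (A * (W powr q) ^ card J * \<dots>) \<le> ennreal (A * (W powr q) ^ card J * (\<Prod>j\<in>J. W' * h j powr q))"
  proof (intro ennreal_leI mult_left_mono prod_mono conjI)
    fix j assume j: "j \<in> J"
    show "0 \<le> (\<Sum>l\<in>\<Lambda>. w l powr q * N j l powr q)" by (intro sum_nonneg) auto
    \<comment> \<open>Half of the weight stays outside to keep the sum over l convergent, since for
      q < 1 a sum of q-th powers is not controlled by the q-th power of the sum. The other half
      joins the energy, which is then bounded by \<open>h j\<close>.\<close>
    have "w l powr q * N j l powr q \<le> w l powr (q / 2) * h j powr q" if l: "l \<in> \<Lambda>" for l
    proof -
      have "sqrt (w l) * N j l \<le> (\<Sum>l\<in>\<Lambda>. sqrt (w l) * N j l)"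
        using \<Lambda> l w N0 by (intro member_le_sum) auto
      then have le: "sqrt (w l) * N j l \<le> h j" using h[OF j] by (simp add: N_def)
      have "w l powr q * N j l powr q = w l powr (q / 2) * (sqrt (w l) * N j l) powr q"
      proof -
        have "w l powr q = w l powr (q / 2) * sqrt (w l) powr q"
          using w[OF l] by (cases "w l = 0") (auto simp: powr_half_sqrt[symmetric] powr_powr simp flip: powr_add)
        then show ?thesis using w[OF l] N0 by (simp add: powr_mult)
      qed
      also have "\<dots> \<le> w l powr (q / 2) * h j powr q"
        using le w[OF l] N0[of j l] q by (intro mult_left_mono powr_mono2) auto
      finally show ?thesis .
    qed
    then have "(\<Sum>l\<in>\<Lambda>. w l powr q * N j l powr q) \<le> (\<Sum>l\<in>\<Lambda>. w l powr (q / 2)) * h j powr q"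
      unfolding sum_distrib_right by (rule sum_mono)
    also have "\<dots> \<le> W' * h j powr q" using W' by (intro mult_right_mono) auto
    finally show "(\<Sum>l\<in>\<Lambda>. w l powr q * N j l powr q) \<le> W' * h j powr q" .
  qed (use A in auto)
  finally show ?thesis by (simp add: prod.distrib power_mult_distrib mult_ac)
qed

section \<open>Taylor expansion of exponentials over words in the basis\<close>

text \<open>Words are used in place of multi-indices: expanding (y \<bullet> u) ^ k over all words
  of length k gives coefficients 1, so no multinomial coefficients occur.\<close>

definition basis_words :: "nat \<Rightarrow> 'e::euclidean_space list set" where
  "basis_words n = {l. set l \<subseteq> Basis \<and> length l < n}"

definition monom_at :: "'e::euclidean_space list \<Rightarrow> 'e \<Rightarrow> real" where
  "monom_at l y = (\<Prod>b\<leftarrow>l. y \<bullet> b)"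

lemma basis_words_eq_UN:
  "basis_words n = (\<Union>k<n. {l. set l \<subseteq> (Basis :: 'e::euclidean_space set) \<and> length l = k})"
  by (auto simp: basis_words_def)

lemma finite_basis_words: "finite (basis_words n :: 'e::euclidean_space list set)"
  unfolding basis_words_eq_UN by (auto intro: finite_lists_length_eq)

lemma sum_basis_words:
  fixes g :: "'e::euclidean_space list \<Rightarrow> 'v::comm_monoid_add"
  shows "(\<Sum>l\<in>basis_words n. g l) = (\<Sum>k<n. \<Sum>l | set l \<subseteq> Basis \<and> length l = k. g l)"
  unfolding basis_words_eq_UN by (rule sum.UNION_disjoint) (auto intro: finite_lists_length_eq)

lemma abs_monom_at_le:
  assumes "set l \<subseteq> Basis" "\<And>b. b \<in> Basis \<Longrightarrow> \<bar>y \<bullet> b\<bar> \<le> C" "0 \<le> C"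
  shows "\<bar>monom_at l y\<bar> \<le> C ^ length l"
  using assms(1)
proof (induction l)
  case (Cons b l)
  have "\<bar>y \<bullet> b\<bar> * \<bar>monom_at l y\<bar> \<le> C * C ^ length l"
    using Cons assms by (intro mult_mono) auto
  then show ?case by (simp add: monom_at_def abs_mult)
qed (simp add: monom_at_def)

lemma inner_power_eq_sum_monom:
  fixes y u :: "'e::euclidean_space"
  shows "(y \<bullet> u) ^ k = (\<Sum>l | set l \<subseteq> Basis \<and> length l = k. monom_at l y * monom_at l u)"
proof (induction k)
  case 0
  have "{l. set l \<subseteq> (Basis::'e set) \<and> length l = 0} = {[]}" by auto
  then show ?case by (simp add: monom_at_def)
next
  case (Suc k)
  let ?S = "{l. set l \<subseteq> (Basis::'e set) \<and> length l = k}"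
  have eq: "{l. set l \<subseteq> (Basis::'e set) \<and> length l = Suc k} = (\<lambda>(b, l). b # l) ` (Basis \<times> ?S)"
    by (auto simp: length_Suc_conv image_iff)
  have inj: "inj_on (\<lambda>(b, l). b # l) ((Basis::'e set) \<times> ?S)" by (auto simp: inj_on_def)
  have "(y \<bullet> u) ^ Suc k = (\<Sum>b\<in>Basis. (y \<bullet> b) * (u \<bullet> b)) * (\<Sum>l\<in>?S. monom_at l y * monom_at l u)"
    using Suc by (simp add: euclidean_inner[of y u])
  also have "\<dots> = (\<Sum>(b, l)\<in>Basis \<times> ?S. (y \<bullet> b) * (u \<bullet> b) * (monom_at l y * monom_at l u))"
    by (simp add: sum_product sum.cartesian_product)
  also have "\<dots> = (\<Sum>l | set l \<subseteq> Basis \<and> length l = Suc k. monom_at l y * monom_at l u)"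
    unfolding eq by (subst sum.reindex[OF inj]) (auto simp: monom_at_def mult_ac intro!: sum.cong)
  finally show ?case .
qed

definition exp_trunc :: "nat \<Rightarrow> complex \<Rightarrow> complex" where
  "exp_trunc n z = (\<Sum>k<n. z ^ k / fact k)"

lemma exp_trunc_tendsto: "(\<lambda>n. exp_trunc n z) \<longlonglongrightarrow> exp z"
  using exp_converges[of z] by (simp add: exp_trunc_def sums_def scaleR_conv_of_real divide_inverse mult.commute)

lemma exp_trunc_inner:
  fixes y u :: "'e::euclidean_space"
  shows "exp_trunc n (2 * pi * \<i> * of_real (y \<bullet> u)) =
    (\<Sum>l\<in>basis_words n. (2 * pi * \<i>) ^ length l / fact (length l) * of_real (monom_at l y) * of_real (monom_at l u))"
  unfolding sum_basis_words exp_trunc_def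
proof (intro sum.cong refl)
  fix k
  have "(2 * pi * \<i> * of_real (y \<bullet> u)) ^ k / fact k = (2 * pi * \<i>) ^ k / fact k * of_real ((y \<bullet> u) ^ k)"
    by (simp add: power_mult_distrib)
  also have "\<dots> = (\<Sum>l | set l \<subseteq> Basis \<and> length l = k. (2 * pi * \<i>) ^ k / fact k * (of_real (monom_at l y) * of_real (monom_at l u)))"
    unfolding inner_power_eq_sum_monom by (simp add: sum_distrib_left)
  finally show "(2 * pi * \<i> * of_real (y \<bullet> u)) ^ k / fact k =
    (\<Sum>l | set l \<subseteq> Basis \<and> length l = k. (2 * pi * \<i>) ^ length l / fact (length l) * of_real (monom_at l y) * of_real (monom_at l u))"
    by (auto simp: mult.assoc intro!: sum.cong)
qed

text \<open>The size of the Taylor term of the word l in exp(2 \<pi> i y \<bullet> u) when the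
  coordinates of y are at most 1 and those of u at most C.\<close>

definition word_weight :: "real \<Rightarrow> 'e list \<Rightarrow> real" where
  "word_weight C l = (2 * pi * C) ^ length l / fact (length l)"

lemma word_weight_nonneg: "0 \<le> C \<Longrightarrow> 0 \<le> word_weight C l"
  by (simp add: word_weight_def)

text \<open>Exponents r < 1 occur because the weights are used inside q-th powers and under square
  roots. There are d ^ k words of length k, and any positive power of the factorial beats this: the
  ratio of consecutive terms tends to 0.\<close>

lemma sum_word_weight_bounded:
  assumes C: "0 < C" and r: "0 < r"
  shows "\<exists>W>0. \<forall>n. (\<Sum>l\<in>(basis_words n :: 'e::euclidean_space list set). word_weight C l powr r) \<le> W"
proof -
  let ?d = "real DIM('e)"
  let ?g = "\<lambda>k. ?d ^ k * ((2 * pi * C) ^ k / fact k) powr r"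
  have eq: "(\<Sum>l\<in>(basis_words n :: 'e list set). word_weight C l powr r) = (\<Sum>k<n. ?g k)" for n
    unfolding sum_basis_words
  proof (intro sum.cong refl)
    fix k
    have "(\<Sum>l | set l \<subseteq> (Basis::'e set) \<and> length l = k. word_weight C l powr r) =
      (\<Sum>l | set l \<subseteq> (Basis::'e set) \<and> length l = k. ((2 * pi * C) ^ k / fact k) powr r)"
      by (intro sum.cong) (auto simp: word_weight_def)
    then show "(\<Sum>l | set l \<subseteq> (Basis::'e set) \<and> length l = k. word_weight C l powr r) = ?g k"
      by (simp add: card_lists_length_eq)
  qed
  have lim: "(\<lambda>k. ?d * (2 * pi * C / real (Suc k)) powr r) \<longlonglongrightarrow> ?d * 0"
  proof (intro tendsto_mult tendsto_const)
    have "(\<lambda>k. 2 * pi * C / real (Suc k)) \<longlonglongrightarrow> 0"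
      by (intro LIMSEQ_Suc lim_const_over_n)
    from tendsto_powr'[OF this tendsto_const, of r] show "(\<lambda>k. (2 * pi * C / real (Suc k)) powr r) \<longlonglongrightarrow> 0"
      using r C by simp
  qed
  then have "\<forall>\<^sub>F k in sequentially. ?d * (2 * pi * C / real (Suc k)) powr r < 1 / 2"
    by (rule order_tendstoD) simp
  then obtain N where N: "\<And>k. k \<ge> N \<Longrightarrow> ?d * (2 * pi * C / real (Suc k)) powr r < 1 / 2"
    by (auto simp: eventually_sequentially)
  have "summable ?g"
  proof (rule summable_ratio_test[of "1 / 2" N])
    fix k assume k: "k \<ge> N"
    have "(2 * pi * C) ^ Suc k / fact (Suc k) = (2 * pi * C) ^ k / fact k * (2 * pi * C / real (Suc k))"
      by (simp add: field_simps)
    then have "?g (Suc k) = ?d * (2 * pi * C / real (Suc k)) powr r * ?g k"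
      using C by (simp only: powr_mult) (simp add: mult_ac)
    also have "\<dots> \<le> 1 / 2 * ?g k" using N[OF k] by (intro mult_right_mono) auto
    finally show "norm (?g (Suc k)) \<le> 1 / 2 * norm (?g k)" by simp
  qed simp
  then have "(\<Sum>k<n. ?g k) \<le> suminf ?g" for n by (intro sum_le_suminf) auto
  then show ?thesis using eq suminf_nonneg[OF \<open>summable ?g\<close>]
    by (intro exI[of _ "suminf ?g + 1"]) (auto simp: add_nonneg_pos add_increasing2)
qed

text \<open>Superposition handles finite sums, so it is applied to the Taylor partial sums
  \<open>Fn\<close> with bounds independent of n, and Fatou's lemma passes to the limit. The moments
  M are divided by a power of C, which moves into the weights: for slow frequencies with coordinates
  at most C, the normalised monomials are then at most 1.\<close>

theorem multilinear_bound_Taylor: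
  fixes F :: "'j \<Rightarrow> 'e::euclidean_space \<Rightarrow> complex" and Y :: "'j \<Rightarrow> 'e \<Rightarrow> 'f::euclidean_space"
  assumes C: "0 < C" and q: "0 < q" "q \<le> 1"
    and W: "\<And>n. (\<Sum>l\<in>(basis_words n :: 'f list set). word_weight C l powr 1) \<le> W"
    and W': "\<And>n. (\<Sum>l\<in>(basis_words n :: 'f list set). word_weight C l powr (q / 2)) \<le> W'"
    and J: "finite J" and mb: "multilinear_bound J q \<omega> \<Theta> Z A" and A: "0 \<le> A" and Z: "Z \<in> sets borel"
    and meas: "\<And>j n. j \<in> J \<Longrightarrow> Fn n j \<in> borel_measurable borel"
    and Y: "\<And>j x b. j \<in> J \<Longrightarrow> x \<in> Z \<Longrightarrow> b \<in> Basis \<Longrightarrow> \<bar>Y j x \<bullet> b\<bar> \<le> 1"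
    and Fn: "\<And>n j x. j \<in> J \<Longrightarrow> x \<in> Z \<Longrightarrow> Fn n j x = (\<Sum>\<kappa>\<in>\<Theta> j. cis (2 * pi * (x \<bullet> \<omega> \<kappa>)) *
        (\<Sum>l\<in>basis_words n. (2 * pi * \<i>) ^ length l / fact (length l) * of_real (monom_at l (Y j x)) * M j l \<kappa>))"
    and lim: "\<And>j x. j \<in> J \<Longrightarrow> x \<in> Z \<Longrightarrow> (\<lambda>n. Fn n j x) \<longlonglongrightarrow> F j x"
    and h: "\<And>j n. j \<in> J \<Longrightarrow> (\<Sum>l\<in>basis_words n. sqrt (word_weight C l) * (\<Sum>\<kappa>\<in>\<Theta> j. (cmod (M j l \<kappa> / of_real C ^ length l))\<^sup>2)) \<le> h j"
  shows "(\<integral>\<^sup>+x. ennreal (\<Prod>j\<in>J. cmod (F j x) powr (2 * q)) * indicator Z x \<partial>lborel)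
       \<le> ennreal (A * (W powr q * W') ^ card J * (\<Prod>j\<in>J. h j powr q))"
proof -
    let ?K = "ennreal (A * (W powr q * W') ^ card J * (\<Prod>j\<in>J. h j powr q))"
    let ?G = "\<lambda>n x. ennreal (\<Prod>j\<in>J. cmod (Fn n j x) powr (2 * q)) * indicator Z x"
    have bound: "(\<integral>\<^sup>+x. ?G n x \<partial>lborel) \<le> ?K" for n
    proof (rule multilinear_bound_superposition[OF mb A J q Z, where \<Lambda> = "basis_words n" and w = "word_weight C"
          and b = "\<lambda>j l \<kappa>. M j l \<kappa> / of_real C ^ length l"])
      show "(\<Sum>l\<in>(basis_words n :: 'f list set). word_weight C l) \<le> W"
        using W[of n] C by (simp add: word_weight_nonneg)
      show "(\<Sum>l\<in>(basis_words n :: 'f list set). word_weight C l powr (q / 2)) \<le> W'" by (rule W')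
      fix j x assume j: "j \<in> J" and x: "x \<in> Z"
      have "Fn n j x = (\<Sum>\<kappa>\<in>\<Theta> j. \<Sum>l\<in>basis_words n. ((2 * pi * \<i>) ^ length l / fact (length l) * of_real (monom_at l (Y j x)) * of_real C ^ length l) *
         (M j l \<kappa> / of_real C ^ length l * cis (2 * pi * (x \<bullet> \<omega> \<kappa>))))"
        using Fn j x C by (simp add: sum_distrib_left mult_ac)
      also have "\<dots> = (\<Sum>l\<in>basis_words n. ((2 * pi * \<i>) ^ length l / fact (length l) * of_real (monom_at l (Y j x)) * of_real C ^ length l) *
         exp_sum \<omega> (\<Theta> j) (\<lambda>\<kappa>. M j l \<kappa> / of_real C ^ length l) x)"
        by (subst sum.swap) (simp add: exp_sum_def sum_distrib_left)
      also have "cmod \<dots> \<le> (\<Sum>l\<in>basis_words n. word_weight C l * cmod (exp_sum \<omega> (\<Theta> j) (\<lambda>\<kappa>. M j l \<kappa> / of_real C ^ length l) x))"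
      proof (rule sum_norm_le)
        fix l :: "'f list" assume "l \<in> basis_words n"
        then have "\<bar>monom_at l (Y j x)\<bar> \<le> 1 ^ length l"
          using Y j x by (intro abs_monom_at_le) (auto simp: basis_words_def)
        then have "(2 * pi) ^ length l / fact (length l) * \<bar>monom_at l (Y j x)\<bar> * C ^ length l
           \<le> (2 * pi) ^ length l / fact (length l) * 1 * C ^ length l"
          using C by (intro mult_left_mono mult_right_mono) auto
        then have "cmod ((2 * pi * \<i>) ^ length l / fact (length l) * of_real (monom_at l (Y j x)) * of_real C ^ length l) \<le> word_weight C l"
          using C by (simp add: word_weight_def norm_mult norm_divide norm_power power_mult_distrib mult_ac)
        then show "cmod ((2 * pi * \<i>) ^ length l / fact (length l) * of_real (monom_at l (Y j x)) * of_real C ^ length l *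
           exp_sum \<omega> (\<Theta> j) (\<lambda>\<kappa>. M j l \<kappa> / of_real C ^ length l) x) \<le> word_weight C l * cmod (exp_sum \<omega> (\<Theta> j) (\<lambda>\<kappa>. M j l \<kappa> / of_real C ^ length l) x)"
          unfolding norm_mult[of _ "exp_sum _ _ _ _"] by (intro mult_right_mono) auto
      qed
      finally show "cmod (Fn n j x) \<le> (\<Sum>l\<in>basis_words n. word_weight C l * cmod (exp_sum \<omega> (\<Theta> j) (\<lambda>\<kappa>. M j l \<kappa> / of_real C ^ length l) x))" .
    qed (use C h in \<open>auto simp: finite_basis_words word_weight_nonneg\<close>)
    have "(\<integral>\<^sup>+x. ennreal (\<Prod>j\<in>J. cmod (F j x) powr (2 * q)) * indicator Z x \<partial>lborel) = (\<integral>\<^sup>+x. liminf (\<lambda>n. ?G n x) \<partial>lborel)"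
    proof (rule nn_integral_cong)
      fix x
      show "ennreal (\<Prod>j\<in>J. cmod (F j x) powr (2 * q)) * indicator Z x = liminf (\<lambda>n. ?G n x)"
      proof (cases "x \<in> Z")
        case True
        have "(\<lambda>n. cmod (Fn n j x) powr (2 * q)) \<longlonglongrightarrow> cmod (F j x) powr (2 * q)" if "j \<in> J" for j
          using lim that True q by (intro tendsto_powr' tendsto_norm tendsto_const) auto
        then have "(\<lambda>n. ennreal (\<Prod>j\<in>J. cmod (Fn n j x) powr (2 * q))) \<longlonglongrightarrow> ennreal (\<Prod>j\<in>J. cmod (F j x) powr (2 * q))"
          by (intro tendsto_ennrealI tendsto_prod)
        then show ?thesis using True by (simp add: lim_imp_Liminf)
      qed (simp add: Liminf_const)
    qed
    also have "\<dots> \<le> liminf (\<lambda>n. \<integral>\<^sup>+x. ?G n x \<partial>lborel)"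
  proof (intro nn_integral_liminf borel_measurable_times_ennreal)
    fix n
    show "(indicator Z :: 'e \<Rightarrow> ennreal) \<in> borel_measurable lborel"
      using Z by (intro borel_measurable_indicator) simp
    have "Fn n j \<in> borel_measurable lborel" if "j \<in> J" for j using meas[OF that] by simp
    then show "(\<lambda>x. ennreal (\<Prod>j\<in>J. cmod (Fn n j x) powr (2 * q))) \<in> borel_measurable lborel"
      by (intro measurable_compose[OF _ measurable_ennreal] borel_measurable_prod powr_real_measurable
          borel_measurable_norm) auto
  qed
    also have "\<dots> \<le> liminf (\<lambda>n::nat. ?K)" by (intro Liminf_mono always_eventually allI bound)
    also have "\<dots> = ?K" by (simp add: Liminf_const)
    finally show "(\<integral>\<^sup>+x. ennreal (\<Prod>j\<in>J. cmod (F j x) powr (2 * q)) * indicator Z x \<partial>lborel) \<le> ?K" .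
qed

section \<open>Orthogonality of characters of residues\<close>

text \<open>A geometric sum over 2 m full periods of an s-th root of unity w. The bound on u
  excludes w = 1.\<close>

lemma sum_cis_period_eq_0:
  fixes u :: int and s m :: nat
  assumes s: "s > 0" and u: "u \<noteq> 0" "\<bar>u\<bar> < int s"
  shows "(\<Sum>k\<in>{- int (m * s)..<int (m * s)}. cis (2 * pi * (of_int k * of_int u / of_nat s))) = 0"
proof -
  define w where "w = cis (2 * pi * (of_int u / of_nat s))"
  have w1: "w \<noteq> 1"
  proof
    assume "w = 1"
    then have "cos (2 * pi * (of_int u / of_nat s)) = 1" by (simp add: w_def complex_eq_iff)
    then obtain n :: int where "2 * pi * (of_int u / of_nat s) = of_int n * 2 * pi"
      using cos_one_2pi_int by blast
    then have "real_of_int u = real_of_int n * real s" using s by (simp add: field_simps)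
    then have "real_of_int u = real_of_int (n * int s)" by simp
    then have un: "u = n * int s" by (simp only: of_int_eq_iff)
    then have "\<bar>u\<bar> = \<bar>n\<bar> * int s" by (simp add: abs_mult)
    moreover have "n \<noteq> 0" using u un by auto
    then have "1 * int s \<le> \<bar>n\<bar> * int s" by (intro mult_right_mono) auto
    ultimately show False using u by simp
  qed
  have ws: "w ^ (2 * (m * s)) = 1"
  proof -
    have "w ^ (2 * (m * s)) = cis (real (2 * (m * s)) * (2 * pi * (of_int u / of_nat s)))"
      unfolding w_def by (rule Complex.DeMoivre)
    also have "real (2 * (m * s)) * (2 * pi * (of_int u / of_nat s)) = 2 * pi * of_int (2 * int m * u)"
      using s by simp
    also have "cis \<dots> = 1" using cis_multiple_2pi[of "of_int (2 * int m * u)"] by simp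
    finally show ?thesis .
  qed
  have bij: "bij_betw (\<lambda>i. int i - int (m * s)) {..<2 * (m * s)} {- int (m * s)..<int (m * s)}"
    by (rule bij_betwI[of _ _ _ "\<lambda>k. nat (k + int (m * s))"]) (auto simp del: of_nat_mult)
  have "(\<Sum>k\<in>{- int (m * s)..<int (m * s)}. cis (2 * pi * (of_int k * of_int u / of_nat s)))
     = (\<Sum>i<2 * (m * s). cis (2 * pi * (of_int (int i - int (m * s)) * of_int u / of_nat s)))"
    by (rule sum.reindex_bij_betw[OF bij, symmetric])
  also have "\<dots> = (\<Sum>i<2 * (m * s). cis (- (2 * pi * (real (m * s) * of_int u / of_nat s))) * w ^ i)"
  proof (rule sum.cong[OF refl])
    fix i
    have "w ^ i = cis (real i * (2 * pi * (of_int u / of_nat s)))" unfolding w_def by (rule Complex.DeMoivre)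
    then show "cis (2 * pi * (of_int (int i - int (m * s)) * of_int u / of_nat s)) =
      cis (- (2 * pi * (real (m * s) * of_int u / of_nat s))) * w ^ i"
      by (simp add: cis_mult left_diff_distrib diff_divide_distrib algebra_simps)
  qed
  also have "\<dots> = 0" using w1 ws by (simp add: sum_distrib_left[symmetric] geometric_sum)
  finally show ?thesis .
qed

text \<open>Two elements of S differ by less than s in each coordinate, so distinct ones give
  characters that are orthogonal over every block of s integers in some coordinate. The range of k
  consists of 2 m such blocks per coordinate, enough for the integer parts of a linear image of a
  ball of radius proportional to s.\<close>

lemma discrete_Bessel:
  fixes a :: "('b::euclidean_space \<Rightarrow> int) \<Rightarrow> complex" and s m :: nat
  assumes s: "s > 0" and S: "S \<subseteq> PiE Basis (\<lambda>_. {0..<int s})"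
  shows "(\<Sum>k\<in>PiE Basis (\<lambda>_. {- int (m * s)..<int (m * s)}).
      (cmod (\<Sum>t\<in>S. a t * cis (2 * pi * (\<Sum>b\<in>(Basis::'b set). of_int (k b) * of_int (t b) / of_nat s))))\<^sup>2)
    = (2 * real m * real s) ^ DIM('b) * (\<Sum>t\<in>S. (cmod (a t))\<^sup>2)"
proof -
  let ?B = "Basis :: 'b set"
  let ?K = "PiE ?B (\<lambda>_. {- int (m * s)..<int (m * s)})"
  define \<phi> where "\<phi> k t = 2 * pi * (\<Sum>b\<in>?B. of_int (k b) * of_int (t b) / of_nat s)" for k t :: "'b \<Rightarrow> int"
  have finS: "finite S" by (rule finite_subset[OF S]) (intro finite_PiE, auto)
  have orth: "(\<Sum>k\<in>?K. cis (\<phi> k t - \<phi> k t')) = (if t = t' then (2 * real m * real s) ^ DIM('b) else 0)"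
    if t: "t \<in> S" "t' \<in> S" for t t'
  proof -
    have "(\<Sum>k\<in>?K. cis (\<phi> k t - \<phi> k t')) = (\<Sum>k\<in>?K. \<Prod>b\<in>?B. cis (2 * pi * (of_int (k b) * of_int (t b - t' b) / of_nat s)))"
    proof (rule sum.cong[OF refl])
      fix k
      have "\<phi> k t - \<phi> k t' = (\<Sum>b\<in>?B. 2 * pi * (of_int (k b) * of_int (t b - t' b) / of_nat s))"
        unfolding \<phi>_def by (simp add: sum_distrib_left sum_subtractf[symmetric] algebra_simps diff_divide_distrib)
      then show "cis (\<phi> k t - \<phi> k t') = (\<Prod>b\<in>?B. cis (2 * pi * (of_int (k b) * of_int (t b - t' b) / of_nat s)))"
        by (simp add: cis_conv_exp exp_sum sum_distrib_left)
    qed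
    also have "\<dots> = (\<Prod>b\<in>?B. \<Sum>k\<in>{- int (m * s)..<int (m * s)}. cis (2 * pi * (of_int k * of_int (t b - t' b) / of_nat s)))"
      by (rule prod_sum_PiE[symmetric]) auto
    also have "\<dots> = (if t = t' then (2 * real m * real s) ^ DIM('b) else 0)"
    proof (cases "t = t'")
      case True
      then show ?thesis by (simp add: power_mult_distrib)
    next
      case False
      obtain b where b: "b \<in> ?B" "t b \<noteq> t' b"
        using False t S by (metis PiE_ext subsetD)
      have "t b \<in> {0..<int s}" "t' b \<in> {0..<int s}" using t S b(1) by (auto simp: PiE_iff subset_iff)
      then have "\<bar>t b - t' b\<bar> < int s" by auto
      then have "(\<Sum>k\<in>{- int (m * s)..<int (m * s)}. cis (2 * pi * (of_int k * of_int (t b - t' b) / of_nat s))) = 0"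
        using b s by (intro sum_cis_period_eq_0) auto
      then show ?thesis using b False by (auto intro!: prod_zero)
    qed
    finally show ?thesis .
  qed
  have "complex_of_real (\<Sum>k\<in>?K. (cmod (\<Sum>t\<in>S. a t * cis (\<phi> k t)))\<^sup>2)
    = (\<Sum>k\<in>?K. (\<Sum>t\<in>S. a t * cis (\<phi> k t)) * cnj (\<Sum>t\<in>S. a t * cis (\<phi> k t)))"
    by (simp only: of_real_sum complex_norm_square)
  also have "\<dots> = (\<Sum>k\<in>?K. \<Sum>t\<in>S. \<Sum>t'\<in>S. a t * cnj (a t') * cis (\<phi> k t - \<phi> k t'))"
    by (simp add: sum_product cis_cnj cis_divide[symmetric] divide_inverse mult_ac flip: cis_inverse)
  also have "\<dots> = (\<Sum>t\<in>S. \<Sum>k\<in>?K. \<Sum>t'\<in>S. a t * cnj (a t') * cis (\<phi> k t - \<phi> k t'))"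
    by (rule sum.swap)
  also have "\<dots> = (\<Sum>t\<in>S. \<Sum>t'\<in>S. \<Sum>k\<in>?K. a t * cnj (a t') * cis (\<phi> k t - \<phi> k t'))"
    by (intro sum.cong refl sum.swap)
  also have "\<dots> = (\<Sum>t\<in>S. \<Sum>t'\<in>S. a t * cnj (a t') * (\<Sum>k\<in>?K. cis (\<phi> k t - \<phi> k t')))"
    by (simp add: sum_distrib_left)
  also have "\<dots> = (\<Sum>t\<in>S. \<Sum>t'\<in>S. a t * cnj (a t') * (if t = t' then (2 * real m * real s) ^ DIM('b) else 0))"
    using orth by simp
  also have "\<dots> = (\<Sum>t\<in>S. a t * cnj (a t) * (2 * real m * real s) ^ DIM('b))"
    using finS by (intro sum.cong refl) (simp add: sum.delta' if_distrib cong: if_cong)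
  also have "\<dots> = complex_of_real ((2 * real m * real s) ^ DIM('b) * (\<Sum>t\<in>S. (cmod (a t))\<^sup>2))"
    by (simp only: complex_norm_square[symmetric]) (simp add: sum_distrib_right mult.commute)
  finally show ?thesis unfolding \<phi>_def by (simp only: of_real_eq_iff)
qed

lemma multilinear_bound_subset:
  assumes "multilinear_bound J q \<omega> \<Theta> Z A" "Z' \<subseteq> Z"
  shows "multilinear_bound J q \<omega> \<Theta> Z' A"
  unfolding multilinear_bound_def
proof
  fix a
  have "(\<integral>\<^sup>+x. ennreal (\<Prod>j\<in>J. cmod (exp_sum \<omega> (\<Theta> j) (a j) x) powr (2 * q)) * indicator Z' x \<partial>lborel) \<le>
     (\<integral>\<^sup>+x. ennreal (\<Prod>j\<in>J. cmod (exp_sum \<omega> (\<Theta> j) (a j) x) powr (2 * q)) * indicator Z x \<partial>lborel)"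
    using assms(2) by (intro nn_integral_mono mult_left_mono) (auto simp: indicator_def)
  then show "(\<integral>\<^sup>+x. ennreal (\<Prod>j\<in>J. cmod (exp_sum \<omega> (\<Theta> j) (a j) x) powr (2 * q)) * indicator Z' x \<partial>lborel)
       \<le> ennreal (A * (\<Prod>j\<in>J. (\<Sum>\<kappa>\<in>\<Theta> j. (cmod (a j \<kappa>))\<^sup>2) powr q))"
    using assms(1) unfolding multilinear_bound_def by (meson order_trans)
qed

text \<open>A translation multiplies each coefficient by a number of modulus 1.\<close>

lemma multilinear_bound_translate:
  assumes mb: "multilinear_bound J q \<omega> \<Theta> Z A" and Z: "Z \<in> sets borel"
  shows "multilinear_bound J q \<omega> \<Theta> ((+) x0 ` Z) A"
  unfolding multilinear_bound_def
proof
  fix a :: "'a \<Rightarrow> 'b \<Rightarrow> complex"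
  let ?a = "\<lambda>j \<kappa>. a j \<kappa> * cis (2 * pi * (x0 \<bullet> \<omega> \<kappa>))"
  let ?f = "\<lambda>x. ennreal (\<Prod>j\<in>J. cmod (exp_sum \<omega> (\<Theta> j) (a j) x) powr (2 * q))"
  have Z': "(+) x0 ` Z \<in> sets borel"
  proof -
    have "(+) x0 ` Z = (\<lambda>x. x - x0) -` Z \<inter> space borel" by (force simp: image_iff algebra_simps)
    also have "\<dots> \<in> sets borel" by (rule measurable_sets[OF _ Z]) measurable
    finally show ?thesis .
  qed
  have [measurable]: "?f \<in> borel_measurable borel" by measurable
  have "(\<integral>\<^sup>+x. ?f x * indicator ((+) x0 ` Z) x \<partial>lborel) = (\<integral>\<^sup>+x. ?f x * indicator ((+) x0 ` Z) x \<partial>(distr lborel borel ((+) x0)))"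
    by (simp add: lborel_distr_plus)
  also have "\<dots> = (\<integral>\<^sup>+x. ?f (x0 + x) * indicator ((+) x0 ` Z) (x0 + x) \<partial>lborel)"
    using Z' by (subst nn_integral_distr) auto
  also have "\<dots> = (\<integral>\<^sup>+x. ennreal (\<Prod>j\<in>J. cmod (exp_sum \<omega> (\<Theta> j) (?a j) x) powr (2 * q)) * indicator Z x \<partial>lborel)"
  proof (rule nn_integral_cong)
    fix x
    have "exp_sum \<omega> (\<Theta> j) (a j) (x0 + x) = exp_sum \<omega> (\<Theta> j) (?a j) x" for j
      unfolding exp_sum_def by (intro sum.cong refl) (simp add: cis_mult inner_add_left algebra_simps)
    moreover have "indicator ((+) x0 ` Z) (x0 + x) = (indicator Z x :: ennreal)" by (auto simp: indicator_def)
    ultimately show "?f (x0 + x) * indicator ((+) x0 ` Z) (x0 + x) =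
       ennreal (\<Prod>j\<in>J. cmod (exp_sum \<omega> (\<Theta> j) (?a j) x) powr (2 * q)) * indicator Z x" by simp
  qed
  also have "\<dots> \<le> ennreal (A * (\<Prod>j\<in>J. (\<Sum>\<kappa>\<in>\<Theta> j. (cmod (?a j \<kappa>))\<^sup>2) powr q))"
    using mb[unfolded multilinear_bound_def, rule_format, of ?a] .
  also have "\<dots> = ennreal (A * (\<Prod>j\<in>J. (\<Sum>\<kappa>\<in>\<Theta> j. (cmod (a j \<kappa>))\<^sup>2) powr q))"
    by (simp add: norm_mult)
  finally show "(\<integral>\<^sup>+x. ?f x * indicator ((+) x0 ` Z) x \<partial>lborel)
      \<le> ennreal (A * (\<Prod>j\<in>J. (\<Sum>\<kappa>\<in>\<Theta> j. (cmod (a j \<kappa>))\<^sup>2) powr q))" .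
qed

section \<open>The induction on scales\<close>


definition pt :: "real \<Rightarrow> ('b::euclidean_space \<Rightarrow> int) \<Rightarrow> 'b" where
  "pt R z = (\<Sum>b\<in>Basis. (of_int (z b) / R) *\<^sub>R b)"

text \<open>Membership in \<open>PiE\<close> fixes z outside \<open>Basis\<close>; integer vectors
  then agree if their coordinates do, and the grid is finite.\<close>

definition grid :: "'b::euclidean_space \<Rightarrow> real \<Rightarrow> real \<Rightarrow> ('b \<Rightarrow> int) set" where
  "grid \<xi>0 \<rho> R = {z \<in> PiE Basis (\<lambda>_. UNIV). \<forall>b\<in>Basis. \<bar>of_int (z b) / R - \<xi>0 \<bullet> b\<bar> \<le> \<rho>}"

definition max_box :: "real \<Rightarrow> 'e::euclidean_space set" where
  "max_box R = {x. \<forall>b\<in>Basis. \<bar>x \<bullet> b\<bar> \<le> R}"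

definition coarsen :: "nat \<Rightarrow> ('b::euclidean_space \<Rightarrow> int) \<Rightarrow> 'b \<Rightarrow> int" where
  "coarsen s z = (\<lambda>b\<in>Basis. z b div int s)"

lemma pt_inner [simp]: "b \<in> Basis \<Longrightarrow> pt R z \<bullet> b = of_int (z b) / R"
  by (simp add: pt_def inner_sum_left inner_Basis if_distrib cong: if_cong)

lemma finite_grid:
  assumes R: "R > 0"
  shows "finite (grid \<xi>0 \<rho> R)"
proof -
  have "grid \<xi>0 \<rho> R \<subseteq> PiE Basis (\<lambda>b. {\<lfloor>(\<xi>0 \<bullet> b - \<rho>) * R\<rfloor>..\<lceil>(\<xi>0 \<bullet> b + \<rho>) * R\<rceil>})"
  proof
    fix z assume z: "z \<in> grid \<xi>0 \<rho> R"
    have "z b \<in> {\<lfloor>(\<xi>0 \<bullet> b - \<rho>) * R\<rfloor>..\<lceil>(\<xi>0 \<bullet> b + \<rho>) * R\<rceil>}" if b: "b \<in> Basis" for b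
    proof -
      have "\<bar>of_int (z b) / R - \<xi>0 \<bullet> b\<bar> \<le> \<rho>" using z b by (simp add: grid_def)
      then have "\<xi>0 \<bullet> b - \<rho> \<le> of_int (z b) / R" "of_int (z b) / R \<le> \<xi>0 \<bullet> b + \<rho>" by linarith+
      then have "(\<xi>0 \<bullet> b - \<rho>) * R \<le> of_int (z b)" "of_int (z b) \<le> (\<xi>0 \<bullet> b + \<rho>) * R"
        using R by (simp_all add: field_simps)
      then have "\<lfloor>(\<xi>0 \<bullet> b - \<rho>) * R\<rfloor> \<le> z b" "z b \<le> \<lceil>(\<xi>0 \<bullet> b + \<rho>) * R\<rceil>" by linarith+
      then show ?thesis by simp
    qed
    then show "z \<in> PiE Basis (\<lambda>b. {\<lfloor>(\<xi>0 \<bullet> b - \<rho>) * R\<rfloor>..\<lceil>(\<xi>0 \<bullet> b + \<rho>) * R\<rceil>})"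
      using z by (auto simp: grid_def PiE_iff)
  qed
  then show ?thesis by (rule finite_subset) (intro finite_PiE, auto)
qed

lemma max_box_borel [measurable]: "max_box R \<in> sets borel"
proof -
  have "max_box R = (\<Inter>b\<in>Basis. {x :: 'a. \<bar>x \<bullet> b\<bar> \<le> R})" by (auto simp: max_box_def)
  also have "closed \<dots>" by (intro closed_INT ballI closed_Collect_le continuous_intros)
  finally show ?thesis by (rule borel_closed)
qed

lemma fl_level_borel:
  fixes g :: "'a::topological_space \<Rightarrow> 'v::euclidean_space"
  assumes g: "g \<in> borel_measurable borel"
  shows "{x. fl (g x) = d} \<in> sets borel"
proof (cases "d \<in> extensional Basis")
  case True
  then have "{x. fl (g x) = d} = (\<Inter>b\<in>Basis. {x. \<lfloor>g x \<bullet> b\<rfloor> = d b})"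
    by (auto simp: fl_def fun_eq_iff extensional_def)
  also have "\<dots> \<in> sets borel"
  proof (intro sets.countable_INT'')
    fix b :: 'v
    have "(\<lambda>x. \<lfloor>g x \<bullet> b\<rfloor>) \<in> measurable borel (count_space UNIV)"
      using g by measurable
    from measurable_sets[OF this, of "{d b}"] show "{x. \<lfloor>g x \<bullet> b\<rfloor> = d b} \<in> sets borel"
      by (simp add: vimage_def)
  qed (auto simp: countable_finite)
  finally show ?thesis .
next
  case False
  then have eq: "{x. fl (g x) = d} = {}" by (auto simp: fl_def)
  show ?thesis unfolding eq by simp
qed

lemma coarsen_diff:
  assumes "s > 0" "R > 0"
  shows "of_int (z b) / (real s * R) - of_int (z b div int s) / R = of_int (z b mod int s) / (real s * R)"
proof -
  have "z b = z b div int s * int s + z b mod int s" by simp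
  then have "real_of_int (z b) = of_int (z b div int s) * real s + of_int (z b mod int s)"
    by (metis of_int_add of_int_mult of_int_of_nat_eq)
  then show ?thesis using assms by (simp add: field_simps)
qed

lemma coarsen_diff_bounds:
  assumes "s > 0" "R > 0"
  shows "0 \<le> real_of_int (z b mod int s) / (real s * R)" "real_of_int (z b mod int s) / (real s * R) \<le> 1 / R"
proof -
  have "0 \<le> z b mod int s" "z b mod int s \<le> int s" using assms(1) by (auto simp: less_imp_le)
  then have *: "0 \<le> real_of_int (z b mod int s)" "real_of_int (z b mod int s) \<le> real s"
    by (simp, metis of_int_le_iff of_int_of_nat_eq)
  then show "0 \<le> real_of_int (z b mod int s) / (real s * R)" using assms by simp
  show "real_of_int (z b mod int s) / (real s * R) \<le> 1 / R" using * assms by (simp add: field_simps)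
qed

lemma coarsen_in_grid:
  assumes s: "s \<ge> 2" and R: "R > 0" and z: "z \<in> grid \<xi>0 (1 / real s + 2 / (real s * R)) (real s * R)"
  shows "coarsen s z \<in> grid \<xi>0 (1 / real s + 2 / R) R"
proof -
  have "\<bar>of_int (z b div int s) / R - \<xi>0 \<bullet> b\<bar> \<le> 1 / real s + 2 / R" if b: "b \<in> Basis" for b
  proof -
    have 1: "\<bar>of_int (z b) / (real s * R) - \<xi>0 \<bullet> b\<bar> \<le> 1 / real s + 2 / (real s * R)" using z b by (simp add: grid_def)
    have 2: "2 / (real s * R) \<le> 1 / R" using s R by (simp add: field_simps)
    have s0: "s > 0" using s by simp
    have "\<bar>B - X\<bar> \<le> u + 2 * w" if "\<bar>A - X\<bar> \<le> u + v" "v \<le> w" "A - B = r" "0 \<le> r" "r \<le> w"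
      for A B X r u v w :: real using that by linarith
    from this[OF 1 2 coarsen_diff[OF s0 R, of z b] coarsen_diff_bounds[OF s0 R, of z b]]
    show ?thesis by (simp only: times_divide_eq_right mult_1_right)
  qed
  then show ?thesis by (auto simp: grid_def coarsen_def)
qed

section \<open>Phases on a quadratic graph near fixed points\<close>

text \<open>The adjoint of the parametrisation of the tangent space that sends v to (v, \<Lambda>
  \<xi> v). Its kernel is the orthogonal complement of the tangent space, so it stands for the
  projection onto that space, but with values in a space that does not depend on \<xi>.\<close>

definition dual_map :: "('b::euclidean_space \<Rightarrow> 'b \<Rightarrow> 'c::euclidean_space) \<Rightarrow> 'b \<Rightarrow> 'b \<times> 'c \<Rightarrow> 'b" where
  "dual_map \<Lambda> \<xi> x = fst x + adjoint (\<Lambda> \<xi>) (snd x)"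

text \<open>\<Lambda> \<xi> is the derivative of Q at \<xi>. Differences of a quadratic map equal
  the derivative at the midpoint, so phases can be compared without a Taylor remainder in the
  frequency.\<close>

locale quadratic_graph =
  fixes Q :: "'b::euclidean_space \<Rightarrow> 'c::euclidean_space" and \<Lambda> :: "'b \<Rightarrow> 'b \<Rightarrow> 'c"
  assumes bilin: "bounded_bilinear \<Lambda>"
    and Q_diff: "Q \<xi> - Q \<eta> = \<Lambda> ((1/2) *\<^sub>R (\<xi> + \<eta>)) (\<xi> - \<eta>)"
begin

lemma linear_\<Lambda>: "linear (\<Lambda> \<xi>)"
  using bilin by (meson bounded_bilinear.bounded_linear_right bounded_linear.linear)

lemma linear_dual_map: "linear (dual_map \<Lambda> \<xi>)"
  using adjoint_linear[OF linear_\<Lambda>[of \<xi>]]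
  by (intro linearI) (auto simp: dual_map_def linear_add linear_scale scaleR_add_right)

lemma inner_graph_diff:
  "x \<bullet> (\<theta>, Q \<theta>) - x \<bullet> (\<kappa>, Q \<kappa>) =
     dual_map \<Lambda> \<xi>0 x \<bullet> (\<theta> - \<kappa>) + snd x \<bullet> \<Lambda> ((1/2) *\<^sub>R (\<theta> + \<kappa>) - \<xi>0) (\<theta> - \<kappa>)"
proof -
  have "x \<bullet> (\<theta>, Q \<theta>) - x \<bullet> (\<kappa>, Q \<kappa>) = fst x \<bullet> (\<theta> - \<kappa>) + snd x \<bullet> (Q \<theta> - Q \<kappa>)"
    by (cases x) (simp add: inner_diff_right)
  also have "Q \<theta> - Q \<kappa> = \<Lambda> \<xi>0 (\<theta> - \<kappa>) + \<Lambda> ((1/2) *\<^sub>R (\<theta> + \<kappa>) - \<xi>0) (\<theta> - \<kappa>)"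
    unfolding Q_diff by (simp add: bounded_bilinear.diff_left[OF bilin])
  also have "snd x \<bullet> (\<Lambda> \<xi>0 (\<theta> - \<kappa>) + \<Lambda> ((1/2) *\<^sub>R (\<theta> + \<kappa>) - \<xi>0) (\<theta> - \<kappa>))
     = adjoint (\<Lambda> \<xi>0) (snd x) \<bullet> (\<theta> - \<kappa>) + snd x \<bullet> \<Lambda> ((1/2) *\<^sub>R (\<theta> + \<kappa>) - \<xi>0) (\<theta> - \<kappa>)"
    using adjoint_works[OF linear_\<Lambda>[of \<xi>0], where x = "\<theta> - \<kappa>" and y = "snd x"] by (simp add: inner_add_right inner_commute)
  finally show ?thesis by (simp add: dual_map_def inner_add_left)
qed

definition freq :: "real \<Rightarrow> ('b \<Rightarrow> int) \<Rightarrow> 'b \<times> 'c" where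
  "freq R z = (pt R z, Q (pt R z))"

text \<open>Passing from \<open>R\<close> to \<open>s R\<close>, the phase of a frequency \<open>z\<close> relative to its cell \<open>coarsen s z\<close> splits into
  a character of the finite group of residues, which only sees the integer part \<open>k\<close> of \<open>dual_map x / R\<close>, and the
  inner product of the bounded vectors \<open>slow_space\<close> and \<open>slow_freq\<close>, which is expanded in a Taylor series.\<close>

definition slow_space :: "nat \<Rightarrow> real \<Rightarrow> 'b \<Rightarrow> ('b \<Rightarrow> int) \<Rightarrow> 'b \<times> 'c \<Rightarrow> 'b \<times> 'c" where
  "slow_space s R \<xi>0 k x = ((1 / R) *\<^sub>R dual_map \<Lambda> \<xi>0 x - (\<Sum>b\<in>Basis. of_int (k b) *\<^sub>R b), (1 / (real s * R)) *\<^sub>R snd x)"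

definition slow_freq :: "nat \<Rightarrow> real \<Rightarrow> 'b \<Rightarrow> ('b \<Rightarrow> int) \<Rightarrow> 'b \<times> 'c" where
  "slow_freq s R \<xi>0 z = (let \<theta> = pt (real s * R) z; \<kappa> = pt R (coarsen s z) in
     (R *\<^sub>R (\<theta> - \<kappa>), (real s * R) *\<^sub>R \<Lambda> ((1/2) *\<^sub>R (\<theta> + \<kappa>) - \<xi>0) (\<theta> - \<kappa>)))"

definition fourier_phase :: "nat \<Rightarrow> ('b \<Rightarrow> int) \<Rightarrow> ('b \<Rightarrow> int) \<Rightarrow> real" where
  "fourier_phase s k t = (\<Sum>b\<in>Basis. of_int (k b) * of_int (t b) / of_nat s)"

definition residue :: "nat \<Rightarrow> ('b \<Rightarrow> int) \<Rightarrow> 'b \<Rightarrow> int" where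
  "residue s z = (\<lambda>b\<in>Basis. z b mod int s)"

lemma inner_freq_split:
  assumes s: "s > 0" and R: "R > 0"
  shows "x \<bullet> freq (real s * R) z = x \<bullet> freq R (coarsen s z) + fourier_phase s k (residue s z)
     + slow_space s R \<xi>0 k x \<bullet> slow_freq s R \<xi>0 z"
proof -
  define \<theta> \<kappa> where "\<theta> = pt (real s * R) z" and "\<kappa> = pt R (coarsen s z)"
  define v where "v = \<Lambda> ((1/2) *\<^sub>R (\<theta> + \<kappa>) - \<xi>0) (\<theta> - \<kappa>)"
  have "x \<bullet> freq (real s * R) z - x \<bullet> freq R (coarsen s z) = dual_map \<Lambda> \<xi>0 x \<bullet> (\<theta> - \<kappa>) + snd x \<bullet> v"
    using inner_graph_diff[of x \<theta> \<kappa> \<xi>0] by (simp add: freq_def \<theta>_def \<kappa>_def v_def)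
  \<comment> \<open>R (\<theta> - \<kappa>) has the coordinates residue / s, so its product with an
    integer vector is the phase of a character of the residues modulo s.\<close>
  moreover have "(\<Sum>b\<in>Basis. of_int (k b) *\<^sub>R b) \<bullet> (R *\<^sub>R (\<theta> - \<kappa>)) = fourier_phase s k (residue s z)"
    unfolding inner_sum_left fourier_phase_def
  proof (rule sum.cong[OF refl])
    fix b :: 'b assume b: "b \<in> Basis"
    have "b \<bullet> (\<theta> - \<kappa>) = of_int (z b mod int s) / (real s * R)"
      using coarsen_diff[OF s R, of z b] b by (simp add: \<theta>_def \<kappa>_def coarsen_def inner_diff_right inner_commute[of b])
    moreover have "of_int (k b) *\<^sub>R b \<bullet> R *\<^sub>R (\<theta> - \<kappa>) = of_int (k b) * (R * (b \<bullet> (\<theta> - \<kappa>)))"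
      by (simp only: inner_scaleR_left inner_scaleR_right mult.left_commute)
    ultimately show "of_int (k b) *\<^sub>R b \<bullet> R *\<^sub>R (\<theta> - \<kappa>) = of_int (k b) * of_int (residue s z b) / of_nat s"
      using b R by (simp add: residue_def)
  qed
  moreover have "slow_space s R \<xi>0 k x \<bullet> slow_freq s R \<xi>0 z =
     dual_map \<Lambda> \<xi>0 x \<bullet> (\<theta> - \<kappa>) - (\<Sum>b\<in>Basis. of_int (k b) *\<^sub>R b) \<bullet> (R *\<^sub>R (\<theta> - \<kappa>)) + snd x \<bullet> v"
    using s R by (simp add: slow_space_def slow_freq_def Let_def \<theta>_def[symmetric] \<kappa>_def[symmetric] v_def[symmetric] inner_diff_left right_diff_distrib)
  ultimately show ?thesis by linarith
qed

lemma abs_slow_space_le: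
  assumes s: "s > 0" and R: "R > 0" and x: "x \<in> max_box (real s * R)"
    and k: "fl ((1 / R) *\<^sub>R dual_map \<Lambda> \<xi>0 x) = k" and b: "b \<in> Basis"
  shows "\<bar>slow_space s R \<xi>0 k x \<bullet> b\<bar> \<le> 1"
proof -
  from b consider c where "c \<in> Basis" "b = (c, 0)" | c where "c \<in> Basis" "b = (0, c)"
    by (auto simp: Basis_prod_def)
  then show ?thesis
  proof cases
    case 1
    have "(\<Sum>b\<in>Basis. of_int (k b) *\<^sub>R b) \<bullet> c = of_int (k c)"
      using 1 by (simp add: inner_sum_left inner_Basis if_distrib cong: if_cong)
    moreover have "k c = \<lfloor>((1 / R) *\<^sub>R dual_map \<Lambda> \<xi>0 x) \<bullet> c\<rfloor>" using k 1 by (auto simp: fl_def)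
    ultimately show ?thesis using 1 by (simp add: slow_space_def inner_diff_left) linarith
  next
    case 2
    have "\<bar>snd x \<bullet> c\<bar> \<le> real s * R" using x 2 b by (auto simp: max_box_def inner_prod_def)
    then show ?thesis using 2 s R by (simp add: slow_space_def field_simps abs_mult)
  qed
qed

text \<open>The radius of the frequency cubes pays for the large ball. Since R \<ge> s, the midpoint
  is within 3 / s of \<xi>0 in each coordinate, and \<theta> - \<kappa> has coordinates at most 1 /
  R; so the quadratic error is O(1 / (s R)), and the factor s R leaves a bound free of s and
  R.\<close>

lemma abs_slow_freq_le:
  assumes \<Lambda>: "\<And>a b. norm (\<Lambda> a b) \<le> norm a * norm b * CL" "CL \<ge> 0"
    and s: "s \<ge> 2" and R: "R \<ge> real s" and z: "z \<in> grid \<xi>0 (1 / real s + 2 / (real s * R)) (real s * R)"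
    and b: "b \<in> Basis"
  shows "\<bar>slow_freq s R \<xi>0 z \<bullet> b\<bar> \<le> 1 + 3 * (real DIM('b))\<^sup>2 * CL"
proof -
  have R0: "R > 0" and s0: "s > 0" using s R by auto
  define \<theta> \<kappa> where "\<theta> = pt (real s * R) z" and "\<kappa> = pt R (coarsen s z)"
  have d: "(\<theta> - \<kappa>) \<bullet> c = of_int (z c mod int s) / (real s * R)" if "c \<in> Basis" for c
    using coarsen_diff[OF s0 R0, of z c] that by (simp add: \<theta>_def \<kappa>_def coarsen_def inner_diff_left)
  have d1: "\<bar>(\<theta> - \<kappa>) \<bullet> c\<bar> \<le> 1 / R" if "c \<in> Basis" for c
    using coarsen_diff_bounds[OF s0 R0, of z c] that by (simp add: d)
  have n1: "norm (\<theta> - \<kappa>) \<le> real DIM('b) / R"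
  proof -
    have "norm (\<theta> - \<kappa>) \<le> (\<Sum>c\<in>Basis. \<bar>(\<theta> - \<kappa>) \<bullet> c\<bar>)" by (rule norm_le_l1)
    also have "\<dots> \<le> (\<Sum>c\<in>(Basis::'b set). 1 / R)" using d1 by (rule sum_mono)
    finally show ?thesis by simp
  qed
  have n2: "norm ((1/2) *\<^sub>R (\<theta> + \<kappa>) - \<xi>0) \<le> real DIM('b) * (3 / real s)"
  proof -
    have "\<bar>((1/2) *\<^sub>R (\<theta> + \<kappa>) - \<xi>0) \<bullet> c\<bar> \<le> 3 / real s" if c: "c \<in> Basis" for c
    proof -
      have 1: "2 / (real s * R) \<le> 2 / R" using s R0 by (simp add: field_simps)
      have 2: "2 / R \<le> 2 / real s" using s R by (simp add: frac_le)
      have 3: "\<bar>\<theta> \<bullet> c - \<xi>0 \<bullet> c\<bar> \<le> 1 / real s + 2 / (real s * R)" using z c by (simp add: grid_def \<theta>_def)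
      have 4: "\<bar>\<kappa> \<bullet> c - \<xi>0 \<bullet> c\<bar> \<le> 1 / real s + 2 / R"
        using coarsen_in_grid[OF s R0 z] c by (simp add: grid_def \<kappa>_def)
      have "((1/2) *\<^sub>R (\<theta> + \<kappa>) - \<xi>0) \<bullet> c = (1/2) * (\<theta> \<bullet> c - \<xi>0 \<bullet> c) + (1/2) * (\<kappa> \<bullet> c - \<xi>0 \<bullet> c)"
        by (simp add: inner_diff_left inner_add_left field_simps)
      moreover have "\<bar>(1/2) * A + (1/2) * B\<bar> \<le> u + v" if "w \<le> t" "t \<le> v" "\<bar>A\<bar> \<le> u + w" "\<bar>B\<bar> \<le> u + t"
        for A B t u v w :: real using that by linarith
      note this[OF 1 2 3 4]
      ultimately show ?thesis by (simp add: add_divide_distrib[symmetric])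
    qed
    then have "(\<Sum>c\<in>Basis. \<bar>((1/2) *\<^sub>R (\<theta> + \<kappa>) - \<xi>0) \<bullet> c\<bar>) \<le> (\<Sum>c\<in>(Basis::'b set). 3 / real s)" by (rule sum_mono)
    then show ?thesis using norm_le_l1[of "(1/2) *\<^sub>R (\<theta> + \<kappa>) - \<xi>0"] by simp
  qed
  from b consider c where "c \<in> Basis" "b = (c, 0)" | c where "c \<in> Basis" "b = (0, c)"
    by (auto simp: Basis_prod_def)
  then show ?thesis
  proof cases
    case 1
    have "\<bar>R * ((\<theta> - \<kappa>) \<bullet> c)\<bar> \<le> R * (1 / R)"
      unfolding abs_mult using R0 d1[OF 1(1)] by (intro mult_mono) auto
    then have "\<bar>slow_freq s R \<xi>0 z \<bullet> b\<bar> \<le> 1"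
      using 1 R0 by (simp add: slow_freq_def Let_def \<theta>_def \<kappa>_def)
    then show ?thesis using \<Lambda>(2) by (simp add: add_increasing2)
  next
    case 2
    have "\<bar>slow_freq s R \<xi>0 z \<bullet> b\<bar> = (real s * R) * \<bar>\<Lambda> ((1/2) *\<^sub>R (\<theta> + \<kappa>) - \<xi>0) (\<theta> - \<kappa>) \<bullet> c\<bar>"
      using 2 R0 by (simp add: slow_freq_def Let_def \<theta>_def \<kappa>_def abs_mult)
    also have "\<bar>\<Lambda> ((1/2) *\<^sub>R (\<theta> + \<kappa>) - \<xi>0) (\<theta> - \<kappa>) \<bullet> c\<bar> \<le> norm (\<Lambda> ((1/2) *\<^sub>R (\<theta> + \<kappa>) - \<xi>0) (\<theta> - \<kappa>))"
      using 2 by (intro Basis_le_norm)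
    also have "\<dots> \<le> norm ((1/2) *\<^sub>R (\<theta> + \<kappa>) - \<xi>0) * norm (\<theta> - \<kappa>) * CL" by (rule \<Lambda>)
    also have "\<dots> \<le> (real DIM('b) * (3 / real s)) * (real DIM('b) / R) * CL"
      using n1 n2 \<Lambda>(2) R0 by (intro mult_mono) auto
    finally have "\<bar>slow_freq s R \<xi>0 z \<bullet> b\<bar> \<le> (real s * R) * ((real DIM('b) * (3 / real s)) * (real DIM('b) / R) * CL)"
      using R0 by (simp add: mult_left_mono)
    also have "\<dots> = 3 * (real DIM('b))\<^sup>2 * CL" using s R0 by (simp add: field_simps power2_eq_square)
    finally show ?thesis by simp
  qed
qed

text \<open>The moment of order l of the slow frequencies in the cell \<kappa>, twisted by the
  character of k: the coefficient of the coarse frequency \<kappa> in the Taylor term l, at points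
  with integer part k.\<close>

definition cell_coeff ::
  "nat \<Rightarrow> real \<Rightarrow> 'b \<Rightarrow> ('b \<Rightarrow> int) set \<Rightarrow> (('b \<Rightarrow> int) \<Rightarrow> complex) \<Rightarrow> ('b \<Rightarrow> int) \<Rightarrow> ('b \<times> 'c) list \<Rightarrow> ('b \<Rightarrow> int) \<Rightarrow> complex" where
  "cell_coeff s R \<xi>0 G a k l \<kappa> = (\<Sum>z | z \<in> G \<and> coarsen s z = \<kappa>.
     a z * of_real (monom_at l (slow_freq s R \<xi>0 z)) * cis (2 * pi * fourier_phase s k (residue s z)))"

text \<open>Inside one cell the residue determines z, so as a function of k the moment is a
  trigonometric polynomial in the residues and \<open>discrete_Bessel\<close> sums its squares. The
  monomials, once divided by the power of C, are at most 1.\<close>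

lemma sum_cell_coeff_le:
  assumes s: "s > 0" and fin: "finite G" "G \<subseteq> PiE Basis (\<lambda>_. UNIV)" and \<Theta>: "finite \<Theta>" "coarsen s ` G \<subseteq> \<Theta>"
    and C: "C > 0" and l: "set l \<subseteq> Basis"
    and U: "\<And>z b. z \<in> G \<Longrightarrow> b \<in> Basis \<Longrightarrow> \<bar>slow_freq s R \<xi>0 z \<bullet> b\<bar> \<le> C"
  shows "(\<Sum>k\<in>PiE Basis (\<lambda>_. {- int (m * s)..<int (m * s)}). \<Sum>\<kappa>\<in>\<Theta>. (cmod (cell_coeff s R \<xi>0 G a k l \<kappa> / of_real C ^ length l))\<^sup>2)
     \<le> (2 * real m * real s) ^ DIM('b) * (\<Sum>z\<in>G. (cmod (a z))\<^sup>2)"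
proof -
  let ?K = "PiE Basis (\<lambda>_. {- int (m * s)..<int (m * s)})"
  have one: "(\<Sum>k\<in>?K. (cmod (cell_coeff s R \<xi>0 G a k l \<kappa> / of_real C ^ length l))\<^sup>2)
      \<le> (2 * real m * real s) ^ DIM('b) * (\<Sum>z | z \<in> G \<and> coarsen s z = \<kappa>. (cmod (a z))\<^sup>2)" for \<kappa>
  proof -
    let ?F = "{z. z \<in> G \<and> coarsen s z = \<kappa>}"
    define g where "g z = a z * of_real (monom_at l (slow_freq s R \<xi>0 z)) / of_real C ^ length l" for z
    have inj: "inj_on (residue s) ?F"
    proof (rule inj_onI)
      fix x y assume x: "x \<in> ?F" and y: "y \<in> ?F" and eq: "residue s x = residue s y"
      show "x = y"
      proof (rule PiE_ext)
        show "x \<in> PiE Basis (\<lambda>_. UNIV)" "y \<in> PiE Basis (\<lambda>_. UNIV)" using x y fin by auto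
        fix b :: 'b assume b: "b \<in> Basis"
        have "coarsen s x b = coarsen s y b" using x y by simp
        then have "x b div int s = y b div int s" "x b mod int s = y b mod int s"
          using fun_cong[OF eq, of b] b by (simp_all add: coarsen_def residue_def)
        then show "x b = y b" by (metis div_mult_mod_eq)
      qed
    qed
    let ?g = "\<lambda>t. g (the_inv_into ?F (residue s) t)"
    have "cell_coeff s R \<xi>0 G a k l \<kappa> / of_real C ^ length l =
        (\<Sum>t\<in>residue s ` ?F. ?g t * cis (2 * pi * (\<Sum>b\<in>Basis. of_int (k b) * of_int (t b) / of_nat s)))" for k
      unfolding sum.reindex[OF inj] cell_coeff_def sum_divide_distrib
      by (intro sum.cong) (simp_all add: g_def fourier_phase_def the_inv_into_f_f[OF inj])
    then have "(\<Sum>k\<in>?K. (cmod (cell_coeff s R \<xi>0 G a k l \<kappa> / of_real C ^ length l))\<^sup>2) =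
       (2 * real m * real s) ^ DIM('b) * (\<Sum>t\<in>residue s ` ?F. (cmod (?g t))\<^sup>2)"
      using s by (simp only:) (intro discrete_Bessel, auto simp: residue_def)
    also have "(\<Sum>t\<in>residue s ` ?F. (cmod (?g t))\<^sup>2) = (\<Sum>z\<in>?F. (cmod (g z))\<^sup>2)"
      unfolding sum.reindex[OF inj] by (intro sum.cong) (simp_all add: the_inv_into_f_f[OF inj])
    also have "\<dots> \<le> (\<Sum>z\<in>?F. (cmod (a z))\<^sup>2)"
    proof (intro sum_mono power_mono)
      fix z assume z: "z \<in> ?F"
      have "\<bar>monom_at l (slow_freq s R \<xi>0 z)\<bar> \<le> C ^ length l"
        using l U z C by (intro abs_monom_at_le) auto
      then have "cmod (a z) * \<bar>monom_at l (slow_freq s R \<xi>0 z)\<bar> \<le> cmod (a z) * C ^ length l"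
        by (intro mult_left_mono) auto
      then show "cmod (g z) \<le> cmod (a z)"
        using C by (simp add: g_def norm_mult norm_divide norm_power divide_le_eq)
    qed simp
    finally show ?thesis by (simp add: mult_left_mono)
  qed
  have "(\<Sum>k\<in>?K. \<Sum>\<kappa>\<in>\<Theta>. (cmod (cell_coeff s R \<xi>0 G a k l \<kappa> / of_real C ^ length l))\<^sup>2)
     = (\<Sum>\<kappa>\<in>\<Theta>. \<Sum>k\<in>?K. (cmod (cell_coeff s R \<xi>0 G a k l \<kappa> / of_real C ^ length l))\<^sup>2)"
    by (rule sum.swap)
  also have "\<dots> \<le> (\<Sum>\<kappa>\<in>\<Theta>. (2 * real m * real s) ^ DIM('b) * (\<Sum>z | z \<in> G \<and> coarsen s z = \<kappa>. (cmod (a z))\<^sup>2))"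
    by (intro sum_mono one)
  also have "\<dots> = (2 * real m * real s) ^ DIM('b) * (\<Sum>\<kappa>\<in>\<Theta>. \<Sum>z | z \<in> G \<and> coarsen s z = \<kappa>. (cmod (a z))\<^sup>2)"
    by (simp add: sum_distrib_left)
  also have "(\<Sum>\<kappa>\<in>\<Theta>. \<Sum>z | z \<in> G \<and> coarsen s z = \<kappa>. (cmod (a z))\<^sup>2) = (\<Sum>z\<in>G. (cmod (a z))\<^sup>2)"
    by (rule sum.group[OF fin(1) \<Theta>])
  finally show ?thesis .
qed

end

lemma continuous_monom_at:
  fixes Y :: "'a::topological_space \<Rightarrow> 'e::euclidean_space"
  assumes "continuous_on S Y"
  shows "continuous_on S (\<lambda>x. monom_at l (Y x))"
  by (induction l) (auto simp: monom_at_def intro!: continuous_intros assms)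

context quadratic_graph
begin

lemma continuous_slow_space: "continuous_on S (slow_space s R \<xi>0 k)"
proof -
  have "continuous_on S (\<lambda>x. dual_map \<Lambda> \<xi>0 x)"
    by (rule linear_continuous_on) (simp add: linear_dual_map linear_linear)
  then show ?thesis unfolding slow_space_def[abs_def] by (intro continuous_intros)
qed

section \<open>Passing from scale R to scale s R\<close>

text \<open>Where all integer parts are constant, the exponential sums at scale s R are
  superpositions of sums over the coarse frequencies with coefficients \<open>cell_coeff\<close>, so
  the estimate at scale R carries over.\<close>

lemma cell_bound:
  assumes C: "0 < C" and q: "0 < q" "q \<le> 1"
    and W: "\<And>n. (\<Sum>l\<in>(basis_words n :: ('b \<times> 'c) list set). word_weight C l powr 1) \<le> W"
    and W': "\<And>n. (\<Sum>l\<in>(basis_words n :: ('b \<times> 'c) list set). word_weight C l powr (q / 2)) \<le> W'"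
    and J: "finite J" and A: "0 \<le> A" and Z: "Z \<in> sets borel"
    and mb: "multilinear_bound J q (freq R) \<Theta> Z A" and s: "s > 0" and R: "R > 0"
    and \<Theta>: "\<And>j. j \<in> J \<Longrightarrow> finite (\<Theta> j)" "\<And>j. j \<in> J \<Longrightarrow> coarsen s ` G j \<subseteq> \<Theta> j" "\<And>j. j \<in> J \<Longrightarrow> finite (G j)"
    and Zbox: "Z \<subseteq> max_box (real s * R)"
    and k: "\<And>x j. x \<in> Z \<Longrightarrow> j \<in> J \<Longrightarrow> fl ((1 / R) *\<^sub>R dual_map \<Lambda> (\<xi>0 j) x) = k j"
    and h: "\<And>j n. j \<in> J \<Longrightarrow> (\<Sum>l\<in>basis_words n. sqrt (word_weight C l) *
        (\<Sum>\<kappa>\<in>\<Theta> j. (cmod (cell_coeff s R (\<xi>0 j) (G j) (a j) (k j) l \<kappa> / of_real C ^ length l))\<^sup>2)) \<le> h j"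
  shows "(\<integral>\<^sup>+x. ennreal (\<Prod>j\<in>J. cmod (exp_sum (freq (real s * R)) (G j) (a j) x) powr (2 * q)) * indicator Z x \<partial>lborel)
       \<le> ennreal (A * (W powr q * W') ^ card J * (\<Prod>j\<in>J. h j powr q))"
proof -
  define Y where "Y j = slow_space s R (\<xi>0 j) (k j)" for j
  define U where "U j = slow_freq s R (\<xi>0 j)" for j
  define M where "M j = cell_coeff s R (\<xi>0 j) (G j) (a j) (k j)" for j
  define Fn where "Fn n j x = (\<Sum>\<kappa>\<in>\<Theta> j. cis (2 * pi * (x \<bullet> freq R \<kappa>)) *
        (\<Sum>l\<in>basis_words n. (2 * pi * \<i>) ^ length l / fact (length l) * of_real (monom_at l (Y j x)) * M j l \<kappa>))" for n j x
  show ?thesis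
  proof (rule multilinear_bound_Taylor[OF C q W W' J mb A Z, where Fn = Fn and Y = Y and M = M])
    fix n j assume j: "j \<in> J"
    have "continuous_on UNIV (Fn n j)"
      unfolding Fn_def[abs_def] cis_conv_exp Y_def
      by (intro continuous_intros continuous_monom_at continuous_slow_space)
    then show "Fn n j \<in> borel_measurable borel" by (rule borel_measurable_continuous_onI)
    show "(\<Sum>l\<in>basis_words n. sqrt (word_weight C l) * (\<Sum>\<kappa>\<in>\<Theta> j. (cmod (M j l \<kappa> / of_real C ^ length l))\<^sup>2)) \<le> h j"
      unfolding M_def by (rule h[OF j])
  next
    fix j x b assume "j \<in> J" "x \<in> Z" "b \<in> (Basis :: ('b \<times> 'c) set)"
    then show "\<bar>Y j x \<bullet> b\<bar> \<le> 1" unfolding Y_def using Zbox k by (intro abs_slow_space_le[OF s R]) auto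
  next
    fix j x assume j: "j \<in> J" and x: "x \<in> Z"
    define c where "c z = a j z * cis (2 * pi * fourier_phase s (k j) (residue s z))" for z
    have Fn_eq: "Fn n j x = (\<Sum>\<kappa>\<in>\<Theta> j. \<Sum>z | z \<in> G j \<and> coarsen s z = \<kappa>. cis (2 * pi * (x \<bullet> freq R \<kappa>)) *
         (c z * exp_trunc n (2 * pi * \<i> * of_real (Y j x \<bullet> U j z))))" for n
      unfolding Fn_def
    proof (rule sum.cong[OF refl])
      fix \<kappa>
      have "(\<Sum>l\<in>basis_words n. (2 * pi * \<i>) ^ length l / fact (length l) * of_real (monom_at l (Y j x)) * M j l \<kappa>)
        = (\<Sum>l\<in>basis_words n. \<Sum>z | z \<in> G j \<and> coarsen s z = \<kappa>. c z * ((2 * pi * \<i>) ^ length l / fact (length l) *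
            of_real (monom_at l (Y j x)) * of_real (monom_at l (U j z))))"
        by (simp add: M_def cell_coeff_def c_def U_def sum_distrib_left mult_ac)
      also have "\<dots> = (\<Sum>z | z \<in> G j \<and> coarsen s z = \<kappa>. c z * exp_trunc n (2 * pi * \<i> * of_real (Y j x \<bullet> U j z)))"
        by (subst sum.swap) (simp only: exp_trunc_inner sum_distrib_left)
      finally show "cis (2 * pi * (x \<bullet> freq R \<kappa>)) *
        (\<Sum>l\<in>basis_words n. (2 * pi * \<i>) ^ length l / fact (length l) * of_real (monom_at l (Y j x)) * M j l \<kappa>) =
        (\<Sum>z | z \<in> G j \<and> coarsen s z = \<kappa>. cis (2 * pi * (x \<bullet> freq R \<kappa>)) * (c z * exp_trunc n (2 * pi * \<i> * of_real (Y j x \<bullet> U j z))))"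
        by (simp add: sum_distrib_left)
    qed
    have F_eq: "exp_sum (freq (real s * R)) (G j) (a j) x = (\<Sum>\<kappa>\<in>\<Theta> j. \<Sum>z | z \<in> G j \<and> coarsen s z = \<kappa>.
         cis (2 * pi * (x \<bullet> freq R \<kappa>)) * (c z * exp (2 * pi * \<i> * of_real (Y j x \<bullet> U j z))))"
    proof -
      have "exp_sum (freq (real s * R)) (G j) (a j) x =
        (\<Sum>\<kappa>\<in>\<Theta> j. \<Sum>z | z \<in> G j \<and> coarsen s z = \<kappa>. a j z * cis (2 * pi * (x \<bullet> freq (real s * R) z)))"
        unfolding exp_sum_def by (rule sum.group[OF \<Theta>(3) \<Theta>(1) \<Theta>(2), OF j j j, symmetric])
      also have "\<dots> = (\<Sum>\<kappa>\<in>\<Theta> j. \<Sum>z | z \<in> G j \<and> coarsen s z = \<kappa>.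
         cis (2 * pi * (x \<bullet> freq R \<kappa>)) * (c z * exp (2 * pi * \<i> * of_real (Y j x \<bullet> U j z))))"
      proof (intro sum.cong refl)
        fix \<kappa> z assume "z \<in> {z. z \<in> G j \<and> coarsen s z = \<kappa>}"
        then have "x \<bullet> freq (real s * R) z = x \<bullet> freq R \<kappa> + fourier_phase s (k j) (residue s z) + Y j x \<bullet> U j z"
          using inner_freq_split[OF s R, of x z "k j" "\<xi>0 j"] by (simp add: Y_def U_def)
        then have "cis (2 * pi * (x \<bullet> freq (real s * R) z)) = cis (2 * pi * (x \<bullet> freq R \<kappa>)) *
           cis (2 * pi * fourier_phase s (k j) (residue s z)) * cis (2 * pi * (Y j x \<bullet> U j z))"
          by (simp add: cis_mult algebra_simps)
        moreover have "exp (2 * pi * \<i> * of_real (Y j x \<bullet> U j z)) = cis (2 * pi * (Y j x \<bullet> U j z))"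
          by (simp add: cis_conv_exp mult_ac)
        ultimately show "a j z * cis (2 * pi * (x \<bullet> freq (real s * R) z)) =
           cis (2 * pi * (x \<bullet> freq R \<kappa>)) * (c z * exp (2 * pi * \<i> * of_real (Y j x \<bullet> U j z)))"
          by (simp add: c_def)
      qed
      finally show ?thesis .
    qed
    show "(\<lambda>n. Fn n j x) \<longlonglongrightarrow> exp_sum (freq (real s * R)) (G j) (a j) x"
      unfolding Fn_eq F_eq by (intro tendsto_sum tendsto_mult tendsto_const exp_trunc_tendsto)
  qed (simp add: Fn_def)
qed

text \<open>The radius \<open>1 / s + 2 / R\<close> is preserved by coarsening: \<open>1 / s + 2 / (s R) + 1 / R \<le> 1 / s + 2 / R\<close>.\<close>

definition scale_bound :: "'j set \<Rightarrow> real \<Rightarrow> ('j \<Rightarrow> 'b) \<Rightarrow> nat \<Rightarrow> real \<Rightarrow> real \<Rightarrow> bool" where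
  "scale_bound J q \<xi>0 s R A \<longleftrightarrow>
     multilinear_bound J q (freq R) (\<lambda>j. grid (\<xi>0 j) (1 / real s + 2 / R) R) (max_box R) A"

text \<open>The box is cut into cells on which the integer parts of x / R and of all the dual maps
  of x / R are constant. On each cell the estimate at scale R yields a product of factors
  \<open>H j\<close>, the j-th depending only on the j-th integer part. Their sum over the cells is
  a discrete Brascamp-Lieb sum at scale s, which gives s to the power B; Bessel's inequality bounds
  each sum of \<open>H j\<close> by O(s ^ d) times the energy. The constant C precedes s, R and
  A.\<close>

theorem scale_bound_step:
  fixes J :: "'j set" and \<xi>0 :: "'j \<Rightarrow> 'b"
  assumes J: "finite J" and q: "0 < q" "q \<le> 1"
    and rank: "\<And>V. subspace V \<Longrightarrow> real (dim V) - q * (\<Sum>j\<in>J. real (dim (dual_map \<Lambda> (\<xi>0 j) ` V))) \<le> B"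
  shows "\<exists>C>0. \<forall>s R A. s \<ge> 2 \<and> R \<ge> real s \<and> 0 \<le> A \<and> scale_bound J q \<xi>0 s R A \<longrightarrow>
     scale_bound J q \<xi>0 s (real s * R) (C * real s powr (B + q * real DIM('b) * real (card J)) * A)"
proof -
  obtain CL where CL: "CL > 0" "\<And>a b. norm (\<Lambda> a b) \<le> norm a * norm b * CL"
    using bounded_bilinear.pos_bounded[OF bilin] by auto
  define C where "C = 1 + 3 * (real DIM('b))\<^sup>2 * CL"
  have C: "C > 0" unfolding C_def using CL(1) by (simp add: add_pos_nonneg)
  obtain W where W: "W > 0" "\<And>n. (\<Sum>l\<in>(basis_words n :: ('b \<times> 'c) list set). word_weight C l powr 1) \<le> W"
    using sum_word_weight_bounded[OF C, of 1] by auto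
  obtain W' where W': "W' > 0" "\<And>n. (\<Sum>l\<in>(basis_words n :: ('b \<times> 'c) list set). word_weight C l powr (q / 2)) \<le> W'"
    using sum_word_weight_bounded[OF C, of "q / 2"] q by auto
  obtain W2 where W2: "W2 > 0" "\<And>n. (\<Sum>l\<in>(basis_words n :: ('b \<times> 'c) list set). word_weight C l powr (1 / 2)) \<le> W2"
    using sum_word_weight_bounded[OF C, of "1 / 2"] by auto
  let ?N = "real DIM('b \<times> 'c)"
  have N: "?N \<ge> 1" using DIM_positive[where 'a = "'b \<times> 'c"] by linarith
  have "\<forall>j. \<exists>c>0. \<forall>x. norm (dual_map \<Lambda> (\<xi>0 j) x) \<le> c * norm x"
    using linear_bounded_pos[OF linear_dual_map] by (metis mult.commute)
  from choice[OF this] obtain cd where cd: "\<And>j. cd j > 0" "\<And>j x. norm (dual_map \<Lambda> (\<xi>0 j) x) \<le> cd j * norm x"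
    by auto
  \<comment> \<open>Chosen so that the integer parts of the dual maps on the box lie between - m s
    and m s; the summand 2 leaves room for rounding down.\<close>
  define m where "m = nat \<lceil>(\<Sum>j\<in>J. cd j) * ?N\<rceil> + 2"
  have m: "real m \<ge> cd j * ?N + 2" if "j \<in> J" for j
  proof -
    have "cd j \<le> (\<Sum>j\<in>J. cd j)" using J that cd(1) by (intro member_le_sum) (auto simp: less_imp_le)
    then have "cd j * ?N \<le> (\<Sum>j\<in>J. cd j) * ?N" by (intro mult_right_mono) auto
    then show ?thesis unfolding m_def by linarith
  qed
  let ?lab = "\<lambda>x. (fl x, \<lambda>j\<in>J. fl (dual_map \<Lambda> (\<xi>0 j) x))"
  have "\<exists>CB>0. \<forall>s \<Omega> H. 1 \<le> s \<and> finite \<Omega> \<and> (\<forall>x\<in>\<Omega>. norm x \<le> s) \<and>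
      inj_on ?lab \<Omega> \<and> (\<forall>j\<in>J. \<forall>k. 0 \<le> H j k) \<longrightarrow>
      (\<Sum>x\<in>\<Omega>. \<Prod>j\<in>J. H j (fl (dual_map \<Lambda> (\<xi>0 j) x)) powr q)
        \<le> CB * s powr B * (\<Prod>j\<in>J. (\<Sum>k\<in>(\<lambda>x. fl (dual_map \<Lambda> (\<xi>0 j) x)) ` \<Omega>. H j k) powr q)"
    by (rule discrete_Brascamp_Lieb[OF J _ q]) (auto intro: linear_dual_map rank)
  then obtain CB where CB: "CB > 0" "\<forall>s \<Omega> H. 1 \<le> s \<and> finite \<Omega> \<and> (\<forall>x\<in>\<Omega>. norm x \<le> s) \<and>
      inj_on ?lab \<Omega> \<and> (\<forall>j\<in>J. \<forall>k. 0 \<le> H j k) \<longrightarrow>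
      (\<Sum>x\<in>\<Omega>. \<Prod>j\<in>J. H j (fl (dual_map \<Lambda> (\<xi>0 j) x)) powr q)
        \<le> CB * s powr B * (\<Prod>j\<in>J. (\<Sum>k\<in>(\<lambda>x. fl (dual_map \<Lambda> (\<xi>0 j) x)) ` \<Omega>. H j k) powr q)"
    by (elim exE conjE)
  define D where "D = (W powr q * W') ^ card J * CB * ?N powr B * ((W2 * (2 * real m) ^ DIM('b)) powr q) ^ card J"
  have D: "D > 0" unfolding D_def using W W' W2 CB N by (simp add: m_def)
  show ?thesis
  proof (intro exI[of _ D] conjI D allI impI, elim conjE)
    fix s :: nat and R A :: real
    assume s: "s \<ge> 2" and R: "R \<ge> real s" and A: "0 \<le> A" and sb: "scale_bound J q \<xi>0 s R A"
    have s0: "s > 0" and R0: "R > 0" using s R by auto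
    let ?\<Theta> = "\<lambda>j. grid (\<xi>0 j) (1 / real s + 2 / R) R"
    let ?G = "\<lambda>j. grid (\<xi>0 j) (1 / real s + 2 / (real s * R)) (real s * R)"
    have finG: "finite (?G j)" and fin\<Theta>: "finite (?\<Theta> j)" for j using R0 s0 by (auto intro: finite_grid)
    have mb: "multilinear_bound J q (freq R) ?\<Theta> (max_box R) A" using sb by (simp add: scale_bound_def)
    show "scale_bound J q \<xi>0 s (real s * R) (D * real s powr (B + q * real DIM('b) * real (card J)) * A)"
      unfolding scale_bound_def multilinear_bound_def
    proof
      fix a :: "'j \<Rightarrow> ('b \<Rightarrow> int) \<Rightarrow> complex"
      let ?f = "\<lambda>x. \<Prod>j\<in>J. cmod (exp_sum (freq (real s * R)) (?G j) (a j) x) powr (2 * q)"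
      let ?S = "\<lambda>j. \<Sum>z\<in>?G j. (cmod (a j z))\<^sup>2"
      let ?K = "PiE Basis (\<lambda>_. {- int (m * s)..<int (m * s)}) :: ('b \<Rightarrow> int) set"
      let ?X = "max_box (real s * R) :: ('b \<times> 'c) set"
      have finK: "finite ?K" by (intro finite_PiE) auto
      have normX: "norm ((1 / R) *\<^sub>R x) \<le> ?N * real s" if x: "x \<in> ?X" for x
      proof -
        have "norm x \<le> (\<Sum>b\<in>Basis. \<bar>x \<bullet> b\<bar>)" by (rule norm_le_l1)
        also have "\<dots> \<le> (\<Sum>b\<in>(Basis :: ('b \<times> 'c) set). real s * R)"
          using x by (intro sum_mono) (simp add: max_box_def)
        finally show ?thesis using R0 by (simp add: field_simps)
      qed
      define lab where "lab x = (fl ((1 / R) *\<^sub>R x), \<lambda>j\<in>J. fl ((1 / R) *\<^sub>R dual_map \<Lambda> (\<xi>0 j) x))" for x :: "'b \<times> 'c"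
      have dual_scale: "(1 / R) *\<^sub>R dual_map \<Lambda> (\<xi>0 j) x = dual_map \<Lambda> (\<xi>0 j) ((1 / R) *\<^sub>R x)" for j x
        by (rule linear_scale[OF linear_dual_map, symmetric])
      have labK: "fl ((1 / R) *\<^sub>R dual_map \<Lambda> (\<xi>0 j) x) \<in> ?K" if x: "x \<in> ?X" and j: "j \<in> J" for x j
      proof
        fix b :: 'b assume b: "b \<in> Basis"
        let ?y = "(1 / R) *\<^sub>R dual_map \<Lambda> (\<xi>0 j) x"
        have "\<bar>?y \<bullet> b\<bar> \<le> norm ?y" by (rule Basis_le_norm[OF b])
        also have "\<dots> \<le> cd j * norm ((1 / R) *\<^sub>R x)" unfolding dual_scale by (rule cd)
        also have "\<dots> \<le> cd j * (?N * real s)" using normX[OF x] cd(1)[of j] by (intro mult_left_mono) auto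
        also have "\<dots> = cd j * ?N * real s" by simp
        also have "\<dots> \<le> (real m - 2) * real s" using m[OF j] by (intro mult_right_mono) auto
        finally have le: "\<bar>?y \<bullet> b\<bar> \<le> real m * real s - 2 * real s" by (simp add: left_diff_distrib)
        have "1 \<le> real s" using s by simp
        then have "- (real m * real s) \<le> ?y \<bullet> b - 1" "?y \<bullet> b < real m * real s" using le by linarith+
        then have "- int (m * s) \<le> \<lfloor>?y \<bullet> b\<rfloor>" "\<lfloor>?y \<bullet> b\<rfloor> < int (m * s)"
          by (simp_all add: le_floor_iff floor_less_iff)
        then show "fl ?y b \<in> {- int (m * s)..<int (m * s)}" using b by (simp add: fl_def)
      qed (simp add: fl_def)
      have fin_lab: "finite (lab ` ?X)"
      proof -
        have "finite (fl ` {y :: 'b \<times> 'c. norm (y - 0) \<le> ?N * real s})"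
          using card_fl_image_le[of "{y :: 'b \<times> 'c. norm (y - 0) \<le> ?N * real s}" 0 "?N * real s"] by simp
        moreover have "lab ` ?X \<subseteq> fl ` {y :: 'b \<times> 'c. norm (y - 0) \<le> ?N * real s} \<times> PiE J (\<lambda>_. ?K)"
        proof (rule image_subsetI)
          fix x assume x: "x \<in> ?X"
          have "(\<lambda>j\<in>J. fl ((1 / R) *\<^sub>R dual_map \<Lambda> (\<xi>0 j) x)) \<in> PiE J (\<lambda>_. ?K)"
            using labK[OF x] unfolding restrict_PiE_iff by blast
          moreover have "fl ((1 / R) *\<^sub>R x) \<in> fl ` {y :: 'b \<times> 'c. norm (y - 0) \<le> ?N * real s}"
            using normX[OF x] by (intro imageI CollectI) (simp only: diff_zero)
          ultimately show "lab x \<in> fl ` {y :: 'b \<times> 'c. norm (y - 0) \<le> ?N * real s} \<times> PiE J (\<lambda>_. ?K)"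
            unfolding lab_def by (rule SigmaI[rotated])
        qed
        ultimately show ?thesis using finK J by (meson finite_PiE finite_SigmaI finite_subset)
      qed
      define Z where "Z c = {x \<in> ?X. lab x = c}" for c
      have Zborel: "Z c \<in> sets borel" for c
      proof -
        have cont: "continuous_on UNIV (dual_map \<Lambda> (\<xi>0 j))" for j
          by (rule linear_continuous_on) (simp add: linear_dual_map linear_linear)
        show ?thesis
        proof (cases "snd c \<in> extensional J")
          case True
          then have "Z c = ?X \<inter> {x. fl ((1 / R) *\<^sub>R x) = fst c} \<inter> (\<Inter>j\<in>J. {x. fl ((1 / R) *\<^sub>R dual_map \<Lambda> (\<xi>0 j) x) = snd c j})"
            by (cases c) (auto simp: Z_def lab_def fun_eq_iff extensional_def)
          moreover have "?X \<inter> {x. fl ((1 / R) *\<^sub>R x) = fst c} \<inter> (\<Inter>j\<in>J. {x. fl ((1 / R) *\<^sub>R dual_map \<Lambda> (\<xi>0 j) x) = snd c j}) \<in> sets borel"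
            using J by (intro sets.Int max_box_borel sets.countable_INT'' fl_level_borel borel_measurable_continuous_onI
                continuous_intros cont) (auto simp: countable_finite)
          ultimately show ?thesis by simp
        next
          case False
          then have "Z c = {}" by (auto simp: Z_def lab_def)
          then show ?thesis by simp
        qed
      qed
      define Hn where "Hn j n k = (\<Sum>l\<in>basis_words n. sqrt (word_weight C l) *
        (\<Sum>\<kappa>\<in>?\<Theta> j. (cmod (cell_coeff s R (\<xi>0 j) (?G j) (a j) k l \<kappa> / of_real C ^ length l))\<^sup>2))" for j n k
      define Bd where "Bd j = W2 * ((2 * real m * real s) ^ DIM('b) * ?S j)" for j
      have ww: "0 \<le> word_weight C l" for l :: "('b \<times> 'c) list" using C by (simp add: word_weight_nonneg)
      have Hn0: "0 \<le> Hn j n k" for j n k unfolding Hn_def using ww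
        by (intro sum_nonneg mult_nonneg_nonneg) auto
      have sumHn: "(\<Sum>k\<in>?K. Hn j n k) \<le> Bd j" for j n
      proof -
        have "(\<Sum>k\<in>?K. Hn j n k) = (\<Sum>l\<in>basis_words n. sqrt (word_weight C l) * (\<Sum>k\<in>?K.
          (\<Sum>\<kappa>\<in>?\<Theta> j. (cmod (cell_coeff s R (\<xi>0 j) (?G j) (a j) k l \<kappa> / of_real C ^ length l))\<^sup>2)))"
          unfolding Hn_def by (subst sum.swap) (simp add: sum_distrib_left)
        also have "\<dots> \<le> (\<Sum>l\<in>(basis_words n :: ('b \<times> 'c) list set). sqrt (word_weight C l) * ((2 * real m * real s) ^ DIM('b) * ?S j))"
        proof (intro sum_mono mult_left_mono)
          fix l :: "('b \<times> 'c) list" assume l: "l \<in> basis_words n"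
          show "(\<Sum>k\<in>?K. \<Sum>\<kappa>\<in>?\<Theta> j. (cmod (cell_coeff s R (\<xi>0 j) (?G j) (a j) k l \<kappa> / of_real C ^ length l))\<^sup>2)
             \<le> (2 * real m * real s) ^ DIM('b) * ?S j"
          proof (rule sum_cell_coeff_le[OF s0 finG _ fin\<Theta> _ C])
            show "?G j \<subseteq> PiE Basis (\<lambda>_. UNIV)" by (auto simp: grid_def)
            show "coarsen s ` ?G j \<subseteq> ?\<Theta> j" using coarsen_in_grid[OF s R0] by blast
            show "set l \<subseteq> Basis" using l by (auto simp: basis_words_def)
            show "\<bar>slow_freq s R (\<xi>0 j) z \<bullet> b\<bar> \<le> C" if "z \<in> ?G j" "b \<in> Basis" for z b
              unfolding C_def using CL by (intro abs_slow_freq_le[OF _ _ s R that]) auto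
          qed
        qed (use ww in auto)
        also have "\<dots> \<le> W2 * ((2 * real m * real s) ^ DIM('b) * ?S j)"
          unfolding sum_distrib_right[symmetric] using W2(2)[of n] ww
          by (intro mult_right_mono mult_nonneg_nonneg sum_nonneg) (auto simp: powr_half_sqrt)
        finally show ?thesis by (simp add: Bd_def)
      qed
      \<comment> \<open>\<open>cell_bound\<close> asks for a bound valid for all truncations n at
        once, while Bessel's inequality bounds the sum over k for each n separately. As
        \<open>Hn\<close> increases with n, its limit satisfies both.\<close>
      have incHn: "incseq (\<lambda>n. Hn j n k)" for j k
      proof (rule incseq_SucI)
        fix n
        have "basis_words n \<subseteq> (basis_words (Suc n) :: ('b \<times> 'c) list set)" by (auto simp: basis_words_def)
        then show "Hn j n k \<le> Hn j (Suc n) k" unfolding Hn_def using ww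
          by (intro sum_mono2 mult_nonneg_nonneg sum_nonneg finite_basis_words) auto
      qed
      have HnBd: "Hn j n k \<le> Bd j" if "k \<in> ?K" for j n k
        using member_le_sum[OF that, of "Hn j n"] Hn0 finK sumHn[of j n] by (meson order_trans)
      have "\<exists>L. (\<lambda>n. Hn j n k) \<longlonglongrightarrow> L \<and> (\<forall>n. Hn j n k \<le> L)" if k: "k \<in> ?K" for j k
        using incseq_convergent[OF incHn[of j k], of "Bd j"] HnBd[OF k] by metis
      then have "\<forall>j. \<forall>k\<in>?K. \<exists>L. (\<lambda>n. Hn j n k) \<longlonglongrightarrow> L \<and> (\<forall>n. Hn j n k \<le> L)" by blast
      then obtain L where L: "\<And>j k. k \<in> ?K \<Longrightarrow> (\<lambda>n. Hn j n k) \<longlonglongrightarrow> L j k" "\<And>j k n. k \<in> ?K \<Longrightarrow> Hn j n k \<le> L j k"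
        by metis
      \<comment> \<open>The Brascamp-Lieb inequality takes functions of all labels, but the limit is
        provided only on \<open>?K\<close>; elsewhere the value 0 is used.\<close>
      define H where "H j k = (if k \<in> ?K then L j k else 0)" for j k
      have H0: "0 \<le> H j k" for j k unfolding H_def using L(2)[of k j 0] Hn0[of j 0 k] by auto
      have sumH: "(\<Sum>k\<in>?K. H j k) \<le> Bd j" for j
      proof -
        have "(\<lambda>n. \<Sum>k\<in>?K. Hn j n k) \<longlonglongrightarrow> (\<Sum>k\<in>?K. L j k)" by (intro tendsto_sum L)
        then have "(\<Sum>k\<in>?K. L j k) \<le> Bd j" by (rule LIMSEQ_le_const2) (use sumHn in auto)
        then show ?thesis by (simp add: H_def)
      qed
      \<comment> \<open>One point per nonempty cell. Divided by R, these points have distinct joint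
        labels, as the Brascamp-Lieb inequality requires.\<close>
      define rep where "rep c = (SOME x. x \<in> Z c)" for c
      have rep: "rep c \<in> ?X" "lab (rep c) = c" if "c \<in> lab ` ?X" for c
      proof -
        have "\<exists>x. x \<in> Z c" using that by (auto simp: Z_def)
        then have "rep c \<in> Z c" unfolding rep_def by (rule someI_ex)
        then show "rep c \<in> ?X" "lab (rep c) = c" by (auto simp: Z_def)
      qed
      let ?A' = "A * (W powr q * W') ^ card J"
      have cell: "(\<integral>\<^sup>+x. ennreal (?f x) * indicator (Z c) x \<partial>lborel) \<le> ennreal (?A' * (\<Prod>j\<in>J. H j (snd c j) powr q))"
        if c: "c \<in> lab ` ?X" for c
      proof (rule cell_bound[OF C q W(2) W'(2) J A Zborel, where \<Theta> = ?\<Theta> and ?\<xi>0.0 = \<xi>0 and k = "snd c"])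
        \<comment> \<open>R times the integer part of x / R: every point of the cell differs from it
          by at most R in each coordinate, so a translate of the estimate on
          \<open>max_box R\<close> applies.\<close>
        define x0 where "x0 = (\<Sum>b\<in>Basis. (R * of_int (fst c b)) *\<^sub>R b :: 'b \<times> 'c)"
        have "Z c \<subseteq> (+) x0 ` max_box R"
        proof
          fix x assume x: "x \<in> Z c"
          have "x - x0 \<in> max_box R" unfolding max_box_def
          proof (clarify)
            fix b :: "'b \<times> 'c" assume b: "b \<in> Basis"
            have x0b: "x0 \<bullet> b = R * of_int (fst c b)"
              using b by (simp add: x0_def inner_sum_left inner_Basis if_distrib cong: if_cong)
            have "fst c b = \<lfloor>(1 / R) * (x \<bullet> b)\<rfloor>" using x b by (auto simp: Z_def lab_def fl_def)
            then have "of_int (fst c b) \<le> (1 / R) * (x \<bullet> b)" "(1 / R) * (x \<bullet> b) \<le> of_int (fst c b) + 1" by linarith+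
            then have "R * of_int (fst c b) \<le> x \<bullet> b" "x \<bullet> b \<le> R * of_int (fst c b) + R" using R0 by (simp_all add: field_simps)
            then show "\<bar>(x - x0) \<bullet> b\<bar> \<le> R" by (simp add: inner_diff_left x0b)
          qed
          then show "x \<in> (+) x0 ` max_box R" by (auto simp: image_iff intro!: bexI[of _ "x - x0"])
        qed
        then show "multilinear_bound J q (freq R) ?\<Theta> (Z c) A"
          using multilinear_bound_subset[OF multilinear_bound_translate[OF mb max_box_borel]] by blast
        show "fl ((1 / R) *\<^sub>R dual_map \<Lambda> (\<xi>0 j) x) = snd c j" if "x \<in> Z c" "j \<in> J" for x j
          using that by (auto simp: Z_def lab_def)
        fix j n assume j: "j \<in> J"
        have "snd (lab (rep c)) j \<in> ?K" using labK[OF rep(1)[OF c] j] j by (simp only: lab_def snd_conv restrict_apply' if_True)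
        then have "snd c j \<in> ?K" by (simp only: rep(2)[OF c])
        then show "(\<Sum>l\<in>basis_words n. sqrt (word_weight C l) *
          (\<Sum>\<kappa>\<in>?\<Theta> j. (cmod (cell_coeff s R (\<xi>0 j) (?G j) (a j) (snd c j) l \<kappa> / of_real C ^ length l))\<^sup>2)) \<le> H j (snd c j)"
          using L(2)[of "snd c j" j n] by (simp add: H_def Hn_def)
      qed (use s0 R0 fin\<Theta> finG coarsen_in_grid[OF s R0] in \<open>auto simp: Z_def\<close>)
      define \<Omega> where "\<Omega> = (\<lambda>c. (1 / R) *\<^sub>R rep c) ` lab ` ?X"
      have lab_rep: "(fl ((1 / R) *\<^sub>R rep c), \<lambda>j\<in>J. fl (dual_map \<Lambda> (\<xi>0 j) ((1 / R) *\<^sub>R rep c))) = c" if "c \<in> lab ` ?X" for c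
        using rep(2)[OF that] by (simp add: lab_def dual_scale)
      have injrep: "inj_on (\<lambda>c. (1 / R) *\<^sub>R rep c) (lab ` ?X)"
        by (rule inj_onI) (metis lab_rep)
      have BL: "(\<Sum>c\<in>lab ` ?X. \<Prod>j\<in>J. H j (snd c j) powr q) \<le> CB * (?N * real s) powr B * (\<Prod>j\<in>J. Bd j powr q)"
      proof -
        have "snd c j = fl (dual_map \<Lambda> (\<xi>0 j) ((1 / R) *\<^sub>R rep c))" if "c \<in> lab ` ?X" "j \<in> J" for c j
          using arg_cong[OF lab_rep[OF that(1)], of "\<lambda>c. snd c j"] that(2) by simp
        then have "(\<Sum>c\<in>lab ` ?X. \<Prod>j\<in>J. H j (snd c j) powr q) = (\<Sum>x\<in>\<Omega>. \<Prod>j\<in>J. H j (fl (dual_map \<Lambda> (\<xi>0 j) x)) powr q)"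
          unfolding \<Omega>_def sum.reindex[OF injrep] by simp
        also have "\<dots> \<le> CB * (?N * real s) powr B * (\<Prod>j\<in>J. (\<Sum>k\<in>(\<lambda>x. fl (dual_map \<Lambda> (\<xi>0 j) x)) ` \<Omega>. H j k) powr q)"
        proof (rule CB(2)[rule_format], intro conjI)
          show "1 \<le> ?N * real s" using N s0 mult_mono[of 1 ?N 1 "real s"] by simp
          show "finite \<Omega>" unfolding \<Omega>_def using fin_lab by simp
          show "\<forall>x\<in>\<Omega>. norm x \<le> ?N * real s"
          proof
            fix x assume "x \<in> \<Omega>"
            then obtain c where c: "c \<in> lab ` ?X" "x = (1 / R) *\<^sub>R rep c" unfolding \<Omega>_def by blast
            show "norm x \<le> ?N * real s" unfolding c(2) by (rule normX[OF rep(1)[OF c(1)]])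
          qed
          show "inj_on (\<lambda>x. (fl x, \<lambda>j\<in>J. fl (dual_map \<Lambda> (\<xi>0 j) x))) \<Omega>"
          proof (rule inj_onI)
            fix x y assume x: "x \<in> \<Omega>" and y: "y \<in> \<Omega>"
              and eq: "(fl x, \<lambda>j\<in>J. fl (dual_map \<Lambda> (\<xi>0 j) x)) = (fl y, \<lambda>j\<in>J. fl (dual_map \<Lambda> (\<xi>0 j) y))"
            obtain c where c: "c \<in> lab ` ?X" "x = (1 / R) *\<^sub>R rep c" using x unfolding \<Omega>_def by blast
            obtain d where d: "d \<in> lab ` ?X" "y = (1 / R) *\<^sub>R rep d" using y unfolding \<Omega>_def by blast
            have "c = d" using eq unfolding c(2) d(2) lab_rep[OF c(1)] lab_rep[OF d(1)] .
            then show "x = y" using c d by simp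
          qed
        qed (use H0 in auto)
        also have "\<dots> \<le> CB * (?N * real s) powr B * (\<Prod>j\<in>J. Bd j powr q)"
        proof (intro mult_left_mono prod_mono conjI powr_mono2)
          fix j assume j: "j \<in> J"
          have "(\<lambda>x. fl (dual_map \<Lambda> (\<xi>0 j) x)) ` \<Omega> \<subseteq> ?K"
          proof (rule image_subsetI)
            fix x assume "x \<in> \<Omega>"
            then obtain c where c: "c \<in> lab ` ?X" "x = (1 / R) *\<^sub>R rep c" unfolding \<Omega>_def by blast
            show "fl (dual_map \<Lambda> (\<xi>0 j) x) \<in> ?K"
              using labK[OF rep(1)[OF c(1)] j] unfolding dual_scale c(2) .
          qed
          then have "(\<Sum>k\<in>(\<lambda>x. fl (dual_map \<Lambda> (\<xi>0 j) x)) ` \<Omega>. H j k) \<le> (\<Sum>k\<in>?K. H j k)"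
            using finK H0 by (intro sum_mono2) auto
          then show "(\<Sum>k\<in>(\<lambda>x. fl (dual_map \<Lambda> (\<xi>0 j) x)) ` \<Omega>. H j k) \<le> Bd j" using sumH[of j] by linarith
        qed (use q H0 CB in \<open>auto intro!: sum_nonneg\<close>)
        finally show ?thesis .
      qed
      have "(\<integral>\<^sup>+x. ennreal (?f x) * indicator ?X x \<partial>lborel) \<le> (\<integral>\<^sup>+x. (\<Sum>c\<in>lab ` ?X. ennreal (?f x) * indicator (Z c) x) \<partial>lborel)"
      proof (rule nn_integral_mono)
        fix x
        show "ennreal (?f x) * indicator ?X x \<le> (\<Sum>c\<in>lab ` ?X. ennreal (?f x) * indicator (Z c) x)"
        proof (cases "x \<in> ?X")
          case True
          then have "ennreal (?f x) * indicator ?X x = ennreal (?f x) * indicator (Z (lab x)) x" by (simp add: Z_def)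
          also have "\<dots> \<le> (\<Sum>c\<in>lab ` ?X. ennreal (?f x) * indicator (Z c) x)"
            using True fin_lab by (intro member_le_sum) auto
          finally show ?thesis .
        qed simp
      qed
      also have "\<dots> = (\<Sum>c\<in>lab ` ?X. \<integral>\<^sup>+x. ennreal (?f x) * indicator (Z c) x \<partial>lborel)"
        using Zborel by (intro nn_integral_sum) auto
      also have "\<dots> \<le> (\<Sum>c\<in>lab ` ?X. ennreal (?A' * (\<Prod>j\<in>J. H j (snd c j) powr q)))"
        by (intro sum_mono cell)
      also have "\<dots> = ennreal (?A' * (\<Sum>c\<in>lab ` ?X. \<Prod>j\<in>J. H j (snd c j) powr q))"
        unfolding sum_distrib_left using A W W'
        by (intro sum_ennreal mult_nonneg_nonneg prod_nonneg) (auto simp: less_imp_le)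
      also have "\<dots> \<le> ennreal (?A' * (CB * (?N * real s) powr B * (\<Prod>j\<in>J. Bd j powr q)))"
        using A W W' by (intro ennreal_leI mult_left_mono BL) (auto simp: less_imp_le)
      also have "?A' * (CB * (?N * real s) powr B * (\<Prod>j\<in>J. Bd j powr q)) =
         D * real s powr (B + q * real DIM('b) * real (card J)) * A * (\<Prod>j\<in>J. ?S j powr q)"
      proof -
        \<comment> \<open>The factor s ^ d of Bessel's inequality, raised to the power q for each j,
          is the source of the exponent q d card J.\<close>
        have "Bd j powr q = (W2 * (2 * real m) ^ DIM('b)) powr q * real s powr (q * real DIM('b)) * ?S j powr q" for j
        proof -
          have "Bd j = (W2 * (2 * real m) ^ DIM('b)) * real s powr real DIM('b) * ?S j"
            using s0 by (simp add: Bd_def power_mult_distrib powr_realpow)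
          then show ?thesis by (simp add: powr_mult powr_powr mult.commute[of q])
        qed
        then have "(\<Prod>j\<in>J. Bd j powr q) = ((W2 * (2 * real m) ^ DIM('b)) powr q) ^ card J *
            (real s powr (q * real DIM('b))) ^ card J * (\<Prod>j\<in>J. ?S j powr q)"
          by (simp only: prod.distrib prod_constant)
        also have "(real s powr (q * real DIM('b))) ^ card J = real s powr (q * real DIM('b) * real (card J))"
          using s0 by (simp add: powr_powr flip: powr_realpow)
        finally show ?thesis by (simp only: D_def powr_add powr_mult mult_ac)
      qed
      finally show "(\<integral>\<^sup>+x. ennreal (?f x) * indicator ?X x \<partial>lborel)
        \<le> ennreal (D * real s powr (B + q * real DIM('b) * real (card J)) * A * (\<Prod>j\<in>J. ?S j powr q))" .
    qed
  qed
qed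

end

section \<open>Extension operators on compact sets\<close>


text \<open>Integrability on a set of finite measure follows from t \<le> 1 + t ^ 2; the second
  claim is Cauchy-Schwarz for nonnegative integrals, brought back to real numbers.\<close>

lemma integral_Cauchy_Schwarz_indicator:
  fixes f :: "'a \<Rightarrow> complex"
  assumes f: "f \<in> borel_measurable M" and f2: "integrable M (\<lambda>x. (cmod (f x))\<^sup>2)"
    and A: "A \<in> sets M" "emeasure M A < \<infinity>"
  shows "integrable M (\<lambda>x. indicator A x *\<^sub>R f x)"
    and "(\<integral>x. indicator A x * cmod (f x) \<partial>M)\<^sup>2 \<le> measure M A * (\<integral>x. indicator A x * (cmod (f x))\<^sup>2 \<partial>M)"
proof -
  have iA: "integrable M (indicator A :: 'a \<Rightarrow> real)" using A by simp
  have i2: "integrable M (\<lambda>x. indicator A x * (cmod (f x))\<^sup>2)"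
    using integrable_real_mult_indicator[OF A(1) f2] by (simp add: mult.commute)
  show int: "integrable M (\<lambda>x. indicator A x *\<^sub>R f x)"
  proof (rule Bochner_Integration.integrable_bound[OF Bochner_Integration.integrable_add[OF iA f2]])
    show "(\<lambda>x. indicator A x *\<^sub>R f x) \<in> borel_measurable M" using f A by measurable
    have "t \<le> 1 + t\<^sup>2" if "0 \<le> t" for t :: real
      using sum_squares_bound[of t 1] that by (simp add: power2_eq_square)
    then show "AE x in M. norm (indicator A x *\<^sub>R f x) \<le> norm (indicator A x + (cmod (f x))\<^sup>2)"
      by (auto simp: indicator_def)
  qed
  have i1: "integrable M (\<lambda>x. indicator A x * cmod (f x))"
    using integrable_norm[OF int] by (rule Bochner_Integration.integrable_cong[THEN iffD1, rotated 2]) (auto simp: indicator_def)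
  let ?u = "\<lambda>x. ennreal (indicator A x * cmod (f x))"
  have "(\<integral>\<^sup>+x. ?u x * ennreal (indicator A x) \<partial>M)\<^sup>2 \<le> (\<integral>\<^sup>+x. ?u x ^ 2 \<partial>M) * (\<integral>\<^sup>+x. ennreal (indicator A x) ^ 2 \<partial>M)"
    using borel_measurable_integrable[OF i1] borel_measurable_integrable[OF iA]
    by (intro Cauchy_Schwarz_nn_integral measurable_compose[OF _ measurable_ennreal])
  also have "(\<integral>\<^sup>+x. ?u x * ennreal (indicator A x) \<partial>M) = (\<integral>\<^sup>+x. ?u x \<partial>M)"
    by (intro nn_integral_cong) (auto simp: indicator_def)
  also have "\<dots> = ennreal (\<integral>x. indicator A x * cmod (f x) \<partial>M)"
    by (rule nn_integral_eq_integral[OF i1]) auto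
  also have "(\<integral>\<^sup>+x. ?u x ^ 2 \<partial>M) = (\<integral>\<^sup>+x. ennreal (indicator A x * (cmod (f x))\<^sup>2) \<partial>M)"
    by (intro nn_integral_cong) (auto simp: indicator_def ennreal_power)
  also have "\<dots> = ennreal (\<integral>x. indicator A x * (cmod (f x))\<^sup>2 \<partial>M)"
    by (rule nn_integral_eq_integral[OF i2]) auto
  also have "(\<integral>\<^sup>+x. ennreal (indicator A x) ^ 2 \<partial>M) = (\<integral>\<^sup>+x. indicator A x \<partial>M)"
    by (intro nn_integral_cong) (auto simp: indicator_def)
  also have "\<dots> = ennreal (measure M A)" using A by (simp add: emeasure_eq_ennreal_measure less_top)
  finally have "ennreal ((\<integral>x. indicator A x * cmod (f x) \<partial>M)\<^sup>2) \<le> ennreal (measure M A * (\<integral>x. indicator A x * (cmod (f x))\<^sup>2 \<partial>M))"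
    by (simp add: ennreal_power ennreal_mult[symmetric] mult.commute)
  then show "(\<integral>x. indicator A x * cmod (f x) \<partial>M)\<^sup>2 \<le> measure M A * (\<integral>x. indicator A x * (cmod (f x))\<^sup>2 \<partial>M)"
    by (subst (asm) ennreal_le_iff) auto
qed

lemma norm_exp_trunc_le: "norm (exp_trunc n z) \<le> exp (norm z)"
proof -
  have "norm (exp_trunc n z) \<le> (\<Sum>k<n. norm z ^ k / fact k)"
    unfolding exp_trunc_def by (rule order_trans[OF norm_sum]) (simp add: norm_divide norm_power)
  also have "\<dots> \<le> exp (norm z)"
    unfolding exp_def using summable_exp[of "norm z"]
    by (simp add: divide_inverse mult.commute) (intro sum_le_suminf, auto)
  finally show ?thesis .
qed

definition energy :: "('b::euclidean_space \<Rightarrow> complex) \<Rightarrow> real" where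
  "energy f = (\<integral>\<xi>. (cmod (f \<xi>))\<^sup>2 \<partial>lebesgue)"

lemma energy_nonneg: "0 \<le> energy f"
  unfolding energy_def by (rule Bochner_Integration.integral_nonneg) simp

definition square_integrable :: "('b::euclidean_space \<Rightarrow> complex) \<Rightarrow> bool" where
  "square_integrable f \<longleftrightarrow> f \<in> borel_measurable lebesgue \<and> integrable lebesgue (\<lambda>\<xi>. (cmod (f \<xi>))\<^sup>2)"

section \<open>The extension operator and its discretisation\<close>

context quadratic_graph
begin

lemma continuous_Q: "continuous_on S Q"
proof -
  have eq: "Q = (\<lambda>\<xi>. Q 0 + \<Lambda> ((1/2) *\<^sub>R \<xi>) \<xi>)"
  proof
    fix \<xi> show "Q \<xi> = Q 0 + \<Lambda> ((1/2) *\<^sub>R \<xi>) \<xi>" using Q_diff[of \<xi> 0] by (simp add: algebra_simps)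
  qed
  have "continuous_on S (\<lambda>\<xi>. Q 0 + \<Lambda> ((1/2) *\<^sub>R \<xi>) \<xi>)"
    by (intro continuous_intros bounded_bilinear.continuous_on[OF bilin])
  then show ?thesis by (subst eq)
qed

definition wave :: "'b \<times> 'c \<Rightarrow> 'b \<Rightarrow> complex" where
  "wave x \<xi> = cis (2 * pi * (x \<bullet> (\<xi>, Q \<xi>)))"

lemma wave_measurable: "wave x \<in> borel_measurable lebesgue"
proof -
  have "continuous_on UNIV (wave x)"
    unfolding wave_def[abs_def] cis_conv_exp by (intro continuous_intros continuous_Q)
  then show ?thesis by (simp add: borel_measurable_continuous_onI measurable_completion)
qed

lemma norm_wave [simp]: "norm (wave x \<xi>) = 1"
  by (simp add: wave_def)

definition ext :: "('b \<Rightarrow> complex) \<Rightarrow> 'b \<times> 'c \<Rightarrow> complex" where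
  "ext f x = (\<integral>\<xi>. f \<xi> * wave x \<xi> \<partial>lebesgue)"

lemma integrable_mult_wave:
  assumes "integrable lebesgue f"
  shows "integrable lebesgue (\<lambda>\<xi>. f \<xi> * wave x \<xi>)"
  by (rule Bochner_Integration.integrable_bound[OF assms])
     (use assms wave_measurable in \<open>auto simp: norm_mult\<close>)

lemma continuous_ext:
  assumes f: "integrable lebesgue f"
  shows "continuous_on UNIV (ext f)"
proof (rule continuous_at_imp_continuous_on, rule ballI)
  fix a
  show "isCont (ext f) a"
  proof (unfold continuous_at_sequentially, intro allI impI)
    fix u assume u: "u \<longlonglongrightarrow> a"
    have "(\<lambda>n. \<integral>\<xi>. f \<xi> * wave (u n) \<xi> \<partial>lebesgue) \<longlonglongrightarrow> (\<integral>\<xi>. f \<xi> * wave a \<xi> \<partial>lebesgue)"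
    proof (rule integral_dominated_convergence[where w = "\<lambda>\<xi>. cmod (f \<xi>)"])
      show "integrable lebesgue (\<lambda>\<xi>. cmod (f \<xi>))" using f by simp
      show "AE \<xi> in lebesgue. (\<lambda>n. f \<xi> * wave (u n) \<xi>) \<longlonglongrightarrow> f \<xi> * wave a \<xi>"
        unfolding wave_def cis_conv_exp by (intro AE_I2 tendsto_intros u)
    qed (use f wave_measurable in \<open>auto simp: norm_mult\<close>)
    then show "(ext f \<circ> u) \<longlonglongrightarrow> ext f a" by (simp add: ext_def o_def)
  qed
qed

lemma ext_measurable [measurable]:
  assumes "integrable lebesgue f"
  shows "ext f \<in> borel_measurable borel"
  by (rule borel_measurable_continuous_onI[OF continuous_ext[OF assms]])

text \<open>A fibre of rounding, hence half-open: the cells of one scale are disjoint and cover the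
  space, so a function is exactly the sum of its restrictions.\<close>

definition cell :: "real \<Rightarrow> ('b \<Rightarrow> int) \<Rightarrow> 'b set" where
  "cell R z = {\<xi>. fl (R *\<^sub>R \<xi>) = z}"

lemma cell_lebesgue: "cell R z \<in> sets lebesgue"
proof -
  have "cell R z \<in> sets borel" unfolding cell_def
    by (intro fl_level_borel borel_measurable_continuous_onI continuous_intros)
  then show ?thesis by simp
qed

lemma cell_coord:
  assumes "\<xi> \<in> cell R z" "R > 0" "b \<in> Basis"
  shows "of_int (z b) / R \<le> \<xi> \<bullet> b" "\<xi> \<bullet> b \<le> of_int (z b) / R + 1 / R"
proof -
  have "z b = \<lfloor>R * (\<xi> \<bullet> b)\<rfloor>" using assms by (auto simp: cell_def fl_def)
  then have "of_int (z b) \<le> R * (\<xi> \<bullet> b)" "R * (\<xi> \<bullet> b) \<le> of_int (z b) + 1" by linarith+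
  then show "of_int (z b) / R \<le> \<xi> \<bullet> b" "\<xi> \<bullet> b \<le> of_int (z b) / R + 1 / R"
    using assms(2) by (simp_all add: field_simps)
qed

lemma emeasure_cell_le:
  assumes R: "R > 0"
  shows "emeasure lebesgue (cell R z) \<le> ennreal ((1 / R) ^ DIM('b))"
proof -
  let ?c = "cbox (pt R z) (pt R z + (1 / R) *\<^sub>R One)"
  have "cell R z \<subseteq> ?c" using cell_coord[OF _ R] by (auto simp: mem_box inner_add_left)
  then have "emeasure lebesgue (cell R z) \<le> emeasure lebesgue ?c" by (intro emeasure_mono) auto
  also have "\<dots> = emeasure lborel ?c" by simp
  also have "\<dots> = ennreal (measure lborel ?c)"
    by (rule emeasure_eq_ennreal_measure) (use emeasure_lborel_cbox_finite[of "pt R z" "pt R z + (1 / R) *\<^sub>R One"] in \<open>metis infinity_ennreal_def less_irrefl\<close>)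
  also have "measure lborel ?c = (1 / R) ^ DIM('b)"
  proof -
    have eq: "(pt R z + (1 / R) *\<^sub>R One) \<bullet> b = of_int (z b) / R + 1 / R" if "b \<in> Basis" for b
      using that by (simp add: inner_add_left)
    have "\<forall>b\<in>Basis. pt R z \<bullet> b \<le> (pt R z + (1 / R) *\<^sub>R One) \<bullet> b" using R by (simp add: eq)
    then have "measure lborel ?c = (\<Prod>b\<in>Basis. (pt R z + (1 / R) *\<^sub>R One) \<bullet> b - pt R z \<bullet> b)" by (rule content_cbox)
    also have "\<dots> = (\<Prod>b\<in>(Basis :: 'b set). 1 / R)" by (intro prod.cong refl) (simp only: eq pt_inner add_diff_cancel_left')
    finally show ?thesis by (simp only: prod_constant)
  qed
  finally show ?thesis .
qed

text \<open>For x in the box of radius R the phase varies by O(1) over a frequency cell of side 1 /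
  R. So the extension is again a superposition of exponential sums over the grid, with moments of f
  on the cells as coefficients. Cauchy-Schwarz on a cell gains its volume R ^ (-d), which becomes
  the power of R in the conclusion.\<close>

lemma ext_scale_bound:
  fixes J :: "'j set" and \<xi>0 :: "'j \<Rightarrow> 'b"
  assumes J: "finite J" and q: "0 < q" "q \<le> 1" and s: "s > 0"
  shows "\<exists>K>0. \<forall>R A f. R \<ge> 1 \<and> 0 \<le> A \<and> scale_bound J q \<xi>0 s R A \<and>
     (\<forall>j\<in>J. square_integrable (f j) \<and> (\<forall>\<xi>. f j \<xi> \<noteq> 0 \<longrightarrow> (\<forall>b\<in>Basis. \<bar>\<xi> \<bullet> b - \<xi>0 j \<bullet> b\<bar> \<le> 1 / real s))) \<longrightarrow>
     (\<integral>\<^sup>+x. ennreal (\<Prod>j\<in>J. cmod (ext (f j) x) powr (2 * q)) * indicator (max_box R) x \<partial>lborel)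
       \<le> ennreal (K * A * R powr (- (q * real DIM('b) * real (card J))) * (\<Prod>j\<in>J. energy (f j) powr q))"
proof -
  obtain CL where CL: "CL > 0" "\<And>a b. norm (\<Lambda> a b) \<le> norm a * norm b * CL"
    using bounded_bilinear.pos_bounded[OF bilin] by auto
  \<comment> \<open>\<open>S0\<close> bounds the midpoint of \<xi> and its grid point, each
    coordinate of which is within 3 of that of some \<xi>0 j; C then bounds the coordinates of the
    rescaled differences \<open>U\<close>.\<close>
  define S0 where "S0 = (\<Sum>j\<in>J. norm (\<xi>0 j)) + real DIM('b) * 3"
  define C where "C = 1 + S0 * real DIM('b) * CL"
  have S0: "0 \<le> S0" unfolding S0_def by (intro add_nonneg_nonneg sum_nonneg) auto
  have C: "C > 0" unfolding C_def using S0 CL by (simp add: add_pos_nonneg)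
  obtain W where W: "W > 0" "\<And>n. (\<Sum>l\<in>(basis_words n :: ('b \<times> 'c) list set). word_weight C l powr 1) \<le> W"
    using sum_word_weight_bounded[OF C, of 1] by auto
  obtain W' where W': "W' > 0" "\<And>n. (\<Sum>l\<in>(basis_words n :: ('b \<times> 'c) list set). word_weight C l powr (q / 2)) \<le> W'"
    using sum_word_weight_bounded[OF C, of "q / 2"] q by auto
  obtain W2 where W2: "W2 > 0" "\<And>n. (\<Sum>l\<in>(basis_words n :: ('b \<times> 'c) list set). word_weight C l powr (1 / 2)) \<le> W2"
    using sum_word_weight_bounded[OF C, of "1 / 2"] by auto
  have ww: "0 \<le> word_weight C l" for l :: "('b \<times> 'c) list" using C by (simp add: word_weight_nonneg)
  let ?K = "(W powr q * W') ^ card J * (W2 powr q) ^ card J"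
  show ?thesis
  proof (intro exI[of _ ?K] conjI allI impI)
    show "0 < ?K" using W W' W2 by simp
  next
    fix R A and f :: "'j \<Rightarrow> 'b \<Rightarrow> complex"
    assume a: "R \<ge> 1 \<and> 0 \<le> A \<and> scale_bound J q \<xi>0 s R A \<and>
     (\<forall>j\<in>J. square_integrable (f j) \<and> (\<forall>\<xi>. f j \<xi> \<noteq> 0 \<longrightarrow> (\<forall>b\<in>Basis. \<bar>\<xi> \<bullet> b - \<xi>0 j \<bullet> b\<bar> \<le> 1 / real s)))"
    then have R: "R \<ge> 1" and A: "0 \<le> A" and sb: "scale_bound J q \<xi>0 s R A"
      and f: "\<And>j. j \<in> J \<Longrightarrow> square_integrable (f j)"
      and supp: "\<And>j \<xi> b. j \<in> J \<Longrightarrow> f j \<xi> \<noteq> 0 \<Longrightarrow> b \<in> Basis \<Longrightarrow> \<bar>\<xi> \<bullet> b - \<xi>0 j \<bullet> b\<bar> \<le> 1 / real s" by auto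
    have R0: "R > 0" using R by simp
    let ?\<Theta> = "\<lambda>j. grid (\<xi>0 j) (1 / real s + 2 / R) R"
    have fin\<Theta>: "finite (?\<Theta> j)" for j using R0 by (rule finite_grid)
    have mb: "multilinear_bound J q (freq R) ?\<Theta> (max_box R) A" using sb by (simp add: scale_bound_def)
    define U where "U z \<xi> = R *\<^sub>R ((\<xi>, Q \<xi>) - freq R z)" for z \<xi>
    have cell_grid: "z \<in> ?\<Theta> j" if "j \<in> J" "f j \<xi> \<noteq> 0" "\<xi> \<in> cell R z" for j \<xi> z
    proof -
      have "\<bar>of_int (z b) / R - \<xi>0 j \<bullet> b\<bar> \<le> 1 / real s + 2 / R" if b: "b \<in> Basis" for b
      proof -
        have "\<bar>B - X\<bar> \<le> u + 2 * v" if "\<bar>A - X\<bar> \<le> u" "B \<le> A" "A \<le> B + v" for A B X u v :: real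
          using that by linarith
        from this[OF supp[OF \<open>j \<in> J\<close> \<open>f j \<xi> \<noteq> 0\<close> b] cell_coord[OF \<open>\<xi> \<in> cell R z\<close> R0 b]]
        show ?thesis by simp
      qed
      then show ?thesis using \<open>\<xi> \<in> cell R z\<close> by (auto simp: grid_def cell_def fl_def)
    qed
    have U_le: "\<bar>U z \<xi> \<bullet> b\<bar> \<le> C" if j: "j \<in> J" and nz: "f j \<xi> \<noteq> 0" and cl: "\<xi> \<in> cell R z" and b: "b \<in> Basis" for j \<xi> z b
    proof -
      define \<kappa> where "\<kappa> = pt R z"
      have d1: "\<bar>(\<xi> - \<kappa>) \<bullet> c\<bar> \<le> 1 / R" if "c \<in> Basis" for c
        using cell_coord[OF cl R0 that] that by (simp add: \<kappa>_def inner_diff_left)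
      have "(\<Sum>c\<in>Basis. \<bar>(\<xi> - \<kappa>) \<bullet> c\<bar>) \<le> (\<Sum>c\<in>(Basis::'b set). 1 / R)" using d1 by (rule sum_mono)
      then have n1: "norm (\<xi> - \<kappa>) \<le> real DIM('b) / R" using norm_le_l1[of "\<xi> - \<kappa>"] by simp
      have n2: "norm ((1/2) *\<^sub>R (\<xi> + \<kappa>)) \<le> S0"
      proof -
        have "\<bar>((1/2) *\<^sub>R (\<xi> + \<kappa>) - \<xi>0 j) \<bullet> c\<bar> \<le> 3" if c: "c \<in> Basis" for c
        proof -
          have 1: "\<bar>\<kappa> \<bullet> c - \<xi>0 j \<bullet> c\<bar> \<le> 1 / real s + 2 / R"
            using cell_grid[OF j nz cl] c by (simp add: grid_def \<kappa>_def)
          have 2: "1 / real s \<le> 1" "2 / R \<le> 2" using s R by (simp_all add: field_simps)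
          have "((1/2) *\<^sub>R (\<xi> + \<kappa>) - \<xi>0 j) \<bullet> c = (1/2) * (\<xi> \<bullet> c - \<xi>0 j \<bullet> c) + (1/2) * (\<kappa> \<bullet> c - \<xi>0 j \<bullet> c)"
            by (simp add: inner_diff_left inner_add_left field_simps)
          moreover have "\<bar>(1/2) * A + (1/2) * B\<bar> \<le> 3" if "\<bar>B\<bar> \<le> u + v" "u \<le> 1" "v \<le> 2" "\<bar>A\<bar> \<le> u"
            for A B u v :: real using that by linarith
          note this[OF 1 2 supp[OF j nz c]]
          ultimately show ?thesis by simp
        qed
        then have "(\<Sum>c\<in>Basis. \<bar>((1/2) *\<^sub>R (\<xi> + \<kappa>) - \<xi>0 j) \<bullet> c\<bar>) \<le> (\<Sum>c\<in>(Basis::'b set). 3)" by (rule sum_mono)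
        then have "norm ((1/2) *\<^sub>R (\<xi> + \<kappa>) - \<xi>0 j) \<le> real DIM('b) * 3"
          using norm_le_l1[of "(1/2) *\<^sub>R (\<xi> + \<kappa>) - \<xi>0 j"] by simp
        moreover have "norm (\<xi>0 j) \<le> (\<Sum>j\<in>J. norm (\<xi>0 j))" using J j by (intro member_le_sum) auto
        moreover have "norm ((1/2) *\<^sub>R (\<xi> + \<kappa>)) \<le> norm ((1/2) *\<^sub>R (\<xi> + \<kappa>) - \<xi>0 j) + norm (\<xi>0 j)"
          using norm_triangle_ineq[of "(1/2) *\<^sub>R (\<xi> + \<kappa>) - \<xi>0 j" "\<xi>0 j"] by simp
        ultimately show ?thesis by (simp add: S0_def)
      qed
      from b consider c where "c \<in> Basis" "b = (c, 0)" | c where "c \<in> Basis" "b = (0, c)"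
        by (auto simp: Basis_prod_def)
      then show ?thesis
      proof cases
        case 1
        have "\<bar>R * ((\<xi> - \<kappa>) \<bullet> c)\<bar> \<le> R * (1 / R)"
          unfolding abs_mult using R0 d1[OF 1(1)] by (intro mult_mono) auto
        then have "\<bar>U z \<xi> \<bullet> b\<bar> \<le> 1" using 1 R0 by (simp add: U_def freq_def \<kappa>_def)
        then show ?thesis using S0 CL by (simp add: C_def add_increasing2)
      next
        case 2
        have "\<bar>U z \<xi> \<bullet> b\<bar> = R * \<bar>\<Lambda> ((1/2) *\<^sub>R (\<xi> + \<kappa>)) (\<xi> - \<kappa>) \<bullet> c\<bar>"
          using 2 R0 by (simp add: U_def freq_def \<kappa>_def abs_mult Q_diff)
        also have "\<bar>\<Lambda> ((1/2) *\<^sub>R (\<xi> + \<kappa>)) (\<xi> - \<kappa>) \<bullet> c\<bar> \<le> norm (\<Lambda> ((1/2) *\<^sub>R (\<xi> + \<kappa>)) (\<xi> - \<kappa>))"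
          using 2 by (intro Basis_le_norm)
        also have "\<dots> \<le> norm ((1/2) *\<^sub>R (\<xi> + \<kappa>)) * norm (\<xi> - \<kappa>) * CL" by (rule CL)
        also have "\<dots> \<le> S0 * (real DIM('b) / R) * CL"
          using n1 n2 CL(1) R0 S0 by (intro mult_mono) auto
        finally have "\<bar>U z \<xi> \<bullet> b\<bar> \<le> R * (S0 * (real DIM('b) / R) * CL)" using R0 by (simp add: mult_left_mono)
        then show ?thesis using R0 by (simp add: C_def)
      qed
    qed
    let ?F = "\<lambda>j z \<xi>. indicator (cell R z) \<xi> *\<^sub>R f j \<xi>"
    have fincell: "emeasure lebesgue (cell R z) < \<infinity>" for z
      using emeasure_cell_le[OF R0, of z] by (rule order.strict_trans1) (simp add: less_top[symmetric])
    have mcell: "measure lebesgue (cell R z) \<le> (1 / R) ^ DIM('b)" for z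
      using emeasure_cell_le[OF R0, of z] fincell[of z] R0 by (simp add: emeasure_eq_ennreal_measure less_top)
    have CS: "integrable lebesgue (?F j z)"
      "(\<integral>\<xi>. indicator (cell R z) \<xi> * cmod (f j \<xi>) \<partial>lebesgue)\<^sup>2 \<le> measure lebesgue (cell R z) * (\<integral>\<xi>. indicator (cell R z) \<xi> * (cmod (f j \<xi>))\<^sup>2 \<partial>lebesgue)"
      if "j \<in> J" for j z
      using integral_Cauchy_Schwarz_indicator[OF _ _ cell_lebesgue fincell, of "f j" z] f[OF that]
      by (auto simp: square_integrable_def)
    define M where "M j l z = (\<integral>\<xi>. ?F j z \<xi> * of_real (monom_at l (U z \<xi>)) \<partial>lebesgue)" for j l z
    have Umeas: "(\<lambda>\<xi>. monom_at l (U z \<xi>)) \<in> borel_measurable lebesgue" for l z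
    proof -
      have "continuous_on UNIV (\<lambda>\<xi>. monom_at l (U z \<xi>))"
        unfolding U_def by (intro continuous_monom_at continuous_intros continuous_Q)
      then show ?thesis by (simp add: borel_measurable_continuous_onI measurable_completion)
    qed
    have bndM: "norm (?F j z \<xi> * of_real (monom_at l (U z \<xi>))) \<le> C ^ length l * (indicator (cell R z) \<xi> * cmod (f j \<xi>))"
      if j: "j \<in> J" and l: "set l \<subseteq> Basis" for j z l \<xi>
    proof (cases "\<xi> \<in> cell R z \<and> f j \<xi> \<noteq> 0")
      case True
      then have "\<bar>monom_at l (U z \<xi>)\<bar> \<le> C ^ length l"
        using U_le[OF j, of \<xi> z] C l by (intro abs_monom_at_le) auto
      then have "cmod (f j \<xi>) * \<bar>monom_at l (U z \<xi>)\<bar> \<le> cmod (f j \<xi>) * C ^ length l"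
        by (intro mult_left_mono) auto
      then show ?thesis using True by (simp add: norm_mult mult.commute)
    qed auto
    have intn: "integrable lebesgue (\<lambda>\<xi>. indicator (cell R z) \<xi> * cmod (f j \<xi>))" if "j \<in> J" for j z
      using integrable_norm[OF CS(1)[OF that, of z]]
      by (rule Bochner_Integration.integrable_cong[THEN iffD1, rotated 2]) (auto simp: indicator_def)
    have intM: "integrable lebesgue (\<lambda>\<xi>. ?F j z \<xi> * of_real (monom_at l (U z \<xi>)))"
      if j: "j \<in> J" and l: "set l \<subseteq> Basis" for j z l
    proof (rule Bochner_Integration.integrable_bound)
      show "integrable lebesgue (\<lambda>\<xi>. C ^ length l * (indicator (cell R z) \<xi> * cmod (f j \<xi>)))"
        using intn[OF j] by simp
      show "(\<lambda>\<xi>. ?F j z \<xi> * of_real (monom_at l (U z \<xi>))) \<in> borel_measurable lebesgue"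
        using CS(1)[OF j, of z] Umeas by (intro borel_measurable_times borel_measurable_of_real) auto
      show "AE \<xi> in lebesgue. norm (?F j z \<xi> * of_real (monom_at l (U z \<xi>))) \<le> norm (C ^ length l * (indicator (cell R z) \<xi> * cmod (f j \<xi>)))"
        using bndM[OF j l] C by (intro AE_I2) (simp add: abs_mult)
    qed
    have M_le: "(cmod (M j l z / of_real C ^ length l))\<^sup>2 \<le> (1 / R) ^ DIM('b) * (\<integral>\<xi>. indicator (cell R z) \<xi> * (cmod (f j \<xi>))\<^sup>2 \<partial>lebesgue)"
      if j: "j \<in> J" and l: "set l \<subseteq> Basis" for j l z
    proof -
      have "cmod (M j l z) \<le> (\<integral>\<xi>. norm (?F j z \<xi> * of_real (monom_at l (U z \<xi>))) \<partial>lebesgue)"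
        unfolding M_def by (rule integral_norm_bound)
      also have "\<dots> \<le> (\<integral>\<xi>. C ^ length l * (indicator (cell R z) \<xi> * cmod (f j \<xi>)) \<partial>lebesgue)"
        by (rule integral_mono[OF integrable_norm[OF intM[OF j l]] _ bndM[OF j l]]) (use intn[OF j] in simp)
      finally have "cmod (M j l z / of_real C ^ length l) \<le> (\<integral>\<xi>. indicator (cell R z) \<xi> * cmod (f j \<xi>) \<partial>lebesgue)"
        using C by (simp add: norm_divide norm_power field_simps)
      then have "(cmod (M j l z / of_real C ^ length l))\<^sup>2 \<le> (\<integral>\<xi>. indicator (cell R z) \<xi> * cmod (f j \<xi>) \<partial>lebesgue)\<^sup>2"
        by (intro power_mono) auto
      also note CS(2)[OF j, of z]
      also have "measure lebesgue (cell R z) * (\<integral>\<xi>. indicator (cell R z) \<xi> * (cmod (f j \<xi>))\<^sup>2 \<partial>lebesgue)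
         \<le> (1 / R) ^ DIM('b) * (\<integral>\<xi>. indicator (cell R z) \<xi> * (cmod (f j \<xi>))\<^sup>2 \<partial>lebesgue)"
        using mcell by (intro mult_right_mono Bochner_Integration.integral_nonneg) auto
      finally show ?thesis .
    qed
    have sumcell: "(\<Sum>z\<in>?\<Theta> j. \<integral>\<xi>. indicator (cell R z) \<xi> * (cmod (f j \<xi>))\<^sup>2 \<partial>lebesgue) \<le> energy (f j)" if j: "j \<in> J" for j
    proof -
      have "integrable lebesgue (\<lambda>\<xi>. (cmod (f j \<xi>))\<^sup>2)" using f[OF j] by (simp add: square_integrable_def)
      from integrable_real_mult_indicator[OF cell_lebesgue this]
      have i: "integrable lebesgue (\<lambda>\<xi>. indicator (cell R z) \<xi> * (cmod (f j \<xi>))\<^sup>2)" for z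
        by (simp add: mult.commute)
      have "(\<Sum>z\<in>?\<Theta> j. \<integral>\<xi>. indicator (cell R z) \<xi> * (cmod (f j \<xi>))\<^sup>2 \<partial>lebesgue) = (\<integral>\<xi>. (\<Sum>z\<in>?\<Theta> j. indicator (cell R z) \<xi> * (cmod (f j \<xi>))\<^sup>2) \<partial>lebesgue)"
        using i by (intro Bochner_Integration.integral_sum[symmetric]) auto
      also have "\<dots> \<le> energy (f j)" unfolding energy_def
      proof (rule integral_mono)
        fix \<xi>
        have "(\<Sum>z\<in>?\<Theta> j. indicator (cell R z) \<xi> * (cmod (f j \<xi>))\<^sup>2) = (\<Sum>z\<in>?\<Theta> j. if z = fl (R *\<^sub>R \<xi>) then (cmod (f j \<xi>))\<^sup>2 else 0)"
          by (intro sum.cong) (auto simp: cell_def indicator_def)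
        also have "\<dots> \<le> (cmod (f j \<xi>))\<^sup>2" using fin\<Theta> by simp
        finally show "(\<Sum>z\<in>?\<Theta> j. indicator (cell R z) \<xi> * (cmod (f j \<xi>))\<^sup>2) \<le> (cmod (f j \<xi>))\<^sup>2" .
      qed (use i f[OF j] in \<open>auto simp: square_integrable_def\<close>)
      finally show ?thesis .
    qed
    define Fn where "Fn n j x = (\<Sum>z\<in>?\<Theta> j. cis (2 * pi * (x \<bullet> freq R z)) *
        (\<Sum>l\<in>basis_words n. (2 * pi * \<i>) ^ length l / fact (length l) * of_real (monom_at l ((1 / R) *\<^sub>R x)) * M j l z))" for n j x
    have "(\<integral>\<^sup>+x. ennreal (\<Prod>j\<in>J. cmod (ext (f j) x) powr (2 * q)) * indicator (max_box R) x \<partial>lborel)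
       \<le> ennreal (A * (W powr q * W') ^ card J * (\<Prod>j\<in>J. (W2 * ((1 / R) ^ DIM('b) * energy (f j))) powr q))"
    proof (rule multilinear_bound_Taylor[OF C q W(2) W'(2) J mb A max_box_borel, where Fn = Fn and Y = "\<lambda>j x. (1 / R) *\<^sub>R x" and M = M])
      fix n j assume j: "j \<in> J"
      have "continuous_on UNIV (Fn n j)"
        unfolding Fn_def[abs_def] cis_conv_exp by (intro continuous_intros continuous_monom_at)
      then show "Fn n j \<in> borel_measurable borel" by (rule borel_measurable_continuous_onI)
      have "(\<Sum>l\<in>(basis_words n :: ('b \<times> 'c) list set). sqrt (word_weight C l) * (\<Sum>z\<in>?\<Theta> j. (cmod (M j l z / of_real C ^ length l))\<^sup>2))
         \<le> (\<Sum>l\<in>(basis_words n :: ('b \<times> 'c) list set). sqrt (word_weight C l) * ((1 / R) ^ DIM('b) * energy (f j)))"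
      proof (intro sum_mono mult_left_mono)
        fix l :: "('b \<times> 'c) list" assume "l \<in> basis_words n"
        then have l: "set l \<subseteq> Basis" by (simp add: basis_words_def)
        have "(\<Sum>z\<in>?\<Theta> j. (cmod (M j l z / of_real C ^ length l))\<^sup>2)
            \<le> (\<Sum>z\<in>?\<Theta> j. (1 / R) ^ DIM('b) * (\<integral>\<xi>. indicator (cell R z) \<xi> * (cmod (f j \<xi>))\<^sup>2 \<partial>lebesgue))"
          by (intro sum_mono M_le[OF j l])
        also have "\<dots> \<le> (1 / R) ^ DIM('b) * energy (f j)"
          unfolding sum_distrib_left[symmetric] using R0 by (intro mult_left_mono sumcell[OF j]) auto
        finally show "(\<Sum>z\<in>?\<Theta> j. (cmod (M j l z / of_real C ^ length l))\<^sup>2) \<le> (1 / R) ^ DIM('b) * energy (f j)" .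
      qed (use ww in auto)
      also have "\<dots> \<le> W2 * ((1 / R) ^ DIM('b) * energy (f j))"
        unfolding sum_distrib_right[symmetric] using W2(2)[of n] ww R0
        by (intro mult_right_mono mult_nonneg_nonneg) (auto simp: powr_half_sqrt energy_nonneg)
      finally show "(\<Sum>l\<in>(basis_words n :: ('b \<times> 'c) list set). sqrt (word_weight C l) * (\<Sum>z\<in>?\<Theta> j. (cmod (M j l z / of_real C ^ length l))\<^sup>2))
         \<le> W2 * ((1 / R) ^ DIM('b) * energy (f j))" .
    next
      fix x b :: "'b \<times> 'c" assume x: "x \<in> max_box R" and b: "b \<in> Basis"
      show "\<bar>((1 / R) *\<^sub>R x) \<bullet> b\<bar> \<le> 1" using x b R0 by (simp add: max_box_def abs_mult)
    next
      fix j and x :: "'b \<times> 'c" assume j: "j \<in> J" and x: "x \<in> max_box R"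
      let ?Y = "(1 / R) *\<^sub>R x"
      let ?G = "\<lambda>n z \<xi>. ?F j z \<xi> * exp_trunc n (complex_of_real (2 * pi) * \<i> * of_real (?Y \<bullet> U z \<xi>))"
      have Fn_eq: "Fn n j x = (\<Sum>z\<in>?\<Theta> j. cis (2 * pi * (x \<bullet> freq R z)) * (\<integral>\<xi>. ?G n z \<xi> \<partial>lebesgue))" for n
        unfolding Fn_def
      proof (intro sum.cong refl arg_cong2[where f = "(*)"])
        fix z
        have "(\<integral>\<xi>. ?G n z \<xi> \<partial>lebesgue) = (\<integral>\<xi>. (\<Sum>l\<in>basis_words n. ((2 * pi * \<i>) ^ length l / fact (length l) * of_real (monom_at l ?Y)) *
            (?F j z \<xi> * of_real (monom_at l (U z \<xi>)))) \<partial>lebesgue)"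
          by (intro Bochner_Integration.integral_cong refl, simp only: exp_trunc_inner sum_distrib_left) (simp only: mult_ac)
        also have "\<dots> = (\<Sum>l\<in>basis_words n. (2 * pi * \<i>) ^ length l / fact (length l) * of_real (monom_at l ?Y) * M j l z)"
          unfolding M_def
        proof (subst Bochner_Integration.integral_sum)
          fix l :: "('b \<times> 'c) list" assume "l \<in> basis_words n"
          then show "integrable lebesgue (\<lambda>\<xi>. ((2 * pi * \<i>) ^ length l / fact (length l) * of_real (monom_at l ?Y)) *
            (?F j z \<xi> * of_real (monom_at l (U z \<xi>))))"
            by (intro integrable_mult_right intM[OF j]) (simp add: basis_words_def)
        qed (simp only: integral_mult_right_zero)
        finally show "(\<Sum>l\<in>basis_words n. (2 * pi * \<i>) ^ length l / fact (length l) * of_real (monom_at l ?Y) * M j l z) = (\<integral>\<xi>. ?G n z \<xi> \<partial>lebesgue)" ..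
      qed
      have F_eq: "ext (f j) x = (\<Sum>z\<in>?\<Theta> j. cis (2 * pi * (x \<bullet> freq R z)) * (\<integral>\<xi>. ?F j z \<xi> * exp (2 * pi * \<i> * of_real (?Y \<bullet> U z \<xi>)) \<partial>lebesgue))"
      proof -
        have ph: "wave x \<xi> = cis (2 * pi * (x \<bullet> freq R z)) * exp (2 * pi * \<i> * of_real (?Y \<bullet> U z \<xi>))" for z \<xi>
        proof -
          have "?Y \<bullet> U z \<xi> = x \<bullet> (\<xi>, Q \<xi>) - x \<bullet> freq R z" using R0 by (simp add: U_def inner_diff_right right_diff_distrib)
          then have "x \<bullet> (\<xi>, Q \<xi>) = x \<bullet> freq R z + ?Y \<bullet> U z \<xi>" by linarith
          then have "wave x \<xi> = cis (2 * pi * (x \<bullet> freq R z)) * cis (2 * pi * (?Y \<bullet> U z \<xi>))"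
            by (simp only: wave_def cis_mult distrib_left)
          also have "cis (2 * pi * (?Y \<bullet> U z \<xi>)) = exp (2 * pi * \<i> * of_real (?Y \<bullet> U z \<xi>))"
            by (simp add: cis_conv_exp mult_ac)
          finally show ?thesis .
        qed
        have "ext (f j) x = (\<integral>\<xi>. (\<Sum>z\<in>?\<Theta> j. ?F j z \<xi> * wave x \<xi>) \<partial>lebesgue)"
          unfolding ext_def
        proof (rule Bochner_Integration.integral_cong[OF refl])
          fix \<xi>
          have "(\<Sum>z\<in>?\<Theta> j. ?F j z \<xi> * wave x \<xi>) = (\<Sum>z\<in>?\<Theta> j. if z = fl (R *\<^sub>R \<xi>) then f j \<xi> * wave x \<xi> else 0)"
            by (intro sum.cong) (auto simp: cell_def indicator_def)
          also have "\<dots> = f j \<xi> * wave x \<xi>"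
            using fin\<Theta> cell_grid[OF j, of \<xi> "fl (R *\<^sub>R \<xi>)"] by (auto simp: cell_def)
          finally show "f j \<xi> * wave x \<xi> = (\<Sum>z\<in>?\<Theta> j. ?F j z \<xi> * wave x \<xi>)" ..
        qed
        also have "\<dots> = (\<Sum>z\<in>?\<Theta> j. \<integral>\<xi>. ?F j z \<xi> * wave x \<xi> \<partial>lebesgue)"
          by (intro Bochner_Integration.integral_sum integrable_mult_wave CS(1)[OF j])
        also have "\<dots> = (\<Sum>z\<in>?\<Theta> j. cis (2 * pi * (x \<bullet> freq R z)) * (\<integral>\<xi>. ?F j z \<xi> * exp (2 * pi * \<i> * of_real (?Y \<bullet> U z \<xi>)) \<partial>lebesgue))"
        proof (intro sum.cong refl)
          fix z
          have "(\<integral>\<xi>. ?F j z \<xi> * wave x \<xi> \<partial>lebesgue) = (\<integral>\<xi>. cis (2 * pi * (x \<bullet> freq R z)) * (?F j z \<xi> * exp (2 * pi * \<i> * of_real (?Y \<bullet> U z \<xi>))) \<partial>lebesgue)"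
            by (intro Bochner_Integration.integral_cong refl) (simp only: ph[of _ z] mult_ac)
          then show "(\<integral>\<xi>. ?F j z \<xi> * wave x \<xi> \<partial>lebesgue) = cis (2 * pi * (x \<bullet> freq R z)) * (\<integral>\<xi>. ?F j z \<xi> * exp (2 * pi * \<i> * of_real (?Y \<bullet> U z \<xi>)) \<partial>lebesgue)"
            by (simp only: integral_mult_right_zero)
        qed
        finally show ?thesis .
      qed
      have contU: "continuous_on UNIV (\<lambda>\<xi>. ?Y \<bullet> U z \<xi>)" for z
        unfolding U_def by (intro continuous_intros continuous_Q)
      \<comment> \<open>Dominated convergence: on the cell the phase is bounded, so all truncated
        exponentials are at most a fixed constant.\<close>
      have DC: "(\<lambda>n. \<integral>\<xi>. ?G n z \<xi> \<partial>lebesgue) \<longlonglongrightarrow> (\<integral>\<xi>. ?F j z \<xi> * exp (2 * pi * \<i> * of_real (?Y \<bullet> U z \<xi>)) \<partial>lebesgue)" for z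
      proof (rule integral_dominated_convergence[where w = "\<lambda>\<xi>. exp (2 * pi * (real DIM('b \<times> 'c) * C)) * (indicator (cell R z) \<xi> * cmod (f j \<xi>))"])
        have m: "g \<in> borel_measurable lebesgue" if "continuous_on UNIV g" for g :: "'b \<Rightarrow> complex"
          using that by (simp add: borel_measurable_continuous_onI measurable_completion)
        have Fm: "?F j z \<in> borel_measurable lebesgue" using CS(1)[OF j, of z] by auto
        show "(\<lambda>\<xi>. ?F j z \<xi> * exp (2 * pi * \<i> * of_real (?Y \<bullet> U z \<xi>))) \<in> borel_measurable lebesgue"
          by (intro borel_measurable_times Fm m continuous_intros contU)
        show "?G n z \<in> borel_measurable lebesgue" for n
          unfolding exp_trunc_def by (intro borel_measurable_times Fm m continuous_intros contU) auto
        show "integrable lebesgue (\<lambda>\<xi>. exp (2 * pi * (real DIM('b \<times> 'c) * C)) * (indicator (cell R z) \<xi> * cmod (f j \<xi>)))"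
          using intn[OF j] by simp
        show "AE \<xi> in lebesgue. (\<lambda>n. ?G n z \<xi>) \<longlonglongrightarrow> ?F j z \<xi> * exp (2 * pi * \<i> * of_real (?Y \<bullet> U z \<xi>))"
          by (intro AE_I2 tendsto_intros exp_trunc_tendsto)
        fix n
        show "AE \<xi> in lebesgue. norm (?G n z \<xi>) \<le> exp (2 * pi * (real DIM('b \<times> 'c) * C)) * (indicator (cell R z) \<xi> * cmod (f j \<xi>))"
        proof (rule AE_I2)
          fix \<xi>
          show "norm (?G n z \<xi>) \<le> exp (2 * pi * (real DIM('b \<times> 'c) * C)) * (indicator (cell R z) \<xi> * cmod (f j \<xi>))"
          proof (cases "\<xi> \<in> cell R z \<and> f j \<xi> \<noteq> 0")
            case True
            have "\<bar>?Y \<bullet> U z \<xi>\<bar> \<le> (\<Sum>b\<in>Basis. \<bar>(?Y \<bullet> b) * (U z \<xi> \<bullet> b)\<bar>)"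
              using sum_abs[of "\<lambda>b. (?Y \<bullet> b) * (U z \<xi> \<bullet> b)" Basis] by (simp only: euclidean_inner[of ?Y "U z \<xi>", symmetric])
            also have "\<dots> \<le> (\<Sum>b\<in>(Basis :: ('b \<times> 'c) set). 1 * C)"
            proof (rule sum_mono)
              fix b :: "'b \<times> 'c" assume b: "b \<in> Basis"
              have "\<bar>?Y \<bullet> b\<bar> \<le> 1" using x b R0 by (simp add: max_box_def abs_mult)
              then show "\<bar>(?Y \<bullet> b) * (U z \<xi> \<bullet> b)\<bar> \<le> 1 * C"
                unfolding abs_mult using U_le[OF j _ _ b, of \<xi> z] True by (intro mult_mono) auto
            qed
            finally have "2 * pi * \<bar>?Y \<bullet> U z \<xi>\<bar> \<le> 2 * pi * (real DIM('b \<times> 'c) * C)" by (intro mult_left_mono) auto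
            then have "exp (norm (2 * pi * \<i> * complex_of_real (?Y \<bullet> U z \<xi>))) \<le> exp (2 * pi * (real DIM('b \<times> 'c) * C))"
              by (simp add: norm_mult norm_divide)
            then have "norm (exp_trunc n (2 * pi * \<i> * of_real (?Y \<bullet> U z \<xi>))) \<le> exp (2 * pi * (real DIM('b \<times> 'c) * C))"
              using norm_exp_trunc_le order_trans by blast
            then have "cmod (f j \<xi>) * norm (exp_trunc n (2 * pi * \<i> * of_real (?Y \<bullet> U z \<xi>))) \<le> cmod (f j \<xi>) * exp (2 * pi * (real DIM('b \<times> 'c) * C))"
              by (intro mult_left_mono) auto
            then show ?thesis using True by (simp add: norm_mult mult.commute)
          qed auto
        qed
      qed
      have eq: "(\<lambda>n. Fn n j x) = (\<lambda>n. \<Sum>z\<in>?\<Theta> j. cis (2 * pi * (x \<bullet> freq R z)) * (\<integral>\<xi>. ?G n z \<xi> \<partial>lebesgue))"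
        by (rule HOL.ext, rule Fn_eq)
      show "(\<lambda>n. Fn n j x) \<longlonglongrightarrow> ext (f j) x"
        by (subst eq, subst F_eq) (intro tendsto_sum tendsto_mult tendsto_const DC)
    qed (simp add: Fn_def)
    also have "A * (W powr q * W') ^ card J * (\<Prod>j\<in>J. (W2 * ((1 / R) ^ DIM('b) * energy (f j))) powr q)
       = ?K * A * R powr (- (q * real DIM('b) * real (card J))) * (\<Prod>j\<in>J. energy (f j) powr q)"
    proof -
      have "(1 / R) ^ DIM('b) = R powr (- real DIM('b))"
        using R0 by (simp add: powr_minus powr_realpow power_one_over inverse_eq_divide)
      then have "(W2 * ((1 / R) ^ DIM('b) * energy (f j))) powr q = W2 powr q * R powr (- (real DIM('b) * q)) * energy (f j) powr q" for j
        by (simp add: powr_mult powr_powr)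
      then have "(\<Prod>j\<in>J. (W2 * ((1 / R) ^ DIM('b) * energy (f j))) powr q) =
         (W2 powr q) ^ card J * (R powr (- (real DIM('b) * q))) ^ card J * (\<Prod>j\<in>J. energy (f j) powr q)"
        by (simp only: prod.distrib prod_constant)
      also have "(R powr (- (real DIM('b) * q))) ^ card J = R powr (- (q * real DIM('b) * real (card J)))"
        using R0 by (simp add: powr_powr mult_ac flip: powr_realpow)
      finally show ?thesis by (simp only: mult_ac)
    qed
    finally show "(\<integral>\<^sup>+x. ennreal (\<Prod>j\<in>J. cmod (ext (f j) x) powr (2 * q)) * indicator (max_box R) x \<partial>lborel)
       \<le> ennreal (?K * A * R powr (- (q * real DIM('b) * real (card J))) * (\<Prod>j\<in>J. energy (f j) powr q))" .
  qed
qed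

end

section \<open>Iteration over scales, compactness and balls\<close>

lemma powr_two_mult: "0 \<le> t \<Longrightarrow> t powr (2 * q) = (t\<^sup>2) powr q" for t q :: real
  by (cases "t = 0") (simp_all add: powr_powr flip: powr_numeral)

lemma emeasure_max_box: "emeasure lborel (max_box R :: 'e::euclidean_space set) < \<infinity>"
proof (rule emeasure_bounded_finite)
  have "max_box R \<subseteq> cbox (- (R *\<^sub>R One)) (R *\<^sub>R One :: 'e)" by (auto simp: max_box_def mem_box abs_le_iff minus_le_iff[of R])
  then show "bounded (max_box R :: 'e set)" using bounded_cbox bounded_subset by blast
qed

lemma max_box_mono: "R \<le> R' \<Longrightarrow> max_box R \<subseteq> max_box R'"
  by (auto simp: max_box_def intro: order_trans)

context quadratic_graph
begin

text \<open>Cauchy-Schwarz on the finite grid and the finite volume of the box. The constant may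
  grow in any way with s and R, because it is used once, at R = s.\<close>

lemma scale_bound_base:
  fixes J :: "'j set" and \<xi>0 :: "'j \<Rightarrow> 'b"
  assumes q: "0 < q"
  shows "\<exists>A\<ge>0. scale_bound J q \<xi>0 s R A"
proof -
  let ?\<Theta> = "\<lambda>j. grid (\<xi>0 j) (1 / real s + 2 / R) R"
  define P where "P = (\<Prod>j\<in>J. real (card (?\<Theta> j)) powr q)"
  define m where "m = measure lborel (max_box R :: ('b \<times> 'c) set)"
  have P0: "0 \<le> P" unfolding P_def by (intro prod_nonneg) auto
  have em: "emeasure lborel (max_box R :: ('b \<times> 'c) set) = ennreal m"
    unfolding m_def
    by (rule emeasure_eq_ennreal_measure)
      (use emeasure_max_box[where 'e = "'b \<times> 'c", of R] in \<open>metis infinity_ennreal_def less_irrefl\<close>)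
  have "scale_bound J q \<xi>0 s R (P * m)" unfolding scale_bound_def multilinear_bound_def
  proof
    fix a :: "'j \<Rightarrow> ('b \<Rightarrow> int) \<Rightarrow> complex"
    define E where "E = (\<Prod>j\<in>J. (\<Sum>z\<in>?\<Theta> j. (cmod (a j z))\<^sup>2) powr q)"
    have E0: "0 \<le> E" unfolding E_def by (intro prod_nonneg) auto
    have pw: "(\<Prod>j\<in>J. cmod (exp_sum (freq R) (?\<Theta> j) (a j) x) powr (2 * q)) \<le> P * E" for x
      unfolding P_def E_def prod.distrib[symmetric]
    proof (intro prod_mono conjI)
      fix j
      have "cmod (exp_sum (freq R) (?\<Theta> j) (a j) x) \<le> (\<Sum>z\<in>?\<Theta> j. 1 * cmod (a j z))"
        unfolding exp_sum_def by (rule order_trans[OF norm_sum]) (simp add: norm_mult)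
      then have "(cmod (exp_sum (freq R) (?\<Theta> j) (a j) x))\<^sup>2 \<le> (\<Sum>z\<in>?\<Theta> j. 1 * cmod (a j z))\<^sup>2"
        by (intro power_mono) auto
      also have "\<dots> \<le> (\<Sum>z\<in>?\<Theta> j. 1\<^sup>2) * (\<Sum>z\<in>?\<Theta> j. (cmod (a j z))\<^sup>2)" by (rule Cauchy_Schwarz_ineq_sum)
      finally have "(cmod (exp_sum (freq R) (?\<Theta> j) (a j) x))\<^sup>2 \<le> real (card (?\<Theta> j)) * (\<Sum>z\<in>?\<Theta> j. (cmod (a j z))\<^sup>2)" by simp
      then have "((cmod (exp_sum (freq R) (?\<Theta> j) (a j) x))\<^sup>2) powr q \<le> (real (card (?\<Theta> j)) * (\<Sum>z\<in>?\<Theta> j. (cmod (a j z))\<^sup>2)) powr q"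
        using q by (intro powr_mono2) auto
      then show "cmod (exp_sum (freq R) (?\<Theta> j) (a j) x) powr (2 * q) \<le> real (card (?\<Theta> j)) powr q * (\<Sum>z\<in>?\<Theta> j. (cmod (a j z))\<^sup>2) powr q"
        by (simp add: powr_two_mult powr_mult)
    qed simp
    have "(\<integral>\<^sup>+x. ennreal (\<Prod>j\<in>J. cmod (exp_sum (freq R) (?\<Theta> j) (a j) x) powr (2 * q)) * indicator (max_box R) x \<partial>lborel)
       \<le> (\<integral>\<^sup>+(x::'b \<times> 'c). ennreal (P * E) * indicator (max_box R) x \<partial>lborel)"
      by (intro nn_integral_mono mult_right_mono ennreal_leI pw) auto
    also have "\<dots> = ennreal (P * E) * ennreal m" by (simp add: nn_integral_cmult_indicator em)
    also have "\<dots> = ennreal (P * m * E)" using P0 E0 by (simp add: m_def mult_ac flip: ennreal_mult)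
    finally show "(\<integral>\<^sup>+x. ennreal (\<Prod>j\<in>J. cmod (exp_sum (freq R) (?\<Theta> j) (a j) x) powr (2 * q)) * indicator (max_box R) x \<partial>lborel)
       \<le> ennreal (P * m * (\<Prod>j\<in>J. (\<Sum>z\<in>?\<Theta> j. (cmod (a j z))\<^sup>2) powr q))" by (simp add: E_def)
  qed
  then show ?thesis using P0 by (intro exI[of _ "P * m"]) (simp add: m_def)
qed

text \<open>The iteration starts at R = s, the smallest scale at which a step is allowed.\<close>

lemma scale_bound_iterate:
  assumes step: "\<And>R A. R \<ge> real s \<Longrightarrow> 0 \<le> A \<Longrightarrow> scale_bound J q \<xi>0 s R A \<Longrightarrow> scale_bound J q \<xi>0 s (real s * R) (c * A)"
    and c: "0 \<le> c" and s: "s \<ge> 1" and base: "0 \<le> A0" "scale_bound J q \<xi>0 s (real s) A0"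
  shows "scale_bound J q \<xi>0 s (real s ^ Suc i) (c ^ i * A0)"
proof (induction i)
  case (Suc i)
  have "real s ^ 1 \<le> real s ^ Suc i" using s by (intro power_increasing) auto
  then have "scale_bound J q \<xi>0 s (real s * real s ^ Suc i) (c * (c ^ i * A0))"
    using Suc c base by (intro step) auto
  then show ?case by (simp add: mult.assoc)
qed (use base in simp)

text \<open>If s is so large that the constant of a step is at most s to the power \<epsilon>, then
  i steps cost at most (s ^ i) powr (B + E + \<epsilon>). The factor R powr (- E) from the
  discretisation removes E, and the initial constant \<open>A0\<close> is harmless because s is now
  fixed.\<close>

lemma local_multilinear_bound:
  fixes J :: "'j set" and \<xi>0 :: "'j \<Rightarrow> 'b"
  assumes J: "finite J" and q: "0 < q" "q \<le> 1" and B: "0 \<le> B" and \<epsilon>: "0 < \<epsilon>"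
    and rank: "\<And>V. subspace V \<Longrightarrow> real (dim V) - q * (\<Sum>j\<in>J. real (dim (dual_map \<Lambda> (\<xi>0 j) ` V))) \<le> B"
  shows "\<exists>s K. 2 \<le> (s::nat) \<and> 0 < K \<and> (\<forall>R f. R \<ge> 1 \<and> (\<forall>j\<in>J. square_integrable (f j) \<and>
       (\<forall>\<xi>. f j \<xi> \<noteq> 0 \<longrightarrow> (\<forall>b\<in>Basis. \<bar>\<xi> \<bullet> b - \<xi>0 j \<bullet> b\<bar> \<le> 1 / real s))) \<longrightarrow>
     (\<integral>\<^sup>+x. ennreal (\<Prod>j\<in>J. cmod (ext (f j) x) powr (2 * q)) * indicator (max_box R) x \<partial>lborel)
       \<le> ennreal (K * R powr (B + \<epsilon>) * (\<Prod>j\<in>J. energy (f j) powr q)))"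
proof -
  define E where "E = q * real DIM('b) * real (card J)"
  have E0: "0 \<le> E" using q by (simp add: E_def)
  have "\<exists>C>0. \<forall>s R A. s \<ge> 2 \<and> R \<ge> real s \<and> 0 \<le> A \<and> scale_bound J q \<xi>0 s R A \<longrightarrow>
     scale_bound J q \<xi>0 s (real s * R) (C * real s powr (B + E) * A)"
    unfolding E_def by (rule scale_bound_step[OF J q rank])
  then obtain C where C: "C > 0" "\<And>s R A. s \<ge> 2 \<Longrightarrow> R \<ge> real s \<Longrightarrow> 0 \<le> A \<Longrightarrow> scale_bound J q \<xi>0 s R A \<Longrightarrow>
     scale_bound J q \<xi>0 s (real s * R) (C * real s powr (B + E) * A)" by blast
  define s where "s = nat \<lceil>C powr (1 / \<epsilon>)\<rceil> + 2"
  have s: "s \<ge> 2" "C powr (1 / \<epsilon>) \<le> real s" unfolding s_def by simp linarith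
  have Cs: "C \<le> real s powr \<epsilon>"
  proof -
    have "C = (C powr (1 / \<epsilon>)) powr \<epsilon>" using C(1) \<epsilon> by (simp add: powr_powr)
    also have "\<dots> \<le> real s powr \<epsilon>" using s \<epsilon> by (intro powr_mono2) auto
    finally show ?thesis .
  qed
  obtain A0 where A0: "0 \<le> A0" "scale_bound J q \<xi>0 s (real s) A0" using scale_bound_base[OF q(1)] by blast
  define c where "c = C * real s powr (B + E)"
  have c0: "0 \<le> c" using C(1) by (simp add: c_def)
  have it: "scale_bound J q \<xi>0 s (real s ^ Suc i) (c ^ i * A0)" for i
    using C(2)[OF s(1)] c0 s(1) A0 unfolding c_def by (intro scale_bound_iterate) auto
  have s0: "s > 0" using s by simp
  have "\<exists>K>0. \<forall>R A f. R \<ge> 1 \<and> 0 \<le> A \<and> scale_bound J q \<xi>0 s R A \<and>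
     (\<forall>j\<in>J. square_integrable (f j) \<and> (\<forall>\<xi>. f j \<xi> \<noteq> 0 \<longrightarrow> (\<forall>b\<in>Basis. \<bar>\<xi> \<bullet> b - \<xi>0 j \<bullet> b\<bar> \<le> 1 / real s))) \<longrightarrow>
     (\<integral>\<^sup>+x. ennreal (\<Prod>j\<in>J. cmod (ext (f j) x) powr (2 * q)) * indicator (max_box R) x \<partial>lborel)
       \<le> ennreal (K * A * R powr (- E) * (\<Prod>j\<in>J. energy (f j) powr q))"
    unfolding E_def by (rule ext_scale_bound[OF J q s0])
  then obtain K where K: "K > 0" "\<forall>R A f. R \<ge> 1 \<and> 0 \<le> A \<and> scale_bound J q \<xi>0 s R A \<and>
     (\<forall>j\<in>J. square_integrable (f j) \<and> (\<forall>\<xi>. f j \<xi> \<noteq> 0 \<longrightarrow> (\<forall>b\<in>Basis. \<bar>\<xi> \<bullet> b - \<xi>0 j \<bullet> b\<bar> \<le> 1 / real s))) \<longrightarrow>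
     (\<integral>\<^sup>+x. ennreal (\<Prod>j\<in>J. cmod (ext (f j) x) powr (2 * q)) * indicator (max_box R) x \<partial>lborel)
       \<le> ennreal (K * A * R powr (- E) * (\<Prod>j\<in>J. energy (f j) powr q))" by (elim exE conjE)
  show ?thesis
  proof (intro exI[of _ s] exI[of _ "K * A0 + 1"] conjI allI impI)
    show "0 < K * A0 + 1" using K A0 by (simp add: add_nonneg_pos)
    fix R :: real and f :: "'j \<Rightarrow> 'b \<Rightarrow> complex"
    assume a: "R \<ge> 1 \<and> (\<forall>j\<in>J. square_integrable (f j) \<and>
       (\<forall>\<xi>. f j \<xi> \<noteq> 0 \<longrightarrow> (\<forall>b\<in>Basis. \<bar>\<xi> \<bullet> b - \<xi>0 j \<bullet> b\<bar> \<le> 1 / real s)))"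
    then have R: "R \<ge> 1" by simp
    obtain n where "R < real s ^ n" using real_arch_pow[of "real s" R] s by auto
    moreover have "real s ^ n \<le> real s ^ Suc n" using s by (intro power_increasing) auto
    ultimately have ex: "\<exists>i. R \<le> real s ^ Suc i" by (intro exI[of _ n]) simp
    \<comment> \<open>The estimate is used on the larger box of radius s ^ Suc i. Only i steps lead
      there, and s ^ i \<le> R by minimality, so the result is in terms of R itself.\<close>
    define i where "i = (LEAST i. R \<le> real s ^ Suc i)"
    have i1: "R \<le> real s ^ Suc i" unfolding i_def using ex by (rule LeastI_ex)
    have i2: "real s ^ i \<le> R"
    proof (cases i)
      case (Suc i')
      then have "i' < (LEAST i. R \<le> real s ^ Suc i)" by (simp add: i_def)
      from not_less_Least[OF this] show ?thesis using Suc by simp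
    qed (use R in simp)
    let ?R = "real s ^ Suc i" and ?P = "\<Prod>j\<in>J. energy (f j) powr q"
    have P0: "0 \<le> ?P" by (intro prod_nonneg) auto
    let ?f = "\<lambda>x. ennreal (\<Prod>j\<in>J. cmod (ext (f j) x) powr (2 * q))"
    have "(\<integral>\<^sup>+x. ?f x * indicator (max_box R) x \<partial>lborel) \<le> (\<integral>\<^sup>+x. ?f x * indicator (max_box ?R) x \<partial>lborel)"
      using max_box_mono[OF i1] by (intro nn_integral_mono mult_left_mono) (auto simp: indicator_def)
    also have "\<dots> \<le> ennreal (K * (c ^ i * A0) * ?R powr (- E) * ?P)"
      using K(2)[rule_format, of ?R "c ^ i * A0" f] a it[of i] c0 A0(1) i1 by auto
    also have "\<dots> \<le> ennreal ((K * A0 + 1) * R powr (B + \<epsilon>) * ?P)"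
    proof (intro ennreal_leI mult_right_mono P0)
      have "c ^ i \<le> (real s powr \<epsilon> * real s powr (B + E)) ^ i"
        unfolding c_def using Cs C(1) by (intro power_mono mult_right_mono mult_nonneg_nonneg) auto
      also have "\<dots> = (real s ^ i) powr (B + \<epsilon> + E)"
        using s0 by (simp add: powr_add[symmetric] powr_power powr_powr mult_ac add_ac flip: powr_realpow)
      finally have "c ^ i * ?R powr (- E) \<le> (real s ^ i) powr (B + \<epsilon> + E) * (real s ^ i) powr (- E)"
      proof (rule mult_mono)
        have "(real s ^ i) \<le> ?R" using s by (intro power_increasing) auto
        then show "?R powr (- E) \<le> (real s ^ i) powr (- E)" using E0 s0 by (intro powr_mono2') auto
      qed auto
      also have "\<dots> = (real s ^ i) powr (B + \<epsilon>)" by (simp flip: powr_add)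
      also have "\<dots> \<le> R powr (B + \<epsilon>)" using i2 B \<epsilon> by (intro powr_mono2) auto
      finally have "c ^ i * ?R powr (- E) \<le> R powr (B + \<epsilon>)" .
      then have "K * A0 * (c ^ i * ?R powr (- E)) \<le> K * A0 * R powr (B + \<epsilon>)"
        using K(1) A0(1) by (intro mult_left_mono) auto
      also have "\<dots> \<le> (K * A0 + 1) * R powr (B + \<epsilon>)" by (intro mult_right_mono) auto
      finally show "K * (c ^ i * A0) * ?R powr (- E) \<le> (K * A0 + 1) * R powr (B + \<epsilon>)" by (simp add: mult_ac)
    qed
    finally show "(\<integral>\<^sup>+x. ?f x * indicator (max_box R) x \<partial>lborel) \<le> ennreal ((K * A0 + 1) * R powr (B + \<epsilon>) * ?P)" .
  qed (use s in simp)
qed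

text \<open>The admissible cubes around a tuple of points have a size depending on the tuple.
  Neighbourhoods of half that size cover the compact product, and finitely many suffice. Each f j is
  cut into cells of side \<rho>, no larger than any of these half sizes: for a tuple of cells,
  points of the sets in the cells lie in one of the neighbourhoods, and the whole cells then lie in
  its admissible cubes.\<close>

theorem compact_multilinear_bound:
  fixes J :: "'j set" and S :: "'j \<Rightarrow> 'b set"
  assumes J: "finite J" and q: "0 < q" "q \<le> 1" and B: "0 \<le> B" and \<epsilon>: "0 < \<epsilon>"
    and S: "\<And>j. j \<in> J \<Longrightarrow> compact (S j)"
    and rank: "\<And>\<xi>0 V. \<xi>0 \<in> PiE J S \<Longrightarrow> subspace V \<Longrightarrow>
       real (dim V) - q * (\<Sum>j\<in>J. real (dim (dual_map \<Lambda> (\<xi>0 j) ` V))) \<le> B"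
  shows "\<exists>K>0. \<forall>R f. R \<ge> 1 \<and> (\<forall>j\<in>J. square_integrable (f j) \<and> (\<forall>\<xi>. f j \<xi> \<noteq> 0 \<longrightarrow> \<xi> \<in> S j)) \<longrightarrow>
     (\<integral>\<^sup>+x. ennreal (\<Prod>j\<in>J. cmod (ext (f j) x) powr (2 * q)) * indicator (max_box R) x \<partial>lborel)
       \<le> ennreal (K * R powr (B + \<epsilon>) * (\<Prod>j\<in>J. energy (f j) powr q))"
proof -
  let ?Q = "\<lambda>\<xi>0 (s::nat) K. 2 \<le> s \<and> 0 < K \<and> (\<forall>R f. R \<ge> 1 \<and> (\<forall>j\<in>J. square_integrable (f j) \<and>
       (\<forall>\<xi>. f j \<xi> \<noteq> 0 \<longrightarrow> (\<forall>b\<in>Basis. \<bar>\<xi> \<bullet> b - \<xi>0 j \<bullet> b\<bar> \<le> 1 / real s))) \<longrightarrow>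
     (\<integral>\<^sup>+x. ennreal (\<Prod>j\<in>J. cmod (ext (f j) x) powr (2 * q)) * indicator (max_box R) x \<partial>lborel)
       \<le> ennreal (K * R powr (B + \<epsilon>) * (\<Prod>j\<in>J. energy (f j) powr q)))"
  have "\<forall>\<xi>0\<in>PiE J S. \<exists>s. \<exists>K. ?Q \<xi>0 s K"
    by (intro ballI local_multilinear_bound[OF J q B \<epsilon>] rank)
  from bchoice[OF this] obtain s where "\<forall>\<xi>0\<in>PiE J S. \<exists>K. ?Q \<xi>0 (s \<xi>0) K" by (elim exE)
  from bchoice[OF this] obtain K where sK: "\<forall>\<xi>0\<in>PiE J S. ?Q \<xi>0 (s \<xi>0) (K \<xi>0)" by (elim exE)
  have s2: "2 \<le> s \<xi>0" and K0: "0 < K \<xi>0" if "\<xi>0 \<in> PiE J S" for \<xi>0 using sK that by auto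
  let ?T = "product_topology (\<lambda>_. euclidean) J :: ('j \<Rightarrow> 'b) topology"
  define N where "N \<xi>0 = PiE J (\<lambda>j. {\<xi>. \<forall>b\<in>Basis. \<bar>\<xi> \<bullet> b - \<xi>0 j \<bullet> b\<bar> < 1 / (2 * real (s \<xi>0))})" for \<xi>0
  have comp: "compactin ?T (PiE J S)" unfolding compactin_PiE using S by (simp add: compactin_euclidean_iff)
  have opN: "openin ?T (N \<xi>0)" for \<xi>0
  proof -
    have "{\<xi>. \<forall>b\<in>Basis. \<bar>\<xi> \<bullet> b - \<xi>0 j \<bullet> b\<bar> < 1 / (2 * real (s \<xi>0))} =
       (\<Inter>b\<in>Basis. {\<xi>. \<bar>\<xi> \<bullet> b - \<xi>0 j \<bullet> b\<bar> < 1 / (2 * real (s \<xi>0))})" for j by auto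
    then have "open {\<xi>. \<forall>b\<in>Basis. \<bar>\<xi> \<bullet> b - \<xi>0 j \<bullet> b\<bar> < 1 / (2 * real (s \<xi>0))}" for j
      by (simp only:) (intro open_INT finite_Basis ballI open_Collect_less continuous_intros)
    then show ?thesis unfolding N_def openin_PiE[OF J] by simp
  qed
  have cov: "PiE J S \<subseteq> \<Union>(N ` PiE J S)"
  proof
    fix \<xi> assume \<xi>: "\<xi> \<in> PiE J S"
    then have "\<xi> \<in> N \<xi>" using s2[OF \<xi>] by (auto simp: N_def PiE_iff)
    then show "\<xi> \<in> \<Union>(N ` PiE J S)" using \<xi> by blast
  qed
  obtain \<F> where \<F>: "finite \<F>" "\<F> \<subseteq> N ` PiE J S" "PiE J S \<subseteq> \<Union>\<F>"
  proof -
    have "\<forall>\<U>. (\<forall>U\<in>\<U>. openin ?T U) \<and> PiE J S \<subseteq> \<Union>\<U> \<longrightarrow> (\<exists>\<F>. finite \<F> \<and> \<F> \<subseteq> \<U> \<and> PiE J S \<subseteq> \<Union>\<F>)"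
      using comp unfolding compactin_def by (rule conjunct2)
    from mp[OF spec[OF this, of "N ` PiE J S"]] cov opN that show ?thesis by auto
  qed
  obtain P where P: "finite P" "P \<subseteq> PiE J S" "PiE J S \<subseteq> \<Union>(N ` P)"
  proof -
    from finite_subset_image[OF \<F>(1,2)] obtain C where "C \<subseteq> PiE J S" "finite C" "\<F> = N ` C" by (elim exE conjE)
    then show ?thesis using that[of C] \<F>(3) by simp
  qed
  \<comment> \<open>Inserting 1 keeps the minimum meaningful when P is empty.\<close>
  define \<rho> where "\<rho> = Min (insert 1 ((\<lambda>\<xi>0. 1 / (2 * real (s \<xi>0))) ` P))"
  have \<rho>: "0 < \<rho>" "\<And>\<xi>0. \<xi>0 \<in> P \<Longrightarrow> \<rho> \<le> 1 / (2 * real (s \<xi>0))"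
  proof -
    have "\<rho> \<in> insert 1 ((\<lambda>\<xi>0. 1 / (2 * real (s \<xi>0))) ` P)" unfolding \<rho>_def using P(1) by (intro Min_in) auto
    moreover have "0 < 1 / (2 * real (s \<xi>0))" if "\<xi>0 \<in> P" for \<xi>0 using s2[of \<xi>0] that P(2) by auto
    ultimately show "0 < \<rho>" by auto
  qed (use P(1) in \<open>auto simp: \<rho>_def\<close>)
  define r where "r = 1 / \<rho>"
  have r0: "r > 0" using \<rho> by (simp add: r_def)
  define L where "L j = (\<lambda>\<xi>. fl (r *\<^sub>R \<xi>)) ` S j" for j
  have finL: "finite (L j)" if j: "j \<in> J" for j
  proof -
    obtain a where a: "\<And>\<xi>. \<xi> \<in> S j \<Longrightarrow> norm \<xi> \<le> a" using compact_imp_bounded[OF S[OF j]] by (auto simp: bounded_iff)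
    have "norm (y - 0) \<le> r * a" if "y \<in> (*\<^sub>R) r ` S j" for y
      using that a r0 by (auto intro: mult_left_mono)
    from card_fl_image_le[of "(*\<^sub>R) r ` S j", OF this] show ?thesis by (simp add: L_def image_image)
  qed
  let ?E = "PiE J L"
  have finE: "finite ?E" using J finL by (intro finite_PiE) auto
  define n where "n = (\<Prod>j\<in>J. real (card (L j)) powr q)"
  define K' where "K' = n * real (card ?E) * (\<Sum>\<xi>0\<in>P. K \<xi>0) + 1"
  have n0: "0 \<le> n" unfolding n_def by (intro prod_nonneg) auto
  have sumK: "0 \<le> (\<Sum>\<xi>0\<in>P. K \<xi>0)" using K0 P(2) by (intro sum_nonneg) (auto simp: less_imp_le subset_iff)
  show ?thesis
  proof (intro exI[of _ K'] conjI allI impI)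
    show "0 < K'" unfolding K'_def using n0 sumK by (intro add_nonneg_pos mult_nonneg_nonneg) auto
    fix R :: real and f :: "'j \<Rightarrow> 'b \<Rightarrow> complex"
    assume a: "R \<ge> 1 \<and> (\<forall>j\<in>J. square_integrable (f j) \<and> (\<forall>\<xi>. f j \<xi> \<noteq> 0 \<longrightarrow> \<xi> \<in> S j))"
    define fc where "fc j z \<xi> = indicator (cell r z) \<xi> *\<^sub>R f j \<xi>" for j z \<xi>
    have fincell: "emeasure lebesgue (cell r z) < \<infinity>" for z
      using emeasure_cell_le[OF r0, of z] by (rule order.strict_trans1) (simp add: less_top[symmetric])
    have fm: "f j \<in> borel_measurable lebesgue" "integrable lebesgue (\<lambda>\<xi>. (cmod (f j \<xi>))\<^sup>2)" if "j \<in> J" for j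
      using a that by (auto simp: square_integrable_def)
    have fci: "integrable lebesgue (fc j z)" if "j \<in> J" for j z
      unfolding fc_def[abs_def] by (rule integral_Cauchy_Schwarz_indicator(1)[OF fm[OF that] cell_lebesgue fincell])
    have fc2: "(\<lambda>\<xi>. (cmod (fc j z \<xi>))\<^sup>2) = (\<lambda>\<xi>. (cmod (f j \<xi>))\<^sup>2 * indicator (cell r z) \<xi>)" for j z
      by (auto simp: fc_def indicator_def)
    have sqi: "square_integrable (fc j z)" if "j \<in> J" for j z
      unfolding square_integrable_def fc2 using fci[OF that] integrable_real_mult_indicator[OF cell_lebesgue fm(2)[OF that]]
      by auto
    have en: "energy (fc j z) \<le> energy (f j)" if "j \<in> J" for j z
      unfolding energy_def fc2 using fm(2)[OF that] integrable_real_mult_indicator[OF cell_lebesgue fm(2)[OF that]]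
      by (intro integral_mono) (auto simp: indicator_def)
    have ext_sum: "ext (f j) x = (\<Sum>z\<in>L j. ext (fc j z) x)" if j: "j \<in> J" for j x
    proof -
      have "(\<Sum>z\<in>L j. ext (fc j z) x) = (\<integral>\<xi>. (\<Sum>z\<in>L j. fc j z \<xi> * wave x \<xi>) \<partial>lebesgue)"
        unfolding ext_def by (intro Bochner_Integration.integral_sum[symmetric] integrable_mult_wave fci j)
      also have "\<dots> = ext (f j) x" unfolding ext_def
      proof (rule Bochner_Integration.integral_cong[OF refl])
        fix \<xi>
        have "(\<Sum>z\<in>L j. fc j z \<xi> * wave x \<xi>) = (\<Sum>z\<in>L j. if z = fl (r *\<^sub>R \<xi>) then f j \<xi> * wave x \<xi> else 0)"
          by (intro sum.cong) (auto simp: fc_def cell_def indicator_def)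
        also have "\<dots> = f j \<xi> * wave x \<xi>" using finL[OF j] a j by (auto simp: L_def)
        finally show "(\<Sum>z\<in>L j. fc j z \<xi> * wave x \<xi>) = f j \<xi> * wave x \<xi>" .
      qed
      finally show ?thesis ..
    qed
    let ?D = "\<lambda>j z x. cmod (ext (fc j z) x) powr (2 * q)"
    let ?P = "\<Prod>j\<in>J. energy (f j) powr q"
    have P0: "0 \<le> ?P" by (intro prod_nonneg) auto
    have pw: "(\<Prod>j\<in>J. cmod (ext (f j) x) powr (2 * q)) \<le> n * (\<Sum>g\<in>?E. \<Prod>j\<in>J. ?D j (g j) x)" for x
    proof -
      have "(\<Prod>j\<in>J. cmod (ext (f j) x) powr (2 * q)) \<le> (\<Prod>j\<in>J. real (card (L j)) powr q * (\<Sum>z\<in>L j. ?D j z x))"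
      proof (intro prod_mono conjI)
        fix j assume j: "j \<in> J"
        have "cmod (ext (f j) x) powr (2 * q) \<le> (\<Sum>z\<in>L j. 1 * cmod (ext (fc j z) x)) powr (2 * q)"
          unfolding ext_sum[OF j] using q by (intro powr_mono2) (auto intro: norm_sum)
        also have "\<dots> \<le> real (card (L j)) powr q * (\<Sum>z\<in>L j. 1 powr q * cmod (ext (fc j z) x) powr (2 * q))"
          using finL[OF j] q by (intro weighted_sum_powr_le) auto
        finally show "cmod (ext (f j) x) powr (2 * q) \<le> real (card (L j)) powr q * (\<Sum>z\<in>L j. ?D j z x)" by simp
      qed simp
      also have "\<dots> = n * (\<Prod>j\<in>J. \<Sum>z\<in>L j. ?D j z x)" by (simp add: prod.distrib n_def)
      also have "(\<Prod>j\<in>J. \<Sum>z\<in>L j. ?D j z x) = (\<Sum>g\<in>?E. \<Prod>j\<in>J. ?D j (g j) x)" by (rule prod_sum_PiE[OF J finL])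
      finally show ?thesis .
    qed
    have piece: "(\<integral>\<^sup>+x. ennreal (\<Prod>j\<in>J. ?D j (g j) x) * indicator (max_box R) x \<partial>lborel)
        \<le> ennreal ((\<Sum>\<xi>0\<in>P. K \<xi>0) * R powr (B + \<epsilon>) * ?P)" if g: "g \<in> ?E" for g
    proof -
      have "\<forall>j\<in>J. \<exists>\<eta>\<in>S j. fl (r *\<^sub>R \<eta>) = g j" using g by (force simp: L_def PiE_iff)
      then obtain \<eta> where \<eta>: "\<And>j. j \<in> J \<Longrightarrow> \<eta> j \<in> S j" "\<And>j. j \<in> J \<Longrightarrow> \<eta> j \<in> cell r (g j)"
        unfolding cell_def by (metis (mono_tags, lifting) mem_Collect_eq)
      then have "restrict \<eta> J \<in> PiE J S" by auto
      then obtain \<xi>0 where \<xi>0: "\<xi>0 \<in> P" "restrict \<eta> J \<in> N \<xi>0" using P(3) by blast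
      have \<xi>0S: "\<xi>0 \<in> PiE J S" using \<xi>0 P(2) by blast
      have supp: "\<bar>\<xi> \<bullet> b - \<xi>0 j \<bullet> b\<bar> \<le> 1 / real (s \<xi>0)" if j: "j \<in> J" and nz: "fc j (g j) \<xi> \<noteq> 0" and b: "b \<in> Basis" for j \<xi> b
      proof -
        have \<xi>: "\<xi> \<in> cell r (g j)" using nz by (auto simp: fc_def indicator_def split: if_splits)
        have "\<bar>\<eta> j \<bullet> b - \<xi>0 j \<bullet> b\<bar> < 1 / (2 * real (s \<xi>0))" using \<xi>0(2) j b by (auto simp: N_def PiE_iff)
        moreover have "\<bar>\<xi> \<bullet> b - \<eta> j \<bullet> b\<bar> \<le> \<rho>"
          using cell_coord[OF \<xi> r0 b] cell_coord[OF \<eta>(2)[OF j] r0 b] by (simp add: r_def abs_le_iff)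
        moreover have "1 / real (s \<xi>0) = 1 / (2 * real (s \<xi>0)) + 1 / (2 * real (s \<xi>0))" by (simp add: field_simps)
        ultimately show ?thesis using \<rho>(2)[OF \<xi>0(1)] by linarith
      qed
      have "(\<integral>\<^sup>+x. ennreal (\<Prod>j\<in>J. cmod (ext (fc j (g j)) x) powr (2 * q)) * indicator (max_box R) x \<partial>lborel)
        \<le> ennreal (K \<xi>0 * R powr (B + \<epsilon>) * (\<Prod>j\<in>J. energy (fc j (g j)) powr q))"
      proof -
        have "\<forall>R f. R \<ge> 1 \<and> (\<forall>j\<in>J. square_integrable (f j) \<and>
           (\<forall>\<xi>. f j \<xi> \<noteq> 0 \<longrightarrow> (\<forall>b\<in>Basis. \<bar>\<xi> \<bullet> b - \<xi>0 j \<bullet> b\<bar> \<le> 1 / real (s \<xi>0)))) \<longrightarrow>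
          (\<integral>\<^sup>+x. ennreal (\<Prod>j\<in>J. cmod (ext (f j) x) powr (2 * q)) * indicator (max_box R) x \<partial>lborel)
          \<le> ennreal (K \<xi>0 * R powr (B + \<epsilon>) * (\<Prod>j\<in>J. energy (f j) powr q))"
          using bspec[OF sK \<xi>0S] by (elim conjE)
        from mp[OF spec[OF spec[OF this, of R], of "\<lambda>j. fc j (g j)"]] show ?thesis using a sqi supp by simp
      qed
      also have "\<dots> \<le> ennreal ((\<Sum>\<xi>0\<in>P. K \<xi>0) * R powr (B + \<epsilon>) * ?P)"
      proof (intro ennreal_leI mult_mono prod_mono conjI)
        show "K \<xi>0 \<le> (\<Sum>\<xi>0\<in>P. K \<xi>0)" using P(1,2) \<xi>0(1) K0 by (intro member_le_sum) (auto simp: less_imp_le subset_iff)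
        show "energy (fc j (g j)) powr q \<le> energy (f j) powr q" if "j \<in> J" for j
          using en[OF that] energy_nonneg q by (intro powr_mono2) auto
      qed (use sumK in \<open>auto intro: prod_nonneg\<close>)
      finally show ?thesis .
    qed
    have meas: "(\<lambda>x. ennreal (\<Prod>j\<in>J. ?D j (g j) x) * indicator (max_box R) x) \<in> borel_measurable lborel" for g
    proof -
      have "ext (fc j z) \<in> borel_measurable lborel" if "j \<in> J" for j z using ext_measurable[OF fci[OF that]] by simp
      then show ?thesis
        by (intro borel_measurable_times_ennreal measurable_compose[OF _ measurable_ennreal] borel_measurable_prod
            powr_real_measurable borel_measurable_norm borel_measurable_indicator) auto
    qed
    have "(\<integral>\<^sup>+x. ennreal (\<Prod>j\<in>J. cmod (ext (f j) x) powr (2 * q)) * indicator (max_box R) x \<partial>lborel)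
      \<le> (\<integral>\<^sup>+x. ennreal n * (\<Sum>g\<in>?E. ennreal (\<Prod>j\<in>J. ?D j (g j) x) * indicator (max_box R) x) \<partial>lborel)"
    proof (rule nn_integral_mono)
      fix x
      have "ennreal (\<Prod>j\<in>J. cmod (ext (f j) x) powr (2 * q)) \<le> ennreal n * (\<Sum>g\<in>?E. ennreal (\<Prod>j\<in>J. ?D j (g j) x))"
        using ennreal_leI[OF pw[of x]] n0 by (simp add: ennreal_mult sum_nonneg prod_nonneg)
      then show "ennreal (\<Prod>j\<in>J. cmod (ext (f j) x) powr (2 * q)) * indicator (max_box R) x
         \<le> ennreal n * (\<Sum>g\<in>?E. ennreal (\<Prod>j\<in>J. ?D j (g j) x) * indicator (max_box R) x)"
        by (auto simp: indicator_def)
    qed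
    also have "\<dots> = ennreal n * (\<Sum>g\<in>?E. \<integral>\<^sup>+x. ennreal (\<Prod>j\<in>J. ?D j (g j) x) * indicator (max_box R) x \<partial>lborel)"
      using meas by (subst nn_integral_cmult) (auto simp: nn_integral_sum)
    also have "\<dots> \<le> ennreal n * (\<Sum>g\<in>?E. ennreal ((\<Sum>\<xi>0\<in>P. K \<xi>0) * R powr (B + \<epsilon>) * ?P))"
      by (intro mult_left_mono sum_mono piece) auto
    also have "\<dots> = ennreal (n * (real (card ?E) * ((\<Sum>\<xi>0\<in>P. K \<xi>0) * R powr (B + \<epsilon>) * ?P)))"
      using n0 sumK P0 by (simp add: ennreal_mult ennreal_of_nat_eq_real_of_nat)
    also have "\<dots> \<le> ennreal (K' * R powr (B + \<epsilon>) * ?P)"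
      using P0 by (intro ennreal_leI) (simp add: K'_def algebra_simps)
    finally show "(\<integral>\<^sup>+x. ennreal (\<Prod>j\<in>J. cmod (ext (f j) x) powr (2 * q)) * indicator (max_box R) x \<partial>lborel)
      \<le> ennreal (K' * R powr (B + \<epsilon>) * ?P)" .
  qed
qed

end

context quadratic_graph
begin

lemma wave_add: "wave (x + y) \<xi> = wave x \<xi> * wave y \<xi>"
  by (simp add: wave_def cis_mult inner_add_left distrib_left)

lemma integrable_of_bounded_support:
  assumes f: "square_integrable f" and S: "compact S" "\<And>\<xi>. f \<xi> \<noteq> 0 \<Longrightarrow> \<xi> \<in> S"
  shows "integrable lebesgue f"
proof -
  have eq: "(\<lambda>\<xi>. indicator S \<xi> *\<^sub>R f \<xi>) = f" using S(2) by (auto simp: fun_eq_iff indicator_def)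
  have "emeasure lebesgue S < \<infinity>"
    using emeasure_bounded_finite[OF compact_imp_bounded[OF S(1)]] S(1) by (simp add: compact_imp_closed)
  moreover have "S \<in> sets lebesgue" using S(1) by (simp add: compact_imp_closed)
  ultimately have "integrable lebesgue (\<lambda>\<xi>. indicator S \<xi> *\<^sub>R f \<xi>)"
    using f by (intro integral_Cauchy_Schwarz_indicator(1)) (auto simp: square_integrable_def)
  then show ?thesis by (simp add: eq)
qed

text \<open>Moving the centre to the origin multiplies each f j by \<open>wave c\<close>, of modulus
  1, which changes neither supports nor energies.\<close>

theorem ball_multilinear_bound:
  fixes J :: "'j set" and S :: "'j \<Rightarrow> 'b set"
  assumes J: "finite J" and q: "0 < q" "q \<le> 1" and B: "0 \<le> B" and \<epsilon>: "0 < \<epsilon>"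
    and S: "\<And>j. j \<in> J \<Longrightarrow> compact (S j)"
    and rank: "\<And>\<xi>0 V. \<xi>0 \<in> PiE J S \<Longrightarrow> subspace V \<Longrightarrow>
       real (dim V) - q * (\<Sum>j\<in>J. real (dim (dual_map \<Lambda> (\<xi>0 j) ` V))) \<le> B"
  shows "\<exists>K>0. \<forall>R c f. R \<ge> 1 \<and> (\<forall>j\<in>J. square_integrable (f j) \<and> (\<forall>\<xi>. f j \<xi> \<noteq> 0 \<longrightarrow> \<xi> \<in> S j)) \<longrightarrow>
     (\<integral>\<^sup>+x. ennreal (\<Prod>j\<in>J. cmod (ext (f j) x) powr (2 * q)) * indicator (ball c R) x \<partial>lborel)
       \<le> ennreal (K * R powr (B + \<epsilon>) * (\<Prod>j\<in>J. energy (f j) powr q))"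
proof -
  have "\<exists>K>0. \<forall>R f. R \<ge> 1 \<and> (\<forall>j\<in>J. square_integrable (f j) \<and> (\<forall>\<xi>. f j \<xi> \<noteq> 0 \<longrightarrow> \<xi> \<in> S j)) \<longrightarrow>
     (\<integral>\<^sup>+x. ennreal (\<Prod>j\<in>J. cmod (ext (f j) x) powr (2 * q)) * indicator (max_box R) x \<partial>lborel)
       \<le> ennreal (K * R powr (B + \<epsilon>) * (\<Prod>j\<in>J. energy (f j) powr q))"
    by (rule compact_multilinear_bound[OF J q B \<epsilon> S rank])
  then obtain K where K: "K > 0" "\<forall>R f. R \<ge> 1 \<and> (\<forall>j\<in>J. square_integrable (f j) \<and> (\<forall>\<xi>. f j \<xi> \<noteq> 0 \<longrightarrow> \<xi> \<in> S j)) \<longrightarrow>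
     (\<integral>\<^sup>+x. ennreal (\<Prod>j\<in>J. cmod (ext (f j) x) powr (2 * q)) * indicator (max_box R) x \<partial>lborel)
       \<le> ennreal (K * R powr (B + \<epsilon>) * (\<Prod>j\<in>J. energy (f j) powr q))" by (elim exE conjE)
  show ?thesis
  proof (intro exI[of _ K] conjI K(1) allI impI)
    fix R :: real and c and f :: "'j \<Rightarrow> 'b \<Rightarrow> complex"
    assume a: "R \<ge> 1 \<and> (\<forall>j\<in>J. square_integrable (f j) \<and> (\<forall>\<xi>. f j \<xi> \<noteq> 0 \<longrightarrow> \<xi> \<in> S j))"
    define g where "g j \<xi> = f j \<xi> * wave c \<xi>" for j \<xi>
    have ng: "cmod (g j \<xi>) = cmod (f j \<xi>)" for j \<xi> by (simp add: g_def norm_mult)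
    have sg: "square_integrable (g j)" if "j \<in> J" for j
    proof -
      have "g j \<in> borel_measurable lebesgue"
        unfolding g_def[abs_def] using a that wave_measurable by (intro borel_measurable_times) (auto simp: square_integrable_def)
      then show ?thesis using a that by (simp add: square_integrable_def ng)
    qed
    have eg: "energy (g j) = energy (f j)" for j by (simp add: energy_def ng)
    have extg: "ext (f j) (c + y) = ext (g j) y" for j y
      by (simp add: ext_def g_def wave_add mult.assoc)
    let ?F = "\<lambda>x. ennreal (\<Prod>j\<in>J. cmod (ext (f j) x) powr (2 * q))"
    have "ext (f j) \<in> borel_measurable borel" if "j \<in> J" for j
      using a that S[OF that] by (intro ext_measurable integrable_of_bounded_support[where S = "S j"]) auto
    then have Fm: "?F \<in> borel_measurable borel"
      by (intro measurable_compose[OF _ measurable_ennreal] borel_measurable_prod powr_real_measurable borel_measurable_norm) auto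
    have "(\<integral>\<^sup>+x. ?F x * indicator (ball c R) x \<partial>lborel) = (\<integral>\<^sup>+x. ?F x * indicator (ball c R) x \<partial>(distr lborel borel ((+) c)))"
      by (simp add: lborel_distr_plus)
    also have "\<dots> = (\<integral>\<^sup>+x. ?F (c + x) * indicator (ball c R) (c + x) \<partial>lborel)"
    proof (subst nn_integral_distr)
      have "(\<lambda>x. ?F x * indicator (ball c R) x) \<in> borel_measurable borel"
        by (intro borel_measurable_times_ennreal Fm borel_measurable_indicator) auto
      then show "(\<lambda>x. ?F x * indicator (ball c R) x) \<in> borel_measurable (distr lborel borel ((+) c))" by simp
    qed auto
    also have "\<dots> \<le> (\<integral>\<^sup>+x. ennreal (\<Prod>j\<in>J. cmod (ext (g j) x) powr (2 * q)) * indicator (max_box R) x \<partial>lborel)"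
    proof (intro nn_integral_mono)
      fix x
      have "x \<in> max_box R" if "c + x \<in> ball c R"
      proof -
        have "norm x < R" using that by (simp add: dist_norm)
        then have "\<bar>x \<bullet> b\<bar> \<le> R" if "b \<in> Basis" for b using Basis_le_norm[OF that, of x] by linarith
        then show ?thesis by (simp add: max_box_def)
      qed
      then show "?F (c + x) * indicator (ball c R) (c + x) \<le> ennreal (\<Prod>j\<in>J. cmod (ext (g j) x) powr (2 * q)) * indicator (max_box R) x"
        by (simp add: extg indicator_def)
    qed
    also have "\<dots> \<le> ennreal (K * R powr (B + \<epsilon>) * (\<Prod>j\<in>J. energy (g j) powr q))"
      using mp[OF spec[OF spec[OF K(2), of R], of g]] a sg by (auto simp: g_def)
    finally show "(\<integral>\<^sup>+x. ?F x * indicator (ball c R) x \<partial>lborel) \<le> ennreal (K * R powr (B + \<epsilon>) * (\<Prod>j\<in>J. energy (f j) powr q))"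
      by (simp add: eg)
  qed
qed

end

section \<open>The exponents and tangent spaces\<close>


lemma hausdorff_measure_empty: "hausdorff_measure s ({} :: 'a::metric_space set) = 0"
proof -
  have "hausdorff_content s \<delta> ({} :: 'a set) \<le> 0" if "\<delta> > 0" for \<delta>
  proof -
    have "(\<Sum>i. ennreal (diameter (({} :: 'a set)) powr s)) \<in> {(\<Sum>i. ennreal (diameter (U i) powr s)) | U :: nat \<Rightarrow> 'a set.
            {} \<subseteq> (\<Union>i. U i) \<and> (\<forall>i. bounded (U i) \<and> diameter (U i) \<le> \<delta>)}"
      using that by (auto simp: diameter_def intro!: exI[of _ "\<lambda>_::nat. {}"])
    from Inf_lower[OF this] show ?thesis unfolding hausdorff_content_def by (simp add: diameter_def)
  qed
  then show ?thesis unfolding hausdorff_measure_def by (simp add: SUP_eq_const le_zero_eq[symmetric] del: le_zero_eq) (simp add: SUP_le_iff)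
qed

text \<open>Only positive exponents enter the infimum, so 0 is approached through arbitrarily small
  ones.\<close>

lemma hausdorff_dim_empty: "hausdorff_dim ({} :: 'a::metric_space set) \<le> 0"
  unfolding hausdorff_dim_def
proof (rule ccontr)
  assume "\<not> Inf (ereal ` {s. 0 < s \<and> hausdorff_measure s ({} :: 'a set) = 0}) \<le> 0"
  then obtain e where e: "0 < ereal e" "ereal e < Inf (ereal ` {s. 0 < s \<and> hausdorff_measure s ({} :: 'a set) = 0})"
    using ereal_dense2[of 0] by (auto simp: not_le)
  then have "Inf (ereal ` {s. 0 < s \<and> hausdorff_measure s ({} :: 'a set) = 0}) \<le> ereal e"
    by (intro Inf_lower imageI) (simp add: hausdorff_measure_empty)
  then show False using e(2) by simp
qed

text \<open>U need not be measurable and is replaced by a cube of side twice its diameter. Since the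
  diameter is at most 1, lowering the exponent from the dimension to s only increases the
  bound.\<close>

lemma emeasure_le_diameter_powr:
  fixes U :: "'a::euclidean_space set"
  assumes "bounded U" "diameter U \<le> 1"  and s: "0 < s" "s \<le> real DIM('a)"
  shows "\<exists>V. U \<subseteq> V \<and> V \<in> sets lborel \<and> emeasure lborel V \<le> ennreal (2 ^ DIM('a) * diameter U powr s)"
proof (cases "U = {}")
  case True
  then show ?thesis by (intro exI[of _ "{}"]) auto
next
  case False
  then obtain x where x: "x \<in> U" by auto
  define r where "r = diameter U"
  have r: "0 \<le> r" "r \<le> 1" using assms by (auto simp: r_def diameter_ge_0)
  let ?V = "cbox (x - r *\<^sub>R One) (x + r *\<^sub>R One)"
  have "U \<subseteq> ?V"
  proof
    fix y assume y: "y \<in> U"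
    have "\<bar>(y - x) \<bullet> b\<bar> \<le> r" if b: "b \<in> Basis" for b
      using Basis_le_norm[OF b, of "y - x"] diameter_bounded_bound[OF assms(1) y x] by (simp add: r_def dist_norm)
    then show "y \<in> ?V" by (auto simp: mem_box inner_diff_left inner_add_left abs_le_iff algebra_simps) 
  qed
  moreover have "emeasure lborel ?V = ennreal ((2 * r) ^ DIM('a))"
    using r by (subst emeasure_lborel_cbox) (auto simp: inner_diff_left inner_add_left)
  moreover have "(2 * r) ^ DIM('a) \<le> 2 ^ DIM('a) * r powr s"
  proof (cases "r = 0")
    case False
    then have "r ^ DIM('a) = r powr real DIM('a)" using r by (simp add: powr_realpow)
    also have "\<dots> \<le> r powr s" using r s False by (intro powr_mono') auto
    finally show ?thesis by (simp add: power_mult_distrib)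
  next
    case True
    then show ?thesis using DIM_positive[where 'a = 'a] by (simp add: power_0_left)
  qed
  ultimately show ?thesis by (intro exI[of _ ?V]) (auto simp: r_def intro: ennreal_leI)
qed

text \<open>The unit cube has volume 1, so for covers by sets of diameter at most 1 the sum of the
  diameters to the power s cannot fall below 2 ^ (-d).\<close>

lemma hausdorff_measure_UNIV_nonzero:
  assumes s: "0 < s" "s \<le> real DIM('a)"
  shows "hausdorff_measure s (UNIV :: 'a::euclidean_space set) \<noteq> 0"
proof
  assume "hausdorff_measure s (UNIV :: 'a set) = 0"
  then have "hausdorff_content s 1 (UNIV :: 'a set) \<le> 0"
    unfolding hausdorff_measure_def by (metis SUP_upper greaterThan_iff zero_less_one)
  then have "hausdorff_content s 1 (UNIV :: 'a set) < ennreal (1 / 2 ^ DIM('a))"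
    by (simp add: order.strict_trans1)
  then obtain U :: "nat \<Rightarrow> 'a set" where U: "UNIV \<subseteq> (\<Union>i. U i)" "\<And>i. bounded (U i)" "\<And>i. diameter (U i) \<le> 1"
    "(\<Sum>i. ennreal (diameter (U i) powr s)) < ennreal (1 / 2 ^ DIM('a))"
    unfolding hausdorff_content_def Inf_less_iff by auto
  have "\<forall>i. \<exists>V. U i \<subseteq> V \<and> V \<in> sets lborel \<and> emeasure lborel V \<le> ennreal (2 ^ DIM('a) * diameter (U i) powr s)"
    using emeasure_le_diameter_powr[OF U(2,3) s] by blast
  then obtain V where V: "\<And>i. U i \<subseteq> V i" "\<And>i. V i \<in> sets lborel"
    "\<And>i. emeasure lborel (V i) \<le> ennreal (2 ^ DIM('a) * diameter (U i) powr s)" by metis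
  let ?c = "cbox (0 :: 'a) One"
  have "1 = emeasure lborel ?c" by (subst emeasure_lborel_cbox) auto
  also have "\<dots> \<le> emeasure lborel (\<Union>i. V i)"
  proof (rule emeasure_mono)
    show "?c \<subseteq> (\<Union>i. V i)" using U(1) V(1) by blast
    show "(\<Union>i. V i) \<in> sets lborel" using V(2) by (intro sets.countable_UN) auto
  qed
  also have "\<dots> \<le> (\<Sum>i. emeasure lborel (V i))" using V(2) by (intro emeasure_subadditive_countably) auto
  also have "\<dots> \<le> (\<Sum>i. ennreal (2 ^ DIM('a)) * ennreal (diameter (U i) powr s))"
    using V(3) by (intro suminf_le) (auto simp: ennreal_mult)
  also have "\<dots> = ennreal (2 ^ DIM('a)) * (\<Sum>i. ennreal (diameter (U i) powr s))" by (rule ennreal_suminf_cmult)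
  also have "\<dots> < ennreal (2 ^ DIM('a)) * ennreal (1 / 2 ^ DIM('a))"
    using U(4) by (intro ennreal_mult_strict_left_mono) auto
  also have "\<dots> = 1" by (simp flip: ennreal_mult)
  finally show False by simp
qed

lemma hausdorff_dim_UNIV_ge: "ereal (real DIM('a)) \<le> hausdorff_dim (UNIV :: 'a::euclidean_space set)"
  unfolding hausdorff_dim_def
proof (rule Inf_greatest)
  fix x assume "x \<in> ereal ` {s. 0 < s \<and> hausdorff_measure s (UNIV :: 'a set) = 0}"
  then obtain s where s: "x = ereal s" "0 < s" "hausdorff_measure s (UNIV :: 'a set) = 0" by auto
  then have "\<not> s \<le> real DIM('a)" using hausdorff_measure_UNIV_nonzero by blast
  then show "ereal (real DIM('a)) \<le> x" using s by simp
qed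

section \<open>Projections onto tangent spaces\<close>

lemma linear_orth_proj:
  assumes "subspace V"
  shows "linear (orth_proj V)"
proof -
  have unique: "orth_proj V x = y" if "y \<in> V" "\<And>v. v \<in> V \<Longrightarrow> (x - y) \<bullet> v = 0" for x y
  proof -
    have "orth_proj V x - y \<in> V" using orth_proj_works[OF assms, of x] that assms by (auto intro: subspace_diff)
    then have "(x - orth_proj V x) \<bullet> (orth_proj V x - y) = 0" "(x - y) \<bullet> (orth_proj V x - y) = 0"
      using orth_proj_works[OF assms, of x] that(2) by auto
    then have "(orth_proj V x - y) \<bullet> (orth_proj V x - y) = 0" by (simp add: inner_diff_left)
    then show ?thesis by simp
  qed
  show ?thesis
  proof (rule linearI)
    fix x y
    show "orth_proj V (x + y) = orth_proj V x + orth_proj V y"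
    proof (rule unique)
      show "orth_proj V x + orth_proj V y \<in> V" using orth_proj_works[OF assms] assms by (simp add: subspace_add)
      fix v assume "v \<in> V"
      then have "(x - orth_proj V x) \<bullet> v = 0" "(y - orth_proj V y) \<bullet> v = 0" using orth_proj_works[OF assms] by auto
      then show "(x + y - (orth_proj V x + orth_proj V y)) \<bullet> v = 0" by (simp add: inner_diff_left inner_add_left)
    qed
  next
    fix c x
    show "orth_proj V (c *\<^sub>R x) = c *\<^sub>R orth_proj V x"
    proof (rule unique)
      show "c *\<^sub>R orth_proj V x \<in> V" using orth_proj_works[OF assms] assms by (simp add: subspace_scale)
      fix v assume "v \<in> V"
      then have "(x - orth_proj V x) \<bullet> v = 0" using orth_proj_works[OF assms] by auto
      then show "(c *\<^sub>R x - c *\<^sub>R orth_proj V x) \<bullet> v = 0" by (simp add: inner_diff_left)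
    qed
  qed
qed

lemma orth_proj_eq_0_iff:
  assumes "subspace V"
  shows "orth_proj V x = 0 \<longleftrightarrow> (\<forall>v\<in>V. x \<bullet> v = 0)"
proof
  assume "orth_proj V x = 0"
  then show "\<forall>v\<in>V. x \<bullet> v = 0" using orth_proj_works[OF assms, of x] by simp
next
  assume "\<forall>v\<in>V. x \<bullet> v = 0"
  then have "(x - orth_proj V x) \<bullet> orth_proj V x = 0" "x \<bullet> orth_proj V x = 0"
    using orth_proj_works[OF assms, of x] by auto
  then show "orth_proj V x = 0" by (simp add: inner_diff_left)
qed

text \<open>\<open>quadratic_form\<close> allows any matrix, so the form is symmetrised explicitly.
  Without a factor 1/2 it is the derivative of Q at \<xi>, applied to \<eta>.\<close>

definition polar_form :: "('n \<Rightarrow> real^'d^'d) \<Rightarrow> real^'d \<Rightarrow> real^'d \<Rightarrow> real^'n" where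
  "polar_form A \<xi> \<eta> = (\<chi> i. \<xi> \<bullet> (A i *v \<eta>) + \<eta> \<bullet> (A i *v \<xi>))"

lemma bounded_bilinear_polar_form: "bounded_bilinear (polar_form (A :: 'n::finite \<Rightarrow> real^'d^'d))"
proof -
  have "bilinear (polar_form A)"
    unfolding bilinear_def polar_form_def
    by (intro conjI allI linearI) (simp_all add: vec_eq_iff inner_add_left inner_add_right
        matrix_vector_right_distrib matrix_vector_mult_scaleR algebra_simps)
  then show ?thesis by (simp add: bilinear_conv_bounded_bilinear)
qed

lemma quadratic_graph_polar_form:
  fixes Q :: "real^'d \<Rightarrow> real^'n"
  assumes A: "\<And>i \<xi>. Q \<xi> $ i = \<xi> \<bullet> (A i *v \<xi>)"
  shows "quadratic_graph Q (polar_form A)"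
proof (rule quadratic_graph.intro)
  show "bounded_bilinear (polar_form A)" by (rule bounded_bilinear_polar_form)
  fix \<xi> \<eta>
  show "Q \<xi> - Q \<eta> = polar_form A ((1/2) *\<^sub>R (\<xi> + \<eta>)) (\<xi> - \<eta>)"
    by (simp add: vec_eq_iff A polar_form_def inner_add_left inner_diff_left inner_diff_right
        matrix_vector_right_distrib matrix_vector_mult_diff_distrib matrix_vector_mult_scaleR inner_add_right field_simps)
qed

lemma frechet_derivative_quadratic:
  fixes Q :: "real^'d \<Rightarrow> real^'n"
  assumes A: "\<And>i \<xi>. Q \<xi> $ i = \<xi> \<bullet> (A i *v \<xi>)"
  shows "frechet_derivative Q (at \<xi>) = polar_form A \<xi>"
proof -
  have Q: "Q = (\<lambda>\<xi>. (1/2) *\<^sub>R polar_form A \<xi> \<xi>)"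
    by (rule ext) (simp add: vec_eq_iff A polar_form_def)
  have sym: "polar_form A \<xi> h = polar_form A h \<xi>" for h by (simp add: polar_form_def add.commute)
  have "((\<lambda>\<xi>. (1/2) *\<^sub>R polar_form A \<xi> \<xi>) has_derivative (\<lambda>h. (1/2) *\<^sub>R (polar_form A \<xi> h + polar_form A h \<xi>))) (at \<xi>)"
    by (intro has_derivative_scaleR_right bounded_bilinear.FDERIV[OF bounded_bilinear_polar_form] has_derivative_ident)
  moreover have "(\<lambda>h. (1/2) *\<^sub>R (polar_form A \<xi> h + polar_form A h \<xi>)) = polar_form A \<xi>"
    by (rule ext) (simp add: sym[symmetric] flip: scaleR_2)
  ultimately have "(Q has_derivative polar_form A \<xi>) (at \<xi>)" by (subst Q) simp
  then show ?thesis by (rule frechet_derivative_at[symmetric])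
qed

text \<open>Both maps vanish exactly on the orthogonal complement of the tangent space, so
  rank-nullity on V gives equal ranks. This links the sets in the definition of X with the
  Brascamp-Lieb data.\<close>

lemma dim_orth_proj_tangent:
  fixes Q :: "real^'d \<Rightarrow> real^'n"
  assumes A: "\<And>i \<xi>. Q \<xi> $ i = \<xi> \<bullet> (A i *v \<xi>)" and V: "subspace V"
  shows "dim (orth_proj (tangent_space Q \<xi>) ` V) = dim (dual_map (polar_form A) \<xi> ` V)"
proof -
  interpret quadratic_graph Q "polar_form A" by (rule quadratic_graph_polar_form[OF A])
  have T: "subspace (tangent_space Q \<xi>)" by (simp add: tangent_space_def)
  have "orth_proj (tangent_space Q \<xi>) x = 0 \<longleftrightarrow> dual_map (polar_form A) \<xi> x = 0" for x
  proof -
    let ?e = "\<lambda>j::'d. (axis j 1, polar_form A \<xi> (axis j 1))"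
    have inner: "x \<bullet> ?e j = dual_map (polar_form A) \<xi> x $ j" for j
    proof -
      have "snd x \<bullet> polar_form A \<xi> (axis j 1) = adjoint (polar_form A \<xi>) (snd x) \<bullet> axis j 1"
        using adjoint_works[OF linear_\<Lambda>[of \<xi>], where x = "axis j 1" and y = "snd x"] by (simp add: inner_commute)
      then show ?thesis by (cases x) (simp add: dual_map_def inner_axis)
    qed
    have "(\<forall>v\<in>tangent_space Q \<xi>. x \<bullet> v = 0) \<longleftrightarrow> (\<forall>j. x \<bullet> ?e j = 0)"
    proof
      assume "\<forall>v\<in>tangent_space Q \<xi>. x \<bullet> v = 0"
      then show "\<forall>j. x \<bullet> ?e j = 0"
        unfolding tangent_space_def frechet_derivative_quadratic[OF A] by (auto intro: span_base)
    next
      assume *: "\<forall>j. x \<bullet> ?e j = 0"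
      show "\<forall>v\<in>tangent_space Q \<xi>. x \<bullet> v = 0"
      proof
        fix v assume "v \<in> tangent_space Q \<xi>"
        then have "v \<in> span (range ?e)" unfolding tangent_space_def frechet_derivative_quadratic[OF A] .
        then have "orthogonal x v" by (rule orthogonal_to_span) (use * in \<open>auto simp: orthogonal_def\<close>)
        then show "x \<bullet> v = 0" by (simp add: orthogonal_def)
      qed
    qed
    then show ?thesis unfolding orth_proj_eq_0_iff[OF T] inner by (simp add: vec_eq_iff)
  qed
  then have "{x. orth_proj (tangent_space Q \<xi>) x = 0} = {x. dual_map (polar_form A) \<xi> x = 0}" by blast
  then show ?thesis
    using dim_linear_image_subspace[OF linear_orth_proj[OF T] V] dim_linear_image_subspace[OF linear_dual_map[of \<xi>] V]
    by simp
qed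

section \<open>Values of the exponent X\<close>

text \<open>The maximum is taken over a finite set that contains 0: for X = 0 the bad sets are
  empty, of dimension at most 0 \<le> k - 2.\<close>

lemma X_exponent_admissible:
  fixes Q :: "real^'d \<Rightarrow> real^'n"
  assumes k: "2 \<le> k"
  shows "X_exponent Q k m \<in> {X. X \<le> CARD('d) + 1 \<and>
     (SUP V\<in>{V. subspace V \<and> dim V = m}. hausdorff_dim (bad_set Q V X)) \<le> ereal (real k - 2)}"
  unfolding X_exponent_def
proof (rule Max_in)
  have "bad_set Q V 0 = {}" for V by (simp add: bad_set_def)
  then have "(SUP V\<in>{V. subspace V \<and> dim V = m}. hausdorff_dim (bad_set Q V 0)) \<le> ereal (real k - 2)"
    using hausdorff_dim_empty[where 'a = "real^'d"] k by (intro SUP_least) (auto intro: order_trans)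
  then show "{X. X \<le> CARD('d) + 1 \<and>
     (SUP V\<in>{V. subspace V \<and> dim V = m}. hausdorff_dim (bad_set Q V X)) \<le> ereal (real k - 2)} \<noteq> {}" by blast
qed (rule finite_subset[of _ "{..CARD('d) + 1}"], auto)

lemma X_exponent_le: "2 \<le> k \<Longrightarrow> X_exponent (Q :: real^'d \<Rightarrow> real^'n) k m \<le> CARD('d) + 1"
  using X_exponent_admissible[of k Q m] by simp

text \<open>The projections of V = {0} are all {0}, so a positive X would make the bad set the whole
  space, whose dimension d exceeds k - 2 because k \<le> d + 1.\<close>

lemma X_exponent_0:
  fixes Q :: "real^'d \<Rightarrow> real^'n"
  assumes k: "2 \<le> k" "k \<le> CARD('d) + 1"
  shows "X_exponent Q k 0 = 0"
proof (rule ccontr)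
  assume X: "X_exponent Q k 0 \<noteq> 0"
  let ?X = "X_exponent Q k 0"
  let ?V = "{0 :: (real^'d) \<times> (real^'n)}"
  have "orth_proj (tangent_space Q \<xi>) 0 = 0" for \<xi>
    using linear_0[OF linear_orth_proj[of "tangent_space Q \<xi>"]] by (simp add: tangent_space_def)
  then have "bad_set Q ?V ?X = UNIV" using X by (simp add: bad_set_def)
  moreover have "hausdorff_dim (bad_set Q ?V ?X) \<le> ereal (real k - 2)"
  proof -
    have "hausdorff_dim (bad_set Q ?V ?X) \<le> (SUP V\<in>{V. subspace V \<and> dim V = 0}. hausdorff_dim (bad_set Q V ?X))"
      by (rule SUP_upper) simp
    also have "\<dots> \<le> ereal (real k - 2)" using X_exponent_admissible[OF k(1), of Q 0] by simp
    finally show ?thesis .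
  qed
  ultimately have "hausdorff_dim (UNIV :: (real^'d) set) \<le> ereal (real k - 2)" by simp
  from order_trans[OF hausdorff_dim_UNIV_ge this] show False using k by simp
qed

section \<open>Uniform families of cubes\<close>

lemma finite_dyadic_cubes: "finite (dyadic_cubes K :: (real^'d) set set)"
proof -
  have "{a :: 'd \<Rightarrow> nat. \<forall>i. a i < K} = PiE UNIV (\<lambda>_. {..<K})" by (auto simp: PiE_iff)
  then have "finite {a :: 'd \<Rightarrow> nat. \<forall>i. a i < K}" by (simp add: finite_PiE)
  then have "finite ((\<lambda>a. cbox (\<chi> i. real (a i) / real K) (\<chi> i. (real (a i) + 1) / real K) :: (real^'d) set) ` {a. \<forall>i. a i < K})"
    by (rule finite_imageI)
  moreover have "dyadic_cubes K = (\<lambda>a. cbox (\<chi> i. real (a i) / real K) (\<chi> i. (real (a i) + 1) / real K) :: (real^'d) set) ` {a. \<forall>i. a i < K}"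
    by (auto simp: dyadic_cubes_def)
  ultimately show ?thesis by simp
qed

text \<open>At most \<theta> M of the cubes meet the bad set of V, and at every point of the others
  the rank is at least X. So the points in the cubes may be chosen arbitrarily, as the compactness
  argument demands.\<close>

lemma sum_dim_dual_map_ge:
  fixes Q :: "real^'d \<Rightarrow> real^'n"
  assumes A: "\<And>i \<xi>. Q \<xi> $ i = \<xi> \<bullet> (A i *v \<xi>)" and T: "finite T" and u: "uniform_family Q \<theta> X T"
    and \<xi>: "\<And>\<tau>. \<tau> \<in> T \<Longrightarrow> \<xi> \<tau> \<in> \<tau>" and V: "subspace V" "dim V \<ge> 1"
  shows "(1 - \<theta>) * real (card T) * real (X (dim V)) \<le> (\<Sum>\<tau>\<in>T. real (dim (dual_map (polar_form A) (\<xi> \<tau>) ` V)))"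
proof -
  let ?X = "X (dim V)"
  let ?bad = "{\<tau>\<in>T. \<tau> \<inter> bad_set Q V ?X \<noteq> {}}"
  have "dim V \<le> CARD('d) + CARD('n)" using dim_subset_UNIV[of V] by simp
  then have "real (card ?bad) \<le> \<theta> * real (card T)"
    using u V by (auto simp: uniform_family_def)
  moreover have "card (T - ?bad) = card T - card ?bad" "card ?bad \<le> card T"
    using T by (auto intro: card_Diff_subset card_mono)
  ultimately have "(1 - \<theta>) * real (card T) \<le> real (card (T - ?bad))" by (simp add: of_nat_diff algebra_simps)
  then have "(1 - \<theta>) * real (card T) * real ?X \<le> real (card (T - ?bad)) * real ?X" by (rule mult_right_mono) simp
  also have "\<dots> = (\<Sum>\<tau>\<in>T - ?bad. real ?X)" by simp
  also have "\<dots> \<le> (\<Sum>\<tau>\<in>T - ?bad. real (dim (dual_map (polar_form A) (\<xi> \<tau>) ` V)))"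
  proof (rule sum_mono)
    fix \<tau> assume \<tau>: "\<tau> \<in> T - ?bad"
    then have "\<xi> \<tau> \<notin> bad_set Q V ?X" using \<xi>[of \<tau>] by blast
    then have "?X \<le> dim (orth_proj (tangent_space Q (\<xi> \<tau>)) ` V)" by (simp add: bad_set_def)
    then show "real ?X \<le> real (dim (dual_map (polar_form A) (\<xi> \<tau>) ` V))"
      by (simp add: dim_orth_proj_tangent[OF A V(1)])
  qed
  also have "\<dots> \<le> (\<Sum>\<tau>\<in>T. real (dim (dual_map (polar_form A) (\<xi> \<tau>) ` V)))"
    using T by (intro sum_mono2) auto
  finally show ?thesis .
qed

section \<open>From the rank condition to powers of \<delta>\<close>

lemma uniform_family_multilinear_estimate:
  fixes Q :: "real^'d \<Rightarrow> real^'n" and \<theta> p \<epsilon> :: real and k :: nat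
  assumes quad: "\<And>i. quadratic_form (\<lambda>\<xi>. Q \<xi> $ i)" and \<theta>: "\<theta> > 0" and p: "p \<ge> 2" and \<epsilon>: "\<epsilon> > 0"
    and k: "2 \<le> k" "k \<le> CARD('d) + 1" and T: "T \<subseteq> dyadic_cubes K"
    and u: "uniform_family Q \<theta> (X_exponent Q k) T" and pT: "p \<le> 2 * real (card T)"
  shows "\<exists>C>0. \<forall>(\<delta>::real) (c :: (real^'d) \<times> (real^'n)) (f :: real^'d \<Rightarrow> complex).
       0 < \<delta> \<and> \<delta> < 1 \<and> (\<forall>\<tau>\<in>T. in_Lp 2 \<tau> f) \<longrightarrow>
       in_Lp p (ball c (1 / \<delta>)) (\<lambda>x. \<Prod>\<tau>\<in>T. cmod (extension_op Q \<tau> f x) powr (1 / real (card T))) \<and>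
       Lp_norm p (ball c (1 / \<delta>)) (\<lambda>x. \<Prod>\<tau>\<in>T. cmod (extension_op Q \<tau> f x) powr (1 / real (card T)))
         \<le> C * \<delta> powr (- \<epsilon> - real (CARD('d) + CARD('n)) * \<theta> / 2)
             * Max ((\<lambda>m. \<delta> powr (- real m / p + real (X_exponent Q k m) / 2)) ` {0..CARD('d) + CARD('n)})
             * (\<Prod>\<tau>\<in>T. Lp_norm 2 \<tau> f powr (1 / real (card T)))"
proof -
  have "\<forall>i. \<exists>A. \<forall>\<xi>. Q \<xi> $ i = \<xi> \<bullet> (A *v \<xi>)" using quad by (simp add: quadratic_form_def)
  from choice[OF this] obtain A where A: "\<And>i \<xi>. Q \<xi> $ i = \<xi> \<bullet> (A i *v \<xi>)" by blast
  interpret quadratic_graph Q "polar_form A" by (rule quadratic_graph_polar_form[OF A])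
  let ?N = "CARD('d) + CARD('n)"
  let ?X = "X_exponent Q k"
  define M where "M = real (card T)"
  have finT: "finite T" using T finite_dyadic_cubes finite_subset by blast
  have M: "M \<ge> 1" using pT p unfolding M_def by linarith
  define q where "q = p / (2 * M)"
  have q: "0 < q" "q \<le> 1" using p pT M by (auto simp: q_def M_def)
  have qM: "q * M = p / 2" using M by (simp add: q_def)
  define e where "e m = real m / p - real (?X m) / 2" for m
  \<comment> \<open>As \<delta> < 1, the maximum of the powers of \<delta> in the claim is \<delta>
    powr (- E). The index m = 0 makes E nonnegative.\<close>
  define E where "E = Max (e ` {0..?N})"
  have E_ge: "e m \<le> E" if "m \<le> ?N" for m unfolding E_def using that by (intro Max_ge) auto
  have "E \<in> e ` {0..?N}" unfolding E_def by (intro Max_in) auto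
  then obtain m0 where m0: "m0 \<le> ?N" "E = e m0" by auto
  have E0: "0 \<le> E" using E_ge[of 0] X_exponent_0[OF k, of Q] by (simp add: e_def)
  \<comment> \<open>For dim V = m the left side of the rank condition is at most m - (p/2)(1 -
    \<theta>) X = p e(m) + (p/2) \<theta> X, and X \<le> d + n. Taking p-th roots turns the two
    parts of B into E and (d + n) \<theta> / 2.\<close>
  define B where "B = p * E + p / 2 * \<theta> * real ?N"
  have B0: "0 \<le> B" unfolding B_def using p E0 \<theta> by (intro add_nonneg_nonneg mult_nonneg_nonneg) auto
  have rank: "real (dim V) - q * (\<Sum>\<tau>\<in>T. real (dim (dual_map (polar_form A) (\<xi> \<tau>) ` V))) \<le> B"
    if \<xi>: "\<xi> \<in> PiE T (\<lambda>\<tau>. \<tau>)" and V: "subspace V" for \<xi> and V :: "((real^'d) \<times> (real^'n)) set"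
  proof (cases "dim V = 0")
    case True
    have "0 \<le> q * (\<Sum>\<tau>\<in>T. real (dim (dual_map (polar_form A) (\<xi> \<tau>) ` V)))"
      using q by (intro mult_nonneg_nonneg sum_nonneg) auto
    moreover have "real (dim V) = 0" by (subst True) simp
    ultimately show ?thesis using B0 by linarith
  next
    case False
    let ?m = "dim V"
    have m: "?m \<le> ?N" using dim_subset_UNIV[of V] by simp
    have "(1 - \<theta>) * M * real (?X ?m) \<le> (\<Sum>\<tau>\<in>T. real (dim (dual_map (polar_form A) (\<xi> \<tau>) ` V)))"
      unfolding M_def
    proof (rule sum_dim_dual_map_ge[OF A finT u _ V])
      show "\<xi> \<tau> \<in> \<tau>" if "\<tau> \<in> T" for \<tau> using \<xi> that by (rule PiE_mem)
      show "1 \<le> dim V" using False by linarith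
    qed
    then have "q * ((1 - \<theta>) * M * real (?X ?m)) \<le> q * (\<Sum>\<tau>\<in>T. real (dim (dual_map (polar_form A) (\<xi> \<tau>) ` V)))"
      using q by (intro mult_left_mono) auto
    moreover have "q * ((1 - \<theta>) * M * real (?X ?m)) = p / 2 * real (?X ?m) - p / 2 * \<theta> * real (?X ?m)"
    proof -
      have "q * ((1 - \<theta>) * M * real (?X ?m)) = (q * M) * ((1 - \<theta>) * real (?X ?m))" by simp
      then show ?thesis unfolding qM by (simp add: algebra_simps)
    qed
    moreover have "p / 2 * \<theta> * real (?X ?m) \<le> p / 2 * \<theta> * real ?N"
    proof (intro mult_left_mono)
      have "?X ?m \<le> CARD('d) + 1" by (rule X_exponent_le[OF k(1)])
      also have "\<dots> \<le> ?N" using zero_less_card_finite[where 'a = 'n] by simp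
      finally show "real (?X ?m) \<le> real ?N" by simp
    qed (use p \<theta> in auto)
    moreover have "p * e ?m \<le> p * E" using E_ge[OF m] p by (intro mult_left_mono) auto
    moreover have "p * e ?m = real ?m - p / 2 * real (?X ?m)" using p by (simp add: e_def right_diff_distrib)
    ultimately show ?thesis unfolding B_def by linarith
  qed
  \<comment> \<open>The integral estimated below is the p-th power of the norm, so a loss of p
    \<epsilon> is affordable there.\<close>
  have pe: "0 < p * \<epsilon>" using p \<epsilon> by simp
  have comp: "compact \<tau>" if "\<tau> \<in> T" for \<tau>
  proof -
    have "\<tau> \<in> dyadic_cubes K" using T that by blast
    then show ?thesis by (auto simp: dyadic_cubes_def)
  qed
  have "\<exists>C>0. \<forall>R c f. R \<ge> 1 \<and> (\<forall>\<tau>\<in>T. square_integrable (f \<tau>) \<and> (\<forall>\<xi>. f \<tau> \<xi> \<noteq> 0 \<longrightarrow> \<xi> \<in> \<tau>)) \<longrightarrow>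
     (\<integral>\<^sup>+x. ennreal (\<Prod>\<tau>\<in>T. cmod (ext (f \<tau>) x) powr (2 * q)) * indicator (ball c R) x \<partial>lborel)
       \<le> ennreal (C * R powr (B + p * \<epsilon>) * (\<Prod>\<tau>\<in>T. energy (f \<tau>) powr q))"
    by (rule ball_multilinear_bound[OF finT q B0 pe comp rank])
  then obtain C where C: "C > 0" "\<forall>R c f. R \<ge> 1 \<and> (\<forall>\<tau>\<in>T. square_integrable (f \<tau>) \<and> (\<forall>\<xi>. f \<tau> \<xi> \<noteq> 0 \<longrightarrow> \<xi> \<in> \<tau>)) \<longrightarrow>
     (\<integral>\<^sup>+x. ennreal (\<Prod>\<tau>\<in>T. cmod (ext (f \<tau>) x) powr (2 * q)) * indicator (ball c R) x \<partial>lborel)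
       \<le> ennreal (C * R powr (B + p * \<epsilon>) * (\<Prod>\<tau>\<in>T. energy (f \<tau>) powr q))" by (elim exE conjE)
  show ?thesis
  proof (intro exI[of _ "C powr (1 / p)"] conjI allI impI)
    show "0 < C powr (1 / p)" using C by simp
    fix \<delta> :: real and c :: "(real^'d) \<times> (real^'n)" and f :: "real^'d \<Rightarrow> complex"
    assume a: "0 < \<delta> \<and> \<delta> < 1 \<and> (\<forall>\<tau>\<in>T. in_Lp 2 \<tau> f)"
    then have \<delta>: "0 < \<delta>" "\<delta> < 1" by auto
    \<comment> \<open>Each cube receives its own restriction of f. The closed cubes may share
      boundary points, which is harmless because the multilinear bound allows unrelated
      functions.\<close>
    define F where "F \<tau> \<xi> = indicator \<tau> \<xi> *\<^sub>R f \<xi>" for \<tau> \<xi>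
    have F2: "(\<lambda>\<xi>. (cmod (F \<tau> \<xi>))\<^sup>2) = (\<lambda>\<xi>. indicator \<tau> \<xi> *\<^sub>R (norm (f \<xi>) powr 2))" for \<tau>
      by (auto simp: F_def indicator_def)
    have Fsq: "square_integrable (F \<tau>)" if "\<tau> \<in> T" for \<tau>
      using a that unfolding square_integrable_def F2
      by (auto simp: in_Lp_def set_borel_measurable_def set_integrable_def F_def[abs_def])
    have Fsupp: "\<xi> \<in> \<tau>" if "F \<tau> \<xi> \<noteq> 0" for \<tau> \<xi> using that by (auto simp: F_def indicator_def split: if_splits)
    have FE: "energy (F \<tau>) = (LINT x:\<tau>|lebesgue. norm (f x) powr 2)" for \<tau>
      unfolding energy_def F2 set_lebesgue_integral_def ..
    have LF: "Lp_norm 2 \<tau> f = energy (F \<tau>) powr (1 / 2)" for \<tau>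
      by (simp only: Lp_norm_def FE)
    have Fext: "extension_op Q \<tau> f x = ext (F \<tau>) x" for \<tau> x
      unfolding extension_op_def ext_def set_lebesgue_integral_def
      by (intro Bochner_Integration.integral_cong refl) (simp add: F_def wave_def cis_conv_exp mult_ac)
    define G where "G x = (\<Prod>\<tau>\<in>T. cmod (ext (F \<tau>) x) powr (1 / M))" for x
    have Gp: "norm (G x) powr p = (\<Prod>\<tau>\<in>T. cmod (ext (F \<tau>) x) powr (2 * q))" for x
    proof -
      have "norm (G x) = G x" unfolding G_def by (simp add: prod_nonneg)
      then have "norm (G x) powr p = (\<Prod>\<tau>\<in>T. (cmod (ext (F \<tau>) x) powr (1 / M)) powr p)"
        unfolding G_def by (simp add: prod_powr_distrib)
      also have "\<dots> = (\<Prod>\<tau>\<in>T. cmod (ext (F \<tau>) x) powr (2 * q))"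
        using M by (intro prod.cong) (auto simp: powr_powr q_def)
      finally show ?thesis .
    qed
    have extm: "ext (F \<tau>) \<in> borel_measurable borel" if "\<tau> \<in> T" for \<tau>
      by (intro ext_measurable integrable_of_bounded_support[OF Fsq[OF that] comp[OF that]] Fsupp)
    have Gm: "G \<in> borel_measurable borel" unfolding G_def[abs_def] using extm
      by (intro borel_measurable_prod powr_real_measurable borel_measurable_norm) auto
    then have Gml: "G \<in> borel_measurable lebesgue" by (simp add: measurable_completion)
    let ?b = "ball c (1 / \<delta>)"
    let ?P = "\<Prod>\<tau>\<in>T. energy (F \<tau>) powr q"
    let ?I = "C * (1 / \<delta>) powr (B + p * \<epsilon>) * ?P"
    have P0: "0 \<le> ?P" by (intro prod_nonneg) auto
    have I0: "0 \<le> ?I" using C P0 by simp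
    have "(\<integral>\<^sup>+x. ennreal (indicator ?b x *\<^sub>R (norm (G x) powr p)) \<partial>lebesgue)
       = (\<integral>\<^sup>+x. ennreal (\<Prod>\<tau>\<in>T. cmod (ext (F \<tau>) x) powr (2 * q)) * indicator ?b x \<partial>lborel)"
      unfolding nn_integral_completion by (intro nn_integral_cong) (simp add: Gp[unfolded real_norm_def] indicator_def)
    also have "\<dots> \<le> ennreal ?I"
      using mp[OF spec[OF spec[OF spec[OF C(2), of "1 / \<delta>"], of c], of F]] \<delta> Fsq Fsupp by (simp add: field_simps)
    finally have nn: "(\<integral>\<^sup>+x. ennreal (indicator ?b x *\<^sub>R (norm (G x) powr p)) \<partial>lebesgue) \<le> ennreal ?I" .
    have ms: "(\<lambda>x. indicator ?b x *\<^sub>R (norm (G x) powr p)) \<in> borel_measurable lebesgue"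
      using Gml by (intro borel_measurable_scaleR borel_measurable_indicator powr_real_measurable borel_measurable_norm) auto
    have int: "integrable lebesgue (\<lambda>x. indicator ?b x *\<^sub>R (norm (G x) powr p))"
    proof (rule integrableI_nonneg[OF ms])
      show "(\<integral>\<^sup>+x. ennreal (indicator ?b x *\<^sub>R (norm (G x) powr p)) \<partial>lebesgue) < \<infinity>"
        using nn by (rule order.strict_trans1) simp
    qed simp
    have "ennreal (LINT x:?b|lebesgue. norm (G x) powr p) \<le> ennreal ?I"
      unfolding set_lebesgue_integral_def using nn nn_integral_eq_integral[OF int] by simp
    then have le: "(LINT x:?b|lebesgue. norm (G x) powr p) \<le> ?I" using I0 by (simp add: ennreal_le_iff)
    have G_eq: "(\<lambda>x. \<Prod>\<tau>\<in>T. cmod (extension_op Q \<tau> f x) powr (1 / real (card T))) = G"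
      by (simp add: G_def[abs_def] Fext M_def)
    have "(\<lambda>x. indicator ?b x *\<^sub>R G x) \<in> borel_measurable lebesgue"
      by (intro borel_measurable_scaleR borel_measurable_indicator Gml) auto
    then show "in_Lp p ?b (\<lambda>x. \<Prod>\<tau>\<in>T. cmod (extension_op Q \<tau> f x) powr (1 / real (card T)))"
      unfolding G_eq in_Lp_def set_borel_measurable_def set_integrable_def
      using int by (rule conjI)
    have nonneg: "0 \<le> (LINT x:?b|lebesgue. norm (G x) powr p)"
      unfolding set_lebesgue_integral_def by (intro Bochner_Integration.integral_nonneg) auto
    have "Lp_norm p ?b G \<le> ?I powr (1 / p)"
      unfolding Lp_norm_def using le nonneg p by (intro powr_mono2) auto
    also have "?I powr (1 / p) = C powr (1 / p) * ((1 / \<delta>) powr (B + p * \<epsilon>)) powr (1 / p) * ?P powr (1 / p)"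
      by (simp only: powr_mult)
    also have "((1 / \<delta>) powr (B + p * \<epsilon>)) powr (1 / p) = \<delta> powr (- \<epsilon> - real ?N * \<theta> / 2) * \<delta> powr (- E)"
    proof -
      have "(B + p * \<epsilon>) * (1 / p) = E + \<theta> * real ?N / 2 + \<epsilon>" using p by (simp add: B_def field_simps)
      then have "((1 / \<delta>) powr (B + p * \<epsilon>)) powr (1 / p) = (1 / \<delta>) powr (E + \<theta> * real ?N / 2 + \<epsilon>)" by (simp only: powr_powr)
      also have "\<dots> = \<delta> powr (- (E + \<theta> * real ?N / 2 + \<epsilon>))"
      proof -
        have "(1 / \<delta>) powr t = \<delta> powr (- t)" for t using \<delta> by (simp add: powr_divide powr_minus_divide)
        then show ?thesis .
      qed
      also have "- (E + \<theta> * real ?N / 2 + \<epsilon>) = (- \<epsilon> - real ?N * \<theta> / 2) + (- E)" by simp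
      finally show ?thesis by (simp only: powr_add)
    qed
    also have "?P powr (1 / p) = (\<Prod>\<tau>\<in>T. Lp_norm 2 \<tau> f powr (1 / real (card T)))"
    proof -
      have "?P powr (1 / p) = (\<Prod>\<tau>\<in>T. (energy (F \<tau>) powr q) powr (1 / p))" by (simp add: prod_powr_distrib)
      also have "\<dots> = (\<Prod>\<tau>\<in>T. Lp_norm 2 \<tau> f powr (1 / real (card T)))"
        using p M by (intro prod.cong) (auto simp: LF powr_powr q_def M_def)
      finally show ?thesis .
    qed
    also have "C powr (1 / p) * (\<delta> powr (- \<epsilon> - real ?N * \<theta> / 2) * \<delta> powr (- E)) * (\<Prod>\<tau>\<in>T. Lp_norm 2 \<tau> f powr (1 / real (card T)))
      \<le> C powr (1 / p) * (\<delta> powr (- \<epsilon> - real ?N * \<theta> / 2) * Max ((\<lambda>m. \<delta> powr (- real m / p + real (?X m) / 2)) ` {0..?N}))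
         * (\<Prod>\<tau>\<in>T. Lp_norm 2 \<tau> f powr (1 / real (card T)))"
    proof (intro mult_right_mono mult_left_mono prod_nonneg)
      have "- E = - real m0 / p + real (?X m0) / 2" by (simp add: m0(2) e_def)
      then have "\<delta> powr (- E) \<in> (\<lambda>m. \<delta> powr (- real m / p + real (?X m) / 2)) ` {0..?N}" using m0(1) by auto
      then show "\<delta> powr (- E) \<le> Max ((\<lambda>m. \<delta> powr (- real m / p + real (?X m) / 2)) ` {0..?N})" by (intro Max_ge) auto
    qed auto
    finally show "Lp_norm p ?b (\<lambda>x. \<Prod>\<tau>\<in>T. cmod (extension_op Q \<tau> f x) powr (1 / real (card T)))
      \<le> C powr (1 / p) * \<delta> powr (- \<epsilon> - real ?N * \<theta> / 2)
         * Max ((\<lambda>m. \<delta> powr (- real m / p + real (?X m) / 2)) ` {0..?N})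
         * (\<Prod>\<tau>\<in>T. Lp_norm 2 \<tau> f powr (1 / real (card T)))"
      unfolding G_eq by (simp only: mult.assoc)
  qed
qed

text \<open>The constant precedes k and the family of cubes. There are finitely many dyadic cubes of
  side 1/K, hence finitely many admissible pairs (k, T), and the constants of these pairs are
  summed; the added 1 keeps the sum positive when there is no such pair.\<close>

theorem theorem1p8:
  fixes Q :: "real^'d \<Rightarrow> real^'n"
    and K :: nat and \<theta> p \<epsilon> :: real
  assumes "\<And>i. quadratic_form (\<lambda>\<xi>. Q \<xi> $ i)"
    and "\<exists>a::nat. K = 2 ^ a"
    and "\<theta> > 0" and "p \<ge> 2" and "\<epsilon> > 0"
  shows "\<exists>C>0. \<forall>(k::nat) (T :: (real^'d) set set).
    2 \<le> k \<and> k \<le> CARD('d) + 1 \<and> T \<subseteq> dyadic_cubes K \<and>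
    uniform_family Q \<theta> (X_exponent Q k) T \<and> p \<le> 2 * real (card T) \<longrightarrow>
    (\<forall>(\<delta>::real) (c :: (real^'d) \<times> (real^'n)) (f :: real^'d \<Rightarrow> complex).
       0 < \<delta> \<and> \<delta> < 1 \<and> (\<forall>\<tau>\<in>T. in_Lp 2 \<tau> f) \<longrightarrow>
       in_Lp p (ball c (1 / \<delta>)) (\<lambda>x. \<Prod>\<tau>\<in>T. cmod (extension_op Q \<tau> f x) powr (1 / real (card T))) \<and>
       Lp_norm p (ball c (1 / \<delta>)) (\<lambda>x. \<Prod>\<tau>\<in>T. cmod (extension_op Q \<tau> f x) powr (1 / real (card T)))
         \<le> C * \<delta> powr (- \<epsilon> - real (CARD('d) + CARD('n)) * \<theta> / 2)
             * Max ((\<lambda>m. \<delta> powr (- real m / p + real (X_exponent Q k m) / 2)) ` {0..CARD('d) + CARD('n)})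
             * (\<Prod>\<tau>\<in>T. Lp_norm 2 \<tau> f powr (1 / real (card T))))"
proof -
  define \<A> where "\<A> = {(k, T :: (real^'d) set set). 2 \<le> k \<and> k \<le> CARD('d) + 1 \<and> T \<subseteq> dyadic_cubes K \<and>
    uniform_family Q \<theta> (X_exponent Q k) T \<and> p \<le> 2 * real (card T)}"
  have "\<A> \<subseteq> {..CARD('d) + 1} \<times> Pow (dyadic_cubes K)" by (auto simp: \<A>_def)
  then have fin: "finite \<A>" by (rule finite_subset) (simp add: finite_dyadic_cubes)
  let ?in = "\<lambda>\<delta> T c f. in_Lp p (ball c (1 / \<delta>)) (\<lambda>x. \<Prod>\<tau>\<in>T. cmod (extension_op Q \<tau> f x) powr (1 / real (card T)))"
  let ?lhs = "\<lambda>\<delta> T c f. Lp_norm p (ball c (1 / \<delta>)) (\<lambda>x. \<Prod>\<tau>\<in>T. cmod (extension_op Q \<tau> f x) powr (1 / real (card T)))"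
  let ?a = "\<lambda>\<delta>. \<delta> powr (- \<epsilon> - real (CARD('d) + CARD('n)) * \<theta> / 2)"
  let ?m = "\<lambda>\<delta> k. Max ((\<lambda>m. \<delta> powr (- real m / p + real (X_exponent Q k m) / 2)) ` {0..CARD('d) + CARD('n)})"
  let ?n = "\<lambda>T f. \<Prod>\<tau>\<in>T. Lp_norm 2 \<tau> f powr (1 / real (card T))"
  have "\<forall>kT\<in>\<A>. \<exists>C>0. \<forall>\<delta> c f. 0 < \<delta> \<and> \<delta> < 1 \<and> (\<forall>\<tau>\<in>snd kT. in_Lp 2 \<tau> f) \<longrightarrow>
      ?in \<delta> (snd kT) c f \<and> ?lhs \<delta> (snd kT) c f \<le> C * ?a \<delta> * ?m \<delta> (fst kT) * ?n (snd kT) f"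
    using uniform_family_multilinear_estimate[OF assms(1,3-5)] by (auto simp: \<A>_def)
  from bchoice[OF this] obtain C where C: "\<forall>kT\<in>\<A>. 0 < C kT \<and> (\<forall>\<delta> c f. 0 < \<delta> \<and> \<delta> < 1 \<and> (\<forall>\<tau>\<in>snd kT. in_Lp 2 \<tau> f) \<longrightarrow>
      ?in \<delta> (snd kT) c f \<and> ?lhs \<delta> (snd kT) c f \<le> C kT * ?a \<delta> * ?m \<delta> (fst kT) * ?n (snd kT) f)" by (elim exE)
  show ?thesis
  proof (intro exI[of _ "(\<Sum>kT\<in>\<A>. C kT) + 1"] conjI allI impI)
    have "0 \<le> (\<Sum>kT\<in>\<A>. C kT)" using C by (intro sum_nonneg) (auto simp: less_imp_le)
    then show "0 < (\<Sum>kT\<in>\<A>. C kT) + 1" by simp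
    fix k :: nat and T :: "(real^'d) set set" and \<delta> :: real and c :: "(real^'d) \<times> (real^'n)" and f :: "real^'d \<Rightarrow> complex"
    assume kT: "2 \<le> k \<and> k \<le> CARD('d) + 1 \<and> T \<subseteq> dyadic_cubes K \<and>
      uniform_family Q \<theta> (X_exponent Q k) T \<and> p \<le> 2 * real (card T)"
      and f: "0 < \<delta> \<and> \<delta> < 1 \<and> (\<forall>\<tau>\<in>T. in_Lp 2 \<tau> f)"
    then have mem: "(k, T) \<in> \<A>" by (simp add: \<A>_def)
    have "\<forall>\<delta> c f. 0 < \<delta> \<and> \<delta> < 1 \<and> (\<forall>\<tau>\<in>T. in_Lp 2 \<tau> f) \<longrightarrow>
      ?in \<delta> T c f \<and> ?lhs \<delta> T c f \<le> C (k, T) * ?a \<delta> * ?m \<delta> k * ?n T f"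
      using conjunct2[OF bspec[OF C mem]] unfolding fst_conv snd_conv .
    from mp[OF spec[OF spec[OF spec[OF this, of \<delta>], of c], of f] f]
    have *: "?in \<delta> T c f" "?lhs \<delta> T c f \<le> C (k, T) * ?a \<delta> * ?m \<delta> k * ?n T f" by (rule conjunct1, rule conjunct2)
    show "?in \<delta> T c f" by (rule *)
    have "C (k, T) \<le> (\<Sum>kT\<in>\<A>. C kT)" using fin mem C by (intro member_le_sum) (auto simp: less_imp_le)
    then have "C (k, T) * (?a \<delta> * ?m \<delta> k * ?n T f) \<le> ((\<Sum>kT\<in>\<A>. C kT) + 1) * (?a \<delta> * ?m \<delta> k * ?n T f)"
      by (intro mult_right_mono mult_nonneg_nonneg prod_nonneg) (auto simp: Max_ge_iff intro!: bexI[of _ 0])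
    then show "?lhs \<delta> T c f \<le> ((\<Sum>kT\<in>\<A>. C kT) + 1) * ?a \<delta> * ?m \<delta> k * ?n T f"
      using order_trans[OF *(2)[unfolded mult.assoc]] by (simp only: mult.assoc)
  qed
qed

end
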